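(* Suppose given a parallel stable integer sorting routine which stably sorts a sequence of $n$ symbols from $\{0,\ldots,\sigma-1\}$, using as key the top $l$ bits of each symbol's $\lceil\log\sigma\rceil$-bit binary representation (for any $1\le l<\lceil\log\sigma\rceil$), in $W_{sort}(n)$ work and $D_{sort}(n)$ depth. Then there is a parallel algorithm (the sorting-based algorithm sortWT) which, using this routine, given a sequence $S$ of length $n$ over the alphabet $\Sigma=\{0,\ldots,\sigma-1\}$ with $\sigma\le n$, constructs the wavelet tree of $S$ using $O(W_{sort}(n)\log\sigma)$ work and $O(D_{sort}(n)+\log n)$ depth.
   Context: Model: work-depth model with concurrent reads and writes permitted, with unit-cost operations on machine words of $\Theta(\log n)$ bits. The work is the total number of operations and the depth is the number of parallel time steps. $\log$ is base 2, and, as usual in asymptotic bounds, logarithmic factors are read as being at least $1$. A sort is stable if elements with equal keys keep their relative order; a sorting routine's work is understood to be at least linear, $W_{sort}(n)=\Omega(n)$. Sequences are indexed from $0$. The (standard, binary) wavelet tree of $S$ is defined recursively. The root represents the symbols $[0,\ldots,2^{\lceil\log\sigma\rceil}-1]$. A node $v$ representing the symbols $[a,\ldots,b]$ stores a bitmap: let $S_v$ be the subsequence of $S$ (in the original order) of all symbols lying in $[a,\ldots,b]$; the bitmap has length $|S_v|$ and has a $0$ in position $i$ if $S_v[i]\in[a,\ldots,\frac{a+b+1}{2}-1]$ and a $1$ otherwise. The left child of $v$ represents $[a,\ldots,\frac{a+b+1}{2}-1]$ and the right child represents $[\frac{a+b+1}{2},\ldots,b]$. The recursion stops when the size of the range is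 2 or less, or if a node has no symbols to represent (its subsequence is empty). Along with its bitmap, each node stores a succinct rank/select structure (of size sub-linear in the bitmap length) supporting rank and select queries on the bitmap in $O(1)$ work. The bitmaps of all nodes on one level may be stored consecutively in one bitmap of length $n$, with each node storing its starting point and its length. *)

theory Defs
  imports Complex_Main "HOL-Library.Landau_Symbols" "HOL-Library.Multiset"
begin

section \<open>Conventions\<close>

text \<open>Inside asymptotic bounds, logarithmic factors are read as being at least 1.\<close>

definition lg :: "nat \<Rightarrow> real" where
  "lg x = max 1 (log 2 (real x))"

text \<open>The length \<open>\<lceil>log \<sigma>\<rceil>\<close> of the binary representation of the symbols of \<open>{0..<\<sigma>}\<close>, for \<open>\<sigma> \<ge> 1\<close>.\<close>

definition symbol_bits :: "nat \<Rightarrow> nat" where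
  "symbol_bits \<sigma> = nat \<lceil>log 2 (real \<sigma>)\<rceil>"

definition top_bits :: "nat \<Rightarrow> nat \<Rightarrow> nat \<Rightarrow> nat" where
  "top_bits \<sigma> l x = drop_bit (symbol_bits \<sigma> - l) x"


section \<open>Stable integer sorting routines\<close>

definition stable_sort_of :: "('a \<Rightarrow> nat) \<Rightarrow> 'a list \<Rightarrow> 'a list \<Rightarrow> bool" where
  "stable_sort_of key xs ys \<longleftrightarrow>
     mset ys = mset xs \<and> sorted (map key ys) \<and>
     (\<forall>k. filter (\<lambda>x. key x = k) ys = filter (\<lambda>x. key x = k) xs)"

text \<open>
  A sorting routine is used as a black box: \<open>sorted_by r \<sigma> l xs\<close> is its output on the sequence
  \<open>xs\<close> over \<open>{0..<\<sigma>}\<close> with the top \<open>l\<close> bits as keys, and \<open>sort_work r n\<close>, \<open>sort_depth r n\<close> are the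
  work and the depth of one call on a sequence of length \<open>n\<close>. Only sequences that are
  at least as long as the alphabet is large are considered.
\<close>

record sort_routine =
  sorted_by :: "nat \<Rightarrow> nat \<Rightarrow> nat list \<Rightarrow> nat list"
  sort_work :: "nat \<Rightarrow> nat"
  sort_depth :: "nat \<Rightarrow> nat"

definition valid_sort_input :: "nat \<Rightarrow> nat \<Rightarrow> nat list \<Rightarrow> bool" where
  "valid_sort_input \<sigma> l xs \<longleftrightarrow>
     \<sigma> \<le> length xs \<and> set xs \<subseteq> {0..<\<sigma>} \<and> 1 \<le> l \<and> l < symbol_bits \<sigma>"

definition stable_integer_sort :: "sort_routine \<Rightarrow> bool" where
  "stable_integer_sort r \<longleftrightarrow>
     (\<forall>\<sigma> l xs. valid_sort_input \<sigma> l xs \<longrightarrow>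
        stable_sort_of (top_bits \<sigma> l) xs (sorted_by r \<sigma> l xs))"


section \<open>The work-depth model\<close>

text \<open>
  A program controls a sequence of synchronous parallel steps on a shared memory of words of
  \<open>w\<close> bits; it also has finitely many named registers, which all lanes of a parallel step can read.
  Every operation on words costs one unit. Memory cells and registers are indexed by
  natural numbers, but a program only produces addresses below \<open>2 ^ w\<close>.
\<close>

datatype binop = Add | Sub | Mul | Div | Mod | And | Or | Xor | Shl | Shr | Eq | Less

datatype exp =
    Const nat
  | Reg nat
  | Lane
  | Load exp
  | Bin binop exp exp

fun apply_binop :: "nat \<Rightarrow> binop \<Rightarrow> nat \<Rightarrow> nat \<Rightarrow> nat" where
  "apply_binop w Add x y = (x + y) mod 2 ^ w"
| "apply_binop w Sub x y = (x + 2 ^ w - y) mod 2 ^ w"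
| "apply_binop w Mul x y = (x * y) mod 2 ^ w"
| "apply_binop w Div x y = x div y"
| "apply_binop w Mod x y = x mod y"
| "apply_binop w And x y = Bit_Operations.and x y"
| "apply_binop w Or x y = Bit_Operations.or x y"
| "apply_binop w Xor x y = Bit_Operations.xor x y"
| "apply_binop w Shl x y = push_bit y x mod 2 ^ w"
| "apply_binop w Shr x y = drop_bit y x"
| "apply_binop w Eq x y = of_bool (x = y)"
| "apply_binop w Less x y = of_bool (x < y)"

type_synonym state = "(nat \<Rightarrow> nat) \<times> (nat \<Rightarrow> nat)" \<comment> \<open>registers, shared memory\<close>

primrec eval :: "nat \<Rightarrow> state \<Rightarrow> nat \<Rightarrow> exp \<Rightarrow> nat" where
  "eval w s i (Const c) = c mod 2 ^ w"
| "eval w s i (Reg r) = fst s r"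
| "eval w s i Lane = i"
| "eval w s i (Load e) = snd s (eval w s i e)"
| "eval w s i (Bin b e1 e2) = apply_binop w b (eval w s i e1) (eval w s i e2)"

primrec cost :: "exp \<Rightarrow> nat" where
  "cost (Const c) = 1"
| "cost (Reg r) = 1"
| "cost Lane = 1"
| "cost (Load e) = cost e + 1"
| "cost (Bin b e1 e2) = cost e1 + cost e2 + 1"

text \<open>
  \<open>Pardo k g a v\<close>: for all lanes \<open>i < k\<close> in lock-step, if \<open>g\<close> is nonzero then write \<open>v\<close> to address \<open>a\<close>,
  where \<open>g\<close>, \<open>a\<close>, \<open>v\<close> may depend on the lane number \<open>i\<close> and all reads precede all writes.
  \<open>Sortdo k src dst m \<sigma> l\<close>: for all lanes \<open>i < k\<close> in parallel, call the sorting routine on the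
  \<open>m\<close> words from \<open>src\<close> on and write its output from \<open>dst\<close> on. The output segments must be disjoint from
  each other and from the input segments. A call has no meaning on invalid input.
\<close>

datatype com =
    Assign nat exp
  | Pardo exp exp exp exp
  | Sortdo exp exp exp exp exp exp
  | Seq com com
  | Cond exp com com
  | Loop exp com

definition segment :: "(nat \<Rightarrow> nat) \<Rightarrow> nat \<Rightarrow> nat \<Rightarrow> nat list" where
  "segment M a m = map M [a..<a + m]"

definition store :: "(nat \<times> nat) set \<Rightarrow> (nat \<Rightarrow> nat) \<Rightarrow> nat \<Rightarrow> nat" where
  "store wr M a = (if a \<in> Domain wr then THE v. (a, v) \<in> wr else M a)"

text \<open>
  \<open>exec w r c s s' wk dp\<close>: started in state \<open>s\<close>, program \<open>c\<close> terminates in \<open>s'\<close> with work \<open>wk\<close> and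
  depth \<open>dp\<close>. Concurrent reads are unrestricted. Concurrent writes to one cell are allowed if
  they agree on the value (otherwise the program has no execution); such programs behave identically
  under the common, arbitrary and priority conventions for concurrent writes.
  The relation is deterministic, see \<open>exec_deterministic\<close> below.
\<close>

inductive exec :: "nat \<Rightarrow> sort_routine \<Rightarrow> com \<Rightarrow> state \<Rightarrow> state \<Rightarrow> nat \<Rightarrow> nat \<Rightarrow> bool"
  for w :: nat and r :: sort_routine where
  Assign:
    "exec w r (Assign x e) (R, M) (R(x := eval w (R, M) 0 e), M) (cost e + 1) (cost e + 1)"
| Pardo:
    "\<lbrakk>k = eval w (R, M) 0 ek;
      wr = {(eval w (R, M) i a, eval w (R, M) i v) | i. i < k \<and> eval w (R, M) i g \<noteq> 0};
      single_valued wr;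
      c = cost g + cost a + cost v + 1\<rbrakk>
     \<Longrightarrow> exec w r (Pardo ek g a v) (R, M) (R, store wr M) (cost ek + 1 + k * c) (cost ek + 1 + c)"
| Sortdo:
    "\<lbrakk>k = eval w (R, M) 0 ek;
      from = (\<lambda>i. eval w (R, M) i src);
      to = (\<lambda>i. eval w (R, M) i dst);
      len = (\<lambda>i. eval w (R, M) i m);
      xs = (\<lambda>i. segment M (from i) (len i));
      ys = (\<lambda>i. sorted_by r (eval w (R, M) i \<sigma>) (eval w (R, M) i l) (xs i));
      \<forall>i<k. valid_sort_input (eval w (R, M) i \<sigma>) (eval w (R, M) i l) (xs i);
      \<forall>i<k. from i + len i \<le> 2 ^ w \<and> to i + len i \<le> 2 ^ w;
      \<forall>i<k. \<forall>j<k. disjnt {to i..<to i + len i} {from j..<from j + len j};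
      \<forall>i<k. \<forall>j<k. i \<noteq> j \<longrightarrow> disjnt {to i..<to i + len i} {to j..<to j + len j};
      wr = {(to i + j, ys i ! j) | i j. i < k \<and> j < len i};
      c = cost src + cost dst + cost m + cost \<sigma> + cost l + 1\<rbrakk>
     \<Longrightarrow> exec w r (Sortdo ek src dst m \<sigma> l) (R, M) (R, store wr M)
           (cost ek + 1 + (\<Sum>i<k. c + sort_work r (len i)))
           (cost ek + 1 + c + Max (insert 0 ((\<lambda>i. sort_depth r (len i)) ` {..<k})))"
| Seq:
    "\<lbrakk>exec w r c1 s s' wk dp; exec w r c2 s' s'' wk' dp'\<rbrakk>
     \<Longrightarrow> exec w r (Seq c1 c2) s s'' (wk + wk') (dp + dp')"
| CondTrue:
    "\<lbrakk>eval w s 0 e \<noteq> 0; exec w r c1 s s' wk dp\<rbrakk>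
     \<Longrightarrow> exec w r (Cond e c1 c2) s s' (cost e + 1 + wk) (cost e + 1 + dp)"
| CondFalse:
    "\<lbrakk>eval w s 0 e = 0; exec w r c2 s s' wk dp\<rbrakk>
     \<Longrightarrow> exec w r (Cond e c1 c2) s s' (cost e + 1 + wk) (cost e + 1 + dp)"
| LoopEnd:
    "eval w s 0 e = 0 \<Longrightarrow> exec w r (Loop e c) s s (cost e + 1) (cost e + 1)"
| LoopStep:
    "\<lbrakk>eval w s 0 e \<noteq> 0; exec w r c s s' wk dp; exec w r (Loop e c) s' s'' wk' dp'\<rbrakk>
     \<Longrightarrow> exec w r (Loop e c) s s'' (cost e + 1 + wk + wk') (cost e + 1 + dp + dp')"

lemma exec_deterministic:
  "exec w r c s s1 wk1 dp1 \<Longrightarrow> exec w r c s s2 wk2 dp2 \<Longrightarrow> s1 = s2 \<and> wk1 = wk2 \<and> dp1 = dp2"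
proof (induction arbitrary: s2 wk2 dp2 rule: exec.induct)
  case (Assign x e R M)
  then show ?case by (cases rule: exec.cases) auto
next
  case (Pardo k R M ek wr a v g c)
  from Pardo.prems Pardo.hyps show ?case by (cases rule: exec.cases) auto
next
  case Sortdo
  from Sortdo.prems Sortdo.hyps show ?case by (cases rule: exec.cases) auto
next
  case (Seq c1 s s' wk dp c2 s'' wk' dp')
  from Seq.prems show ?case by (cases rule: exec.cases) (use Seq.IH in blast)
next
  case (CondTrue s e c1 s' wk dp c2)
  from CondTrue.prems CondTrue.hyps show ?case
    by (cases rule: exec.cases) (use CondTrue.IH in blast)+
next
  case (CondFalse s e c2 s' wk dp c1)
  from CondFalse.prems CondFalse.hyps show ?case
    by (cases rule: exec.cases) (use CondFalse.IH in blast)+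
next
  case (LoopEnd s e c)
  from LoopEnd.prems LoopEnd.hyps show ?case by (cases rule: exec.cases) auto
next
  case (LoopStep s e c s' wk dp s'' wk' dp')
  from LoopStep.prems LoopStep.hyps show ?case
    by (cases rule: exec.cases) (use LoopStep.IH in blast)+
qed

definition words :: "nat \<Rightarrow> (nat \<Rightarrow> nat) \<Rightarrow> bool" where
  "words w f \<longleftrightarrow> (\<forall>a. f a < 2 ^ w)"


section \<open>Wavelet trees\<close>

text \<open>
  Bit 1 is \<open>True\<close>. A node at which the recursion stops is a \<open>Leaf\<close>; it still has a bitmap,
  which is empty if no symbols are represented.
\<close>

datatype wtree = Leaf "bool list" | Node "bool list" wtree wtree

function wt_node :: "nat list \<Rightarrow> nat \<Rightarrow> nat \<Rightarrow> wtree" where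
  "wt_node S a b =
     (let Sv = filter (\<lambda>x. x \<in> {a..b}) S;
          mid = (a + b + 1) div 2;
          bitmap = map (\<lambda>x. x \<notin> {a..<mid}) Sv
      in if b + 1 - a \<le> 2 \<or> Sv = [] then Leaf bitmap
         else Node bitmap (wt_node S a (mid - 1)) (wt_node S mid b))"
  by pat_completeness auto
termination by (relation "measure (\<lambda>(S, a, b). b - a)") auto

declare wt_node.simps [simp del]

definition wavelet_tree :: "nat \<Rightarrow> nat list \<Rightarrow> wtree" where
  "wavelet_tree \<sigma> S = wt_node S 0 (2 ^ symbol_bits \<sigma> - 1)"


section \<open>Wavelet trees in memory\<close>

text \<open>
  A node is stored as a record of consecutive words at an address \<open>p\<close>:
  \<^item> \<open>M p\<close>, \<open>M (p + 1)\<close>, \<open>M (p + 2)\<close>: address of the first word of the bit string that contains the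
    bitmap, starting point of the bitmap in that bit string, length of the bitmap;
  \<^item> \<open>M (p + 3)\<close>, \<open>M (p + 4)\<close>: address and number of words of the rank/select structure;
  \<^item> \<open>M (p + 5)\<close>, \<open>M (p + 6)\<close>: addresses of the left and right child (inner nodes only).
  Bit strings are packed, \<open>w\<close> bits per word, so the bitmaps of a level can share one bit string.
\<close>

definition bitmap_words :: "nat \<Rightarrow> (nat \<Rightarrow> nat) \<Rightarrow> nat \<Rightarrow> nat set" where
  "bitmap_words w M p = (\<lambda>i. M p + (M (p + 1) + i) div w) ` {..<M (p + 2)}"

definition has_bitmap :: "nat \<Rightarrow> (nat \<Rightarrow> nat) \<Rightarrow> nat \<Rightarrow> bool list \<Rightarrow> bool" where
  "has_bitmap w M p B \<longleftrightarrow>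
     M (p + 2) = length B \<and>
     (\<forall>i<length B. bit (M (M p + (M (p + 1) + i) div w)) ((M (p + 1) + i) mod w) = B ! i)"

text \<open>
  All that a query on a node may depend on: the node's record and bitmap, its rank/select
  structure, and a lookup table of \<open>tn\<close> words at address \<open>t\<close>.
\<close>

definition query_words :: "nat \<Rightarrow> (nat \<Rightarrow> nat) \<Rightarrow> nat \<Rightarrow> nat \<Rightarrow> nat \<Rightarrow> nat set" where
  "query_words w M t tn p =
     {p..<p + 5} \<union> bitmap_words w M p \<union> {M (p + 3)..<M (p + 3) + M (p + 4)} \<union> {t..<t + tn}"

text \<open>
  A query program receives the addresses of the node and of the lookup table, \<open>n\<close>, \<open>w\<close>, the bit and the
  argument in registers 0 to 5, and returns its result in register 0 without changing the memory.
\<close>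

definition computes_query ::
    "nat \<Rightarrow> sort_routine \<Rightarrow> com \<Rightarrow> nat \<Rightarrow> (nat \<Rightarrow> nat) \<Rightarrow> nat set \<Rightarrow> nat list \<Rightarrow> (nat \<Rightarrow> bool) \<Rightarrow> bool" where
  "computes_query w r q c M A args result_ok \<longleftrightarrow>
     (\<forall>R M'. words w R \<and> words w M' \<and> (\<forall>a\<in>A. M' a = M a) \<and> (\<forall>j<length args. R j = args ! j) \<longrightarrow>
        (\<exists>R' wk dp. exec w r q (R, M') (R', M') wk dp \<and> wk \<le> c \<and> result_ok (R' 0)))"

text \<open>
  \<open>rank b i\<close> is the number of occurrences of \<open>b\<close> among the first \<open>i\<close> bits; \<open>select b j\<close> is the position of
  the occurrence of \<open>b\<close> which is preceded by exactly \<open>j\<close> others.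
\<close>

definition supports_rank_select ::
    "nat \<Rightarrow> sort_routine \<Rightarrow> com \<Rightarrow> com \<Rightarrow> nat \<Rightarrow> nat \<Rightarrow> (nat \<Rightarrow> nat) \<Rightarrow> nat \<Rightarrow> nat \<Rightarrow> nat \<Rightarrow> bool list \<Rightarrow> bool" where
  "supports_rank_select w r rankq selectq c n M t tn p B \<longleftrightarrow>
     (\<forall>b. \<forall>i\<le>length B.
        computes_query w r rankq c M (query_words w M t tn p) [p, t, n, w, of_bool b, i]
          (\<lambda>y. y = count_list (take i B) b)) \<and>
     (\<forall>b. \<forall>j<count_list B b.
        computes_query w r selectq c M (query_words w M t tn p) [p, t, n, w, of_bool b, j]
          (\<lambda>y. y < length B \<and> B ! y = b \<and> count_list (take y B) b = j))"

primrec stores_wtree :: "(nat \<Rightarrow> bool list \<Rightarrow> bool) \<Rightarrow> (nat \<Rightarrow> nat) \<Rightarrow> nat \<Rightarrow> wtree \<Rightarrow> bool" where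
  "stores_wtree node_ok M p (Leaf B) = node_ok p B"
| "stores_wtree node_ok M p (Node B t1 t2) =
     (node_ok p B \<and> stores_wtree node_ok M (M (p + 5)) t1 \<and> stores_wtree node_ok M (M (p + 6)) t2)"

text \<open>
  The rank/select structure of a bitmap of length \<open>m\<close> may have \<open>f m\<close> bits (\<open>f\<close> will be sub-linear), up to
  rounding by a constant number \<open>c\<close> of words: a node in any case stores words such as its
  starting point, and a nonempty structure occupies at least one word even if \<open>m < w\<close>.
\<close>

definition wavelet_tree_in_memory ::
    "nat \<Rightarrow> sort_routine \<Rightarrow> com \<Rightarrow> com \<Rightarrow> nat \<Rightarrow> (nat \<Rightarrow> real) \<Rightarrow> nat \<Rightarrow> (nat \<Rightarrow> nat) \<Rightarrow> nat \<Rightarrow> nat \<Rightarrow> nat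
      \<Rightarrow> wtree \<Rightarrow> bool" where
  "wavelet_tree_in_memory w r rankq selectq c f n M t tn p T \<longleftrightarrow>
     stores_wtree
       (\<lambda>p B. has_bitmap w M p B \<and>
              real (M (p + 4) * w) \<le> f (length B) + real (c * w) \<and>
              supports_rank_select w r rankq selectq c n M t tn p B)
       M p T"

text \<open>
  The initial state: \<open>n\<close>, \<open>\<sigma>\<close>, \<open>w\<close> are in registers 0, 1, 2 and the sequence is at addresses \<open>0..<n\<close>;
  all other registers and memory cells have arbitrary contents.
\<close>

definition initial_state :: "nat \<Rightarrow> nat \<Rightarrow> nat list \<Rightarrow> state \<Rightarrow> bool" where
  "initial_state w \<sigma> S s \<longleftrightarrow>
     words w (fst s) \<and> words w (snd s) \<and>
     fst s 0 = length S \<and> fst s 1 = \<sigma> \<and> fst s 2 = w \<and> segment (snd s) 0 (length S) = S"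

text \<open>
  The programs and \<open>c\<close>, \<open>f\<close>, \<open>g\<close>, \<open>tab\<close> will not depend on the input. The final state has the address of
  the root in register 0 and the address of the lookup table in register 1. The contents
  of the table are universal, i.e. they depend on \<open>n\<close> and \<open>w\<close> only, and it has \<open>g n\<close> bits
  (\<open>g\<close> will be sub-linear).
\<close>

definition constructs_wavelet_tree ::
    "nat \<Rightarrow> sort_routine \<Rightarrow> com \<Rightarrow> com \<Rightarrow> com \<Rightarrow> nat \<Rightarrow> (nat \<Rightarrow> real) \<Rightarrow> (nat \<Rightarrow> real) \<Rightarrow> (nat \<Rightarrow> nat \<Rightarrow> nat list)
      \<Rightarrow> nat \<Rightarrow> nat list \<Rightarrow> state \<Rightarrow> nat \<Rightarrow> nat \<Rightarrow> bool" where
  "constructs_wavelet_tree w r prog rankq selectq c f g tab \<sigma> S s wk dp \<longleftrightarrow>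
     (\<exists>R M. exec w r prog s (R, M) wk dp \<and>
        (let n = length S; table = tab n w in
           segment M (R 1) (length table) = table \<and>
           real (length table * w) \<le> g n \<and>
           wavelet_tree_in_memory w r rankq selectq c f n M (R 1) (length table) (R 0)
             (wavelet_tree \<sigma> S)))"

end

theory Submission
  imports Defs "HOL-Real_Asymp.Real_Asymp"
begin

text \<open>
  The symbols of level \<open>l\<close> in the order of the tree are \<open>S\<close> stably sorted by the top \<open>l\<close> bits, so all levels are
  obtained independently by \<open>\<lceil>log \<sigma>\<rceil> - 1\<close> simultaneous calls of the sorting routine on \<open>S\<close>, and the next bit of
  each symbol is its bit in the bitmap. A node occupies an interval of its level. The bitmaps of all
  levels form one bit string of length \<open>N = O(n log \<sigma>)\<close>, and everything else is computed from its prefix counts.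
  These are counted within words by \<open>w\<close> rounds and across words by doubling; there are only \<open>N / w\<close>
  words, so both take \<open>O(N)\<close> work and \<open>O(w) = O(log n)\<close> depth.

  For rank, a large cell of \<open>q\<^sup>2\<close> words stores an absolute count and, packed into one word, the relative
  counts of its \<open>q\<close> small cells; each small cell likewise packs those of its \<open>q\<close> words. The fields have
  \<open>h = O(log log n)\<close> bits and \<open>q = \<Theta>(log n / log log n)\<close>. Words are scanned in \<open>O(1)\<close> chunks of \<open>U = q h\<close> bits, about
  a quarter of \<open>log n\<close>, with the help of the table. For select, the position of every \<open>G\<close>-th occurrence is stored. If two
  consecutive samples are at least a large cell apart, all positions between them are stored too; otherwise
  these positions meet at most two large cells, and the table finds the small cell and the word.
\<close>

section \<open>Overflow-free expressions over two-dimensional arrays\<close>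

text \<open>Programs are concrete code on \<open>w\<close>-bit words, so every intermediate value
  must be kept from wrapping around. Apart from bitmap words and masks, all values are polynomial in
  \<open>n\<close> and \<open>w\<close>. Since w \<ge> 2^16 * lg n, there is a row length Q above
  all parameters such that even Q^60 fits into a word. Expressions are therefore written over
  unbounded naturals, and one check rules out overflow.

  A query may read only its own node, but the cells are those of the whole bit string and ignore
  node boundaries. So each node keeps, in a row of its own, copies of the cells it meets and of one
  cell beyond. These rows are filled in by positions, each writing on behalf of its node. Concurrent
  writes agree, which avoids assigning lanes or space to nodes.

  For a node of \<open>m\<close> positions the samples take about m / h bits, the small cells m / q
  and the sparse positions m * w * h / q^2, each up to a constant. As q = \<Theta>(log n / log log
  n), the samples dominate, which gives O(m / log log m).\<close>

datatype uexp =
    Num nat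
  | Rg nat
  | RgW nat
  | Ln
  | Arr nat uexp uexp
  | ArrW nat uexp uexp
  | Mem uexp
  | MemW uexp
  | Ones
  | Plus uexp uexp (infixl "\<oplus>" 65)
  | PlusW uexp uexp
  | Minus uexp uexp (infixl "\<ominus>" 65)
  | Times uexp uexp (infixl "\<otimes>" 70)
  | Guard uexp uexp
  | Quot uexp uexp (infixl "\<oslash>" 70)
  | Rem uexp uexp (infixl "\<odot>" 70)
  | XorW uexp uexp
  | Shiftr uexp uexp
  | Shiftl uexp uexp
  | ShiftlW uexp uexp
  | Equal uexp uexp
  | Lt uexp uexp

text \<open>A word has room for the product of 60 row lengths, because 60 * (w div 64) < w. A power
  of two can be computed by a single shift, which is how register 11 gets it.\<close>

definition rowlen :: "nat \<Rightarrow> nat" where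
  "rowlen w = 2 ^ (w div 64)"

text \<open>
  The arrays from 16 on are interleaved, so that the rows \<open>v\<close> of all of them together are one segment: it
  holds the record and the rank/select structure of the node \<open>v\<close>.
\<close>

definition loc :: "nat \<Rightarrow> nat \<Rightarrow> nat \<Rightarrow> nat \<Rightarrow> nat" where
  "loc w a x y =
     (if a < 16 then (a * rowlen w + x) * rowlen w + y
      else 16 * (rowlen w * rowlen w) + a + 64 * (x * rowlen w + y))"

text \<open>Outside the index range \<open>loc\<close> could hit cells of other arrays. The default
  0 lets frame conditions be stated as equations between functions.\<close>

definition rd :: "nat \<Rightarrow> (nat \<Rightarrow> nat) \<Rightarrow> nat \<Rightarrow> nat \<Rightarrow> nat \<Rightarrow> nat" where
  "rd w M a x y = (if x < rowlen w \<and> y < rowlen w then M (loc w a x y) else 0)"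

definition adr :: "nat \<Rightarrow> exp \<Rightarrow> exp \<Rightarrow> exp" where
  "adr a x y =
     (if a < 16 then Bin Add (Bin Mul (Bin Add (Bin Mul (Const a) (Reg 11)) x) (Reg 11)) y
      else Bin Add (Bin Add (Bin Mul (Const 16) (Bin Mul (Reg 11) (Reg 11))) (Const a))
             (Bin Mul (Const 64) (Bin Add (Bin Mul x (Reg 11)) y)))"

text \<open>A constructor and its variant with suffix \<open>W\<close> compile to the same code, and
  so do \<open>Times\<close> and \<open>Guard\<close>. They are separate because they carry
  different guarantees: the \<open>W\<close> variants yield arbitrary words, whose size is not
  tracked.\<close>

primrec cp :: "uexp \<Rightarrow> exp" where
  "cp (Num c) = Const c"
| "cp (Rg r) = Reg r"
| "cp (RgW r) = Reg r"
| "cp Ln = Lane"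
| "cp (Arr a x y) = Load (adr a (cp x) (cp y))"
| "cp (ArrW a x y) = Load (adr a (cp x) (cp y))"
| "cp (Mem p) = Load (cp p)"
| "cp (MemW p) = Load (cp p)"
| "cp Ones = Bin Sub (Const 0) (Const 1)"
| "cp (x \<oplus> y) = Bin Add (cp x) (cp y)"
| "cp (PlusW x y) = Bin Add (cp x) (cp y)"
| "cp (x \<ominus> y) = Bin Sub (cp x) (cp y)"
| "cp (x \<otimes> y) = Bin Mul (cp x) (cp y)"
| "cp (Guard x y) = Bin Mul (cp x) (cp y)"
| "cp (x \<oslash> y) = Bin Div (cp x) (cp y)"
| "cp (x \<odot> y) = Bin Mod (cp x) (cp y)"
| "cp (XorW x y) = Bin Xor (cp x) (cp y)"
| "cp (Shiftr x y) = Bin Shr (cp x) (cp y)"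
| "cp (Shiftl x y) = Bin Shl (cp x) (cp y)"
| "cp (ShiftlW x y) = Bin Shl (cp x) (cp y)"
| "cp (Equal x y) = Bin Eq (cp x) (cp y)"
| "cp (Lt x y) = Bin Less (cp x) (cp y)"

primrec uval :: "nat \<Rightarrow> (nat \<Rightarrow> nat) \<Rightarrow> (nat \<Rightarrow> nat) \<Rightarrow> nat \<Rightarrow> uexp \<Rightarrow> nat" where
  "uval w R M i (Num c) = c"
| "uval w R M i (Rg r) = R r"
| "uval w R M i (RgW r) = R r"
| "uval w R M i Ln = i"
| "uval w R M i (Arr a x y) = rd w M a (uval w R M i x) (uval w R M i y)"
| "uval w R M i (ArrW a x y) = rd w M a (uval w R M i x) (uval w R M i y)"
| "uval w R M i (Mem p) = M (uval w R M i p)"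
| "uval w R M i (MemW p) = M (uval w R M i p)"
| "uval w R M i Ones = 2 ^ w - 1"
| "uval w R M i (x \<oplus> y) = uval w R M i x + uval w R M i y"
| "uval w R M i (PlusW x y) = uval w R M i x + uval w R M i y"
| "uval w R M i (x \<ominus> y) = uval w R M i x - uval w R M i y"
| "uval w R M i (x \<otimes> y) = uval w R M i x * uval w R M i y"
| "uval w R M i (Guard x y) = uval w R M i x * uval w R M i y"
| "uval w R M i (x \<oslash> y) = uval w R M i x div uval w R M i y"
| "uval w R M i (x \<odot> y) = uval w R M i x mod uval w R M i y"
| "uval w R M i (XorW x y) = Bit_Operations.xor (uval w R M i x) (uval w R M i y)"
| "uval w R M i (Shiftr x y) = uval w R M i x div 2 ^ uval w R M i y"
| "uval w R M i (Shiftl x y) = uval w R M i x * 2 ^ uval w R M i y"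
| "uval w R M i (ShiftlW x y) = uval w R M i x * 2 ^ uval w R M i y"
| "uval w R M i (Equal x y) = of_bool (uval w R M i x = uval w R M i y)"
| "uval w R M i (Lt x y) = of_bool (uval w R M i x < uval w R M i y)"

text \<open>
  A value of level \<open>l \<le> 60\<close> is at most \<open>rowlen w ^ l\<close>, which rules out overflow; level 100 only
  guarantees that the value fits into a word.
\<close>

primrec lvl :: "uexp \<Rightarrow> nat" where
  "lvl (Num c) = 1"
| "lvl (Rg r) = 4"
| "lvl (RgW r) = 100"
| "lvl Ln = 1"
| "lvl (Arr a x y) = 1"
| "lvl (ArrW a x y) = 100"
| "lvl (Mem p) = 4"
| "lvl (MemW p) = 100"
| "lvl Ones = 100"
| "lvl (x \<oplus> y) = max (lvl x) (lvl y) + 1"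
| "lvl (PlusW x y) = 100"
| "lvl (x \<ominus> y) = lvl x"
| "lvl (x \<otimes> y) = lvl x + lvl y"
| "lvl (Guard x y) = lvl x + lvl y"
| "lvl (x \<oslash> y) = lvl x"
| "lvl (x \<odot> y) = lvl y"
| "lvl (XorW x y) = 100"
| "lvl (Shiftr x y) = lvl x"
| "lvl (Shiftl x y) = 1"
| "lvl (ShiftlW x y) = 100"
| "lvl (Equal x y) = 1"
| "lvl (Lt x y) = 1"

text \<open>\<open>Minus\<close> must not truncate, since machine subtraction would wrap around. In
  \<open>Rem\<close> the divisor must be positive because x mod 0 = x is not bounded by the level of
  the divisor; in \<open>Quot\<close> a zero divisor does no harm. The second factor of
  \<open>Guard\<close> may be garbage when the first is 0, as 0 times any word is 0.\<close>

primrec safe :: "nat \<Rightarrow> (nat \<Rightarrow> nat) \<Rightarrow> (nat \<Rightarrow> nat) \<Rightarrow> nat \<Rightarrow> uexp \<Rightarrow> bool" where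
  "safe w R M i (Num c) \<longleftrightarrow> c \<le> 2 ^ 15"
| "safe w R M i (Rg r) \<longleftrightarrow> R r \<le> rowlen w ^ 4"
| "safe w R M i (RgW r) \<longleftrightarrow> R r < 2 ^ w"
| "safe w R M i Ln \<longleftrightarrow> i \<le> rowlen w"
| "safe w R M i (Arr a x y) \<longleftrightarrow> safe w R M i x \<and> safe w R M i y \<and> a < 64 \<and> R 11 = rowlen w \<and>
     uval w R M i x < rowlen w \<and> uval w R M i y < rowlen w \<and>
     rd w M a (uval w R M i x) (uval w R M i y) \<le> rowlen w"
| "safe w R M i (ArrW a x y) \<longleftrightarrow> safe w R M i x \<and> safe w R M i y \<and> a < 64 \<and> R 11 = rowlen w \<and>
     uval w R M i x < rowlen w \<and> uval w R M i y < rowlen w \<and>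
     rd w M a (uval w R M i x) (uval w R M i y) < 2 ^ w"
| "safe w R M i (Mem p) \<longleftrightarrow> safe w R M i p \<and> M (uval w R M i p) \<le> rowlen w ^ 4"
| "safe w R M i (MemW p) \<longleftrightarrow> safe w R M i p \<and> M (uval w R M i p) < 2 ^ w"
| "safe w R M i Ones \<longleftrightarrow> True"
| "safe w R M i (x \<oplus> y) \<longleftrightarrow> safe w R M i x \<and> safe w R M i y \<and> lvl (x \<oplus> y) \<le> 60"
| "safe w R M i (PlusW x y) \<longleftrightarrow> safe w R M i x \<and> safe w R M i y \<and>
     uval w R M i x + uval w R M i y < 2 ^ w"
| "safe w R M i (x \<ominus> y) \<longleftrightarrow> safe w R M i x \<and> safe w R M i y \<and> uval w R M i y \<le> uval w R M i x"
| "safe w R M i (x \<otimes> y) \<longleftrightarrow> safe w R M i x \<and> safe w R M i y \<and> lvl (x \<otimes> y) \<le> 60"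
| "safe w R M i (Guard x y) \<longleftrightarrow> safe w R M i x \<and> (uval w R M i x \<noteq> 0 \<longrightarrow> safe w R M i y) \<and>
     lvl (Guard x y) \<le> 60"
| "safe w R M i (x \<oslash> y) \<longleftrightarrow> safe w R M i x \<and> safe w R M i y"
| "safe w R M i (x \<odot> y) \<longleftrightarrow> safe w R M i x \<and> safe w R M i y \<and> uval w R M i y > 0"
| "safe w R M i (XorW x y) \<longleftrightarrow> safe w R M i x \<and> safe w R M i y"
| "safe w R M i (Shiftr x y) \<longleftrightarrow> safe w R M i x \<and> safe w R M i y"
| "safe w R M i (Shiftl x y) \<longleftrightarrow> safe w R M i x \<and> safe w R M i y \<and>
     uval w R M i x * 2 ^ uval w R M i y \<le> rowlen w"
| "safe w R M i (ShiftlW x y) \<longleftrightarrow> safe w R M i x \<and> safe w R M i y \<and>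
     uval w R M i x * 2 ^ uval w R M i y < 2 ^ w"
| "safe w R M i (Equal x y) \<longleftrightarrow> safe w R M i x \<and> safe w R M i y"
| "safe w R M i (Lt x y) \<longleftrightarrow> safe w R M i x \<and> safe w R M i y"

section \<open>Absence of overflow in compiled expressions\<close>

lemma rowlen_ge: "2 ^ 16 \<le> w \<Longrightarrow> 2 ^ 1024 \<le> rowlen w"
  unfolding rowlen_def by (rule power_increasing) auto

lemma rowlen_pos [simp]: "0 < rowlen w"
  by (simp add: rowlen_def)

lemma rowlen_power_less: "2 ^ 16 \<le> w \<Longrightarrow> rowlen w ^ 60 < 2 ^ w"
proof -
  assume "2 ^ 16 \<le> w"
  then have "w div 64 * 60 < w" by simp
  then have "(2::nat) ^ (w div 64 * 60) < 2 ^ w" by (rule power_strict_increasing) simp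
  then show ?thesis by (simp add: rowlen_def power_mult)
qed

lemma rowlen_power_le_less:
  "2 ^ 16 \<le> w \<Longrightarrow> l \<le> 60 \<Longrightarrow> x \<le> rowlen w ^ l \<Longrightarrow> x < 2 ^ w"
proof -
  assume a: "2 ^ 16 \<le> w" "l \<le> 60" "x \<le> rowlen w ^ l"
  have "rowlen w ^ l \<le> rowlen w ^ 60" using a(2) by (intro power_increasing) (simp_all add: Suc_le_eq)
  with a(3) rowlen_power_less[OF a(1)] show ?thesis by linarith
qed

lemma small_le_rowlen: "2 ^ 16 \<le> w \<Longrightarrow> c \<le> 2 ^ 15 \<Longrightarrow> c \<le> rowlen w"
proof -
  assume a: "2 ^ 16 \<le> w" "c \<le> 2 ^ 15"
  have "(2::nat) ^ 15 \<le> 2 ^ 1024" by (rule power_increasing) auto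
  with rowlen_ge[OF a(1)] a(2) show ?thesis by linarith
qed

lemma loc_less:
  assumes "2 ^ 16 \<le> w" "x < rowlen w" "y < rowlen w" "a < 64"
  shows "loc w a x y < rowlen w ^ 3"
proof -
  let ?Q = "rowlen w"
  have Q: "1000 \<le> ?Q" by (rule small_le_rowlen) (use assms in auto)
  have xy: "x * ?Q + y < ?Q * ?Q"
  proof -
    have "x * ?Q + y < (x + 1) * ?Q" using assms by simp
    also have "\<dots> \<le> ?Q * ?Q" using assms by (intro mult_right_mono) auto
    finally show ?thesis .
  qed
  have "loc w a x y \<le> 16 * (?Q * ?Q) + 64 + 64 * (x * ?Q + y)"
  proof (cases "a < 16")
    case True
    then have "a * (?Q * ?Q) \<le> 16 * (?Q * ?Q)" by (intro mult_right_mono) auto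
    moreover have "loc w a x y = a * (?Q * ?Q) + (x * ?Q + y)"
      using True by (simp add: loc_def algebra_simps)
    moreover have "x * ?Q + y \<le> 64 + 64 * (x * ?Q + y)" by simp
    ultimately show ?thesis by (simp only: add.assoc add_mono)
  next
    case False
    then show ?thesis unfolding loc_def using assms by simp
  qed
  also have "\<dots> \<le> 80 * (?Q * ?Q)" using xy by simp
  also have "\<dots> < ?Q * (?Q * ?Q)" using Q by (intro mult_strict_right_mono) auto
  finally show ?thesis by (simp add: power3_eq_cube algebra_simps)
qed

lemma mult_add_eqD:
  fixes q :: nat
  assumes "x * q + y = x' * q + y'" "y < q" "y' < q"
  shows "x = x' \<and> y = y'"
proof -
  have "(x * q + y) div q = (x' * q + y') div q" "(x * q + y) mod q = (x' * q + y') mod q"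
    using assms(1) by simp_all
  then show ?thesis using assms(2,3) by simp
qed

text \<open>Arrays below 16 fill the addresses below 16 * Q^2 and the others lie above. Among the
  latter, the distance from this boundary modulo 64 identifies the array.\<close>

lemma loc_eq_iff:
  assumes "x < rowlen w" "y < rowlen w" "a < 64" "x' < rowlen w" "y' < rowlen w" "a' < 64"
  shows "loc w a x y = loc w a' x' y' \<longleftrightarrow> a = a' \<and> x = x' \<and> y = y'"
proof
  let ?Q = "rowlen w"
  have low: "(b * ?Q + s) * ?Q + t < 16 * (?Q * ?Q)" if "b < 16" "s < ?Q" "t < ?Q" for b s t
  proof -
    have "b * ?Q + s < (b + 1) * ?Q" using that by simp
    also have "\<dots> \<le> 16 * ?Q" using that by (intro mult_right_mono) auto
    finally have "b * ?Q + s + 1 \<le> 16 * ?Q" by simp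
    then have "(b * ?Q + s + 1) * ?Q \<le> 16 * ?Q * ?Q" by (rule mult_right_mono) simp
    then show ?thesis using that by (simp add: algebra_simps)
  qed
  assume eq: "loc w a x y = loc w a' x' y'"
  show "a = a' \<and> x = x' \<and> y = y'"
  proof (cases "a < 16"; cases "a' < 16")
    assume "a < 16" "a' < 16"
    then show ?thesis using eq assms unfolding loc_def
      by (auto dest!: mult_add_eqD)
  next
    assume "a < 16" "\<not> a' < 16"
    then show ?thesis using eq low[of a x y] assms unfolding loc_def by simp
  next
    assume "\<not> a < 16" "a' < 16"
    then show ?thesis using eq low[of a' x' y'] assms unfolding loc_def by simp
  next
    assume "\<not> a < 16" "\<not> a' < 16"
    then have "(x * ?Q + y) * 64 + a = (x' * ?Q + y') * 64 + a'" using eq unfolding loc_def by simp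
    from mult_add_eqD[OF this] assms have "a = a'" "x * ?Q + y = x' * ?Q + y'" by simp_all
    with assms show ?thesis by (auto dest!: mult_add_eqD)
  qed
qed simp

text \<open>Reduction modulo 2^w commutes with addition and multiplication, so only the final
  address has to fit into a word.\<close>

lemma eval_adr:
  assumes w: "2 ^ 16 \<le> w" and R: "R 11 = rowlen w" and a: "a < 64"
    and x: "eval w (R, M) i ex = x" "x < rowlen w" and y: "eval w (R, M) i ey = y" "y < rowlen w"
  shows "eval w (R, M) i (adr a ex ey) = loc w a x y"
proof -
  have *: "loc w a x y < 2 ^ w"
    using rowlen_power_le_less[OF w, of 3 "loc w a x y"] loc_less[OF w x(2) y(2) a] by simp
  show ?thesis
  proof (cases "a < 16")
    case True
    then show ?thesis using * R x y unfolding adr_def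
      by (simp add: loc_def mod_simps)
  next
    case False
    then show ?thesis using * R x y unfolding adr_def
      by (simp add: loc_def mod_simps)
  qed
qed

lemma xor_less_power:
  fixes x y :: nat
  assumes "x < 2 ^ w" "y < 2 ^ w" shows "Bit_Operations.xor x y < 2 ^ w"
proof -
  have "take_bit w (Bit_Operations.xor x y) = Bit_Operations.xor x y"
    using assms by (simp add: take_bit_xor take_bit_nat_eq_self)
  then show ?thesis by (metis take_bit_nat_less_exp)
qed

text \<open>The bound by level belongs to the induction: overflow of a sum or a product is excluded
  by the bounds on its operands.\<close>

lemma cp_correct:
  assumes w: "2 ^ 16 \<le> w" and "safe w R M i e"
  shows "eval w (R, M) i (cp e) = uval w R M i e \<and> uval w R M i e < 2 ^ w \<and>
    (lvl e \<le> 60 \<longrightarrow> uval w R M i e \<le> rowlen w ^ lvl e)"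
  using assms(2)
proof (induction e)
  case (Num c)
  have "c \<le> rowlen w" using small_le_rowlen[OF w] Num by simp
  then show ?case using rowlen_power_le_less[OF w, of 1 c] by simp
next
  case (Rg r)
  then show ?case using rowlen_power_le_less[OF w, of 4] by simp
next
  case Ln
  then show ?case using rowlen_power_le_less[OF w, of 1] by simp
next
  case (Arr a x y)
  then have "eval w (R, M) i (adr a (cp x) (cp y)) = loc w a (uval w R M i x) (uval w R M i y)"
    by (intro eval_adr[OF w]) auto
  with Arr rowlen_power_le_less[OF w, of 1] show ?case by (auto simp: rd_def)
next
  case (ArrW a x y)
  then have "eval w (R, M) i (adr a (cp x) (cp y)) = loc w a (uval w R M i x) (uval w R M i y)"
    by (intro eval_adr[OF w]) auto
  with ArrW show ?case by (auto simp: rd_def)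
next
  case (Mem p)
  then show ?case using rowlen_power_le_less[OF w, of 4] by simp
next
  case Ones
  have "1 < (2::nat) ^ w" using w by (intro one_less_power) auto
  then show ?case by simp
next
  case (Plus x y)
  let ?Q = "rowlen w" and ?m = "max (lvl x) (lvl y)"
  have "uval w R M i x \<le> ?Q ^ lvl x" "uval w R M i y \<le> ?Q ^ lvl y" using Plus by auto
  moreover have "?Q ^ lvl x \<le> ?Q ^ ?m" "?Q ^ lvl y \<le> ?Q ^ ?m"
    using rowlen_pos[of w] by (auto intro!: power_increasing simp: Suc_le_eq simp del: rowlen_pos)
  ultimately have "uval w R M i x + uval w R M i y \<le> 2 * ?Q ^ ?m" by linarith
  also have "\<dots> \<le> ?Q * ?Q ^ ?m" using small_le_rowlen[OF w, of 2] by (intro mult_right_mono) auto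
  finally have *: "uval w R M i x + uval w R M i y \<le> ?Q ^ (?m + 1)" by simp
  moreover from this have "uval w R M i x + uval w R M i y < 2 ^ w"
    using Plus by (intro rowlen_power_le_less[OF w, of "?m + 1"]) auto
  ultimately show ?case using Plus by auto
next
  case (Times x y)
  let ?Q = "rowlen w"
  have "uval w R M i x * uval w R M i y \<le> ?Q ^ lvl x * ?Q ^ lvl y"
    using Times by (intro mult_mono) auto
  then have *: "uval w R M i x * uval w R M i y \<le> ?Q ^ (lvl x + lvl y)" by (simp add: power_add)
  moreover from this have "uval w R M i x * uval w R M i y < 2 ^ w"
    using Times by (intro rowlen_power_le_less[OF w, of "lvl x + lvl y"]) auto
  ultimately show ?case using Times by auto
next
  case (Guard x y)
  let ?Q = "rowlen w"
  show ?case
  proof (cases "uval w R M i x = 0")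
    case True
    then show ?thesis using Guard by simp
  next
    case False
    then have "uval w R M i x * uval w R M i y \<le> ?Q ^ lvl x * ?Q ^ lvl y"
      using Guard by (intro mult_mono) auto
    then have *: "uval w R M i x * uval w R M i y \<le> ?Q ^ (lvl x + lvl y)" by (simp add: power_add)
    moreover from this have "uval w R M i x * uval w R M i y < 2 ^ w"
      using Guard by (intro rowlen_power_le_less[OF w, of "lvl x + lvl y"]) auto
    ultimately show ?thesis using Guard False by auto
  qed
next
  case (Minus x y)
  let ?x = "uval w R M i x" and ?y = "uval w R M i y"
  have IH: "eval w (R, M) i (cp x) = ?x" "?x < 2 ^ w" "eval w (R, M) i (cp y) = ?y" "?y \<le> ?x"
    "lvl x \<le> 60 \<longrightarrow> ?x \<le> rowlen w ^ lvl x" using Minus by auto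
  have "?x + 2 ^ w - ?y = (?x - ?y) + 2 ^ w" using IH by simp
  then have "(?x + 2 ^ w - ?y) mod 2 ^ w = ?x - ?y"
    using IH(2) by (metis less_imp_diff_less mod_add_self2 mod_less)
  then show ?case using IH by auto
next
  case (Quot x y)
  have "a div b < c" if "a < c" for a b c :: nat using that by (meson div_le_dividend le_less_trans)
  moreover have "a div b \<le> c" if "a \<le> c" for a b c :: nat
    using that by (meson div_le_dividend order_trans)
  ultimately show ?case using Quot by simp
next
  case (Rem x y)
  have "a mod b < c" if "b < c" "b > 0" for a b c :: nat using that
    by (meson less_trans mod_less_divisor)
  moreover have "a mod b \<le> c" if "b \<le> c" "b > 0" for a b c :: nat using that
    by (meson mod_less_divisor less_imp_le order_trans)
  ultimately show ?case using Rem by simp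
next
  case (XorW x y)
  then show ?case by (simp add: xor_less_power)
next
  case (Shiftr x y)
  have "a div b < c" if "a < c" for a b c :: nat using that by (meson div_le_dividend le_less_trans)
  moreover have "a div b \<le> c" if "a \<le> c" for a b c :: nat
    using that by (meson div_le_dividend order_trans)
  ultimately show ?case using Shiftr by (simp add: drop_bit_eq_div)
next
  case (Shiftl x y)
  then show ?case using rowlen_power_le_less[OF w, of 1 "uval w R M i x * 2 ^ uval w R M i y"]
    by (simp add: push_bit_eq_mult)
next
  case (ShiftlW x y)
  then show ?case by (simp add: push_bit_eq_mult)
next
  case (Equal x y)
  have "(1::nat) < 2 ^ w" using w by (intro one_less_power) auto
  with Equal show ?case by (simp add: of_bool_def Suc_le_eq)
next
  case (Lt x y)
  have "(1::nat) < 2 ^ w" using w by (intro one_less_power) auto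
  with Lt show ?case by (simp add: of_bool_def Suc_le_eq)
qed auto

lemmas cp_eval = cp_correct[THEN conjunct1]


section \<open>Parallel writes to arrays\<close>

text \<open>Up to constant factors, the work of a loop is \<open>csz\<close> times lanes times rounds, see \<open>for_exec\<close>.\<close>

primrec csz :: "com \<Rightarrow> nat" where
  "csz (Assign x e) = cost e + 1"
| "csz (Pardo k g a v) = cost k + cost g + cost a + cost v + 2"
| "csz (Sortdo k src dst m \<sigma> l) = cost k + cost src + cost dst + cost m + cost \<sigma> + cost l + 2"
| "csz (Seq c1 c2) = csz c1 + csz c2"
| "csz (Cond e c1 c2) = cost e + 1 + csz c1 + csz c2"
| "csz (Loop e c) = cost e + 1 + csz c"

definition pd :: "uexp \<Rightarrow> nat \<Rightarrow> uexp \<Rightarrow> uexp \<Rightarrow> uexp \<Rightarrow> uexp \<Rightarrow> com" where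
  "pd k a x y g v = Pardo (cp k) (cp g) (adr a (cp x) (cp y)) (cp v)"

definition asg :: "nat \<Rightarrow> uexp \<Rightarrow> com" where
  "asg r e = Assign r (cp e)"

lemma rd_store_unchanged:
  assumes "\<And>i. i < k \<Longrightarrow> g i \<Longrightarrow> loc w a x y \<noteq> ad i"
    and "wr = {(ad i, v i) | i. i < (k::nat) \<and> g i}"
  shows "rd w (store wr M) a x y = rd w M a x y"
proof -
  have "loc w a x y \<notin> Domain wr" using assms by auto
  then show ?thesis by (simp add: rd_def store_def)
qed

text \<open>Guards, addresses and values are all evaluated in the old memory, and \<open>sv\<close>
  is the condition under which concurrent writes are admissible. Distinct arrays share no cell,
  which yields the frame part.\<close>

lemma pd_exec:
  assumes w: "2 ^ 16 \<le> w" and R: "R 11 = rowlen w" and a: "a < 64"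
    and k: "safe w R M 0 k" "uval w R M 0 k = kk"
    and g: "\<And>i. i < kk \<Longrightarrow> safe w R M i g \<and> (uval w R M i g \<noteq> 0) = G i"
    and s: "\<And>i. i < kk \<Longrightarrow> G i \<Longrightarrow>
      safe w R M i x \<and> safe w R M i y \<and> safe w R M i v \<and>
      uval w R M i x = X i \<and> uval w R M i y = Y i \<and> uval w R M i v = V i \<and>
      X i < rowlen w \<and> Y i < rowlen w"
    and sv: "\<And>i j. i < kk \<Longrightarrow> j < kk \<Longrightarrow> G i \<Longrightarrow> G j \<Longrightarrow> X i = X j \<Longrightarrow> Y i = Y j \<Longrightarrow> V i = V j"
  shows "\<exists>M' wk dp. exec w r (pd k a x y g v) (R, M) (R, M') wk dp \<and>
    wk \<le> csz (pd k a x y g v) * (kk + 1) \<and> dp \<le> csz (pd k a x y g v) \<and>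
    (\<forall>i<kk. G i \<longrightarrow> rd w M' a (X i) (Y i) = V i) \<and>
    (\<forall>x y. (\<forall>i<kk. G i \<longrightarrow> \<not> (X i = x \<and> Y i = y)) \<longrightarrow> rd w M' a x y = rd w M a x y) \<and>
    (\<forall>a'<64. a' \<noteq> a \<longrightarrow> rd w M' a' = rd w M a')"
proof -
  define wr where "wr = {(loc w a (X i) (Y i), V i) | i. i < kk \<and> G i}"
  have wr: "wr = {(eval w (R, M) i (adr a (cp x) (cp y)), eval w (R, M) i (cp v)) | i.
      i < kk \<and> eval w (R, M) i (cp g) \<noteq> 0}" (is "_ = ?rhs")
  proof -
    have "(eval w (R, M) i (adr a (cp x) (cp y)), eval w (R, M) i (cp v)) = (loc w a (X i) (Y i), V i)"
      if "i < kk" "G i" for i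
      using s[OF that] w R a by (simp add: cp_eval eval_adr)
    moreover have "(eval w (R, M) i (cp g) \<noteq> 0) = G i" if "i < kk" for i
      using g[OF that] w by (simp add: cp_eval)
    ultimately show ?thesis unfolding wr_def by (intro Collect_cong) metis
  qed
  have inj: "X i = X j \<and> Y i = Y j"
    if "loc w a (X i) (Y i) = loc w a (X j) (Y j)" "i < kk" "j < kk" "G i" "G j" for i j
    using that s[of i] s[of j] a by (simp add: loc_eq_iff)
  have single: "single_valued wr"
  proof (rule single_valuedI)
    fix p u u' assume "(p, u) \<in> wr" "(p, u') \<in> wr"
    then obtain i j where ij: "i < kk" "j < kk" "G i" "G j" "u = V i" "u' = V j"
      "p = loc w a (X i) (Y i)" "p = loc w a (X j) (Y j)" unfolding wr_def by auto
    then have "X i = X j \<and> Y i = Y j" using inj[of i j] by simp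
    then show "u = u'" using sv[of i j] ij by simp
  qed
  have ex: "exec w r (pd k a x y g v) (R, M) (R, store wr M)
      (cost (cp k) + 1 + kk * (cost (cp g) + cost (adr a (cp x) (cp y)) + cost (cp v) + 1))
      (cost (cp k) + 1 + (cost (cp g) + cost (adr a (cp x) (cp y)) + cost (cp v) + 1))"
    unfolding pd_def
  proof (rule exec.Pardo[OF _ wr single])
    show "kk = eval w (R, M) 0 (cp k)" using k w by (simp add: cp_eval)
  qed simp
  have val: "rd w (store wr M) a (X i) (Y i) = V i" if i: "i < kk" "G i" for i
  proof -
    have "(loc w a (X i) (Y i), V i) \<in> wr" unfolding wr_def using i by blast
    moreover from this have "(THE v. (loc w a (X i) (Y i), v) \<in> wr) = V i"
      using single unfolding single_valued_def by blast
    ultimately show ?thesis using s[OF i] by (auto simp: rd_def store_def)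
  qed
  have un: "rd w (store wr M) a xx yy = rd w M a xx yy"
    if "\<forall>i<kk. G i \<longrightarrow> \<not> (X i = xx \<and> Y i = yy)" for xx yy
  proof (cases "xx < rowlen w \<and> yy < rowlen w")
    case True
    show ?thesis
      by (rule rd_store_unchanged[OF _ wr_def]) (use True that s a in \<open>auto simp: loc_eq_iff\<close>)
  qed (auto simp: rd_def)
  have other: "rd w (store wr M) a' = rd w M a'" if "a' < 64" "a' \<noteq> a" for a'
  proof (intro ext)
    fix xx yy
    show "rd w (store wr M) a' xx yy = rd w M a' xx yy"
    proof (cases "xx < rowlen w \<and> yy < rowlen w")
      case True
      show ?thesis
        by (rule rd_store_unchanged[OF _ wr_def]) (use True that s a in \<open>auto simp: loc_eq_iff\<close>)
    qed (auto simp: rd_def)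
  qed
  show ?thesis
    by (intro exI conjI, rule ex) (use val un other in \<open>auto simp: pd_def algebra_simps\<close>)
qed

text \<open>Register 12 counts the rounds of every loop; no parameter is ever kept there.\<close>

definition for_do :: "uexp \<Rightarrow> com \<Rightarrow> com" where
  "for_do b c = Seq (asg 12 (Num 0)) (Loop (cp (Lt (Rg 12) b)) (Seq c (asg 12 (Rg 12 \<oplus> Num 1))))"

text \<open>The invariant speaks of the memory only, because the registers in round \<open>t\<close>
  are known. \<open>T\<close> has to be the value of the bound for all \<open>t\<close> and
  \<open>M\<close>, since the bound is evaluated again before each round.\<close>

lemma for_exec:
  assumes w: "2 ^ 16 \<le> w"
    and T: "\<And>t M. safe w (R(12 := t)) M 0 b \<and> uval w (R(12 := t)) M 0 b = T" and TQ: "T \<le> rowlen w"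
    and I0: "I 0 M"
    and body: "\<And>t M. t < T \<Longrightarrow> I t M \<Longrightarrow> \<exists>M' wk dp. exec w r c (R(12 := t), M) (R(12 := t), M') wk dp \<and>
       wk \<le> csz c * (k + 1) \<and> dp \<le> csz c \<and> I (Suc t) M'"
  shows "\<exists>M' wk dp. exec w r (for_do b c) (R, M) (R(12 := T), M') wk dp \<and>
    wk \<le> csz (for_do b c) * ((T + 1) * (k + 1)) \<and> dp \<le> csz (for_do b c) * (T + 1) \<and> I T M'"
proof -
  let ?R = "\<lambda>t. R(12 := t)" and ?e = "Lt (Rg 12) b" and ?inc = "asg 12 (Rg 12 \<oplus> Num 1)"
  let ?L = "Loop (cp ?e) (Seq c ?inc)"
  define z where "z = csz ?L"
  have Q4: "t \<le> rowlen w ^ 4" if "t \<le> T" for t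
  proof -
    have "rowlen w ^ 1 \<le> rowlen w ^ 4" by (rule power_increasing) (simp_all add: Suc_le_eq)
    then show ?thesis using that TQ by simp
  qed
  have cond: "eval w (?R t, M) 0 (cp ?e) = of_bool (t < T)" if "t \<le> T" for t M
    using cp_eval[OF w, of "?R t" M 0 ?e] T[of t M] Q4[OF that] by simp
  have inc: "exec w r ?inc (?R t, M) (?R (Suc t), M) (csz ?inc) (csz ?inc)" if "t < T" for t M
  proof -
    have b4: "lvl b \<le> lvl b" by simp
    have s: "safe w (?R t) M 0 (Rg 12 \<oplus> Num 1)" using Q4[of t] that by simp
    have "exec w r (Assign 12 (cp (Rg 12 \<oplus> Num 1))) (?R t, M)
      ((?R t)(12 := eval w (?R t, M) 0 (cp (Rg 12 \<oplus> Num 1))), M) (cost (cp (Rg 12 \<oplus> Num 1)) + 1)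
      (cost (cp (Rg 12 \<oplus> Num 1)) + 1)" by (rule exec.Assign)
    then show ?thesis using cp_eval[OF w s] by (simp add: asg_def)
  qed
  have loop: "\<exists>M' wk dp. exec w r ?L (?R t, M) (?R T, M') wk dp \<and>
     wk \<le> z * ((T - t + 1) * (k + 1)) \<and> dp \<le> z * (T - t + 1) \<and> I T M'"
    if "t \<le> T" "I t M" for t M
    using that
  proof (induction "T - t" arbitrary: t M)
    case 0
    then have e: "t = T" by simp
    have "exec w r ?L (?R T, M) (?R T, M) (cost (cp ?e) + 1) (cost (cp ?e) + 1)"
      by (rule exec.LoopEnd) (simp only: cond[OF order_refl], simp)
    moreover have "cost (cp ?e) + 1 \<le> z * ((T - t + 1) * (k + 1))" "cost (cp ?e) + 1 \<le> z * (T - t + 1)"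
      by (simp_all add: z_def)
    ultimately show ?case using 0(3) unfolding e by blast
  next
    case (Suc d)
    then have t: "t < T" by simp
    from body[OF t Suc.prems(2)] obtain M1 wk1 dp1 where 1: "exec w r c (?R t, M) (?R t, M1) wk1 dp1"
      "wk1 \<le> csz c * (k + 1)" "dp1 \<le> csz c" "I (Suc t) M1" by blast
    have "d = T - Suc t" "Suc t \<le> T" using Suc(2) t by simp_all
    from Suc(1)[OF this 1(4)] obtain M2 wk2 dp2 where
      2: "exec w r ?L (?R (Suc t), M1) (?R T, M2) wk2 dp2"
      "wk2 \<le> z * ((T - Suc t + 1) * (k + 1))" "dp2 \<le> z * (T - Suc t + 1)" "I T M2" by blast
    have "exec w r ?L (?R t, M) (?R T, M2)
      (cost (cp ?e) + 1 + (wk1 + csz ?inc) + wk2) (cost (cp ?e) + 1 + (dp1 + csz ?inc) + dp2)"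
      by (rule exec.LoopStep[OF _ exec.Seq[OF 1(1) inc[OF t]] 2(1)]) (use t in \<open>simp only: cond less_imp_le, simp\<close>)
    moreover have "cost (cp ?e) + 1 + (wk1 + csz ?inc) + wk2 \<le> z * ((T - t + 1) * (k + 1))"
    proof -
      have "cost (cp ?e) + 1 + csz ?inc \<le> (cost (cp ?e) + 1 + csz ?inc) * (k + 1)" by simp
      with 1(2) have "cost (cp ?e) + 1 + (wk1 + csz ?inc) \<le> z * (k + 1)"
        unfolding z_def by (simp add: algebra_simps)
      moreover have "T - t = Suc (T - Suc t)" using t by simp
      ultimately show ?thesis using 2(2) by (simp add: algebra_simps)
    qed
    moreover have "cost (cp ?e) + 1 + (dp1 + csz ?inc) + dp2 \<le> z * (T - t + 1)"
    proof -
      have "cost (cp ?e) + 1 + (dp1 + csz ?inc) \<le> z" using 1(3) unfolding z_def by simp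
      moreover have "T - t = Suc (T - Suc t)" using t by simp
      ultimately show ?thesis using 2(3) by (simp add: algebra_simps)
    qed
    ultimately show ?case using 2(4) by blast
  qed
  from loop[of 0 M] I0 obtain M' wk dp where L: "exec w r ?L (?R 0, M) (?R T, M') wk dp"
     "wk \<le> z * ((T + 1) * (k + 1))" "dp \<le> z * (T + 1)" "I T M'" by auto
  have "exec w r (asg 12 (Num 0)) (R, M) (R(12 := 0), M) 2 2"
    using exec.Assign[of w r 12 "Const 0" R M] by (simp add: asg_def numeral_2_eq_2)
  from exec.Seq[OF this L(1)] have "exec w r (for_do b c) (R, M) (?R T, M') (2 + wk) (2 + dp)"
    by (simp add: for_do_def)
  moreover have z: "csz (for_do b c) = z + 2" by (simp add: for_do_def z_def asg_def)
  moreover have "2 + wk \<le> csz (for_do b c) * ((T + 1) * (k + 1))"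
    unfolding z using L(2) by (simp add: algebra_simps)
  moreover have "2 + dp \<le> csz (for_do b c) * (T + 1)"
    unfolding z using L(3) by (simp add: algebra_simps)
  ultimately show ?thesis using L(4) by blast
qed

section \<open>Counting and packed fields\<close>

definition cnt :: "(nat \<Rightarrow> bool) \<Rightarrow> nat \<Rightarrow> nat" where
  "cnt f x = (\<Sum>i<x. of_bool (f i))"

lemma cnt_0 [simp]: "cnt f 0 = 0"
  and cnt_Suc [simp]: "cnt f (Suc x) = cnt f x + of_bool (f x)"
  by (simp_all add: cnt_def)

lemma cnt_mono: "x \<le> y \<Longrightarrow> cnt f x \<le> cnt f y"
  unfolding cnt_def by (intro sum_mono2) auto

lemma cnt_add_le: "cnt f (x + k) \<le> cnt f x + k"
  by (induction k) auto

lemma cnt_le: "cnt f x \<le> x"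
  using cnt_add_le[of f 0 x] by simp

text \<open>The count jumps at an occurrence \<open>z\<close>, so comparing a count with that of
  \<open>z\<close> is comparing positions. All select steps rest on this, as they can see counts
  only.\<close>

lemma cnt_le_iff: "f z \<Longrightarrow> cnt f y \<le> cnt f z \<longleftrightarrow> y \<le> z"
proof
  assume "f z" "cnt f y \<le> cnt f z"
  show "y \<le> z"
  proof (rule ccontr)
    assume "\<not> y \<le> z"
    then have "cnt f (Suc z) \<le> cnt f y" by (intro cnt_mono) simp
    with \<open>f z\<close> \<open>cnt f y \<le> cnt f z\<close> show False by simp
  qed
qed (rule cnt_mono)

text \<open>Counts grow in steps of at most 1, so every smaller value is the count at some
  occurrence.\<close>

lemma cnt_attained: "\<rho> < cnt f x \<Longrightarrow> \<exists>z<x. f z \<and> cnt f z = \<rho>"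
proof (induction x)
  case (Suc x)
  show ?case
  proof (cases "\<rho> < cnt f x")
    case True
    then show ?thesis using Suc.IH less_SucI by blast
  next
    case False
    then have "f x" "cnt f x = \<rho>" using Suc.prems by (auto split: if_splits simp: of_bool_def)
    then show ?thesis by blast
  qed
qed simp

lemma cnt_cong: "(\<And>i. i < x \<Longrightarrow> f i = g i) \<Longrightarrow> cnt f x = cnt g x"
  unfolding cnt_def by (intro sum.cong) auto

lemma cnt_inj: "f y \<Longrightarrow> f z \<Longrightarrow> cnt f y = cnt f z \<Longrightarrow> y = z"
  using cnt_le_iff[of f z y] cnt_le_iff[of f y z] by simp

lemma sum_of_bool_le: "k < (q::nat) \<Longrightarrow> (\<Sum>e<q. of_bool (e \<le> k)) = k + (1::nat)"
proof -
  assume "k < q"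
  then have "{e. e < q \<and> e \<le> k} = {..k}" by auto
  then show ?thesis by (simp add: of_bool_def sum.If_cases lessThan_def Collect_conj_eq[symmetric])
qed

lemma sum_of_bool_less: "k \<le> (q::nat) \<Longrightarrow> (\<Sum>e<q. of_bool (e < k)) = (k::nat)"
proof -
  assume "k \<le> q"
  then have "{e. e < q \<and> e < k} = {..<k}" by auto
  then show ?thesis by (simp add: of_bool_def sum.If_cases lessThan_def Collect_conj_eq[symmetric])
qed

section \<open>Packed fields and population counts of words\<close>

definition pack :: "nat \<Rightarrow> (nat \<Rightarrow> nat) \<Rightarrow> nat \<Rightarrow> nat" where
  "pack h F q = (\<Sum>e<q. F e * 2 ^ (e * h))"

lemma pack_Suc: "pack h F (Suc q) = F 0 + 2 ^ h * pack h (\<lambda>e. F (Suc e)) q"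
  unfolding pack_def sum.lessThan_Suc_shift by (simp add: sum_distrib_left power_add algebra_simps)

lemma pack_less: "(\<And>e. e < q \<Longrightarrow> F e < 2 ^ h) \<Longrightarrow> pack h F q < 2 ^ (q * h)"
proof (induction q arbitrary: F)
  case (Suc q)
  have "pack h (\<lambda>e. F (Suc e)) q + 1 \<le> 2 ^ (q * h)" using Suc by (simp add: Suc_le_eq)
  then have "2 ^ h * (pack h (\<lambda>e. F (Suc e)) q + 1) \<le> 2 ^ h * 2 ^ (q * h)" by (rule mult_left_mono) simp
  moreover have "F 0 < 2 ^ h" using Suc.prems by simp
  ultimately show ?case by (simp add: pack_Suc power_add algebra_simps)
qed (simp add: pack_def)

lemma pack_field:
  "(\<And>e. e < q \<Longrightarrow> F e < 2 ^ h) \<Longrightarrow> e < q \<Longrightarrow> pack h F q div 2 ^ (e * h) mod 2 ^ h = F e"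
proof (induction q arbitrary: F e)
  case (Suc q)
  show ?case
  proof (cases e)
    case 0
    then show ?thesis using Suc.prems(1)[of 0] by (simp add: pack_Suc)
  next
    case (Suc e')
    have "(F 0 + 2 ^ h * pack h (\<lambda>e. F (Suc e)) q) div 2 ^ (e * h) =
      (F 0 + 2 ^ h * pack h (\<lambda>e. F (Suc e)) q) div 2 ^ h div 2 ^ (e' * h)"
      by (simp add: Suc power_add div_mult2_eq)
    also have "\<dots> = pack h (\<lambda>e. F (Suc e)) q div 2 ^ (e' * h)"
      using Suc.prems(1)[of 0] by simp
    finally show ?thesis using Suc.IH[of "\<lambda>e. F (Suc e)" e'] Suc.prems Suc by (simp add: pack_Suc)
  qed
qed simp

text \<open>The population count of \<open>y mod 2 ^ m\<close>.\<close>

definition pop :: "nat \<Rightarrow> nat \<Rightarrow> nat" where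
  "pop y m = (\<Sum>p<m. y div 2 ^ p mod 2)"

lemma digit_shift_mod:
  "p < u \<Longrightarrow> (y div 2 ^ c mod 2 ^ u) div 2 ^ p mod 2 = (y :: nat) div 2 ^ (c + p) mod 2"
proof -
  assume p: "p < u"
  have "odd (y div 2 ^ c mod 2 ^ u div 2 ^ p) = odd (y div 2 ^ (c + p))"
    using p by (simp add: take_bit_eq_mod[symmetric] drop_bit_eq_div[symmetric] bit_iff_odd_drop_bit[symmetric]
        bit_take_bit_iff bit_drop_bit_eq)
  then show ?thesis by (simp add: mod2_eq_if)
qed

lemma pop_add: "pop y (m + k) = pop y m + (\<Sum>p<k. y div 2 ^ (m + p) mod 2)"
  by (induction k) (auto simp: pop_def)

lemma pop_chunk: "m \<le> u \<Longrightarrow> pop (y div 2 ^ c mod 2 ^ u) m = pop y (c + m) - pop y c"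
proof -
  assume "m \<le> u"
  then have "pop (y div 2 ^ c mod 2 ^ u) m = (\<Sum>p<m. y div 2 ^ (c + p) mod 2)"
    unfolding pop_def by (intro sum.cong) (auto simp: digit_shift_mod)
  then show ?thesis by (simp add: pop_add)
qed

lemma pop_mono: "m \<le> k \<Longrightarrow> pop y m \<le> pop y k"
  unfolding pop_def by (intro sum_mono2) auto

lemma pop_le: "pop y m \<le> m"
  unfolding pop_def using sum_bounded_above[of "{..<m}" "\<lambda>p. y div 2 ^ p mod 2" 1] by simp

text \<open>The case m > w matters: scanning in chunks of fixed width runs past the end of the
  word.\<close>

lemma pop_le_word: "y < 2 ^ w \<Longrightarrow> pop y m \<le> w"
proof (cases "m \<le> w")
  case False
  assume y: "y < 2 ^ w"
  have "pop y (w + (m - w)) = pop y w"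
  proof -
    have "y div 2 ^ (w + p) mod 2 = 0" for p
    proof -
      have "(2::nat) ^ w \<le> 2 ^ (w + p)" by simp
      with y have "y div 2 ^ (w + p) = 0" by (metis div_less less_le_trans)
      then show ?thesis by simp
    qed
    then show ?thesis by (simp add: pop_add)
  qed
  with False pop_le[of y w] show ?thesis by simp
qed (use pop_le[of y m] in simp)

lemma pop_mod: "m \<le> u \<Longrightarrow> pop (y mod 2 ^ u) m = pop y m"
  using pop_chunk[of m u y 0] by (simp add: pop_def)

text \<open>After masking, a scan of any larger width counts only the first \<open>m\<close>
  bits.\<close>

lemma pop_mod_ge: "m \<le> u \<Longrightarrow> pop (y mod 2 ^ m) u = pop y m"
proof -
  assume "m \<le> u"
  have "pop (y mod 2 ^ m) (m + (u - m)) = pop (y mod 2 ^ m) m"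
  proof -
    have "y mod 2 ^ m div 2 ^ (m + p) = 0" for p
    proof -
      have "(2::nat) ^ m \<le> 2 ^ (m + p)" "y mod 2 ^ m < 2 ^ m" by simp_all
      then show ?thesis by (metis div_less less_le_trans)
    qed
    then show ?thesis by (simp add: pop_add)
  qed
  then show ?thesis using \<open>m \<le> u\<close> by (simp add: pop_mod)
qed

lemma word_pop:
  assumes "\<And>p. p < w \<Longrightarrow> y div 2 ^ p mod 2 = of_bool (g (k * w + p))" "m \<le> w"
  shows "pop y m = cnt g (k * w + m) - cnt g (k * w)"
  using assms(2)
proof (induction m)
  case (Suc m)
  then show ?case using assms(1)[of m] cnt_mono[of "k * w" "k * w + m" g] by (simp add: pop_def)
qed (simp add: pop_def)

text \<open>The argument \<open>J\<close> is shifted by \<open>w\<close> because the rank within a chunk is negative for chunks after the target.\<close>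

definition sel_entry :: "nat \<Rightarrow> nat \<Rightarrow> nat \<Rightarrow> nat \<Rightarrow> nat" where
  "sel_entry w u x J = (\<Sum>p<u. of_bool (pop (x mod 2 ^ Suc p) u + w \<le> J))"

definition field_entry :: "nat \<Rightarrow> nat \<Rightarrow> nat \<Rightarrow> nat \<Rightarrow> nat" where
  "field_entry h q x d = (\<Sum>e<q. of_bool (x div 2 ^ (e * h) mod 2 ^ h \<le> d))"

lemma sel_entry_chunk:
  assumes "y < 2 ^ w"
  shows "sel_entry w u (y div 2 ^ c mod 2 ^ u) (d + w - pop y c) =
    (\<Sum>p<u. of_bool (pop y (c + Suc p) \<le> d))"
  unfolding sel_entry_def
proof (intro sum.cong refl)
  fix p assume "p \<in> {..<u}"
  then have p: "Suc p \<le> u" by simp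
  have "pop ((y div 2 ^ c mod 2 ^ u) mod 2 ^ Suc p) u = pop y (c + Suc p) - pop y c"
    using p by (simp only: pop_mod_ge pop_chunk)
  moreover have "a - b + w \<le> d + w - b \<longleftrightarrow> a \<le> d" if "b \<le> w" "b \<le> a" for a b :: nat
    using that by arith
  from this[OF pop_le_word[OF assms] pop_mono]
  have "pop y (c + Suc p) - pop y c + w \<le> d + w - pop y c \<longleftrightarrow> pop y (c + Suc p) \<le> d" by simp
  ultimately show "of_bool (pop ((y div 2 ^ c mod 2 ^ u) mod 2 ^ Suc p) u + w \<le> d + w - pop y c) =
    (of_bool (pop y (c + Suc p) \<le> d) :: nat)"
    by simp
qed

text \<open>The results depend on the chunks only through K * u, so any number of chunks that covers
  the word will do.\<close>

lemma scan_chunks: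
  assumes "y < 2 ^ w"
  shows "(\<Sum>c<K. pop (y div 2 ^ (c * u) mod 2 ^ u) u) = pop y (K * u)"
    and "(\<Sum>c<K. sel_entry w u (y div 2 ^ (c * u) mod 2 ^ u) (d + w - pop y (c * u))) =
      (\<Sum>p<K * u. of_bool (pop y (Suc p) \<le> d))"
proof -
  show "(\<Sum>c<K. pop (y div 2 ^ (c * u) mod 2 ^ u) u) = pop y (K * u)"
  proof (induction K)
    case (Suc K)
    have "pop y (K * u) \<le> pop y (K * u + u)" by (rule pop_mono) simp
    with Suc show ?case by (simp add: pop_chunk add.commute)
  qed (simp add: pop_def)
  have "(\<Sum>p<a + b. F p) = (\<Sum>p<a. F p) + (\<Sum>p<b. F (a + p))" for a b and F :: "nat \<Rightarrow> nat"
    by (induction b) auto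
  then show "(\<Sum>c<K. sel_entry w u (y div 2 ^ (c * u) mod 2 ^ u) (d + w - pop y (c * u))) =
      (\<Sum>p<K * u. of_bool (pop y (Suc p) \<le> d))"
    by (induction K) (simp_all add: sel_entry_chunk[OF assms] add.commute[of u])
qed

text \<open>Let d be the relative count of \<open>z\<close>. At most d ones are seen up to and
  including \<open>p\<close> exactly if \<open>p\<close> lies before \<open>z\<close>, so the number
  of such \<open>p\<close> is the offset of \<open>z\<close>. Beyond the word the condition fails
  because the word has more than d ones; hence \<open>T\<close> may exceed \<open>w\<close>.\<close>

lemma word_select:
  assumes y: "\<And>p. p < w \<Longrightarrow> y div 2 ^ p mod 2 = of_bool (g (k * w + p))"
    and z: "g z" "z div w = k" "w > 0" and T: "w \<le> T"
  shows "(\<Sum>p<T. of_bool (pop y (Suc p) \<le> cnt g z - cnt g (k * w))) = z mod w"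
proof -
  have zk: "z = k * w + z mod w" using z(2) by (metis div_mult_mod_eq)
  have "of_bool (pop y (Suc p) \<le> cnt g z - cnt g (k * w)) = (of_bool (p < z mod w) :: nat)" for p
  proof -
    have le: "cnt g (k * w) \<le> cnt g (k * w + m)" for m by (rule cnt_mono) simp
    show ?thesis
    proof (cases "p < w")
      case True
      then have "pop y (Suc p) \<le> cnt g z - cnt g (k * w) \<longleftrightarrow> cnt g (k * w + Suc p) \<le> cnt g z"
        using word_pop[of w y g k "Suc p", OF y] le[of "Suc p"] le[of "z mod w"] zk by auto
      also have "\<dots> \<longleftrightarrow> k * w + Suc p \<le> z" using z(1) by (rule cnt_le_iff)
      also have "\<dots> \<longleftrightarrow> p < z mod w" using zk by auto
      finally show ?thesis by simp
    next
      case False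
      have "z mod w < w" using z(3) by simp
      then have "cnt g (k * w) + pop y w = cnt g (k * w + w)" "cnt g z < cnt g (k * w + w)"
        using word_pop[of w y g k w, OF y] le[of w] cnt_le_iff[of g z "k * w + w"] z(1) zk by auto
      moreover have "pop y w \<le> pop y (Suc p)" using False by (intro pop_mono) simp
      moreover have "cnt g (k * w) \<le> cnt g z" by (rule cnt_mono) (metis zk le_add1)
      ultimately have "\<not> pop y (Suc p) \<le> cnt g z - cnt g (k * w)" 
        using le[of w] by linarith
      then show ?thesis using False \<open>z mod w < w\<close> by simp
    qed
  qed
  then have "(\<Sum>p<T. of_bool (pop y (Suc p) \<le> cnt g z - cnt g (k * w))) = (\<Sum>p<T. of_bool (p < z mod w) :: nat)"
    by (simp only:)
  also have "\<dots> = z mod w" by (rule sum_of_bool_less) (use T z(3) in \<open>meson mod_less_divisor less_imp_le order_trans\<close>)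
  finally show ?thesis .
qed

text \<open>A cell of \<open>q\<close> sub-cells of \<open>z\<close> positions; field \<open>e\<close> counts the sub-cells before the \<open>e\<close>-th.\<close>

definition cell_pack :: "(nat \<Rightarrow> bool) \<Rightarrow> nat \<Rightarrow> nat \<Rightarrow> nat \<Rightarrow> nat \<Rightarrow> nat" where
  "cell_pack f h q z c = pack h (\<lambda>e. cnt f (c * (q * z) + e * z) - cnt f (c * (q * z))) q"

lemma cell_field_less:
  assumes "q * z < 2 ^ h" "e < q"
  shows "cnt f (c * (q * z) + e * z) - cnt f (c * (q * z)) < 2 ^ h"
proof -
  have "cnt f (c * (q * z) + e * z) - cnt f (c * (q * z)) \<le> e * z"
    using cnt_add_le[of f "c * (q * z)" "e * z"] by simp
  also have "\<dots> \<le> q * z" using assms by (intro mult_right_mono) auto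
  finally show ?thesis using assms by simp
qed

lemma cell_pack_less: "q * z < 2 ^ h \<Longrightarrow> cell_pack f h q z c < 2 ^ (q * h)"
  unfolding cell_pack_def by (intro pack_less cell_field_less)

lemma cell_pack_field:
  "q * z < 2 ^ h \<Longrightarrow> e < q \<Longrightarrow> cell_pack f h q z c div 2 ^ (e * h) mod 2 ^ h =
    cnt f (c * (q * z) + e * z) - cnt f (c * (q * z))"
  unfolding cell_pack_def by (rule pack_field) (auto intro: cell_field_less)

text \<open>By \<open>cnt_le_iff\<close> a field is at most the relative count of \<open>t\<close>
  exactly if its sub-cell starts at or before \<open>t\<close>. These are the first fields of the
  cell, so their number is one more than the index of the sub-cell containing
  \<open>t\<close>.\<close>

lemma field_entry_cell_pack:
  assumes h: "q * z < 2 ^ h" and t: "f t" "t div (q * z) = c" and z: "z > 0" "q > 0"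
  shows "field_entry h q (cell_pack f h q z c) (cnt f t - cnt f (c * (q * z))) = Suc (t div z mod q)"
proof -
  let ?Z = "q * z"
  have tc: "t = c * ?Z + t mod ?Z" using t(2) by (metis div_mult_mod_eq)
  have cell: "t div z = c * q + t mod ?Z div z"
  proof -
    have "(t mod ?Z + c * q * z) div z = c * q + t mod ?Z div z" using z by simp
    then show ?thesis using tc by (simp add: mult.assoc add.commute)
  qed
  have less: "t mod ?Z div z < q" using z by (simp add: less_mult_imp_div_less)
  with cell have e: "t mod ?Z div z = t div z mod q" by simp
  have "of_bool (cell_pack f h q z c div 2 ^ (e * h) mod 2 ^ h \<le> cnt f t - cnt f (c * ?Z)) =
      (of_bool (e \<le> t div z mod q) :: nat)" if "e < q" for e
  proof -
    have "cnt f (c * ?Z) \<le> cnt f (c * ?Z + e * z)" "cnt f (c * ?Z) \<le> cnt f t"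
      by (intro cnt_mono; use tc in simp)+
    then have "cell_pack f h q z c div 2 ^ (e * h) mod 2 ^ h \<le> cnt f t - cnt f (c * ?Z) \<longleftrightarrow>
       cnt f (c * ?Z + e * z) \<le> cnt f t"
      using cell_pack_field[OF h that, of f c] by auto
    also have "\<dots> \<longleftrightarrow> c * ?Z + e * z \<le> t" using t(1) by (rule cnt_le_iff)
    also have "\<dots> \<longleftrightarrow> e * z \<le> t mod ?Z" using tc by auto
    also have "\<dots> \<longleftrightarrow> e \<le> t mod ?Z div z" using z by (simp add: less_eq_div_iff_mult_less_eq)
    finally show ?thesis using e by simp
  qed
  then have "field_entry h q (cell_pack f h q z c) (cnt f t - cnt f (c * ?Z)) =
      (\<Sum>e<q. of_bool (e \<le> t div z mod q))"
    unfolding field_entry_def by (intro sum.cong) auto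
  also have "\<dots> = Suc (t div z mod q)" using z sum_of_bool_le[of "t div z mod q" q] by simp
  finally show ?thesis .
qed

section \<open>The levels of the wavelet tree as one bit string\<close>

lemma symbol_bits_bounds:
  assumes "1 \<le> x" shows "x \<le> 2 ^ symbol_bits x" "2 ^ symbol_bits x < 2 * x"
proof -
  have "0 \<le> log 2 (real x)" using assms by simp
  then have k: "real (symbol_bits x) = of_int \<lceil>log 2 (real x)\<rceil>"
    unfolding symbol_bits_def by (simp add: le_ceiling_iff)
  have "log 2 (real x) \<le> real (symbol_bits x)" unfolding k by linarith
  then have "real x \<le> 2 powr real (symbol_bits x)" using assms by (simp add: log_le_iff)
  then have "real x \<le> real (2 ^ symbol_bits x)" by (simp add: powr_realpow)
  then show "x \<le> 2 ^ symbol_bits x" by linarith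
  have "real (symbol_bits x) - 1 < log 2 (real x)" unfolding k by linarith
  then have "2 powr (real (symbol_bits x) - 1) < real x" using assms by (simp add: less_log_iff)
  then have "2 powr real (symbol_bits x) / 2 < real x" by (simp add: powr_diff)
  then have "real (2 ^ symbol_bits x) < real (2 * x)" by (simp add: powr_realpow)
  then show "2 ^ symbol_bits x < 2 * x" by linarith
qed

text \<open>This lets a program find the logarithm by testing all candidates simultaneously.\<close>

lemma symbol_bits_unique:
  assumes "1 \<le> x" "x \<le> 2 ^ t" "2 ^ t < 2 * x" shows "t = symbol_bits x"
proof -
  note b = symbol_bits_bounds[OF assms(1)]
  have "(2::nat) ^ t < 2 ^ Suc (symbol_bits x)" using assms b by simp
  then have "t < Suc (symbol_bits x)" by (simp only: power_strict_increasing_iff)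
  moreover have "(2::nat) ^ symbol_bits x < 2 ^ Suc t" using assms b by simp
  then have "symbol_bits x < Suc t" by (simp only: power_strict_increasing_iff)
  ultimately show ?thesis by simp
qed

lemma convex_nat_set:
  fixes A :: "nat set"
  assumes "finite A" "a \<in> A" and convex: "\<And>x y z. x \<in> A \<Longrightarrow> z \<in> A \<Longrightarrow> x \<le> y \<Longrightarrow> y \<le> z \<Longrightarrow> y \<in> A"
  shows "A = {(LEAST x. x \<in> A)..<(LEAST x. x \<in> A) + card A}"
proof -
  let ?m = "LEAST x. x \<in> A"
  have m: "?m \<in> A" using assms(2) by (rule LeastI)
  have "A = {?m..Max A}"
  proof (intro equalityI subsetI)
    fix x assume "x \<in> A"
    then show "x \<in> {?m..Max A}" using assms(1) by (simp add: Least_le)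
  next
    fix x assume "x \<in> {?m..Max A}"
    moreover have "Max A \<in> A" using assms(1,2) by (intro Max_in) auto
    ultimately show "x \<in> A" using convex[OF m, of "Max A" x] by simp
  qed
  moreover from this have "card A = Suc (Max A) - ?m" by (metis card_atLeastAtMost)
  moreover have "?m \<le> Max A" using m assms(1) by simp
  then have "{?m..Max A} = {?m..<?m + (Suc (Max A) - ?m)}" by auto
  ultimately show ?thesis by simp
qed

lemma filter_upt_interval: "b \<le> k \<Longrightarrow> filter (\<lambda>x. a \<le> x \<and> x < b) [0..<k] = [a..<b]"
proof (induction k arbitrary: b)
  case (Suc k)
  show ?case
  proof (cases "b = Suc k")
    case True
    have "filter (\<lambda>x. a \<le> x \<and> x < Suc k) [0..<k] = filter (\<lambda>x. a \<le> x \<and> x < k) [0..<k]"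
      by (rule filter_cong) auto
    then show ?thesis using Suc.IH[of k] True by auto
  qed (use Suc in auto)
qed simp

text \<open>\<open>rowlen_large\<close> leaves room for the product of any two parameters below a
  row length. It follows, like \<open>w_large\<close> and \<open>n_w\<close>, from w \<ge> 2^16 * lg
  n; see \<open>wavelet_inputI\<close>.\<close>

locale wavelet_input =
  fixes n \<sigma> w :: nat and S :: "nat list" and r :: sort_routine
  assumes length_S: "length S = n"
    and sigma: "1 \<le> \<sigma>" "\<sigma> \<le> n"
    and set_S: "set S \<subseteq> {0..<\<sigma>}"
    and stable: "stable_integer_sort r"
    and w_large: "2 ^ 16 \<le> w"
    and n_w: "2 * n \<le> 2 ^ w" "symbol_bits n < w"
    and rowlen_large: "(2 ^ 8 * n * w ^ 8)\<^sup>2 \<le> rowlen w"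
begin

text \<open>
  A single level is kept if \<open>\<sigma> = 1\<close>, hence \<open>L'\<close>. Position \<open>x\<close> of the bit string belongs to the level \<open>x div n\<close> and
  to the node \<open>own x\<close>, in heap order with root 1; \<open>nst\<close> and \<open>nen\<close> delimit the positions of a node. Small and large
  cells have \<open>Z1\<close> and \<open>Z2\<close> positions, and the bit string is padded to length \<open>NN\<close>.
\<close>

definition L where "L = symbol_bits \<sigma>"
definition L' where "L' = L + of_bool (L = 0)"
definition N where "N = n * L'"
text \<open>Counts inside a large cell are at most q^2 * w \<le> w^3, so they fit into
  \<open>h\<close> bits. So do the arguments of \<open>sel_entry\<close>, which are at most 2 *
  w.\<close>

definition h where "h = symbol_bits (4 * w ^ 3 + 1)"
text \<open>A quarter of the logarithm keeps the table at about n^(1/4) entries, up to powers of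
  \<open>w\<close>. Adding 1 keeps \<open>q\<close> positive.\<close>

definition q where "q = symbol_bits n div (4 * h) + 1"
text \<open>One sample of \<open>w\<close> bits per \<open>w * h\<close> occurrences costs 1 / h
  bits per occurrence.\<close>

definition G where "G = w * h"
definition Z1 where "Z1 = q * w"
definition Z2 where "Z2 = q * Z1"
text \<open>Windows and queries look one cell beyond the last cell of a node. The summand 3 leaves
  more than two large cells of padding after position \<open>N\<close>.\<close>

definition NN where "NN = (N div Z2 + 3) * Z2"
definition NW where "NW = NN div w"
definition U where "U = q * h"

definition srt :: "nat \<Rightarrow> nat list" where
  "srt l = (if l = 0 then S else sorted_by r \<sigma> l S)"
definition own :: "nat \<Rightarrow> nat" where
  "own x = 2 ^ (x div n) + (srt (x div n) ! (x mod n)) div 2 ^ (L - x div n)"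
text \<open>For \<sigma> = 1 the root has the range [0..0] with midpoint 0, so every symbol counts
  as lying to the right and every bit is 1. The added \<open>of_bool\<close> produces this.\<close>

definition lbit :: "nat \<Rightarrow> bool" where
  "lbit x = odd ((srt (x div n) ! (x mod n) + of_bool (L = 0)) div 2 ^ (L' - 1 - x div n))"
text \<open>The default 0 for a node without positions agrees with the value by which
  \<open>st_prog\<close> initialises array 31.\<close>

definition nst :: "nat \<Rightarrow> nat" where
  "nst v = (if \<exists>x<N. own x = v then LEAST x. x < N \<and> own x = v else 0)"
definition nen :: "nat \<Rightarrow> nat" where
  "nen v = nst v + card {x. x < N \<and> own x = v}"

section \<open>Nodes as intervals of the sorted levels\<close>

lemma n_pos: "0 < n" using sigma by simp
lemma w_pos: "0 < w" using w_large by simp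

lemma L_bounds: "\<sigma> \<le> 2 ^ L" "2 ^ L < 2 * \<sigma>"
  using symbol_bits_bounds[of \<sigma>] sigma by (auto simp: L_def)

lemma L'_pos: "1 \<le> L'" and L_le_L': "L \<le> L'"
  by (auto simp: L'_def)

lemma level_le: "l < L' \<Longrightarrow> l \<le> L" by (cases "L = 0") (auto simp: L'_def)

lemma S_less: "x \<in> set S \<Longrightarrow> x < 2 ^ L"
  using set_S L_bounds(1) by fastforce

text \<open>Level 0 is not a legal call of the routine, which needs at least one bit. There all keys
  are 0, so \<open>S\<close> itself is a valid output.\<close>

lemma srt_stable: "l < L' \<Longrightarrow> stable_sort_of (top_bits \<sigma> l) S (srt l)"
proof (cases "l = 0")
  case True
  have "top_bits \<sigma> 0 x = 0" if "x \<in> set S" for x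
    using S_less[OF that] by (simp add: top_bits_def drop_bit_eq_div L_def)
  then have "map (top_bits \<sigma> 0) S = replicate (length S) 0" by (simp add: map_replicate_const[symmetric])
  then have "sorted (map (top_bits \<sigma> 0) S)" by (simp only: sorted_replicate)
  then show ?thesis using True by (simp add: stable_sort_of_def srt_def)
next
  case False
  assume "l < L'"
  with False have "l < L" by (cases "L = 0") (auto simp: L'_def)
  then have "valid_sort_input \<sigma> l S"
    using False sigma length_S set_S by (simp add: valid_sort_input_def L_def)
  then show ?thesis using stable False by (simp add: stable_integer_sort_def srt_def)
qed

lemma srt_set: "l < L' \<Longrightarrow> set (srt l) = set S" and length_srt: "l < L' \<Longrightarrow> length (srt l) = n"
  using srt_stable[of l] length_S by (auto simp: stable_sort_of_def dest: mset_eq_setD mset_eq_length)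

lemma srt_less: "l < L' \<Longrightarrow> i < n \<Longrightarrow> srt l ! i < 2 ^ L"
  using S_less srt_set length_srt by (metis nth_mem)

lemma pos_level: "x < N \<Longrightarrow> x div n < L'"
  unfolding N_def by (simp add: less_mult_imp_div_less mult.commute)

lemma own_split: "own x = 2 ^ (x div n) + top_bits \<sigma> (x div n) (srt (x div n) ! (x mod n))"
  by (simp add: own_def top_bits_def drop_bit_eq_div L_def)

lemma own_level: "x < N \<Longrightarrow> 2 ^ (x div n) \<le> own x \<and> own x < 2 ^ Suc (x div n)"
proof -
  assume x: "x < N"
  let ?l = "x div n"
  have "srt ?l ! (x mod n) < 2 ^ L" using srt_less[OF pos_level[OF x]] n_pos by simp
  also have "(2::nat) ^ L = 2 ^ ?l * 2 ^ (L - ?l)"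
    using level_le[OF pos_level[OF x]] by (simp add: power_add[symmetric])
  finally have "srt ?l ! (x mod n) div 2 ^ (L - ?l) < 2 ^ ?l" by (simp add: less_mult_imp_div_less)
  then show ?thesis by (simp add: own_def)
qed

lemma own_less: "x < N \<Longrightarrow> own x < 2 ^ L'"
proof -
  assume x: "x < N"
  have "(2::nat) ^ Suc (x div n) \<le> 2 ^ L'" using pos_level[OF x] by (intro power_increasing) auto
  with own_level[OF x] show ?thesis by linarith
qed

lemma own_pos: "x < N \<Longrightarrow> 0 < own x"
  using own_level[of x] by (metis less_le_trans zero_less_numeral zero_less_power)

text \<open>Inside a level this is sortedness by the top bits, between levels it is the heap order.
  Hence the positions of a node form an interval.\<close>

lemma own_mono: "x \<le> y \<Longrightarrow> y < N \<Longrightarrow> own x \<le> own y"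
proof (cases "x div n = y div n")
  case True
  assume a: "x \<le> y" "y < N"
  let ?l = "y div n"
  have "sorted (map (top_bits \<sigma> ?l) (srt ?l))" "length (srt ?l) = n"
    using srt_stable length_srt pos_level a by (auto simp: stable_sort_of_def)
  moreover have "x mod n \<le> y mod n" using True a by (metis add_le_cancel_left div_mult_mod_eq)
  moreover have "y mod n < n" using n_pos by simp
  ultimately have "map (top_bits \<sigma> ?l) (srt ?l) ! (x mod n) \<le> map (top_bits \<sigma> ?l) (srt ?l) ! (y mod n)"
    by (intro sorted_nth_mono) auto
  then show ?thesis using True \<open>length (srt ?l) = n\<close> n_pos by (simp add: own_split)
next
  case False
  assume a: "x \<le> y" "y < N"
  then have "x div n < y div n" using False by (meson div_le_mono le_neq_implies_less)
  then have "(2::nat) ^ Suc (x div n) \<le> 2 ^ (y div n)" by (intro power_increasing) auto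
  with own_level[of x] own_level[of y] a show ?thesis by simp
qed

lemma own_set: "{x. x < N \<and> own x = v} = {nst v..<nen v}"
proof (cases "\<exists>x<N. own x = v")
  case True
  let ?A = "{x. x < N \<and> own x = v}"
  have "y \<in> ?A" if "x \<in> ?A" "z \<in> ?A" "x \<le> y" "y \<le> z" for x y z
    using that own_mono[of x y] own_mono[of y z] by auto
  moreover obtain x where "x \<in> ?A" using True by auto
  moreover have "finite ?A" by simp
  ultimately have "?A = {(LEAST x. x \<in> ?A)..<(LEAST x. x \<in> ?A) + card ?A}"
    by (intro convex_nat_set) blast+
  then show ?thesis using True by (simp add: nen_def nst_def)
next
  case False
  then have "{x. x < N \<and> own x = v} = {}" by blast
  then show ?thesis by (simp add: nen_def)
qed

lemma mem_node_iff: "x < N \<and> own x = v \<longleftrightarrow> nst v \<le> x \<and> x < nen v"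
proof -
  have "x \<in> {x. x < N \<and> own x = v} \<longleftrightarrow> x \<in> {nst v..<nen v}" by (simp only: own_set)
  then show ?thesis by simp
qed

lemma own_iff: "x < N \<Longrightarrow> own x = v \<longleftrightarrow> nst v \<le> x \<and> x < nen v"
  using mem_node_iff[of x v] by simp

lemma nen_bounds: "nst v \<le> nen v" "nen v \<le> N"
proof -
  show "nst v \<le> nen v" by (simp add: nen_def)
  show "nen v \<le> N"
  proof (cases "nst v < nen v")
    case True
    then show ?thesis using mem_node_iff[of "nen v - 1" v] by auto
  next
    case False
    then have "\<not> (\<exists>x<N. own x = v)" using mem_node_iff[of _ v] by auto
    then have "nst v = 0" unfolding nst_def by (rule if_not_P)
    then show ?thesis using False by linarith
  qed
qed

lemma nst_le: "nst v \<le> N" using nen_bounds[of v] by linarith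

lemma node_positions: "nst v \<le> x \<Longrightarrow> x < nen v \<Longrightarrow> x < N \<and> own x = v"
  using mem_node_iff[of x v] by simp

lemma node_length: "nen v - nst v \<le> n"
proof (cases "nst v < nen v")
  case True
  define l where "l = nst v div n"
  have "x div n = l" if "nst v \<le> x" "x < nen v" for x
  proof -
    note p = own_level[of x] own_level[of "nst v"] node_positions[OF that] node_positions[of v "nst v"] True
    then have "(2::nat) ^ (x div n) < 2 ^ Suc l" "(2::nat) ^ l < 2 ^ Suc (x div n)" unfolding l_def by auto
    then have "x div n < Suc l" "l < Suc (x div n)" by (simp_all only: power_strict_increasing_iff)
    then show ?thesis by simp
  qed
  from this[of "nen v - 1"] this[of "nst v"] True
  have "(nen v - 1) div n = l" "nst v div n = l" by auto
  then have "nen v - 1 < l * n + n" "l * n \<le> nst v"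
    using n_pos by (metis add.commute dividend_less_div_times, metis div_times_less_eq_dividend)
  then show ?thesis by linarith
qed simp

text \<open>This is where stability enters: the symbols sharing their top \<open>l\<close> bits
  stand next to each other in the sorted level and in their original order, so they form the
  subsequence of the node.\<close>

lemma node_elements:
  assumes l: "l < L'" and p: "p < 2 ^ l"
  shows "filter (\<lambda>y. y div 2 ^ (L - l) = p) S =
      map (\<lambda>x. srt l ! (x mod n)) [nst (2 ^ l + p)..<nen (2 ^ l + p)]"
    and "\<And>x. nst (2 ^ l + p) \<le> x \<Longrightarrow> x < nen (2 ^ l + p) \<Longrightarrow> x div n = l"
proof -
  let ?v = "2 ^ l + p" and ?key = "\<lambda>y. y div 2 ^ (L - l)"
  show lev: "x div n = l" if "nst ?v \<le> x" "x < nen ?v" for x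
  proof -
    have "2 ^ (x div n) < (2::nat) ^ Suc l" "(2::nat) ^ l < 2 ^ Suc (x div n)"
      using own_level[of x] node_positions[OF that] p by auto
    then have "x div n < Suc l" "l < Suc (x div n)" by (simp_all only: power_strict_increasing_iff)
    then show ?thesis by simp
  qed
  have key: "top_bits \<sigma> l = ?key" by (simp add: fun_eq_iff top_bits_def drop_bit_eq_div L_def)
  have "filter (\<lambda>y. ?key y = p) S = filter (\<lambda>y. ?key y = p) (srt l)"
    using srt_stable[OF l] by (simp add: stable_sort_of_def key)
  also have "srt l = map ((!) (srt l)) [0..<n]" using length_srt[OF l] by (metis map_nth)
  also have "filter (\<lambda>y. ?key y = p) (map ((!) (srt l)) [0..<n]) =
      map ((!) (srt l)) (filter (\<lambda>i. ?key (srt l ! i) = p) [0..<n])"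
    by (simp add: filter_map o_def)
  also have "filter (\<lambda>i. ?key (srt l ! i) = p) [0..<n] =
      filter (\<lambda>i. nst ?v - l * n \<le> i \<and> i < nen ?v - l * n) [0..<n]"
  proof (rule filter_cong[OF refl])
    fix i assume "i \<in> set [0..<n]"
    then have i: "i < n" by simp
    have d: "(l * n + i) div n = l" "(l * n + i) mod n = i" using i by simp_all
    have "l * n + i < Suc l * n" using i by simp
    also have "\<dots> \<le> L' * n" using l by (intro mult_right_mono) auto
    finally have x: "l * n + i < N" by (simp add: N_def mult.commute)
    have "?key (srt l ! i) = p \<longleftrightarrow> own (l * n + i) = ?v" using i by (simp add: own_def d)
    also have "\<dots> \<longleftrightarrow> nst ?v \<le> l * n + i \<and> l * n + i < nen ?v" by (rule own_iff[OF x])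
    also have "\<dots> \<longleftrightarrow> nst ?v - l * n \<le> i \<and> i < nen ?v - l * n" by auto
    finally show "(?key (srt l ! i) = p) = \<dots>" .
  qed
  also have "\<dots> = [nst ?v - l * n..<nen ?v - l * n]"
  proof (rule filter_upt_interval)
    show "nen ?v - l * n \<le> n"
    proof (cases "nst ?v < nen ?v")
      case True
      with lev[of "nen ?v - 1"] have "(nen ?v - 1) div n = l" by auto
      then have "nen ?v - 1 < l * n + n" using n_pos by (metis add.commute dividend_less_div_times)
      then show ?thesis by simp
    next
      case False
      then have "nen ?v = nst ?v" "\<not> (\<exists>x<N. own x = ?v)"
        using nen_bounds[of ?v] mem_node_iff[of _ ?v] by auto
      then show ?thesis by (simp add: nst_def)
    qed
  qed
  also have "map ((!) (srt l)) \<dots> = map (\<lambda>x. srt l ! (x mod n)) [nst ?v..<nen ?v]"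
  proof (cases "nst ?v < nen ?v")
    case True
    with lev[of "nst ?v"] have "nst ?v div n = l" by simp
    then have ln: "l * n \<le> nst ?v" by (metis div_times_less_eq_dividend)
    show ?thesis
    proof (rule nth_equalityI)
      show "length (map ((!) (srt l)) [nst ?v - l * n..<nen ?v - l * n]) =
        length (map (\<lambda>x. srt l ! (x mod n)) [nst ?v..<nen ?v])" using ln by simp
    next
      fix i assume "i < length (map ((!) (srt l)) [nst ?v - l * n..<nen ?v - l * n])"
      then have i: "nst ?v + i < nen ?v" using ln by simp
      have "(nst ?v + i) mod n = nst ?v + i - l * n"
        using lev[of "nst ?v + i"] i by (simp add: minus_div_mult_eq_mod[symmetric])
      then show "map ((!) (srt l)) [nst ?v - l * n..<nen ?v - l * n] ! i =
        map (\<lambda>x. srt l ! (x mod n)) [nst ?v..<nen ?v] ! i"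
        using i ln nth_upt[OF i] by simp
    qed
  qed simp
  finally show "filter (\<lambda>y. ?key y = p) S = map (\<lambda>x. srt l ! (x mod n)) [nst ?v..<nen ?v]" .
qed

lemma range_iff:
  "(y::nat) \<in> {p * 2 ^ k..p * 2 ^ k + 2 ^ k - 1} \<longleftrightarrow> y div 2 ^ k = p"
proof -
  have "y div 2 ^ k = p \<longleftrightarrow> p * 2 ^ k \<le> y \<and> y < p * 2 ^ k + 2 ^ k"
  proof
    assume "y div 2 ^ k = p"
    then show "p * 2 ^ k \<le> y \<and> y < p * 2 ^ k + 2 ^ k"
      using div_times_less_eq_dividend[of y "2 ^ k"] dividend_less_div_times[of "2 ^ k" y]
      by (simp add: add.commute)
  qed (auto intro: div_nat_eqI simp: algebra_simps)
  moreover have "y \<in> {A..A + B - 1} \<longleftrightarrow> A \<le> y \<and> y < A + B" if "0 < B" for A B :: nat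
    using that by auto
  ultimately show ?thesis by simp
qed

definition node_bits :: "nat \<Rightarrow> bool list" where
  "node_bits v = map lbit [nst v..<nen v]"

lemma length_node_bits: "length (node_bits v) = nen v - nst v"
  by (simp add: node_bits_def)

text \<open>Heap numbers turn the recursion into arithmetic: level \<open>l\<close> and prefix
  \<open>p\<close> give the node 2^l + p, and its children are twice that number and the successor.
  \<open>ok\<close> and \<open>ch\<close> are assumed for all heap numbers, so nodes omitted by the
  tree cause no case distinction.\<close>

lemma wt_node_stored:
  assumes "l < L'" "p < 2 ^ l" "p * 2 ^ (L - l) = a" "a + 2 ^ (L - l) - 1 = b"
    and ok: "\<And>v. v < 2 ^ L' \<Longrightarrow> 0 < v \<Longrightarrow> node_ok (P v) (node_bits v)"
    and ch: "\<And>v. v < 2 ^ L' \<Longrightarrow> 0 < v \<Longrightarrow> M (P v + 5) = P (2 * v) \<and> M (P v + 6) = P (2 * v + 1)"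
  shows "stores_wtree node_ok M (P (2 ^ l + p)) (wt_node S a b)"
  using assms(1-4)
proof (induction "L' - l" arbitrary: l p a b rule: less_induct)
  case less
  note l = less.prems(1) and p = less.prems(2) and a = less.prems(3) and b = less.prems(4)
  let ?k = "L - l" and ?v = "2 ^ l + p"
  let ?Sv = "filter (\<lambda>x. x \<in> {a..b}) S" and ?mid = "(a + b + 1) div 2"
  let ?B = "map (\<lambda>x. x \<notin> {a..<?mid}) ?Sv"
  have "?Sv = filter (\<lambda>y. y div 2 ^ ?k = p) S"
    unfolding a[symmetric] b[symmetric] by (simp only: range_iff)
  also have "\<dots> = map (\<lambda>x. srt l ! (x mod n)) [nst ?v..<nen ?v]"
    by (rule node_elements(1)[OF l p])
  finally have Sv: "?Sv = \<dots>" .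
  have ab: "a + b + 1 = 2 * a + 2 ^ ?k" 
  proof -
    have "a + (a + B - 1) + 1 = 2 * a + B" if "0 < B" for B :: nat using that by simp
    from this[of "2 ^ ?k"] show ?thesis unfolding b by simp
  qed
  have "(srt l ! (x mod n) \<notin> {a..<?mid}) = lbit x" if x: "nst ?v \<le> x" "x < nen ?v" for x
  proof -
    let ?e = "srt l ! (x mod n)"
    have xl: "x div n = l" by (rule node_elements(2)[OF l p x])
    have ep: "?e div 2 ^ ?k = p"
    proof -
      have "own x = ?v" using node_positions[OF x] by simp
      then show ?thesis by (simp add: own_def xl)
    qed
    show ?thesis
    proof (cases "L = 0")
      case True
      then have "l = 0" using l by (simp add: L'_def)
      moreover have "?e = 0"
        using srt_less[of 0 "x mod n"] True \<open>l = 0\<close> n_pos l by simp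
      ultimately show ?thesis using True ab xl p by (simp add: lbit_def L'_def)
    next
      case False
      then have L': "L' = L" "l < L" using l by (simp_all add: L'_def)
      then obtain k where k: "?k = Suc k" by (metis Suc_diff_Suc)
      have mid: "?mid = a + 2 ^ k" using ab k by simp
      have "a \<le> ?e" "?e < a + 2 * 2 ^ k"
      proof -
        have "?e \<in> {p * 2 ^ ?k..p * 2 ^ ?k + 2 ^ ?k - 1}" using ep by (simp only: range_iff)
        then have "a \<le> ?e" "?e \<le> a + 2 ^ ?k - 1" using a by auto
        moreover have "e < a + B" if "e \<le> a + B - 1" "0 < B" for e B :: nat using that by simp
        from this[of ?e "2 ^ ?k"] calculation have "?e < a + 2 ^ ?k" by simp
        ultimately show "a \<le> ?e" "?e < a + 2 * 2 ^ k" unfolding k by simp_all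
      qed
      moreover have "?e div 2 ^ k = 2 * p + (?e - a) div 2 ^ k"
      proof -
        have "?e = 2 * p * 2 ^ k + (?e - a)" using a k \<open>a \<le> ?e\<close> by simp
        then show ?thesis by (metis add.commute div_mult_self3 power_not_zero zero_neq_numeral)
      qed
      moreover have "L' - 1 - l = k" using L' k by simp
      moreover have "(?e - a) div 2 ^ k < 2" using calculation(1,2)
        by (intro less_mult_imp_div_less) simp
      moreover have "(?e - a) div 2 ^ k = 0 \<longleftrightarrow> ?e - a < 2 ^ k" by (simp add: div_eq_0_iff)
      ultimately have "lbit x \<longleftrightarrow> \<not> ?e - a < 2 ^ k"
        using False xl by (auto simp: lbit_def less_2_cases_iff)
      then show ?thesis using mid \<open>a \<le> ?e\<close> by auto
    qed
  qed
  then have B: "?B = node_bits ?v" unfolding Sv node_bits_def by simp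
  have v: "?v < 2 ^ L'" "0 < ?v"
  proof -
    have "?v < 2 ^ Suc l" using p by simp
    also have "\<dots> \<le> (2::nat) ^ L'" using l by (intro power_increasing) auto
    finally show "?v < 2 ^ L'" .
  qed simp
  show ?case
  proof (cases "b + 1 - a \<le> 2 \<or> ?Sv = []")
    case True
    then have "wt_node S a b = Leaf ?B" by (subst wt_node.simps) (simp only: Let_def if_True)
    then show ?thesis using ok[OF v] B by simp
  next
    case False
    then have wt: "wt_node S a b = Node ?B (wt_node S a (?mid - 1)) (wt_node S ?mid b)"
      by (subst wt_node.simps) (simp only: Let_def if_False)
    \<comment> \<open>A range of more than two symbols leaves at least two bits undecided, so the
      children still belong to a level.\<close>
    have k2: "2 < (2::nat) ^ ?k" using False ab by simp
    then have "?k \<noteq> 0" "?k \<noteq> 1" by auto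
    then have k: "Suc l < L" by simp
    then have L': "L' = L" by (simp add: L'_def)
    define k' where "k' = L - Suc l"
    have kk: "?k = Suc k'" using k by (simp add: k'_def)
    have mid: "?mid = a + 2 ^ k'" using ab kk by simp
    have a': "a = (2 * p) * 2 ^ k'" using a kk by simp
    have "stores_wtree node_ok M (P (2 ^ Suc l + 2 * p)) (wt_node S a (?mid - 1))"
      by (rule less.hyps) (use p k L' l a' mid kk in \<open>auto simp: k'_def[symmetric]\<close>)
    moreover have "stores_wtree node_ok M (P (2 ^ Suc l + (2 * p + 1))) (wt_node S ?mid b)"
      by (rule less.hyps) (use p k L' l a' mid b kk in \<open>auto simp: k'_def[symmetric]\<close>)
    moreover have "2 ^ Suc l + 2 * p = 2 * ?v" "2 ^ Suc l + (2 * p + 1) = 2 * ?v + 1" by simp_all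
    ultimately show ?thesis using wt ok[OF v] ch[OF v] B by simp
  qed
qed

lemma wavelet_tree_stored:
  assumes "\<And>v. v < 2 ^ L' \<Longrightarrow> 0 < v \<Longrightarrow> node_ok (P v) (node_bits v)"
    and "\<And>v. v < 2 ^ L' \<Longrightarrow> 0 < v \<Longrightarrow> M (P v + 5) = P (2 * v) \<and> M (P v + 6) = P (2 * v + 1)"
  shows "stores_wtree node_ok M (P 1) (wavelet_tree \<sigma> S)"
  using wt_node_stored[of 0 0 0 "2 ^ L - 1" node_ok P M, OF _ _ _ _ assms] L'_pos
  by (simp add: wavelet_tree_def L_def)

end

section \<open>Parameters and running times\<close>

context wavelet_input
begin

abbreviation Q where "Q \<equiv> rowlen w"

text \<open>A common bound for all parameters. The exponent 8 is dictated by the lookup table, whose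
  size is bounded by a multiple of n * w^6.\<close>

definition BB where "BB = 2 ^ 8 * n * w ^ 8"

lemma BB_less: "BB < Q" and BB_sq: "BB * BB \<le> Q"
proof -
  show sq: "BB * BB \<le> Q" using rowlen_large by (simp add: BB_def power2_eq_square)
  have "1 \<le> n * w ^ 8" using n_pos w_pos by (simp add: Suc_le_eq)
  then have "2 \<le> BB" unfolding BB_def by simp
  then have "BB * 2 \<le> BB * BB" by (intro mult_left_mono) auto
  with sq \<open>2 \<le> BB\<close> show "BB < Q" by linarith
qed

lemma le_BB:
  assumes "x \<le> c * n * w ^ k" "c \<le> 2 ^ 8" "k \<le> 8" shows "x \<le> BB"
proof -
  have "c * n * w ^ k \<le> 2 ^ 8 * n * w ^ 8"
    using assms w_pos by (intro mult_mono power_increasing) auto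
  with assms show ?thesis unfolding BB_def by linarith
qed

lemma le_BB': "x \<le> c * w ^ k \<Longrightarrow> c \<le> 2 ^ 8 \<Longrightarrow> k \<le> 8 \<Longrightarrow> x \<le> BB"
proof -
  assume a: "x \<le> c * w ^ k" "c \<le> 2 ^ 8" "k \<le> 8"
  have "c * 1 * w ^ k \<le> c * n * w ^ k" using n_pos by (intro mult_mono) auto
  with a(1) have "x \<le> c * n * w ^ k" by (metis mult.right_neutral order_trans)
  then show ?thesis using a(2,3) by (rule le_BB)
qed

lemma Q_le_word: "Q \<le> 2 ^ (w div 64)" "Q ^ 4 < 2 ^ w"
  using rowlen_power_le_less[OF w_large, of 4 "Q ^ 4"] by (simp_all add: rowlen_def)

lemma w3: "2 \<le> w ^ 3"
proof -
  have "w ^ 1 \<le> w ^ 3" using w_pos by (intro power_increasing) auto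
  with w_large show ?thesis by simp
qed

lemma h_bounds: "4 * w ^ 3 < 2 ^ h" "2 ^ h \<le> 9 * w ^ 3"
  using symbol_bits_bounds[of "4 * w ^ 3 + 1"] w3 by (auto simp: h_def)

lemma pow_h_BB: "2 ^ h \<le> BB"
  by (rule le_BB'[OF h_bounds(2)]) auto

lemma power_le_Q: "2 ^ k \<le> Q \<Longrightarrow> k \<le> w div 64"
  using Q_le_word(1) by (meson le_trans power_increasing_iff one_less_numeral_iff semiring_norm(76))

lemma h_le: "h \<le> w div 64" and h_pos: "0 < h"
proof -
  show "h \<le> w div 64" using pow_h_BB BB_less by (intro power_le_Q) simp
  show "0 < h" using h_bounds(1) w3 by (cases h) auto
qed

lemma q_le: "q \<le> w" and q_pos: "0 < q"
proof -
  have "symbol_bits n div (4 * h) \<le> symbol_bits n" by (rule div_le_dividend)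
  with n_w show "q \<le> w" unfolding q_def by linarith
qed (simp add: q_def)

lemma Z2_le: "Z2 \<le> w ^ 3"
proof -
  have Z1: "Z1 \<le> w ^ 2" unfolding Z1_def power2_eq_square using q_le by (rule mult_right_mono) simp
  have "Z2 \<le> w * w ^ 2" unfolding Z2_def by (intro mult_mono q_le Z1) auto
  then show "Z2 \<le> w ^ 3" by (simp add: power3_eq_cube power2_eq_square)
qed

lemma Z_pos: "0 < Z1" "0 < Z2" and G_pos: "0 < G"
  using q_pos w_pos h_pos by (simp_all add: Z1_def Z2_def G_def)

lemma w_le_Z: "w \<le> Z1" "Z1 \<le> Z2" "w \<le> Z2"
proof -
  show 1: "w \<le> Z1" "Z1 \<le> Z2" using q_pos by (simp_all add: Z1_def Z2_def)
  then show "w \<le> Z2" by simp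
qed

lemma Z1_less: "q * w < 2 ^ h" and Z2_less: "q * Z1 < 2 ^ h"
  using h_bounds(1) Z2_le w_le_Z Z1_def Z2_def by linarith+

lemma G_le: "G \<le> w ^ 2"
proof -
  have "h \<le> w" using h_le by (meson div_le_dividend le_trans)
  then show ?thesis unfolding G_def power2_eq_square by simp
qed

lemma L_less: "L < w"
proof -
  have "(2::nat) ^ L < 2 ^ w" using L_bounds(2) sigma n_w by linarith
  then show ?thesis by (simp only: power_strict_increasing_iff)
qed

lemma L'_le: "L' \<le> w" using L_less w_large by (cases "L = 0") (auto simp: L'_def)

lemma pow_L'_le: "2 ^ L' \<le> 2 * n"
  using L_bounds(2) sigma by (cases "L = 0") (auto simp: L'_def)

lemma N_le: "N \<le> n * w" unfolding N_def using L'_le by simp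

lemma n_le_N: "n \<le> N" unfolding N_def using L'_pos by simp

lemma NN_mult: "NN = (NN div Z2) * Z2" "NN = (NN div Z1) * Z1" "NN = NW * w"
proof -
  have d: "Z2 dvd NN" "Z1 dvd NN" "w dvd NN" unfolding NN_def Z2_def Z1_def by simp_all
  then show "NN = (NN div Z2) * Z2" "NN = (NN div Z1) * Z1" "NN = NW * w"
    unfolding NW_def by simp_all
qed

lemma NN_upper: "NN \<le> N + 3 * Z2" and NN_lower: "N + 2 * Z2 < NN"
proof -
  have "N div Z2 * Z2 \<le> N" by (rule div_times_less_eq_dividend)
  moreover have "N < N div Z2 * Z2 + Z2" using Z_pos(2) by (metis add.commute dividend_less_div_times)
  moreover have "NN = N div Z2 * Z2 + 3 * Z2" unfolding NN_def by (simp add: algebra_simps)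
  ultimately show "NN \<le> N + 3 * Z2" "N + 2 * Z2 < NN" by linarith+
qed

lemma NN_BB: "64 * NN \<le> BB"
proof -
  have "w \<le> w ^ 3" using w_pos by (simp add: self_le_power)
  then have "n * w \<le> n * w ^ 3" by simp
  moreover have "w ^ 3 \<le> n * w ^ 3" using n_pos by simp
  ultimately have "NN \<le> 4 * (n * w ^ 3)" using NN_upper N_le Z2_le by linarith
  then show ?thesis by (intro le_BB[of _ "2 ^ 8" 3]) simp_all
qed

lemma less_NN: "N < NN" "w \<le> NN" "Z1 \<le> NN" "Z2 \<le> NN" "n \<le> NN" "NW \<le> NN" "NN div Z1 \<le> NN"
  "NN div Z2 \<le> NN" "0 < NN" "1 \<le> NW"
proof -
  show "N < NN" "Z2 \<le> NN" using NN_lower by simp_all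
  then show "w \<le> NN" "Z1 \<le> NN" "n \<le> NN" "0 < NN" using w_le_Z n_le_N by simp_all
  then show "1 \<le> NW" unfolding NW_def using w_pos by (simp add: Suc_le_eq div_greater_zero_iff)
qed (simp_all add: NW_def)

text \<open>A crude estimate that forgets the quarter in \<open>q\<close>; it suffices for
  addresses. The size of the table needs the sharper \<open>pow_U_h\<close>.\<close>

lemma U_le: "U + h \<le> w div 64" and TL_BB: "8 * 2 ^ (U + h) \<le> 8 * (2 ^ 8 * n * w ^ 6)"
  and TL_Q: "8 * 2 ^ (U + h) \<le> BB"
proof -
  have "U \<le> symbol_bits n + h"
  proof -
    have "symbol_bits n div (4 * h) * h \<le> symbol_bits n div (4 * h) * (4 * h)" by (rule mult_left_mono) auto
    also have "\<dots> \<le> symbol_bits n" by (rule div_times_less_eq_dividend)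
    finally show ?thesis unfolding U_def q_def by (simp add: algebra_simps)
  qed
  then have "(2::nat) ^ (U + h) \<le> 2 ^ (symbol_bits n + h + h)" by (intro power_increasing) auto
  also have "\<dots> = 2 ^ symbol_bits n * (2 ^ h * 2 ^ h)" by (simp add: power_add)
  also have "\<dots> \<le> (2 * n) * ((9 * w ^ 3) * (9 * w ^ 3))"
    using symbol_bits_bounds(2)[of n] n_pos by (intro mult_mono h_bounds(2)) auto
  also have "\<dots> = 162 * n * w ^ 6" by (simp add: power_add[symmetric] algebra_simps)
  also have "\<dots> \<le> 2 ^ 8 * n * w ^ 6" by simp
  finally have *: "(2::nat) ^ (U + h) \<le> 2 ^ 8 * n * w ^ 6" .
  then show "8 * 2 ^ (U + h) \<le> 8 * (2 ^ 8 * n * w ^ 6)" by simp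
  have "8 * w ^ 6 \<le> w ^ 2 * w ^ 6" 
  proof (rule mult_right_mono)
    have "w ^ 1 \<le> w ^ 2" using w_pos by (intro power_increasing) auto
    then show "8 \<le> w ^ 2" using w_large by simp
  qed simp
  then have "8 * w ^ 6 \<le> w ^ 8" by (simp add: power_add[symmetric])
  then have "2 ^ 8 * n * (8 * w ^ 6) \<le> 2 ^ 8 * n * w ^ 8" by (rule mult_left_mono) simp
  also have "2 ^ 8 * n * (8 * w ^ 6) = 8 * (2 ^ 8 * n * w ^ 6)" by simp
  finally have "8 * (2 ^ 8 * n * w ^ 6) \<le> BB" by (simp only: BB_def)
  moreover have "8 * 2 ^ (U + h) \<le> 8 * (2 ^ 8 * n * w ^ 6)" using * by (rule mult_left_mono) simp
  ultimately show TL: "8 * 2 ^ (U + h) \<le> BB" by (rule order_trans[rotated])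
  show "U + h \<le> w div 64" using TL BB_less by (intro power_le_Q) simp
qed

lemma params_le_BB: "n \<le> BB" "\<sigma> \<le> BB" "w \<le> BB" "L \<le> BB" "L' \<le> BB" "N \<le> BB" "h \<le> BB" "q \<le> BB"
  "Z2 \<le> BB" "G \<le> BB" "NN \<le> BB" "Z1 \<le> BB" "U \<le> BB" "2 ^ h \<le> BB" "NW \<le> BB"
  "2 ^ (U + h) \<le> BB" "2 ^ L' \<le> BB" "4 \<le> BB"
proof -
  show NN: "NN \<le> BB" using NN_BB by simp
  then show "w \<le> BB" "n \<le> BB" "N \<le> BB" "Z2 \<le> BB" "Z1 \<le> BB" "NW \<le> BB" using less_NN by linarith+
  then show "\<sigma> \<le> BB" "L \<le> BB" "L' \<le> BB" "q \<le> BB" using sigma L_less L'_le q_le by linarith+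
  have "w div 64 \<le> w" by simp
  with \<open>w \<le> BB\<close> h_le U_le show "h \<le> BB" "U \<le> BB" by linarith+
  show "G \<le> BB" using G_le by (intro le_BB'[of _ 1 2]) auto
  show "2 ^ h \<le> BB" by (rule pow_h_BB)
  show "2 ^ (U + h) \<le> BB" using TL_Q by simp
  show "2 ^ L' \<le> BB" using pow_L'_le by (intro le_BB[of _ 2 0]) auto
  show "4 \<le> BB" by (rule order_trans[OF _ \<open>w \<le> BB\<close>]) (use w_large in simp)
qed

lemma le_Q4: "x \<le> BB \<Longrightarrow> x \<le> Q ^ 4"
proof -
  assume "x \<le> BB"
  moreover have "Q ^ 1 \<le> Q ^ 4" by (rule power_increasing) (simp_all add: Suc_le_eq)
  ultimately show ?thesis using BB_less by simp
qed

lemma rowlen_le_Q4 [simp]: "Q \<le> Q ^ 4"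
proof -
  have "Q ^ 1 \<le> Q ^ 4" by (rule power_increasing) (simp_all add: Suc_le_eq)
  then show ?thesis by simp
qed

lemmas params_le_Q4 [simp] = params_le_BB[THEN le_Q4]

lemma le_Q: "x \<le> BB \<Longrightarrow> x \<le> Q" "x \<le> BB \<Longrightarrow> x < Q"
  using BB_less by simp_all

lemmas params_le_Q [simp] = params_le_BB[THEN le_Q(1)]
lemmas params_less_Q [simp] = params_le_BB[THEN le_Q(2)]

lemma le_NN_Q: "x \<le> 64 * NN \<Longrightarrow> x \<le> Q" "x \<le> 64 * NN \<Longrightarrow> x < Q" 
  using NN_BB BB_less by linarith+

definition param_regs :: "(nat \<Rightarrow> nat) \<Rightarrow> bool" where
  "param_regs R \<longleftrightarrow> R 0 = n \<and> R 1 = \<sigma> \<and> R 2 = w \<and> R 3 = L \<and> R 4 = L' \<and> R 5 = N \<and> R 6 = h \<and> R 7 = q \<and>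
     R 8 = Z2 \<and> R 9 = G \<and> R 10 = NN \<and> R 11 = Q \<and> R 13 = Z1 \<and> R 14 = U \<and> R 15 = 2 ^ h \<and>
     R 16 = of_bool (L = 0) \<and> R 17 = NW \<and> R 18 = 2 ^ (U + h) \<and> R 19 = 2 ^ L'"

lemma param_regsD:
  "param_regs R \<Longrightarrow> R 0 = n" "param_regs R \<Longrightarrow> R (Suc 0) = \<sigma>" "param_regs R \<Longrightarrow> R 1 = \<sigma>"
  "param_regs R \<Longrightarrow> R 2 = w"
  "param_regs R \<Longrightarrow> R 3 = L" "param_regs R \<Longrightarrow> R 4 = L'" "param_regs R \<Longrightarrow> R 5 = N"
  "param_regs R \<Longrightarrow> R 6 = h" "param_regs R \<Longrightarrow> R 7 = q" "param_regs R \<Longrightarrow> R 8 = Z2"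
  "param_regs R \<Longrightarrow> R 9 = G" "param_regs R \<Longrightarrow> R 10 = NN" "param_regs R \<Longrightarrow> R 11 = Q"
  "param_regs R \<Longrightarrow> R 13 = Z1" "param_regs R \<Longrightarrow> R 14 = U" "param_regs R \<Longrightarrow> R 15 = 2 ^ h"
  "param_regs R \<Longrightarrow> R 16 = of_bool (L = 0)" "param_regs R \<Longrightarrow> R 17 = NW"
  "param_regs R \<Longrightarrow> R 18 = 2 ^ (U + h)" "param_regs R \<Longrightarrow> R 19 = 2 ^ L'"
  by (simp_all add: param_regs_def)

section \<open>Program logic with built-in time and frame conditions\<close>

lemma param_regs_counter [simp]: "param_regs (R(12 := t)) = param_regs R"
  by (simp add: param_regs_def)

text \<open>A budget for lanes times rounds: positions, nodes, table entries with up to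
  \<open>w\<close> rounds, and also bitmap words with up to \<open>w\<close> rounds, as these are
  fewer than positions by the factor \<open>w\<close>.\<close>

definition X where "X = 4 * (NN + w + 2 ^ L' + 2 ^ (U + h) * (w + 1))"

text \<open>Time is measured relative to the code size. As \<open>csz\<close> is additive, composing
  programs requires no arithmetic on running times.\<close>

definition runs :: "com \<Rightarrow> (nat \<Rightarrow> nat) \<Rightarrow> (nat \<Rightarrow> nat) \<Rightarrow> (nat \<Rightarrow> nat) \<Rightarrow> (nat \<Rightarrow> nat) \<Rightarrow> bool" where
  "runs c R M R' M' \<longleftrightarrow> (\<exists>wk dp. exec w r c (R, M) (R', M') wk dp \<and> wk \<le> csz c * X \<and> dp \<le> csz c * (w + 1))"

lemma runs_Seq: "runs c1 R M R1 M1 \<Longrightarrow> runs c2 R1 M1 R2 M2 \<Longrightarrow> runs (Seq c1 c2) R M R2 M2"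
  unfolding runs_def
  by (elim exE conjE, intro exI conjI, erule (1) exec.Seq) (auto simp: add_mult_distrib)

definition same :: "nat set \<Rightarrow> (nat \<Rightarrow> nat) \<Rightarrow> (nat \<Rightarrow> nat) \<Rightarrow> bool" where
  "same A M M' \<longleftrightarrow> (\<forall>a<64. a \<notin> A \<longrightarrow> rd w M' a = rd w M a)"

lemma sameD: "same A M M' \<Longrightarrow> a < 64 \<Longrightarrow> a \<notin> A \<Longrightarrow> rd w M' a = rd w M a"
  by (simp add: same_def)

lemma same_trans: "same A M M1 \<Longrightarrow> same B M1 M2 \<Longrightarrow> same (A \<union> B) M M2"
  by (simp add: same_def)

lemma same_trans1: "same {a} M M1 \<Longrightarrow> same {a} M1 M2 \<Longrightarrow> same {a} M M2"
  by (simp add: same_def)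

definition writes ::
    "(nat \<Rightarrow> nat) \<Rightarrow> nat \<Rightarrow> nat \<Rightarrow> (nat \<Rightarrow> bool) \<Rightarrow> (nat \<Rightarrow> nat) \<Rightarrow> (nat \<Rightarrow> nat) \<Rightarrow> (nat \<Rightarrow> nat) \<Rightarrow> (nat \<Rightarrow> nat) \<Rightarrow> bool" where
  "writes M a kk Gd Xi Yi V M' \<longleftrightarrow>
    (\<forall>i<kk. Gd i \<longrightarrow> rd w M' a (Xi i) (Yi i) = V i) \<and>
    (\<forall>x y. (\<forall>i<kk. Gd i \<longrightarrow> \<not> (Xi i = x \<and> Yi i = y)) \<longrightarrow> rd w M' a x y = rd w M a x y) \<and>
    same {a} M M'"

lemma writes_val: "writes M a kk Gd Xi Yi V M' \<Longrightarrow> i < kk \<Longrightarrow> Gd i \<Longrightarrow> rd w M' a (Xi i) (Yi i) = V i"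
  unfolding writes_def by blast

lemma writes_other: "writes M a kk Gd Xi Yi V M' \<Longrightarrow>
    (\<And>i. i < kk \<Longrightarrow> Gd i \<Longrightarrow> Xi i = x \<Longrightarrow> Yi i = y \<Longrightarrow> False) \<Longrightarrow> rd w M' a x y = rd w M a x y"
  unfolding writes_def by blast

lemma writes_same: "writes M a kk Gd Xi Yi V M' \<Longrightarrow> same {a} M M'"
  unfolding writes_def by blast

lemma pd_exec':
  assumes P: "param_regs R" and a: "a < 64"
    and k: "safe w R M 0 k" "uval w R M 0 k = kk"
    and g: "\<And>i. i < kk \<Longrightarrow> safe w R M i g \<and> (uval w R M i g \<noteq> 0) = Gd i"
    and s: "\<And>i. i < kk \<Longrightarrow> Gd i \<Longrightarrow>
      safe w R M i x \<and> safe w R M i y \<and> safe w R M i v \<and>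
      uval w R M i x = Xi i \<and> uval w R M i y = Yi i \<and> uval w R M i v = V i \<and>
      Xi i < rowlen w \<and> Yi i < rowlen w"
    and sv: "\<And>i j. i < kk \<Longrightarrow> j < kk \<Longrightarrow> Gd i \<Longrightarrow> Gd j \<Longrightarrow> Xi i = Xi j \<Longrightarrow> Yi i = Yi j \<Longrightarrow> V i = V j"
  shows "\<exists>M' wk dp. exec w r (pd k a x y g v) (R, M) (R, M') wk dp \<and>
    wk \<le> csz (pd k a x y g v) * (kk + 1) \<and> dp \<le> csz (pd k a x y g v) \<and> writes M a kk Gd Xi Yi V M'"
  using pd_exec[OF w_large param_regsD(13)[OF P] a k, of g Gd x y v Xi Yi V r, OF g s sv]
  unfolding writes_def same_def singleton_iff .

text \<open>Existence of a run amounts to total correctness, because \<open>exec\<close> is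
  deterministic.\<close>

definition wp :: "com \<Rightarrow> (nat \<Rightarrow> nat) \<Rightarrow> (nat \<Rightarrow> nat) \<Rightarrow> ((nat \<Rightarrow> nat) \<Rightarrow> (nat \<Rightarrow> nat) \<Rightarrow> bool) \<Rightarrow> bool" where
  "wp c R M Post \<longleftrightarrow> (\<exists>R' M'. runs c R M R' M' \<and> Post R' M')"

lemma wp_Seq: "wp c1 R M (\<lambda>R1 M1. wp c2 R1 M1 Post) \<Longrightarrow> wp (Seq c1 c2) R M Post"
  unfolding wp_def using runs_Seq by blast

lemma wp_pd:
  assumes P: "param_regs R"
    and post: "\<And>M'. writes M a kk Gd Xi Yi V M' \<Longrightarrow> Post R M'"
    and a: "a < 64"
    and k: "safe w R M 0 k" "uval w R M 0 k = kk" "kk + 1 \<le> X"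
    and g: "\<And>i. i < kk \<Longrightarrow> safe w R M i g \<and> (uval w R M i g \<noteq> 0) = Gd i"
    and s: "\<And>i. i < kk \<Longrightarrow> Gd i \<Longrightarrow>
      safe w R M i x \<and> safe w R M i y \<and> safe w R M i v \<and>
      uval w R M i x = Xi i \<and> uval w R M i y = Yi i \<and> uval w R M i v = V i \<and>
      Xi i < rowlen w \<and> Yi i < rowlen w"
    and sv: "\<And>i j. i < kk \<Longrightarrow> j < kk \<Longrightarrow> Gd i \<Longrightarrow> Gd j \<Longrightarrow> Xi i = Xi j \<Longrightarrow> Yi i = Yi j \<Longrightarrow> V i = V j"
  shows "wp (pd k a x y g v) R M Post"
proof -
  from pd_exec'[of R a M k kk g Gd x y v Xi Yi V, OF P a k(1,2) g s sv] obtain M' wk dp where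
    1: "exec w r (pd k a x y g v) (R, M) (R, M') wk dp"
      "wk \<le> csz (pd k a x y g v) * (kk + 1)" "dp \<le> csz (pd k a x y g v)" and
    2: "writes M a kk Gd Xi Yi V M'" by blast
  have "csz (pd k a x y g v) * (kk + 1) \<le> csz (pd k a x y g v) * X" using k(3) by (rule mult_left_mono) simp
  moreover have "csz (pd k a x y g v) * 1 \<le> csz (pd k a x y g v) * (w + 1)" by (rule mult_left_mono) simp_all
  ultimately have "runs (pd k a x y g v) R M R M'"
    unfolding runs_def using 1 by (intro exI[of _ wk] exI[of _ dp]) linarith
  with post[OF 2] show ?thesis unfolding wp_def by blast
qed

lemma wp_for:
  assumes P: "param_regs R"
    and T: "\<And>t M. safe w (R(12 := t)) M 0 b \<and> uval w (R(12 := t)) M 0 b = T"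
    and TX: "(T + 1) * (kk + 1) \<le> X" "T \<le> w"
    and post: "\<And>M'. I T M' \<Longrightarrow> Post (R(12 := T)) M'"
    and I0: "I 0 M"
    and body: "\<And>t M. t < T \<Longrightarrow> I t M \<Longrightarrow> \<exists>M' wk dp. exec w r c (R(12 := t), M) (R(12 := t), M') wk dp \<and>
       wk \<le> csz c * (kk + 1) \<and> dp \<le> csz c \<and> I (Suc t) M'"
  shows "wp (for_do b c) R M Post"
proof -
  have "T \<le> Q" using TX(2) params_le_Q(3) by linarith
  from for_exec[of w R b T I M r c kk, OF w_large T this I0 body] obtain M' wk dp where
    1: "exec w r (for_do b c) (R, M) (R(12 := T), M') wk dp"
    "wk \<le> csz (for_do b c) * ((T + 1) * (kk + 1))" "dp \<le> csz (for_do b c) * (T + 1)" "I T M'" by blast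
  have "csz (for_do b c) * ((T + 1) * (kk + 1)) \<le> csz (for_do b c) * X" using TX(1) by (rule mult_left_mono) simp
  moreover have "csz (for_do b c) * (T + 1) \<le> csz (for_do b c) * (w + 1)"
    using TX(2) by (intro mult_left_mono) simp_all
  ultimately have "runs (for_do b c) R M (R(12 := T)) M'"
    unfolding runs_def using 1 by (intro exI[of _ wk] exI[of _ dp]) linarith
  with post[OF 1(4)] show ?thesis unfolding wp_def by blast
qed

end

text \<open>\<open>PlusW\<close> is used because the sum may fill a whole word, as it does for the
  bitmaps.\<close>

definition accum :: "uexp \<Rightarrow> nat \<Rightarrow> uexp \<Rightarrow> uexp \<Rightarrow> uexp \<Rightarrow> uexp \<Rightarrow> com" where
  "accum k a x y b e = Seq (pd k a x y (Num 1) (Num 0))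
     (for_do b (pd k a x y (Num 1) (PlusW (ArrW a x y) e)))"

context wavelet_input
begin

text \<open>\<open>inj\<close> gives each lane a cell of its own, in which its partial sum survives
  between the rounds. The summand may depend on all arrays except the one being written.\<close>

lemma wp_accum:
  assumes P: "param_regs R"
    and post: "\<And>M'. (\<And>i. i < kk \<Longrightarrow> rd w M' a (Xi i) (Yi i) = (\<Sum>t<T. V i t)) \<Longrightarrow> same {a} M M' \<Longrightarrow>
      Post (R(12 := T)) M'"
    and a: "a < 64"
    and k: "\<And>R' M'. param_regs R' \<Longrightarrow> safe w R' M' 0 k \<and> uval w R' M' 0 k = kk"
    and T: "\<And>R' M'. param_regs R' \<Longrightarrow> safe w R' M' 0 b \<and> uval w R' M' 0 b = T"
    and TX: "(T + 1) * (kk + 1) \<le> X" "T \<le> w"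
    and xy: "\<And>i R' M'. i < kk \<Longrightarrow> param_regs R' \<Longrightarrow> safe w R' M' i x \<and> safe w R' M' i y \<and>
      uval w R' M' i x = Xi i \<and> uval w R' M' i y = Yi i \<and> Xi i < rowlen w \<and> Yi i < rowlen w"
    and inj: "\<And>i j. i < kk \<Longrightarrow> j < kk \<Longrightarrow> Xi i = Xi j \<Longrightarrow> Yi i = Yi j \<Longrightarrow> i = j"
    and e: "\<And>i t R' M'. i < kk \<Longrightarrow> t < T \<Longrightarrow> same {a} M M' \<Longrightarrow> param_regs R' \<Longrightarrow> R' 12 = t \<Longrightarrow>
      safe w R' M' i e \<and> uval w R' M' i e = V i t"
    and less: "\<And>i. i < kk \<Longrightarrow> (\<Sum>t<T. V i t) < 2 ^ w"
  shows "wp (accum k a x y b e) R M Post"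
  unfolding accum_def
proof (rule wp_Seq, rule wp_pd[OF P, where kk = kk and Gd = "\<lambda>_. True" and Xi = Xi and Yi = Yi and V = "\<lambda>_. 0"])
  have "1 * (kk + 1) \<le> (T + 1) * (kk + 1)" by (rule mult_right_mono) simp_all
  then show "kk + 1 \<le> X" using TX(1) by (metis order_trans nat_mult_1)
  fix M1 assume W1: "writes M a kk (\<lambda>_. True) Xi Yi (\<lambda>_. 0) M1"
  define I where "I t M' \<longleftrightarrow> same {a} M M' \<and> (\<forall>i<kk. rd w M' a (Xi i) (Yi i) = (\<Sum>s<t. V i s))" for t M'
  show "wp (for_do b (pd k a x y (Num 1) (PlusW (ArrW a x y) e))) R M1 Post"
  proof (rule wp_for[OF P, where T = T and I = I and kk = kk])
    fix t M2 assume t: "t < T" and I: "I t M2"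
    let ?R = "R(12 := t)" and ?c = "pd k a x y (Num 1) (PlusW (ArrW a x y) e)"
    have P': "param_regs ?R" using P by simp
    have sm: "same {a} M M2" using I by (simp add: I_def)
    have less': "(\<Sum>s<t. V i s) + V i t < 2 ^ w" if "i < kk" for i
    proof -
      have "(\<Sum>s<Suc t. V i s) \<le> (\<Sum>s<T. V i s)" using t by (intro sum_mono2) auto
      with less[OF that] show ?thesis by simp
    qed
    have "\<exists>M' wk dp. exec w r ?c (?R, M2) (?R, M') wk dp \<and>
      wk \<le> csz ?c * (kk + 1) \<and> dp \<le> csz ?c \<and>
      writes M2 a kk (\<lambda>_. True) Xi Yi (\<lambda>i. \<Sum>s<Suc t. V i s) M'"
    proof (rule pd_exec'[OF P' a])
      fix i assume i: "i < kk"
      show "safe w ?R M2 i x \<and> safe w ?R M2 i y \<and> safe w ?R M2 i (PlusW (ArrW a x y) e) \<and>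
        uval w ?R M2 i x = Xi i \<and> uval w ?R M2 i y = Yi i \<and>
        uval w ?R M2 i (PlusW (ArrW a x y) e) = (\<Sum>s<Suc t. V i s) \<and> Xi i < Q \<and> Yi i < Q"
        using xy[OF i P', of M2] e[OF i t sm P'] I i less'[OF i] a param_regsD(13)[OF P'] by (auto simp: I_def)
    next
      fix i j assume "i < kk" "j < kk" "Xi i = Xi j" "Yi i = Yi j"
      then have "i = j" by (rule inj)
      then show "(\<Sum>s<Suc t. V i s) = (\<Sum>s<Suc t. V j s)" by simp
    qed (use k[OF P'] in auto)
    then obtain M' wk dp where 2: "exec w r ?c (?R, M2) (?R, M') wk dp"
      "wk \<le> csz ?c * (kk + 1)" "dp \<le> csz ?c"
      "writes M2 a kk (\<lambda>_. True) Xi Yi (\<lambda>i. \<Sum>s<Suc t. V i s) M'" by blast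
    have "I (Suc t) M'"
      using writes_val[OF 2(4)] same_trans1[OF sm writes_same[OF 2(4)]] by (simp add: I_def)
    with 2 show "\<exists>M' wk dp. exec w r ?c (?R, M2) (?R, M') wk dp \<and>
       wk \<le> csz ?c * (kk + 1) \<and> dp \<le> csz ?c \<and> I (Suc t) M'" by blast
  next
    fix M' assume "I T M'"
    then show "Post (R(12 := T)) M'" by (intro post) (auto simp: I_def)
  next
    show "I 0 M1" using writes_val[OF W1] writes_same[OF W1] by (simp add: I_def)
  qed (use T TX P in auto)
qed (use a k xy P in auto)

lemma X_ge: "NN + 3 \<le> X" "2 ^ L' + 1 \<le> X" "2 ^ (U + h) + 3 \<le> X" "w + 1 \<le> X"
  "t \<le> w \<Longrightarrow> k \<le> NW + 1 \<Longrightarrow> (t + 1) * (k + 1) \<le> X"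
  "t \<le> w \<Longrightarrow> (t + 1) * (2 ^ (U + h) + 1) \<le> X"
proof -
  have p: "1 \<le> (2::nat) ^ L'" "1 \<le> (2::nat) ^ (U + h)" by simp_all
  have T: "2 ^ (U + h) + w \<le> 2 ^ (U + h) * (w + 1)" using p(2) by simp
  obtain A B C where ABC: "A = (2::nat) ^ L'" "B = (2::nat) ^ (U + h)" "C = B * (w + 1)" by blast
  have "NN + 3 \<le> 4 * (NN + w + A + C) \<and> A + 1 \<le> 4 * (NN + w + A + C) \<and>
    B + 3 \<le> 4 * (NN + w + A + C) \<and> w + 1 \<le> 4 * (NN + w + A + C)"
    using less_NN(9) p w_pos T unfolding ABC[symmetric] by auto
  then show "NN + 3 \<le> X" "2 ^ L' + 1 \<le> X" "2 ^ (U + h) + 3 \<le> X" "w + 1 \<le> X"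
    unfolding X_def ABC by simp_all
  show "(t + 1) * (k + 1) \<le> X" if "t \<le> w" "k \<le> NW + 1"
  proof -
    have "(t + 1) * (k + 1) \<le> (w + 1) * (NW + 2)" using that by (intro mult_mono) auto
    also have "\<dots> = NN + NW + 2 * w + 2" using NN_mult(3) by (simp add: algebra_simps)
    also have "\<dots> \<le> X" using less_NN(6) p w_pos unfolding X_def by simp
    finally show ?thesis .
  qed
  show "(t + 1) * (2 ^ (U + h) + 1) \<le> X" if "t \<le> w"
  proof -
    have "(t + 1) * (2 ^ (U + h) + 1) \<le> (w + 1) * (2 * 2 ^ (U + h))"
      using that p(2) by (intro mult_mono) auto
    also have "\<dots> \<le> X" unfolding X_def by simp
    finally show ?thesis .
  qed
qed

end

section \<open>Construction of bitmaps and prefix counts\<close>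

abbreviation level :: uexp where "level \<equiv> Ln \<oslash> Rg 0"
abbreviation elem :: uexp where "elem \<equiv> Arr 1 level (Ln \<odot> Rg 0)"

text \<open>The shift by one makes room for a sentinel at either end. The sentinel 0 differs from
  every heap number, so the ends of a node can be recognised by comparing neighbours without special
  cases.\<close>

definition own_prog :: com where
  "own_prog = Seq (pd (Rg 5 \<oplus> Num 2) 30 (Num 0) Ln (Num 1) (Num 0))
     (pd (Rg 5) 30 (Num 0) (Ln \<oplus> Num 1) (Num 1) (Shiftl (Num 1) level \<oplus> Shiftr elem (Rg 3 \<ominus> level)))"

definition bit_prog :: "nat \<Rightarrow> com" where
  "bit_prog b = Seq (pd (Rg 10) (16 + b) (Num 0) Ln (Num 1) (Num 0))
     (pd (Rg 5) (16 + b) (Num 0) Ln (Num 1)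
        (Equal (Shiftr (elem \<oplus> Rg 16) (Rg 4 \<ominus> Num 1 \<ominus> level) \<odot> Num 2) (Num b)))"

text \<open>The outer \<open>Equal\<close> with 0 negates. A position reports itself exactly if its
  predecessor belongs to another node, so a cell has at most one writer.\<close>

definition st_prog :: com where
  "st_prog = Seq (pd (Rg 19) 31 (Num 0) Ln (Num 1) (Num 0))
     (pd (Rg 5) 31 (Num 0) (Arr 30 (Num 0) (Ln \<oplus> Num 1))
        (Equal (Equal (Arr 30 (Num 0) Ln) (Arr 30 (Num 0) (Ln \<oplus> Num 1))) (Num 0)) Ln)"

definition en_prog :: com where
  "en_prog = Seq (pd (Rg 19) 32 (Num 0) Ln (Num 1) (Num 0))
     (pd (Rg 5) 32 (Num 0) (Arr 30 (Num 0) (Ln \<oplus> Num 1))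
        (Equal (Equal (Arr 30 (Num 0) (Ln \<oplus> Num 1)) (Arr 30 (Num 0) (Ln \<oplus> Num 2))) (Num 0)) (Ln \<oplus> Num 1))"

definition word_cnt_prog :: "nat \<Rightarrow> com" where
  "word_cnt_prog b = Seq (pd (Rg 17 \<oplus> Num 1) (18 + b) Ln (Num 0) (Num 1) (Num 0))
     (for_do (Rg 2) (pd (Rg 17) (18 + b) Ln (Rg 12 \<oplus> Num 1) (Num 1)
        (Arr (18 + b) Ln (Rg 12) \<oplus> Arr (16 + b) (Num 0) (Ln \<otimes> Rg 2 \<oplus> Rg 12))))"

text \<open>Parallel prefix sums by doubling. All reads of a step precede its writes, so one array suffices.\<close>

definition prefix_prog :: "nat \<Rightarrow> com" where
  "prefix_prog b = Seq (pd (Num 1) (20 + b) (Num 0) Ln (Num 1) (Num 0))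
    (Seq (pd (Rg 17) (20 + b) (Num 0) (Ln \<oplus> Num 1) (Num 1) (Arr (18 + b) Ln (Rg 2)))
     (for_do (Rg 2 \<oslash> Num 64) (pd (Rg 17 \<oplus> Num 1) (20 + b) (Num 0) Ln
        (Lt (Shiftl (Num 1) (Rg 12)) (Ln \<oplus> Num 1))
        (Arr (20 + b) (Num 0) Ln \<oplus> Arr (20 + b) (Num 0) (Ln \<ominus> Shiftl (Num 1) (Rg 12))))))"

definition cnt_prog :: "nat \<Rightarrow> com" where
  "cnt_prog b = pd (Rg 10) (22 + b) (Num 0) Ln (Num 1)
     (Arr (20 + b) (Num 0) (Ln \<oslash> Rg 2) \<oplus> Arr (18 + b) (Ln \<oslash> Rg 2) (Ln \<odot> Rg 2))"

definition cell_prog :: "nat \<Rightarrow> nat \<Rightarrow> nat \<Rightarrow> nat \<Rightarrow> com" where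
  "cell_prog a b Zr zr = accum (Rg 10 \<oslash> Rg Zr) (a + b) (Num 0) Ln (Rg 7)
     (Shiftl (Arr (22 + b) (Num 0) (Ln \<otimes> Rg Zr \<oplus> Rg 12 \<otimes> Rg zr) \<ominus> Arr (22 + b) (Num 0) (Ln \<otimes> Rg Zr))
        (Rg 12 \<otimes> Rg 6))"

definition bitmap_prog :: com where
  "bitmap_prog = accum (Rg 17) 2 (Num 0) Ln (Rg 2)
     (ShiftlW (Arr 17 (Num 0) (Ln \<otimes> Rg 2 \<oplus> Rg 12)) (Rg 12))"

text \<open>Three tables, interleaved modulo 3, with a common index: a chunk \<open>x\<close> of
  \<open>q * h\<close> bits and an argument \<open>j\<close> of \<open>h\<close> bits.\<close>

definition table_entry :: "nat \<Rightarrow> nat \<Rightarrow> nat \<Rightarrow> nat \<Rightarrow> nat" where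
  "table_entry h q w i = (let e = i div 3; x = e div 2 ^ h; j = e mod 2 ^ h in
     if i mod 3 = 0 then pop x (q * h)
     else if i mod 3 = 1 then sel_entry w (q * h) x j else field_entry h q x j)"

text \<open>The header spares the queries the computation of logarithms. Its words 2 and 3 are
  masks: a bitmap word is xored with word 2 + b, which complements it for b = 0, so that only ones
  ever have to be counted.\<close>

definition rs_table :: "nat \<Rightarrow> nat \<Rightarrow> nat list" where
  "rs_table n w = (let h = symbol_bits (4 * w ^ 3 + 1); q = symbol_bits n div (4 * h) + 1 in
     [h, q, 2 ^ w - 1, 0] @ map (table_entry h q w) [0..<3 * 2 ^ (q * h + h)])"

context wavelet_input
begin

text \<open>The padding counts for neither bit.\<close>

definition lev_bit :: "nat \<Rightarrow> nat \<Rightarrow> bool" where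
  "lev_bit b x \<longleftrightarrow> x < N \<and> (lbit x \<longleftrightarrow> b = 1)"

definition bit_word :: "nat \<Rightarrow> nat" where
  "bit_word k = pack 1 (\<lambda>j. of_bool (lev_bit 1 (k * w + j))) w"

abbreviation ones :: "nat \<Rightarrow> nat \<Rightarrow> nat" where "ones b \<equiv> cnt (lev_bit b)"

definition sel_pos :: "nat \<Rightarrow> nat \<Rightarrow> nat" where
  "sel_pos b \<rho> = (THE z. lev_bit b z \<and> ones b z = \<rho>)"

text \<open>The end of the node serves as a sample after the last occurrence, so that every group
  has an upper end.\<close>

definition sample :: "nat \<Rightarrow> nat \<Rightarrow> nat \<Rightarrow> nat" where
  "sample b v k = (if ones b (nst v) + k * G < ones b (nen v) then sel_pos b (ones b (nst v) + k * G) else nen v)"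

definition local_rank :: "nat \<Rightarrow> nat \<Rightarrow> nat" where
  "local_rank b x = ones b x - ones b (nst (own x))"

text \<open>All arrays of a node share this number of columns. The terms account for cells, samples
  and positions in sparse groups: such a group spans at least \<open>Z2\<close> positions, so there
  are at most \<open>m div Z2\<close> of them, with \<open>G\<close> slots each. The 3 covers
  rounding.\<close>

definition struct_len :: "nat \<Rightarrow> nat" where
  "struct_len m = m div Z1 + m div G + m div Z2 * G + 3"

text \<open>
  The contents of the arrays: 0 input, 1 sorted sequences of the levels, 2 bitmaps, 3 lookup table,
  16 bits, 18 counts within a word, 20 counts before a word, 22 counts before a position, 24 and 28
  packed counts of small and large cells, 30 nodes (shifted by 1), 31 and 32 first position
  of a node and end, 33 to 35 parts of the table, from 36 on the rank/select structures (row \<open>v\<close> for node \<open>v\<close>):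
  36 count before the node, 38, 40, 42 windows of cells, 44 samples, 46 positions in sparse groups,
  48 to 54 the record of a node. In a pair of arrays the second one counts the bit 1, the first one the bit 0.
\<close>

definition spec :: "nat \<Rightarrow> (nat \<Rightarrow> nat \<Rightarrow> nat) \<Rightarrow> bool" where
  "spec a g \<longleftrightarrow>
    (if a = 0 then \<forall>i<n. g 0 i = S ! i
     else if a = 1 then \<forall>l<L'. \<forall>i<n. g l i = srt l ! i
     else if a = 2 then \<forall>k<NW. g 0 k = bit_word k
     else if a = 3 then \<forall>y<length (rs_table n w). g 0 y = rs_table n w ! y
     else if a \<in> {16, 17} then \<forall>x<NN. g 0 x = of_bool (lev_bit (a - 16) x)
     else if a \<in> {18, 19} then
       g NW 0 = 0 \<and> (\<forall>k<NW. \<forall>j\<le>w. g k j = ones (a - 18) (k * w + j) - ones (a - 18) (k * w))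
     else if a \<in> {20, 21} then \<forall>k\<le>NW. g 0 k = ones (a - 20) (k * w)
     else if a \<in> {22, 23} then \<forall>x<NN. g 0 x = ones (a - 22) x
     else if a \<in> {24, 25} then \<forall>c<NN div Z1. g 0 c = cell_pack (lev_bit (a - 24)) h q w c
     else if a \<in> {28, 29} then \<forall>c<NN div Z2. g 0 c = cell_pack (lev_bit (a - 28)) h q Z1 c
     else if a = 30 then g 0 0 = 0 \<and> g 0 (Suc N) = 0 \<and> (\<forall>x<N. g 0 (Suc x) = own x)
     else if a = 31 then \<forall>v<2 ^ L'. g 0 v = nst v
     else if a = 32 then \<forall>v<2 ^ L'. g 0 v = nen v
     else if a = 33 then \<forall>e<2 ^ (U + h). g 0 e = pop (e div 2 ^ h) U
     else if a = 34 then \<forall>e<2 ^ (U + h). g 0 e = sel_entry w U (e div 2 ^ h) (e mod 2 ^ h)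
     else if a = 35 then \<forall>e<2 ^ (U + h). g 0 e = field_entry h q (e div 2 ^ h) (e mod 2 ^ h)
     else if a \<in> {36, 37} then \<forall>x<N. g (own x) 0 = ones (a - 36) (nst (own x))
     else if a \<in> {38, 39} then \<forall>x<N. \<forall>d<2. g (own x) (x div Z1 + d - nst (own x) div Z1) =
       cell_pack (lev_bit (a - 38)) h q w (x div Z1 + d)
     else if a \<in> {40, 41} then \<forall>x<N. \<forall>d<2. g (own x) (x div Z2 + d - nst (own x) div Z2) =
       ones (a - 40) ((x div Z2 + d) * Z2)
     else if a \<in> {42, 43} then \<forall>x<N. \<forall>d<2. g (own x) (x div Z2 + d - nst (own x) div Z2) =
       cell_pack (lev_bit (a - 42)) h q Z1 (x div Z2 + d)
     else if a \<in> {44, 45} then \<forall>x<N. \<forall>k\<le>(ones (a - 44) (nen (own x)) - ones (a - 44) (nst (own x)) + G - 1) div G.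
       g (own x) k = sample (a - 44) (own x) k
     else if a \<in> {46, 47} then \<forall>x<N. lev_bit (a - 46) x \<longrightarrow>
       (let v = own x; \<rho> = local_rank (a - 46) x; k = \<rho> div G in
        Z2 \<le> sample (a - 46) v (k + 1) - sample (a - 46) v k \<longrightarrow>
        g v ((sample (a - 46) v k - nst v) div Z2 * G + \<rho> mod G) = x - nst v)
     else if a = 48 then \<forall>v<2 ^ L'. g v 0 = loc w 2 0 0
     else if a = 49 then \<forall>v<2 ^ L'. g v 0 = nst v
     else if a = 50 then \<forall>v<2 ^ L'. g v 0 = nen v - nst v
     else if a = 51 then \<forall>v<2 ^ L'. g v 0 = loc w 16 v 0 - 16
     else if a = 52 then \<forall>v<2 ^ L'. g v 0 = 64 * struct_len (nen v - nst v)
     else if a = 53 then \<forall>v<2 ^ L'. g v 0 = loc w 48 (2 * v) 0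
     else if a = 54 then \<forall>v<2 ^ L'. g v 0 = loc w 48 (2 * v + 1) 0
     else False)"

lemma spec_pair:
  assumes "b < 2"
  shows "spec (16 + b) g \<longleftrightarrow> (\<forall>x<NN. g 0 x = of_bool (lev_bit b x))"
    and "spec (18 + b) g \<longleftrightarrow> g NW 0 = 0 \<and> (\<forall>k<NW. \<forall>j\<le>w. g k j = ones b (k * w + j) - ones b (k * w))"
    and "spec (20 + b) g \<longleftrightarrow> (\<forall>k\<le>NW. g 0 k = ones b (k * w))"
    and "spec (22 + b) g \<longleftrightarrow> (\<forall>x<NN. g 0 x = ones b x)"
    and "spec (24 + b) g \<longleftrightarrow> (\<forall>c<NN div Z1. g 0 c = cell_pack (lev_bit b) h q w c)"
    and "spec (28 + b) g \<longleftrightarrow> (\<forall>c<NN div Z2. g 0 c = cell_pack (lev_bit b) h q Z1 c)"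
    and "spec (36 + b) g \<longleftrightarrow> (\<forall>x<N. g (own x) 0 = ones b (nst (own x)))"
    and "spec (38 + b) g \<longleftrightarrow> (\<forall>x<N. \<forall>d<2. g (own x) (x div Z1 + d - nst (own x) div Z1) =
       cell_pack (lev_bit b) h q w (x div Z1 + d))"
    and "spec (40 + b) g \<longleftrightarrow> (\<forall>x<N. \<forall>d<2. g (own x) (x div Z2 + d - nst (own x) div Z2) =
       ones b ((x div Z2 + d) * Z2))"
    and "spec (42 + b) g \<longleftrightarrow> (\<forall>x<N. \<forall>d<2. g (own x) (x div Z2 + d - nst (own x) div Z2) =
       cell_pack (lev_bit b) h q Z1 (x div Z2 + d))"
    and "spec (44 + b) g \<longleftrightarrow> (\<forall>x<N. \<forall>k\<le>(ones b (nen (own x)) - ones b (nst (own x)) + G - 1) div G.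
       g (own x) k = sample b (own x) k)"
    and "spec (46 + b) g \<longleftrightarrow> (\<forall>x<N. lev_bit b x \<longrightarrow>
       (let v = own x; \<rho> = local_rank b x; k = \<rho> div G in
        Z2 \<le> sample b v (k + 1) - sample b v k \<longrightarrow>
        g v ((sample b v k - nst v) div Z2 * G + \<rho> mod G) = x - nst v))"
  using assms by (auto simp: spec_def less_2_cases_iff)

lemma spec_single:
  "spec 0 g \<longleftrightarrow> (\<forall>i<n. g 0 i = S ! i)"
  "spec 1 g \<longleftrightarrow> (\<forall>l<L'. \<forall>i<n. g l i = srt l ! i)"
  "spec (Suc 0) g \<longleftrightarrow> (\<forall>l<L'. \<forall>i<n. g l i = srt l ! i)"
  "spec 2 g \<longleftrightarrow> (\<forall>k<NW. g 0 k = bit_word k)"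
  "spec 3 g \<longleftrightarrow> (\<forall>y<length (rs_table n w). g 0 y = rs_table n w ! y)"
  "spec 30 g \<longleftrightarrow> g 0 0 = 0 \<and> g 0 (Suc N) = 0 \<and> (\<forall>x<N. g 0 (Suc x) = own x)"
  "spec 31 g \<longleftrightarrow> (\<forall>v<2 ^ L'. g 0 v = nst v)"
  "spec 32 g \<longleftrightarrow> (\<forall>v<2 ^ L'. g 0 v = nen v)"
  "spec 33 g \<longleftrightarrow> (\<forall>e<2 ^ (U + h). g 0 e = pop (e div 2 ^ h) U)"
  "spec 34 g \<longleftrightarrow> (\<forall>e<2 ^ (U + h). g 0 e = sel_entry w U (e div 2 ^ h) (e mod 2 ^ h))"
  "spec 35 g \<longleftrightarrow> (\<forall>e<2 ^ (U + h). g 0 e = field_entry h q (e div 2 ^ h) (e mod 2 ^ h))"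
  "spec 48 g \<longleftrightarrow> (\<forall>v<2 ^ L'. g v 0 = loc w 2 0 0)"
  "spec 49 g \<longleftrightarrow> (\<forall>v<2 ^ L'. g v 0 = nst v)"
  "spec 50 g \<longleftrightarrow> (\<forall>v<2 ^ L'. g v 0 = nen v - nst v)"
  "spec 51 g \<longleftrightarrow> (\<forall>v<2 ^ L'. g v 0 = loc w 16 v 0 - 16)"
  "spec 52 g \<longleftrightarrow> (\<forall>v<2 ^ L'. g v 0 = 64 * struct_len (nen v - nst v))"
  "spec 53 g \<longleftrightarrow> (\<forall>v<2 ^ L'. g v 0 = loc w 48 (2 * v) 0)"
  "spec 54 g \<longleftrightarrow> (\<forall>v<2 ^ L'. g v 0 = loc w 48 (2 * v + 1) 0)"
  by (simp_all add: spec_def)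

definition phase :: "nat set \<Rightarrow> com \<Rightarrow> nat set \<Rightarrow> bool" where
  "phase D c A \<longleftrightarrow> (\<forall>R M. param_regs R \<longrightarrow> (\<forall>a\<in>D. spec a (rd w M a)) \<longrightarrow>
     wp c R M (\<lambda>R' M'. param_regs R' \<and> (\<forall>a\<in>A. spec a (rd w M' a)) \<and> same A M M'))"

lemma phaseI:
  "(\<And>R M. param_regs R \<Longrightarrow> (\<And>a. a \<in> D \<Longrightarrow> spec a (rd w M a)) \<Longrightarrow>
     wp c R M (\<lambda>R' M'. param_regs R' \<and> (\<forall>a\<in>A. spec a (rd w M' a)) \<and> same A M M')) \<Longrightarrow> phase D c A"
  by (auto simp: phase_def)

text \<open>As phases name the arrays that they need and write, composing them reduces to computing
  with finite sets of numbers.\<close>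

lemma phase_Seq:
  assumes c1: "phase D c1 A" and c2: "phase D' c2 B"
    and D: "D' \<subseteq> D \<union> A" "A \<inter> B = {}" "D \<inter> A = {}" "D \<union> A \<subseteq> {..<64}"
  shows "phase D (Seq c1 c2) (A \<union> B)"
proof (rule phaseI, rule wp_Seq)
  fix R M assume P: "param_regs R" and D0: "\<And>a. a \<in> D \<Longrightarrow> spec a (rd w M a)"
  from c1 P D0 obtain R1 M1 where 1: "runs c1 R M R1 M1" "param_regs R1" "\<forall>a\<in>A. spec a (rd w M1 a)" "same A M M1"
    unfolding phase_def wp_def by blast
  have D1: "spec a (rd w M1 a)" if "a \<in> D \<union> A" for a
  proof (cases "a \<in> A")
    case False
    then have "rd w M1 a = rd w M a" using sameD[OF 1(4), of a] D(4) that by auto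
    then show ?thesis using D0 that False by simp
  qed (use 1 in auto)
  with D(1) have "\<forall>a\<in>D'. spec a (rd w M1 a)" by blast
  with c2 1(2) obtain R2 M2 where 2: "runs c2 R1 M1 R2 M2" "param_regs R2" "\<forall>a\<in>B. spec a (rd w M2 a)" "same B M1 M2"
    unfolding phase_def wp_def by blast
  have "spec a (rd w M2 a)" if "a \<in> A" for a
  proof -
    have "a \<notin> B" "a < 64" using that D(2,4) by auto
    then have "rd w M2 a = rd w M1 a" using sameD[OF 2(4)] by blast
    then show ?thesis using D1[of a] that by simp
  qed
  with 2 same_trans[OF 1(4) 2(4)] have
    "param_regs R2 \<and> (\<forall>a\<in>A \<union> B. spec a (rd w M2 a)) \<and> same (A \<union> B) M M2" by auto
  with 1(1) 2(1)
  show "wp c1 R M (\<lambda>R1 M1. wp c2 R1 M1 (\<lambda>R' M'. param_regs R' \<and>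
      (\<forall>a\<in>A \<union> B. spec a (rd w M' a)) \<and> same (A \<union> B) M M'))"
    unfolding wp_def by blast
qed

section \<open>Correctness of levels, prefix counts and cells\<close>

lemma level_facts:
  assumes "x < N"
  shows "x div n < L'" "x div n \<le> L" "x mod n < n" "2 ^ (x div n) \<le> Q" "x div n < Q" "x mod n < Q"
    "srt (x div n) ! (x mod n) \<le> Q" "x \<le> Q" "own x < Q" "own x \<le> Q" "x < Q" "own x < 2 ^ L'"
    "x div n \<le> L' - 1"
proof -
  show l: "x div n < L'" "x mod n < n" using pos_level[OF assms] n_pos by auto
  then show "x div n \<le> L" by (intro level_le)
  have "(2::nat) ^ (x div n) \<le> 2 ^ L'" using l by (intro power_increasing) auto
  then show "2 ^ (x div n) \<le> Q" using params_le_Q(17) by (rule order_trans)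
  show "x div n < Q" using l(1) params_less_Q(5) by linarith
  show "x mod n < Q" using l(2) params_less_Q(1) by linarith
  have "srt (x div n) ! (x mod n) < 2 ^ L" using l by (rule srt_less)
  also have "(2::nat) ^ L \<le> 2 ^ L'" using L_le_L' by (intro power_increasing) auto
  also have "\<dots> \<le> Q" by simp
  finally show "srt (x div n) ! (x mod n) \<le> Q" by simp
  show "own x < 2 ^ L'" by (rule own_less[OF assms])
  then show "own x < Q" "own x \<le> Q" using params_less_Q(17) by linarith+
  show "x < Q" "x \<le> Q" using assms params_le_Q(6) by linarith+
  show "x div n \<le> L' - 1" using l by simp
qed

lemma small_Q: "k \<le> 2 ^ 15 \<Longrightarrow> k \<le> Q" "k < 2 ^ 15 \<Longrightarrow> k < Q"
  using small_le_rowlen[OF w_large, of k] small_le_rowlen[OF w_large, of "2 ^ 15"] by simp_all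

lemma lane_Q: "i < NN \<Longrightarrow> i < Q" "i < NN \<Longrightarrow> i \<le> Q" "i < N \<Longrightarrow> i < Q" "i < N \<Longrightarrow> i \<le> Q"
  "i < 2 ^ L' \<Longrightarrow> i < Q" "i < 2 ^ L' \<Longrightarrow> i \<le> Q" "i < 2 ^ (U + h) \<Longrightarrow> i < Q" "i < 2 ^ (U + h) \<Longrightarrow> i \<le> Q"
  "i \<le> NW \<Longrightarrow> i < Q" "i \<le> NW \<Longrightarrow> i \<le> Q"
  by (meson params_less_Q params_le_Q less_trans le_less_trans less_imp_le order_trans)+

lemma own_phase: "phase {1} own_prog {30}"
proof (rule phaseI)
  fix R M assume P: "param_regs R" and D: "\<And>a. a \<in> {1} \<Longrightarrow> spec a (rd w M a)"
  note PD = param_regsD[OF P]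
  have srt: "rd w M 1 l i = srt l ! i" if "l < L'" "i < n" for l i
    using D[of 1] that by (simp add: spec_single)
  have bound: "N + 3 \<le> X" "N + 2 \<le> Q" "N + 2 < Q"
    using X_ge(1) less_NN le_NN_Q(1)[of "N + 2"] le_NN_Q(2)[of "N + 2"] by linarith+
  show "wp own_prog R M (\<lambda>R' M'. param_regs R' \<and> (\<forall>a\<in>{30}. spec a (rd w M' a)) \<and> same {30} M M')"
    unfolding own_prog_def
  proof (rule wp_Seq, rule wp_pd[OF P, where kk = "N + 2" and Gd = "\<lambda>_. True" and Xi = "\<lambda>_. 0"
        and Yi = "\<lambda>i. i" and V = "\<lambda>_. 0"], goal_cases)
    case (1 M1)
    note W1 = this
    note s1 = writes_same[OF W1]
    have srt1: "rd w M1 (Suc 0) l i = srt l ! i" if "l < L'" "i < n" for l i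
      using srt[OF that] sameD[OF s1, of 1] by simp
    show ?case
    proof (rule wp_pd[OF P, where kk = N and Gd = "\<lambda>_. True" and Xi = "\<lambda>_. 0"
        and Yi = Suc and V = own], goal_cases)
      case (1 M2)
      note s2 = writes_same[OF 1]
      have "rd w M2 30 0 0 = 0"
        using writes_other[OF 1, of 0 0] writes_val[OF W1, of 0] by simp
      moreover have "rd w M2 30 0 (Suc N) = 0"
        using writes_other[OF 1, of 0 "Suc N"] writes_val[OF W1, of "Suc N"] by simp
      moreover have "rd w M2 30 0 (Suc x) = own x" if "x < N" for x
        using writes_val[OF 1, of x] that by simp
      ultimately show ?case using P same_trans1[OF s1 s2] by (simp add: spec_single)
    next
      case (7 i)
      then show ?case using level_facts[of i] bound
        by (simp add: PD srt1 own_def small_Q)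
    qed (use bound in \<open>auto simp: PD lane_Q\<close>)
  qed (use bound in \<open>auto simp: PD small_Q\<close>)
qed

lemma bit_phase: "b < 2 \<Longrightarrow> phase {1} (bit_prog b) {16 + b}"
proof (rule phaseI)
  fix R M assume b: "b < 2" and P: "param_regs R" and D: "\<And>a. a \<in> {1} \<Longrightarrow> spec a (rd w M a)"
  note PD = param_regsD[OF P]
  have bound: "NN + 1 \<le> X" "N + 1 \<le> X" "NN \<le> Q" "NN < Q" using X_ge(1) less_NN by simp_all
  show "wp (bit_prog b) R M (\<lambda>R' M'. param_regs R' \<and> (\<forall>a\<in>{16 + b}. spec a (rd w M' a)) \<and> same {16 + b} M M')"
    unfolding bit_prog_def
  proof (rule wp_Seq, rule wp_pd[OF P, where kk = NN and Gd = "\<lambda>_. True" and Xi = "\<lambda>_. 0"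
        and Yi = "\<lambda>i. i" and V = "\<lambda>_. 0"], goal_cases)
    case (1 M1)
    note W1 = this
    note s1 = writes_same[OF W1]
    have srt1: "rd w M1 (Suc 0) l i = srt l ! i" if "l < L'" "i < n" for l i
      using D[of 1] that sameD[OF s1, of 1] b by (simp add: spec_single)
    show ?case
    proof (rule wp_pd[OF P, where kk = N and Gd = "\<lambda>_. True" and Xi = "\<lambda>_. 0"
        and Yi = "\<lambda>i. i" and V = "\<lambda>x. of_bool (lev_bit b x)"], goal_cases)
      case (1 M2)
      note s2 = writes_same[OF 1]
      have "rd w M2 (16 + b) 0 x = of_bool (lev_bit b x)" if "x < NN" for x
      proof (cases "x < N")
        case True
        then show ?thesis using writes_val[OF 1, of x] by simp
      next
        case False
        then show ?thesis using writes_other[OF 1, of 0 x] writes_val[OF W1, of x] that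
          by (simp add: lev_bit_def)
      qed
      then show ?case using P same_trans1[OF s1 s2] b by (simp add: spec_pair)
    next
      case (7 i)
      have "y mod 2 = b \<longleftrightarrow> odd y = (b = 1)" for y :: nat
        using b by (cases "b = 0") (auto simp: odd_iff_mod_2_eq_one)
      then have "of_bool ((srt (i div n) ! (i mod n) + of_bool (L = 0)) div 2 ^ (L' - 1 - i div n) mod 2 = b)
          = (of_bool (lev_bit b i) :: nat)"
        using 7 by (simp add: lev_bit_def lbit_def)
      then show ?case using 7 level_facts[of i] L'_pos b by (simp add: PD srt1 small_Q)
    qed (use bound b in \<open>auto simp: PD lane_Q\<close>)
  qed (use bound b in \<open>auto simp: PD lane_Q\<close>)
qed

lemma own_pred_iff: "x < N \<Longrightarrow> (x = 0 \<or> own (x - 1) \<noteq> own x) \<longleftrightarrow> x = nst (own x)"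
  using own_iff[of x "own x"] own_iff[of "x - 1" "own x"] by auto

lemma own_succ_iff: "x < N \<Longrightarrow> (Suc x = N \<or> own (Suc x) \<noteq> own x) \<longleftrightarrow> Suc x = nen (own x)"
  using own_iff[of x "own x"] own_iff[of "Suc x" "own x"] nen_bounds[of "own x"]
  by (cases "Suc x < N") auto

lemma empty_node: "\<not> (\<exists>x<N. own x = v) \<Longrightarrow> nst v = 0 \<and> nen v = 0"
proof -
  assume a: "\<not> (\<exists>x<N. own x = v)"
  then have "nst v = 0" unfolding nst_def by (rule if_not_P)
  moreover have "\<not> nst v < nen v" using mem_node_iff[of "nst v" v] a by auto
  ultimately show ?thesis by simp
qed

lemma st_phase: "phase {30} st_prog {31}"
proof (rule phaseI)
  fix R M assume P: "param_regs R" and D: "\<And>a. a \<in> {30} \<Longrightarrow> spec a (rd w M a)"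
  note PD = param_regsD[OF P]
  have own: "rd w M 30 0 0 = 0" "\<And>x. x < N \<Longrightarrow> rd w M 30 0 (Suc x) = own x" "rd w M 30 0 (Suc N) = 0"
    using D[of 30] by (auto simp: spec_single)
  have bound: "N + 1 \<le> X" "2 ^ L' + 1 \<le> X" "N + 2 < Q"
    using X_ge(1,2) less_NN le_NN_Q(2)[of "N + 2"] by linarith+
  show "wp st_prog R M (\<lambda>R' M'. param_regs R' \<and> (\<forall>a\<in>{31}. spec a (rd w M' a)) \<and> same {31} M M')"
    unfolding st_prog_def
  proof (rule wp_Seq, rule wp_pd[OF P, where kk = "2 ^ L'" and Gd = "\<lambda>_. True" and Xi = "\<lambda>_. 0"
        and Yi = "\<lambda>i. i" and V = "\<lambda>_. 0"], goal_cases)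
    case (1 M1)
    note W1 = this
    note s1 = writes_same[OF W1]
    have M1: "rd w M1 30 = rd w M 30" using sameD[OF s1, of 30] by simp
    have pred: "rd w M 30 0 x = (if x = 0 then 0 else own (x - 1))" if "x < N" for x
      using own(1) own(2)[of "x - 1"] that by (cases x) auto
    show ?case
    proof (rule wp_pd[OF P, where kk = N and Gd = "\<lambda>x. x = nst (own x)" and Xi = "\<lambda>_. 0"
        and Yi = own and V = "\<lambda>x. x"], goal_cases)
      case (1 M2)
      note s2 = writes_same[OF 1]
      have "rd w M2 31 0 v = nst v" if v: "v < 2 ^ L'" for v
      proof (cases "\<exists>x<N. own x = v")
        case True
        then have "nst v < N \<and> own (nst v) = v" using mem_node_iff by (metis order_refl le_less_trans)
        then show ?thesis using writes_val[OF 1, of "nst v"] by simp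
      next
        case False
        then show ?thesis using writes_other[OF 1, of 0 v] writes_val[OF W1, of v] v empty_node[OF False]
          by auto
      qed
      then show ?case using P same_trans1[OF s1 s2] by (simp add: spec_single)
    next
      case (6 i)
      then have "rd w M 30 0 i \<noteq> own i \<longleftrightarrow> i = nst (own i)"
        using own_pred_iff[of i] own_pos[of i] pred[of i] by auto
      moreover have "rd w M 30 0 i \<le> Q"
        using pred[of i] 6 level_facts(10)[of "i - 1"] by simp
      ultimately show ?case using 6 level_facts[of i] own(2)[of i] bound by (simp add: PD M1 small_Q)
    next
      case (7 i)
      then show ?case using level_facts[of i] own(2)[of i] bound by (simp add: PD M1 small_Q)
    next
      case (8 i j)
      then show ?case by metis
    qed (use bound in \<open>auto simp: PD lane_Q\<close>)
  qed (use bound in \<open>auto simp: PD lane_Q\<close>)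
qed

lemma en_phase: "phase {30} en_prog {32}"
proof (rule phaseI)
  fix R M assume P: "param_regs R" and D: "\<And>a. a \<in> {30} \<Longrightarrow> spec a (rd w M a)"
  note PD = param_regsD[OF P]
  have own: "rd w M 30 0 0 = 0" "\<And>x. x < N \<Longrightarrow> rd w M 30 0 (Suc x) = own x" "rd w M 30 0 (Suc N) = 0"
    using D[of 30] by (auto simp: spec_single)
  have bound: "N + 1 \<le> X" "2 ^ L' + 1 \<le> X" "N + 2 < Q"
    using X_ge(1,2) less_NN le_NN_Q(2)[of "N + 2"] by linarith+
  show "wp en_prog R M (\<lambda>R' M'. param_regs R' \<and> (\<forall>a\<in>{32}. spec a (rd w M' a)) \<and> same {32} M M')"
    unfolding en_prog_def
  proof (rule wp_Seq, rule wp_pd[OF P, where kk = "2 ^ L'" and Gd = "\<lambda>_. True" and Xi = "\<lambda>_. 0"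
        and Yi = "\<lambda>i. i" and V = "\<lambda>_. 0"], goal_cases)
    case (1 M1)
    note W1 = this
    note s1 = writes_same[OF W1]
    have M1: "rd w M1 30 = rd w M 30" using sameD[OF s1, of 30] by simp
    have succ: "rd w M 30 0 (Suc (Suc x)) = (if Suc x = N then 0 else own (Suc x))" if "x < N" for x
      using own(3) own(2)[of "Suc x"] that by auto
    show ?case
    proof (rule wp_pd[OF P, where kk = N and Gd = "\<lambda>x. Suc x = nen (own x)" and Xi = "\<lambda>_. 0"
        and Yi = own and V = Suc], goal_cases)
      case (1 M2)
      note s2 = writes_same[OF 1]
      have "rd w M2 32 0 v = nen v" if v: "v < 2 ^ L'" for v
      proof (cases "\<exists>x<N. own x = v")
        case True
        then have "nst v < nen v" using mem_node_iff by (metis le_less_trans)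
        then have "nen v - 1 < N \<and> own (nen v - 1) = v \<and> Suc (nen v - 1) = nen v"
          using mem_node_iff[of "nen v - 1" v] by simp
        then show ?thesis using writes_val[OF 1, of "nen v - 1"] by simp
      next
        case False
        then show ?thesis using writes_other[OF 1, of 0 v] writes_val[OF W1, of v] v empty_node[OF False]
          by auto
      qed
      then show ?case using P same_trans1[OF s1 s2] by (simp add: spec_single)
    next
      case (6 i)
      have "own i \<noteq> rd w M 30 0 (Suc (Suc i)) \<longleftrightarrow> Suc i = nen (own i)"
      proof (cases "Suc i = N")
        case True
        then show ?thesis using own_succ_iff[OF 6] own_pos[OF 6] succ[OF 6] by simp
      next
        case False
        then show ?thesis using own_succ_iff[OF 6] succ[OF 6] by metis
      qed
      moreover have "rd w M 30 0 (Suc (Suc i)) \<le> Q"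
        using succ[of i] 6 level_facts(10)[of "Suc i"] by simp
      ultimately show ?case using 6 level_facts[of i] own(2)[of i] bound by (simp add: PD M1 small_Q)
    next
      case (7 i)
      then show ?case using level_facts[of i] own(2)[of i] bound by (simp add: PD M1 small_Q)
    next
      case (8 i j)
      then show ?case by metis
    qed (use bound in \<open>auto simp: PD lane_Q\<close>)
  qed (use bound in \<open>auto simp: PD lane_Q\<close>)
qed


lemma NW_cell: "k < NW \<Longrightarrow> j < w \<Longrightarrow> k * w + j < NN"
proof -
  assume "k < NW" "j < w"
  then have "k * w + j < (k + 1) * w" by simp
  also have "\<dots> \<le> NW * w" using \<open>k < NW\<close> by (intro mult_right_mono) auto
  finally show ?thesis using NN_mult(3) by simp
qed

lemma ones_le: "x \<le> NN \<Longrightarrow> ones b x \<le> Q" "x \<le> NN \<Longrightarrow> ones b x \<le> NN" "x < NN \<Longrightarrow> ones b x \<le> Q"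
  using cnt_le[of "lev_bit b" x] params_le_Q(11) by linarith+

lemma NW_1_Q: "NW + 1 < Q" "Suc NW \<le> Q" "w < Q"
  using less_NN le_NN_Q(2)[of "NW + 1"] by simp_all

lemma word_cnt_phase: "b < 2 \<Longrightarrow> phase {16 + b} (word_cnt_prog b) {18 + b}"
proof (rule phaseI)
  fix R M assume b: "b < 2" and P: "param_regs R" and D: "\<And>a. a \<in> {16 + b} \<Longrightarrow> spec a (rd w M a)"
  note PD = param_regsD[OF P]
  let ?c = "ones b" and ?a = "18 + b"
  have bits: "rd w M (16 + b) 0 x = of_bool (lev_bit b x)" if "x < NN" for x
    using D[of "16 + b"] that b by (simp add: spec_pair)
  have bound: "NW + 2 \<le> X" "NW + 1 < Q" "w < Q" "Suc NW \<le> Q" using NW_1_Q X_ge(1) less_NN(6) by linarith+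
  have mono: "?c (k * w) \<le> ?c (k * w + j)" for k j by (rule cnt_mono) simp
  show "wp (word_cnt_prog b) R M (\<lambda>R' M'. param_regs R' \<and> (\<forall>a\<in>{?a}. spec a (rd w M' a)) \<and> same {?a} M M')"
    unfolding word_cnt_prog_def
  proof (rule wp_Seq, rule wp_pd[OF P, where kk = "NW + 1" and Gd = "\<lambda>_. True" and Xi = "\<lambda>i. i"
        and Yi = "\<lambda>_. 0" and V = "\<lambda>_. 0"], goal_cases)
    case (1 M1)
    note W1 = this
    note s1 = writes_same[OF W1]
    define I where "I t M' \<longleftrightarrow> same {?a} M M' \<and> rd w M' ?a NW 0 = 0 \<and>
      (\<forall>k<NW. \<forall>j\<le>t. rd w M' ?a k j = ?c (k * w + j) - ?c (k * w))" for t M'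
    show ?case
    proof (rule wp_for[OF P, where T = w and I = I and kk = NW], goal_cases)
      case (4 M')
      then show ?case using P b by (simp add: I_def spec_pair)
    next
      case 5
      then show ?case using s1 writes_val[OF W1] by (simp add: I_def)
    next
      case (6 t M2)
      note t = 6(1) and I = 6(2)
      have sm: "same {?a} M M2" using I by (simp add: I_def)
      have P': "param_regs (R(12 := t))" using P by simp
      have bits2: "rd w M2 (16 + b) = rd w M (16 + b)" using sameD[OF sm, of "16 + b"] b by simp
      have "\<exists>M' wk dp. exec w r (pd (Rg 17) ?a Ln (Rg 12 \<oplus> Num 1) (Num 1)
          (Arr ?a Ln (Rg 12) \<oplus> Arr (16 + b) (Num 0) (Ln \<otimes> Rg 2 \<oplus> Rg 12))) (R(12 := t), M2) (R(12 := t), M') wk dp \<and>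
        wk \<le> csz (pd (Rg 17) ?a Ln (Rg 12 \<oplus> Num 1) (Num 1)
          (Arr ?a Ln (Rg 12) \<oplus> Arr (16 + b) (Num 0) (Ln \<otimes> Rg 2 \<oplus> Rg 12))) * (NW + 1) \<and>
        dp \<le> csz (pd (Rg 17) ?a Ln (Rg 12 \<oplus> Num 1) (Num 1)
          (Arr ?a Ln (Rg 12) \<oplus> Arr (16 + b) (Num 0) (Ln \<otimes> Rg 2 \<oplus> Rg 12))) \<and>
        writes M2 ?a NW (\<lambda>_. True) (\<lambda>k. k) (\<lambda>_. Suc t) (\<lambda>k. ?c (k * w + Suc t) - ?c (k * w)) M'"
      proof (rule pd_exec'[OF P'], goal_cases)
        case (5 i)
        have "?c (i * w + t) \<le> Q" using NW_cell[OF 5(1) t] by (intro ones_le(3))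
        moreover from this have "?c (i * w + t) - ?c (i * w) \<le> Q" by linarith
        moreover have "rd w M2 ?a i t = ?c (i * w + t) - ?c (i * w)" using I 5 t by (simp add: I_def)
        moreover have "i < Q" "i \<le> Q" using 5 lane_Q(9,10)[of i] by simp_all
        moreover have "t < Q" "t \<le> Q ^ 4" "Suc t < Q"
          using t bound(3) le_Q4[of t] params_le_BB(3) by linarith+
        moreover have "i * w + t < Q" using NW_cell[OF 5(1) t] lane_Q by blast
        ultimately show ?case
          using 5 NW_cell[OF 5(1) t] b bits[of "i * w + t"] mono[of i t]
          by (simp add: PD bits2 small_Q Suc_diff_le)
      qed (use bound b in \<open>auto simp: PD\<close>)
      then obtain M' wk dp where e: "exec w r (pd (Rg 17) ?a Ln (Rg 12 \<oplus> Num 1) (Num 1)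
          (Arr ?a Ln (Rg 12) \<oplus> Arr (16 + b) (Num 0) (Ln \<otimes> Rg 2 \<oplus> Rg 12))) (R(12 := t), M2) (R(12 := t), M') wk dp"
        "wk \<le> csz (pd (Rg 17) ?a Ln (Rg 12 \<oplus> Num 1) (Num 1)
          (Arr ?a Ln (Rg 12) \<oplus> Arr (16 + b) (Num 0) (Ln \<otimes> Rg 2 \<oplus> Rg 12))) * (NW + 1)"
        "dp \<le> csz (pd (Rg 17) ?a Ln (Rg 12 \<oplus> Num 1) (Num 1)
          (Arr ?a Ln (Rg 12) \<oplus> Arr (16 + b) (Num 0) (Ln \<otimes> Rg 2 \<oplus> Rg 12)))"
        and W: "writes M2 ?a NW (\<lambda>_. True) (\<lambda>k. k) (\<lambda>_. Suc t) (\<lambda>k. ?c (k * w + Suc t) - ?c (k * w)) M'"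
        by blast
      have "I (Suc t) M'"
      proof -
        have "rd w M' ?a k j = ?c (k * w + j) - ?c (k * w)" if "k < NW" "j \<le> Suc t" for k j
        proof (cases "j = Suc t")
          case True
          then show ?thesis using writes_val[OF W, of k] that by simp
        next
          case False
          then show ?thesis using writes_other[OF W, of k j] I that by (simp add: I_def)
        qed
        moreover have "rd w M' ?a NW 0 = 0" using writes_other[OF W, of NW 0] I by (simp add: I_def)
        ultimately show ?thesis using same_trans1[OF sm writes_same[OF W]] by (simp add: I_def)
      qed
      with e show ?case by blast
    qed (use X_ge(5)[of w NW] in \<open>auto simp: PD\<close>)
  qed (use bound b in \<open>auto simp: PD lane_Q\<close>)
qed

lemma prefix_phase: "b < 2 \<Longrightarrow> phase {18 + b} (prefix_prog b) {20 + b}"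
proof (rule phaseI)
  fix R M assume b: "b < 2" and P: "param_regs R" and D: "\<And>a. a \<in> {18 + b} \<Longrightarrow> spec a (rd w M a)"
  note PD = param_regsD[OF P]
  let ?c = "ones b" and ?a = "20 + b"
  have wc: "rd w M (18 + b) k w = ?c (Suc k * w) - ?c (k * w)" if "k < NW" for k
  proof -
    have "rd w M (18 + b) k w = ?c (k * w + w) - ?c (k * w)" using D[of "18 + b"] that b by (simp add: spec_pair)
    then show ?thesis by (simp only: mult_Suc add.commute[of w])
  qed
  have bound: "NW + 2 \<le> X" "NW + 1 < Q" "w < Q" "Suc NW \<le> Q" using NW_1_Q X_ge(1) less_NN(6) by linarith+
  have kw: "k * w \<le> NN" if "k \<le> NW" for k using that NN_mult(3) by simp
  have mono: "?c (j * w) \<le> ?c (k * w)" if "j \<le> k" for k j by (rule cnt_mono) (use that in simp)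
  have dle: "?c (k * w) - x \<le> Q" if "k \<le> NW" for k x using ones_le(1)[OF kw[OF that], of b] by simp
  show "wp (prefix_prog b) R M (\<lambda>R' M'. param_regs R' \<and> (\<forall>a\<in>{?a}. spec a (rd w M' a)) \<and> same {?a} M M')"
    unfolding prefix_prog_def
  proof (rule wp_Seq, rule wp_pd[OF P, where kk = 1 and Gd = "\<lambda>_. True" and Xi = "\<lambda>_. 0"
        and Yi = "\<lambda>i. i" and V = "\<lambda>_. 0"], goal_cases)
    case (1 M1)
    note W1 = this
    note s1 = writes_same[OF W1]
    have wc1: "rd w M1 (18 + b) = rd w M (18 + b)" using sameD[OF s1, of "18 + b"] b by simp
    show ?case
    proof (rule wp_Seq, rule wp_pd[OF P, where kk = NW and Gd = "\<lambda>_. True" and Xi = "\<lambda>_. 0"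
        and Yi = "Suc" and V = "\<lambda>k. ?c (Suc k * w) - ?c (k * w)"], goal_cases)
      case (1 M2)
      note W2 = this
      have s2: "same {?a} M M2" by (rule same_trans1[OF s1 writes_same[OF W2]])
      \<comment> \<open>After \<open>t\<close> rounds, entry \<open>k\<close> holds the count over
        the last 2^t words before word \<open>k\<close>, or over all of them if there are
        fewer.\<close>
      define I where "I t M' \<longleftrightarrow> same {?a} M M' \<and>
        (\<forall>k\<le>NW. rd w M' ?a 0 k = ?c (k * w) - ?c ((k - 2 ^ t) * w))" for t M'
      let ?body = "pd (Rg 17 \<oplus> Num 1) (20 + b) (Num 0) Ln
        (Lt (Shiftl (Num 1) (Rg 12)) (Ln \<oplus> Num 1))
        (Arr (20 + b) (Num 0) Ln \<oplus> Arr (20 + b) (Num 0) (Ln \<ominus> Shiftl (Num 1) (Rg 12)))"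
      show ?case
      proof (rule wp_for[OF P, where T = "w div 64" and I = I and kk = "NW + 1"], goal_cases)
        case (4 M')
        \<comment> \<open>The window has reached the row length, which exceeds the number of words;
          so \<open>w div 64\<close> rounds suffice.\<close>
        have "k - 2 ^ (w div 64) = 0" if "k \<le> NW" for k
          using that bound(2) by (simp add: rowlen_def)
        then show ?case using 4 P b by (simp add: I_def spec_pair)
      next
        case 5
        have "rd w M2 ?a 0 k = ?c (k * w) - ?c ((k - 1) * w)" if "k \<le> NW" for k
        proof (cases k)
          case 0
          then show ?thesis using writes_other[OF W2, of 0 0] writes_val[OF W1, of 0] by simp
        next
          case (Suc k')
          then show ?thesis using writes_val[OF W2, of k'] that by simp
        qed
        then show ?case using s2 by (simp add: I_def)
      next
        case (6 t M3)
        note t = 6(1) and I = 6(2)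
        have sm: "same {?a} M M3" using I by (simp add: I_def)
        have P': "param_regs (R(12 := t))" using P by simp
        have "(2::nat) ^ t \<le> 2 ^ (w div 64)" using t by (intro power_increasing) auto
        then have t2: "2 ^ t \<le> Q" by (simp add: rowlen_def)
        have t4: "t \<le> Q ^ 4" using t by (intro le_Q4 order_trans[OF _ params_le_BB(3)]) simp
        have I': "rd w M3 ?a 0 k = ?c (k * w) - ?c ((k - 2 ^ t) * w)" if "k \<le> NW" for k
          using I that by (simp add: I_def)
        have "\<exists>M' wk dp. exec w r ?body (R(12 := t), M3) (R(12 := t), M') wk dp \<and>
          wk \<le> csz ?body * (NW + 1 + 1) \<and> dp \<le> csz ?body \<and>
          writes M3 ?a (NW + 1) (\<lambda>k. 2 ^ t \<le> k) (\<lambda>_. 0) (\<lambda>k. k) (\<lambda>k. ?c (k * w) - ?c ((k - 2 ^ Suc t) * w)) M'"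
        proof (rule pd_exec'[OF P'], goal_cases)
          case (5 i)
          then have i: "i \<le> NW" "i - 2 ^ t \<le> NW" by simp_all
          have "?c (i * w) - ?c ((i - 2 ^ t) * w) + (?c ((i - 2 ^ t) * w) - ?c ((i - 2 ^ t - 2 ^ t) * w)) =
            ?c (i * w) - ?c ((i - 2 ^ Suc t) * w)"
          proof -
            \<comment> \<open>This holds for truncated subtraction too, so entries near the
              beginning need no separate treatment.\<close>
            have e: "i - 2 ^ Suc t = i - 2 ^ t - 2 ^ t" by simp
            have "?c ((i - 2 ^ t) * w) \<le> ?c (i * w)" "?c ((i - 2 ^ t - 2 ^ t) * w) \<le> ?c ((i - 2 ^ t) * w)"
              by (intro mono; simp)+
            then show ?thesis unfolding e by linarith
          qed
          then show ?case using 5 t2 t4 I'[OF i(1)] I'[OF i(2)] dle[OF i(1)] dle[OF i(2)]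
              lane_Q(9,10)[OF i(1)] lane_Q(9)[OF i(2)] b by (simp add: PD small_Q)
        next
          case (4 i)
          then show ?case using lane_Q(9,10)[of i] t2 t4 by (auto simp: PD small_Q)
        qed (use bound b in \<open>auto simp: PD\<close>)
        then obtain M' wk dp where e: "exec w r ?body (R(12 := t), M3) (R(12 := t), M') wk dp"
          "wk \<le> csz ?body * (NW + 1 + 1)" "dp \<le> csz ?body"
          and W: "writes M3 ?a (NW + 1) (\<lambda>k. 2 ^ t \<le> k) (\<lambda>_. 0) (\<lambda>k. k)
            (\<lambda>k. ?c (k * w) - ?c ((k - 2 ^ Suc t) * w)) M'"
          by blast
        have "rd w M' ?a 0 k = ?c (k * w) - ?c ((k - 2 ^ Suc t) * w)" if "k \<le> NW" for k
        proof (cases "2 ^ t \<le> k")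
          case True
          then show ?thesis using writes_val[OF W, of k] that by simp
        next
          case False
          then show ?thesis using writes_other[OF W, of 0 k] I'[OF that] by simp
        qed
        then have "I (Suc t) M'" using same_trans1[OF sm writes_same[OF W]] by (simp add: I_def)
        with e show ?case by blast
      qed (use X_ge(5)[of "w div 64" "NW + 1"] in \<open>auto simp: PD\<close>)
    next
      case (7 i)
      then show ?case using wc[of i] dle[of "Suc i"] lane_Q(9,10)[of i] lane_Q(9)[of "Suc i"] bound b
        by (simp add: PD wc1 small_Q)
    qed (use bound b in \<open>auto simp: PD\<close>)
  qed (use bound b in \<open>auto simp: PD small_Q\<close>)
qed

lemma cnt_phase: "b < 2 \<Longrightarrow> phase {18 + b, 20 + b} (cnt_prog b) {22 + b}"
proof (rule phaseI)
  fix R M assume b: "b < 2" and P: "param_regs R" and D: "\<And>a. a \<in> {18 + b, 20 + b} \<Longrightarrow> spec a (rd w M a)"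
  note PD = param_regsD[OF P]
  have wc: "rd w M (18 + b) k j = ones b (k * w + j) - ones b (k * w)" if "k < NW" "j \<le> w" for k j
    using D[of "18 + b"] that b by (simp add: spec_pair)
  have pc: "rd w M (20 + b) 0 k = ones b (k * w)" if "k \<le> NW" for k
    using D[of "20 + b"] that b by (simp add: spec_pair)
  have bound: "NN + 1 \<le> X" "w < Q" using NW_1_Q X_ge(1) by linarith+
  show "wp (cnt_prog b) R M (\<lambda>R' M'. param_regs R' \<and> (\<forall>a\<in>{22 + b}. spec a (rd w M' a)) \<and> same {22 + b} M M')"
    unfolding cnt_prog_def
  proof (rule wp_pd[OF P, where kk = NN and Gd = "\<lambda>_. True" and Xi = "\<lambda>_. 0"
        and Yi = "\<lambda>i. i" and V = "\<lambda>x. ones b x"], goal_cases)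
    case (1 M1)
    then show ?case using P writes_val[OF 1] writes_same[OF 1] b by (simp add: spec_pair)
  next
    case (7 i)
    have k: "i div w < NW" using 7 NN_mult(3) by (simp add: less_mult_imp_div_less)
    have j: "i mod w < w" using w_pos by simp
    have "ones b (i div w * w) \<le> ones b i" by (rule cnt_mono) simp
    moreover have "ones b i \<le> Q" using 7 by (intro ones_le) simp
    moreover have "i mod w < Q" using j bound(2) by linarith
    ultimately show ?case
      using 7 wc[OF k, of "i mod w"] pc[of "i div w"] k j lane_Q(9)[of "i div w"] lane_Q(1,2)[of i] b w_pos
      by (simp add: PD small_Q)
  qed (use bound b in \<open>auto simp: PD\<close>)
qed

lemma cell_positions:
  assumes "NN = (NN div (q * z)) * (q * z)" "c < NN div (q * z)" "e < q" "0 < z"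
  shows "c * (q * z) + e * z < NN"
proof -
  have "e * z + z \<le> q * z" using assms(3) by (metis Suc_leI mult_Suc mult_le_mono1 add.commute)
  then have "c * (q * z) + e * z < (c + 1) * (q * z)"
    using assms(4) unfolding add_mult_distrib mult_1 by linarith
  also have "\<dots> \<le> (NN div (q * z)) * (q * z)" using assms(2) by (intro mult_right_mono) auto
  finally show ?thesis using assms(1) by simp
qed

text \<open>One argument for both cell sizes: the sub-cells are the words (\<open>z = w\<close>) or
  the small cells (\<open>z = Z1\<close>).\<close>

lemma cell_step:
  assumes P: "param_regs R" and b: "b < 2" and D: "spec (22 + b) (rd w M (22 + b))"
    and a: "a + b < 64" "a + b \<noteq> 22 + b"
    and z: "\<And>R'. param_regs R' \<Longrightarrow> R' Zr = q * z \<and> R' zr = z" "0 < z" "q * z \<le> BB" "q * z < 2 ^ h"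
      "NN = (NN div (q * z)) * (q * z)" "w \<le> q * z"
    and post: "\<And>R' M'. param_regs R' \<Longrightarrow> (\<And>c. c < NN div (q * z) \<Longrightarrow> rd w M' (a + b) 0 c = cell_pack (lev_bit b) h q z c) \<Longrightarrow>
      same {a + b} M M' \<Longrightarrow> Post R' M'"
  shows "wp (cell_prog a b Zr zr) R M Post"
proof -
  let ?F = "\<lambda>c e. ones b (c * (q * z) + e * z) - ones b (c * (q * z))"
  have rk: "rd w M (22 + b) 0 x = ones b x" if "x < NN" for x using D that b by (simp add: spec_pair)
  have sum: "(\<Sum>e<q. ?F c e * 2 ^ (e * h)) = cell_pack (lev_bit b) h q z c" for c
    by (simp add: cell_pack_def pack_def)
  have U: "2 ^ (q * h) \<le> Q"
  proof -
    have "(2::nat) ^ (q * h) \<le> 2 ^ (U + h)" unfolding U_def by (rule power_increasing) auto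
    then show ?thesis using params_le_Q(16) by (rule order_trans)
  qed
  have cells: "NN div (q * z) \<le> NW"
  proof -
    have "NN div (q * z) \<le> NN div w" using z(6) w_pos by (rule div_le_mono2[rotated])
    then show ?thesis by (simp add: NW_def)
  qed
  have "Q \<le> Q ^ 4" by simp
  then have "q \<le> w" "NN div (q * z) \<le> NW + 1" using q_le cells by simp_all
  note TX = X_ge(5)[OF this] q_le
  show ?thesis unfolding cell_prog_def
  proof (rule wp_accum[OF P, where kk = "NN div (q * z)" and Xi = "\<lambda>_. 0" and Yi = "\<lambda>i. i" and T = q
        and V = "\<lambda>c e. ?F c e * 2 ^ (e * h)"], goal_cases)
    case (1 M')
    then show ?case using P by (intro post) (simp_all add: sum)
  next
    case (3 R' M')
    then show ?case using z(1)[OF 3] z(3) by (simp add: param_regsD[OF 3] le_Q4)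
  next
    case (4 R' M')
    then show ?case by (simp add: param_regsD[OF 4])
  next
    case (7 i R' M')
    then have "i < Q" using cells lane_Q(9)[of i] by simp
    then show ?case by (simp add: small_Q)
  next
    case (9 c e R' M')
    note z' = z(1)[OF 9(4)] and P' = param_regsD[OF 9(4)]
    have M': "rd w M' (22 + b) = rd w M (22 + b)" using sameD[OF 9(3), of "22 + b"] a b by simp
    have x: "c * (q * z) + e * z < NN" by (rule cell_positions) (use z 9 in auto)
    then have x0: "c * (q * z) < NN" by simp
    \<comment> \<open>A single term is at most the whole sum, which is a packed word of
      \<open>q * h\<close> bits.\<close>
    have F: "?F c e * 2 ^ (e * h) \<le> Q"
    proof -
      have "?F c e * 2 ^ (e * h) \<le> (\<Sum>e<q. ?F c e * 2 ^ (e * h))"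
        using 9(2) by (intro member_le_sum) auto
      also have "\<dots> < 2 ^ (q * h)" unfolding sum by (rule cell_pack_less[OF z(4)])
      finally show ?thesis using U by simp
    qed
    have "e \<le> Q ^ 4" using 9(2) q_le by (intro le_Q4 order_trans[OF _ params_le_BB(3)]) simp
    moreover have "z \<le> Q ^ 4"
    proof -
      have "1 * z \<le> q * z" using q_pos by (intro mult_right_mono) auto
      then show ?thesis using z(3) by (intro le_Q4) linarith
    qed
    moreover have "c \<le> Q" using 9(1) cells lane_Q(10)[of c] by simp
    moreover have "ones b (c * (q * z)) \<le> ones b (c * (q * z) + e * z)" by (rule cnt_mono) simp
    ultimately show ?case using 9(5) F z(3) lane_Q(1)[OF x] lane_Q(1)[OF x0] ones_le(3)[OF x, of b]
      ones_le(3)[OF x0, of b] b by (simp add: P' z' M' rk[OF x] rk[OF x0] small_Q le_Q4)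
  next
    case (10 c)
    have "cell_pack (lev_bit b) h q z c < 2 ^ (q * h)" by (rule cell_pack_less[OF z(4)])
    then show ?case unfolding sum using U Q_le_word(2) \<open>Q \<le> Q ^ 4\<close> by linarith
  qed (use a TX in auto)
qed

lemma small_cell_phase: "b < 2 \<Longrightarrow> phase {22 + b} (cell_prog 24 b 13 2) {24 + b}"
proof (rule phaseI)
  fix R M assume b: "b < 2" and P: "param_regs R" and D: "\<And>a. a \<in> {22 + b} \<Longrightarrow> spec a (rd w M a)"
  show "wp (cell_prog 24 b 13 2) R M (\<lambda>R' M'. param_regs R' \<and> (\<forall>a\<in>{24 + b}. spec a (rd w M' a)) \<and> same {24 + b} M M')"
    by (rule cell_step[OF P b, where z = w])
      (use b D NN_mult(2) Z1_less w_pos w_le_Z in \<open>auto simp: param_regsD Z1_def[symmetric] params_le_BB spec_pair\<close>)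
qed

lemma large_cell_phase: "b < 2 \<Longrightarrow> phase {22 + b} (cell_prog 28 b 8 13) {28 + b}"
proof (rule phaseI)
  fix R M assume b: "b < 2" and P: "param_regs R" and D: "\<And>a. a \<in> {22 + b} \<Longrightarrow> spec a (rd w M a)"
  show "wp (cell_prog 28 b 8 13) R M (\<lambda>R' M'. param_regs R' \<and> (\<forall>a\<in>{28 + b}. spec a (rd w M' a)) \<and> same {28 + b} M M')"
    by (rule cell_step[OF P b, where z = Z1])
      (use b D NN_mult(1) Z2_less Z_pos w_le_Z in \<open>auto simp: param_regsD Z2_def[symmetric] params_le_BB spec_pair\<close>)
qed

lemma bit_word_less: "bit_word k < 2 ^ w"
  unfolding bit_word_def using pack_less[of w "\<lambda>j. of_bool (lev_bit 1 (k * w + j))" 1] by simp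

lemma bit_word_digit: "j < w \<Longrightarrow> bit_word k div 2 ^ j mod 2 = of_bool (lev_bit 1 (k * w + j))"
  unfolding bit_word_def using pack_field[of w "\<lambda>j. of_bool (lev_bit 1 (k * w + j))" 1 j] by simp

lemma bitmap_phase: "phase {17} bitmap_prog {2}"
proof (rule phaseI)
  fix R M assume P: "param_regs R" and D: "\<And>a. a \<in> {17} \<Longrightarrow> spec a (rd w M a)"
  have bits: "rd w M 17 0 x = of_bool (lev_bit 1 x)" if "x < NN" for x
    using D[of 17] that spec_pair(1)[of 1] by simp
  have sum: "(\<Sum>j<w. of_bool (lev_bit 1 (k * w + j)) * 2 ^ j) = bit_word k" for k
    by (simp add: bit_word_def pack_def)
  note TX = X_ge(5)[of w NW]
  show "wp bitmap_prog R M (\<lambda>R' M'. param_regs R' \<and> (\<forall>a\<in>{2}. spec a (rd w M' a)) \<and> same {2} M M')"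
    unfolding bitmap_prog_def
  proof (rule wp_accum[OF P, where kk = NW and Xi = "\<lambda>_. 0" and Yi = "\<lambda>i. i" and T = w
        and V = "\<lambda>k j. of_bool (lev_bit 1 (k * w + j)) * 2 ^ j"], goal_cases)
    case (1 M')
    then show ?case using P unfolding sum by (simp add: spec_single)
  next
    case (3 R' M')
    then show ?case by (simp add: param_regsD[OF 3])
  next
    case (4 R' M')
    then show ?case by (simp add: param_regsD[OF 4])
  next
    case (7 i R' M')
    then show ?case using lane_Q(9,10)[of i] by (simp add: small_Q)
  next
    case (9 k j R' M')
    note P' = param_regsD[OF 9(4)]
    have M': "rd w M' 17 = rd w M 17" using sameD[OF 9(3), of 17] by simp
    have x: "k * w + j < NN" by (rule NW_cell) (use 9 in auto)
    have "(2::nat) ^ j < 2 ^ w" using 9(2) by simp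
    moreover have "j \<le> Q ^ 4" using 9(2) by (intro le_Q4 order_trans[OF _ params_le_BB(3)]) simp
    ultimately show ?case using 9 bits[OF x] lane_Q(1)[OF x] lane_Q(9,10)[of k]
      by (simp add: P' M' small_Q)
  next
    case (10 k)
    then show ?case unfolding sum by (rule_tac bit_word_less)
  qed (use TX in auto)
qed

end

section \<open>Construction of the rank and select structures\<close>

abbreviation node :: uexp where "node \<equiv> Arr 30 (Num 0) (Ln \<oplus> Num (Suc 0))"
abbreviation node_st :: uexp where "node_st \<equiv> Arr 31 (Num 0) node"
abbreviation node_en :: uexp where "node_en \<equiv> Arr 32 (Num 0) node"
abbreviation rank_e :: "nat \<Rightarrow> uexp" where "rank_e b \<equiv> Arr (22 + b) (Num 0) Ln \<ominus> Arr (22 + b) (Num 0) node_st"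

definition base_prog :: "nat \<Rightarrow> com" where
  "base_prog b = pd (Rg 5) (36 + b) node (Num 0) (Num 1) (Arr (22 + b) (Num 0) node_st)"

text \<open>The cell after the current one is copied as well: rank at the end of a node and the
  second candidate among the large cells in select both need it. Columns count from the first cell
  of the node.\<close>

definition window_prog :: "nat \<Rightarrow> nat \<Rightarrow> (nat \<Rightarrow> uexp) \<Rightarrow> com" where
  "window_prog a Zr src = Seq
     (pd (Rg 5) a node (Ln \<oslash> Rg Zr \<ominus> node_st \<oslash> Rg Zr) (Num 1) (src 0))
     (pd (Rg 5) a node (Ln \<oslash> Rg Zr \<oplus> Num (Suc 0) \<ominus> node_st \<oslash> Rg Zr) (Num 1) (src 1))"

text \<open>The second step writes the end of the node behind the samples. Its column is the number
  of groups, so it overwrites no sample.\<close>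

definition sample_prog :: "nat \<Rightarrow> com" where
  "sample_prog b = Seq
     (pd (Rg 5) (44 + b) node (rank_e b \<oslash> Rg 9)
        (Guard (Arr (16 + b) (Num 0) Ln) (Equal (rank_e b \<odot> Rg 9) (Num 0))) Ln)
     (pd (Rg 5) (44 + b) node
        ((Arr (22 + b) (Num 0) node_en \<ominus> Arr (22 + b) (Num 0) node_st \<oplus> Rg 9 \<ominus> Num 1) \<oslash> Rg 9) (Num 1) node_en)"

text \<open>Sparse groups need no allocation of space: a group is addressed by the block of
  \<open>Z2\<close> positions, counted from the start of the node, in which its first sample lies.
  The added 1 turns the strict comparison into Z2 \<le> difference.\<close>

definition sparse_prog :: "nat \<Rightarrow> com" where
  "sparse_prog b = pd (Rg 5) (46 + b) node
     ((Arr (44 + b) node (rank_e b \<oslash> Rg 9) \<ominus> node_st) \<oslash> Rg 8 \<otimes> Rg 9 \<oplus> rank_e b \<odot> Rg 9)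
     (Guard (Arr (16 + b) (Num 0) Ln)
       (Lt (Rg 8) (Arr (44 + b) node (rank_e b \<oslash> Rg 9 \<oplus> Num (Suc 0)) \<ominus> Arr (44 + b) node (rank_e b \<oslash> Rg 9) \<oplus> Num (Suc 0))))
     (Ln \<ominus> node_st)"

definition pop_prog :: com where
  "pop_prog = accum (Rg 18) 33 (Num 0) Ln (Rg 14) (Shiftr (Ln \<oslash> Rg 15) (Rg 12) \<odot> Num 2)"

text \<open>The population counts of the prefixes of a chunk are looked up in array 33, so that each
  round takes constant time.\<close>

definition sel_prog :: com where
  "sel_prog = accum (Rg 18) 34 (Num 0) Ln (Rg 14)
     (Lt (Arr 33 (Num 0) ((Ln \<oslash> Rg 15 \<odot> Shiftl (Num 1) (Rg 12 \<oplus> Num (Suc 0))) \<otimes> Rg 15) \<oplus> Rg 2) (Ln \<odot> Rg 15 \<oplus> Num (Suc 0)))"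

definition field_prog :: com where
  "field_prog = accum (Rg 18) 35 (Num 0) Ln (Rg 7)
     (Lt (Shiftr (Ln \<oslash> Rg 15) (Rg 12 \<otimes> Rg 6) \<odot> Rg 15) (Ln \<odot> Rg 15 \<oplus> Num (Suc 0)))"

text \<open>The mask of ones gets a step of its own: \<open>Ones\<close> has level 100 and cannot be
  an operand of a safe \<open>Plus\<close>.\<close>

definition table_prog :: com where
  "table_prog = Seq
     (pd (Num 4) 3 (Num 0) Ln (Num 1) (Rg 6 \<otimes> Equal Ln (Num 0) \<oplus> Rg 7 \<otimes> Equal Ln (Num 1)))
     (Seq (pd (Num 1) 3 (Num 0) (Num 2) (Num 1) Ones)
     (pd (Num 3 \<otimes> Rg 18) 3 (Num 0) (Num 4 \<oplus> Ln) (Num 1)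
       (Equal (Ln \<odot> Num 3) (Num 0) \<otimes> Arr 33 (Num 0) (Ln \<oslash> Num 3)
        \<oplus> Equal (Ln \<odot> Num 3) (Num 1) \<otimes> Arr 34 (Num 0) (Ln \<oslash> Num 3)
        \<oplus> Equal (Ln \<odot> Num 3) (Num 2) \<otimes> Arr 35 (Num 0) (Ln \<oslash> Num 3))))"

definition record_prog :: "nat \<Rightarrow> uexp \<Rightarrow> com" where
  "record_prog a e = pd (Rg 19) a Ln (Num 0) (Num 1) e"

abbreviation node_len :: uexp where "node_len \<equiv> Arr 32 (Num 0) Ln \<ominus> Arr 31 (Num 0) Ln"

definition records_prog :: com where
  "records_prog =
     Seq (record_prog 48 (Num 2 \<otimes> (Rg 11 \<otimes> Rg 11)))
    (Seq (record_prog 49 (Arr 31 (Num 0) Ln))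
    (Seq (record_prog 50 node_len)
    (Seq (record_prog 51 (Num 16 \<otimes> (Rg 11 \<otimes> Rg 11) \<oplus> Num 64 \<otimes> (Ln \<otimes> Rg 11)))
    (Seq (record_prog 52 (Num 64 \<otimes> (node_len \<oslash> Rg 13 \<oplus> node_len \<oslash> Rg 9 \<oplus> node_len \<oslash> Rg 8 \<otimes> Rg 9 \<oplus> Num 3)))
    (Seq (record_prog 53 (Num 16 \<otimes> (Rg 11 \<otimes> Rg 11) \<oplus> Num 48 \<oplus> Num 64 \<otimes> (Num 2 \<otimes> Ln \<otimes> Rg 11)))
         (record_prog 54 (Num 16 \<otimes> (Rg 11 \<otimes> Rg 11) \<oplus> Num 48 \<oplus> Num 64 \<otimes> ((Num 2 \<otimes> Ln \<oplus> Num (Suc 0)) \<otimes> Rg 11))))))))"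

context wavelet_input
begin

text \<open>Removed from the simplifier where facts about complete array reads are at hand, since
  unfolding would keep these facts from matching.\<close>

lemmas no_arr_simps = safe.simps(5) uval.simps(5)

section \<open>Samples and ranks within a node\<close>

lemma sel_pos_eq: "lev_bit b z \<Longrightarrow> sel_pos b (ones b z) = z"
  unfolding sel_pos_def by (rule the_equality) (auto dest: cnt_inj)

lemma node_one_exists:
  assumes "ones b (nst v) \<le> \<rho>" "\<rho> < ones b (nen v)"
  shows "\<exists>z. lev_bit b z \<and> ones b z = \<rho> \<and> nst v \<le> z \<and> z < nen v"
proof -
  from cnt_attained[OF assms(2)] obtain z where z: "z < nen v" "lev_bit b z" "ones b z = \<rho>" by blast
  with assms(1) cnt_le_iff[of "lev_bit b" z "nst v"] show ?thesis by auto
qed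

lemma sample_one:
  assumes "ones b (nst v) + k * G < ones b (nen v)"
  shows "lev_bit b (sample b v k)" "ones b (sample b v k) = ones b (nst v) + k * G"
    "nst v \<le> sample b v k" "sample b v k < nen v"
proof -
  from node_one_exists[OF _ assms] obtain z where
    "lev_bit b z" "ones b z = ones b (nst v) + k * G" "nst v \<le> z" "z < nen v" by auto
  moreover from this have "sample b v k = z" using assms sel_pos_eq[of b z] by (simp add: sample_def)
  ultimately show "lev_bit b (sample b v k)" "ones b (sample b v k) = ones b (nst v) + k * G"
    "nst v \<le> sample b v k" "sample b v k < nen v" by simp_all
qed

lemma sample_end: "ones b (nen v) \<le> ones b (nst v) + k * G \<Longrightarrow> sample b v k = nen v"
  by (simp add: sample_def)

lemma sample_bounds: "nst v \<le> sample b v k" "sample b v k \<le> nen v"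
  using sample_one[of b v k] sample_end[of b v k] nen_bounds[of v]
  by (cases "ones b (nst v) + k * G < ones b (nen v)"; simp)+

lemma sample_mono: "k \<le> j \<Longrightarrow> sample b v k \<le> sample b v j"
proof (cases "ones b (nst v) + j * G < ones b (nen v)")
  case True
  assume "k \<le> j"
  then have kj: "k * G \<le> j * G" by simp
  with True have True': "ones b (nst v) + k * G < ones b (nen v)" by linarith
  have "ones b (sample b v k) \<le> ones b (sample b v j)"
    using sample_one(2)[OF True] sample_one(2)[OF True'] kj by simp
  then show ?thesis using cnt_le_iff[of "lev_bit b"] sample_one(1)[OF True] by simp
next
  case False
  then show ?thesis using sample_end[of b v j] sample_bounds(2)[of b v k] by simp
qed

lemma local_rank_less:
  assumes "x < N" "lev_bit b x"
  shows "ones b (nst (own x)) \<le> ones b x" "ones b x < ones b (nen (own x))"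
    "local_rank b x < ones b (nen (own x)) - ones b (nst (own x))"
proof -
  have x: "nst (own x) \<le> x" "x < nen (own x)" using own_iff[OF assms(1), of "own x"] by simp_all
  then show 1: "ones b (nst (own x)) \<le> ones b x" by (intro cnt_mono)
  have "ones b (Suc x) \<le> ones b (nen (own x))" using x by (intro cnt_mono) simp
  then show 2: "ones b x < ones b (nen (own x))" using assms(2) by simp
  with 1 show "local_rank b x < ones b (nen (own x)) - ones b (nst (own x))" by (simp add: local_rank_def)
qed

lemma group_index_le:
  assumes "j < C" shows "j div G + 1 \<le> (C + G - 1) div G"
proof -
  have "j div G + 1 = (j + G) div G" using G_pos by simp
  also have "\<dots> \<le> (C + G - 1) div G" using assms by (intro div_le_mono) simp
  finally show ?thesis .
qed

text \<open>The rounded-up quotient is the number of groups, and thereby the column of the final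
  sample at the end of the node.\<close>

lemma last_group: "C \<le> (C + G - 1) div G * G" "k < (C + G - 1) div G \<Longrightarrow> k * G < C"
proof -
  show "C \<le> (C + G - 1) div G * G" using dividend_less_div_times[OF G_pos, of "C + G - 1"] G_pos by linarith
  assume "k < (C + G - 1) div G"
  then have "(k + 1) * G \<le> (C + G - 1) div G * G" by (intro mult_right_mono) auto
  also have "\<dots> \<le> C + G - 1" by (rule div_times_less_eq_dividend)
  finally show "k * G < C" using G_pos by simp
qed

lemma node_facts:
  assumes x: "x < N" and D: "spec 30 (rd w M 30)" "spec 31 (rd w M 31)" "spec 32 (rd w M 32)" and P: "param_regs R"
    and M': "rd w M' 30 = rd w M 30" "rd w M' 31 = rd w M 31" "rd w M' 32 = rd w M 32"
  shows "safe w R M' x node" "uval w R M' x node = own x" "safe w R M' x node_st" "uval w R M' x node_st = nst (own x)"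
    "safe w R M' x node_en" "uval w R M' x node_en = nen (own x)"
    "nst (own x) \<le> x" "x < nen (own x)" "nst (own x) < NN" "nen (own x) < NN" "nst (own x) < Q" "nen (own x) < Q"
    "nst (own x) \<le> Q" "nen (own x) \<le> Q"
proof -
  note f = level_facts[OF x] and P' = param_regsD[OF P]
  have own: "rd w M 30 0 (Suc x) = own x" using D x by (simp add: spec_single)
  have st: "rd w M 31 0 (own x) = nst (own x)" and en: "rd w M 32 0 (own x) = nen (own x)"
    using D f by (simp_all add: spec_single)
  show b: "nst (own x) < NN" "nen (own x) < NN" using nst_le[of "own x"] nen_bounds[of "own x"] less_NN(1) by linarith+
  then show b': "nst (own x) < Q" "nen (own x) < Q" by (auto intro: lane_Q)
  then show "nst (own x) \<le> Q" "nen (own x) \<le> Q" by simp_all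
  have sx: "Suc x < Q" using x less_NN(1) lane_Q(1)[of "Suc x"] by simp
  show 1: "safe w R M' x node" "uval w R M' x node = own x"
    using f sx by (simp_all add: own M' P' small_Q)
  show "safe w R M' x node_st" "uval w R M' x node_st = nst (own x)"
    "safe w R M' x node_en" "uval w R M' x node_en = nen (own x)"
    using 1 f b' by (simp_all add: st en own M' P' small_Q)
  show "nst (own x) \<le> x" "x < nen (own x)" using own_iff[OF x, of "own x"] by simp_all
qed

lemma N_X: "N + 1 \<le> X" using X_ge(1) less_NN(1) by linarith

lemma base_phase: "b < 2 \<Longrightarrow> phase {22 + b, 30, 31, 32} (base_prog b) {36 + b}"
proof (rule phaseI)
  fix R M assume b: "b < 2" and P: "param_regs R" and D: "\<And>a. a \<in> {22 + b, 30, 31, 32} \<Longrightarrow> spec a (rd w M a)"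
  note PD = param_regsD[OF P]
  have rk: "rd w M (22 + b) 0 x = ones b x" if "x < NN" for x using D[of "22 + b"] that b by (simp add: spec_pair)
  show "wp (base_prog b) R M (\<lambda>R' M'. param_regs R' \<and> (\<forall>a\<in>{36 + b}. spec a (rd w M' a)) \<and> same {36 + b} M M')"
    unfolding base_prog_def
  proof (rule wp_pd[OF P, where kk = N and Gd = "\<lambda>_. True" and Xi = own
        and Yi = "\<lambda>_. 0" and V = "\<lambda>x. ones b (nst (own x))"], goal_cases)
    case (1 M1)
    then show ?case using P writes_val[OF 1] writes_same[OF 1] b by (simp add: spec_pair)
  next
    case (7 x)
    note f = node_facts[OF 7(1) D D D P refl refl refl, simplified]
    show ?case using f level_facts[OF 7(1)] rk[of "nst (own x)"] ones_le(3)[of "nst (own x)" b] b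
      by (simp add: PD small_Q)
  qed (use N_X b in \<open>auto simp: PD\<close>)
qed

lemma window_step:
  assumes P: "param_regs R" and D: "spec 30 (rd w M 30)" "spec 31 (rd w M 31)" "spec 32 (rd w M 32)"
    and a: "a < 64" "a \<notin> {30, 31, 32}" and Z: "R Zr = Z" "Z \<le> BB" "0 < Z"
    and src: "\<And>x d M'. x < N \<Longrightarrow> d < 2 \<Longrightarrow> same {a} M M' \<Longrightarrow> safe w R M' x (src d) \<and> uval w R M' x (src d) = F (x div Z + d)"
    and post: "\<And>M'. (\<And>x d. x < N \<Longrightarrow> d < 2 \<Longrightarrow> rd w M' a (own x) (x div Z + d - nst (own x) div Z) = F (x div Z + d)) \<Longrightarrow>
      same {a} M M' \<Longrightarrow> Post R M'"
  shows "wp (window_prog a Zr src) R M Post"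
proof -
  note PD = param_regsD[OF P]
  have Z4: "Z \<le> Q ^ 4" using Z(2) by (rule le_Q4)
  have le: "nst (own x) div Z \<le> x div Z" if "x < N" for x
    using own_iff[OF that, of "own x"] by (intro div_le_mono) simp
  have Q: "x div Z + 1 < Q" if "x < N" for x
  proof -
    have "x div Z \<le> x" by simp
    then have "x div Z + 1 < NN" using that less_NN(1) by linarith
    then show ?thesis by (rule lane_Q)
  qed
  note nf = node_facts[OF _ D P]
  show ?thesis unfolding window_prog_def
  proof (rule wp_Seq, rule wp_pd[OF P, where kk = N and Gd = "\<lambda>_. True" and Xi = own
        and Yi = "\<lambda>x. x div Z - nst (own x) div Z" and V = "\<lambda>x. F (x div Z)"], goal_cases)
    case (1 M1)
    note W1 = this
    note s1 = writes_same[OF W1]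
    have M1: "rd w M1 30 = rd w M 30" "rd w M1 31 = rd w M 31" "rd w M1 32 = rd w M 32"
      using sameD[OF s1] a by auto
    show ?case
    proof (rule wp_pd[OF P, where kk = N and Gd = "\<lambda>_. True" and Xi = own
        and Yi = "\<lambda>x. x div Z + 1 - nst (own x) div Z" and V = "\<lambda>x. F (x div Z + 1)"], goal_cases)
      case (1 M2)
      note W2 = this
      show ?case
      proof (rule post[OF _ same_trans1[OF s1 writes_same[OF W2]]])
        fix x d assume x: "x < N" and d: "d < (2::nat)"
        consider "d = 0" | "d = 1" using d by linarith
        then show "rd w M2 a (own x) (x div Z + d - nst (own x) div Z) = F (x div Z + d)"
        proof cases
          case 2
          then show ?thesis using writes_val[OF W2 x] by simp
        next
          case 1
          show ?thesis
          \<comment> \<open>The second step may overwrite a column of the first one, but only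
            through lanes one cell earlier. Their next cell is the present one, so they store the
            same value.\<close>
          proof (cases "\<exists>y<N. own y = own x \<and> y div Z + 1 - nst (own y) div Z = x div Z - nst (own x) div Z")
            case True
            then obtain y where y: "y < N" "own y = own x"
              "y div Z + 1 - nst (own y) div Z = x div Z - nst (own x) div Z" by blast
            then have "y div Z + 1 = x div Z" using le[OF x] le[OF y(1)] by simp
            then show ?thesis using writes_val[OF W2 y(1)] y 1 by simp
          next
            case False
            then show ?thesis using writes_other[OF W2, of "own x" "x div Z - nst (own x) div Z"]
                writes_val[OF W1 x] 1 by auto
          qed
        qed
      qed
    next
      case (7 x)
      note f = nf[OF 7(1) M1]
      show ?case using f Z Z4 le[OF 7(1)] Q[OF 7(1)] src[OF 7(1) _ s1, of 1] level_facts[OF 7(1)]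
        by (simp add: small_Q del: no_arr_simps)
    next
      case (8 x y)
      then have "x div Z + 1 - nst (own y) div Z = y div Z + 1 - nst (own y) div Z"
        "nst (own y) div Z \<le> x div Z" using le[OF 8(1)] by simp_all
      with le[OF 8(2)] have "x div Z = y div Z" by linarith
      then show ?case by simp
    qed (use N_X a in \<open>auto simp: PD\<close>)
  next
    case (7 x)
    note f = nf[OF 7(1) refl refl refl]
    have "same {a} M M" by (simp add: same_def)
    then show ?case using f Z Z4 le[OF 7(1)] Q[OF 7(1)] src[OF 7(1), of 0 M] level_facts[OF 7(1)]
      by (simp add: small_Q del: no_arr_simps)
  next
    case (8 x y)
    then have "x div Z - nst (own y) div Z = y div Z - nst (own y) div Z" "nst (own y) div Z \<le> x div Z"
      using le[OF 8(1)] by simp_all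
    with le[OF 8(2)] have "x div Z = y div Z" by linarith
    then show ?case by simp
  qed (use N_X a in \<open>auto simp: PD\<close>)
qed

lemma cell_less:
  assumes "x < N" "d < 2" "NN = (NN div Z) * Z" "Z \<le> Z2" "0 < Z"
  shows "x div Z + d < NN div Z" "(x div Z + d) * Z < NN"
proof -
  have "x div Z * Z \<le> x" by simp
  moreover have "d * Z \<le> Z" using assms(2) by (cases d) auto
  moreover have "(x div Z + d) * Z = x div Z * Z + d * Z" by (rule add_mult_distrib)
  ultimately show *: "(x div Z + d) * Z < NN" using NN_lower assms(1,4) by linarith
  then have "(x div Z + d) * Z < (NN div Z) * Z" using assms(3) by simp
  then show "x div Z + d < NN div Z" by simp
qed

lemma cell_pack_Q: "q * z < 2 ^ h \<Longrightarrow> cell_pack f h q z c \<le> Q"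
proof -
  assume "q * z < 2 ^ h"
  then have "cell_pack f h q z c < 2 ^ (q * h)" by (rule cell_pack_less)
  also have "(2::nat) ^ (q * h) \<le> 2 ^ (U + h)" unfolding U_def by (rule power_increasing) auto
  finally show ?thesis using params_le_Q(16) by linarith
qed

lemma small_window_phase:
  "b < 2 \<Longrightarrow> phase {24 + b, 30, 31, 32} (window_prog (38 + b) 13 (\<lambda>d. Arr (24 + b) (Num 0) (Ln \<oslash> Rg 13 \<oplus> Num d))) {38 + b}"
proof (rule phaseI)
  fix R M assume b: "b < 2" and P: "param_regs R" and D: "\<And>a. a \<in> {24 + b, 30, 31, 32} \<Longrightarrow> spec a (rd w M a)"
  note PD = param_regsD[OF P]
  show "wp (window_prog (38 + b) 13 (\<lambda>d. Arr (24 + b) (Num 0) (Ln \<oslash> Rg 13 \<oplus> Num d))) R M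
    (\<lambda>R' M'. param_regs R' \<and> (\<forall>a\<in>{38 + b}. spec a (rd w M' a)) \<and> same {38 + b} M M')"
  proof (rule window_step[OF P, where Z = Z1 and F = "cell_pack (lev_bit b) h q w"], goal_cases)
    case (9 x d M')
    have c: "x div Z1 + d < NN div Z1" by (rule cell_less) (use 9 NN_mult(2) w_le_Z Z_pos in auto)
    moreover have "NN div Z1 \<le> NN" by simp
    ultimately have "x div Z1 + d < Q" using lane_Q(1)[of "x div Z1 + d"] by linarith
    moreover have "rd w M' (24 + b) = rd w M (24 + b)" using sameD[OF 9(3), of "24 + b"] b by simp
    moreover have "rd w M (24 + b) 0 (x div Z1 + d) = cell_pack (lev_bit b) h q w (x div Z1 + d)"
      using D[of "24 + b"] b c by (simp add: spec_pair)
    ultimately show ?case using cell_pack_Q[OF Z1_less, of "lev_bit b" "x div Z1 + d"] level_facts[OF 9(1)] b 9(2)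
      by (simp add: PD small_Q)
  next
    case (10 M')
    then show ?case using P b by (simp add: spec_pair)
  qed (use D b Z_pos in \<open>auto simp: PD params_le_BB\<close>)
qed

lemma count_window_phase:
  "b < 2 \<Longrightarrow> phase {22 + b, 30, 31, 32} (window_prog (40 + b) 8 (\<lambda>d. Arr (22 + b) (Num 0) ((Ln \<oslash> Rg 8 \<oplus> Num d) \<otimes> Rg 8))) {40 + b}"
proof (rule phaseI)
  fix R M assume b: "b < 2" and P: "param_regs R" and D: "\<And>a. a \<in> {22 + b, 30, 31, 32} \<Longrightarrow> spec a (rd w M a)"
  note PD = param_regsD[OF P]
  show "wp (window_prog (40 + b) 8 (\<lambda>d. Arr (22 + b) (Num 0) ((Ln \<oslash> Rg 8 \<oplus> Num d) \<otimes> Rg 8))) R M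
    (\<lambda>R' M'. param_regs R' \<and> (\<forall>a\<in>{40 + b}. spec a (rd w M' a)) \<and> same {40 + b} M M')"
  proof (rule window_step[OF P, where Z = Z2 and F = "\<lambda>c. ones b (c * Z2)"], goal_cases)
    case (9 x d M')
    have c: "(x div Z2 + d) * Z2 < NN" by (rule cell_less) (use 9 NN_mult(1) Z_pos in auto)
    moreover have "rd w M' (22 + b) = rd w M (22 + b)" using sameD[OF 9(3), of "22 + b"] b by simp
    moreover have "rd w M (22 + b) 0 ((x div Z2 + d) * Z2) = ones b ((x div Z2 + d) * Z2)"
      using D[of "22 + b"] b c by (simp add: spec_pair)
    ultimately show ?case using ones_le(3)[OF c, of b] lane_Q(1)[OF c] level_facts[OF 9(1)] b 9(2)
      by (simp add: PD small_Q)
  next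
    case (10 M')
    then show ?case using P b by (simp add: spec_pair)
  qed (use D b Z_pos in \<open>auto simp: PD params_le_BB\<close>)
qed

lemma large_window_phase:
  "b < 2 \<Longrightarrow> phase {28 + b, 30, 31, 32} (window_prog (42 + b) 8 (\<lambda>d. Arr (28 + b) (Num 0) (Ln \<oslash> Rg 8 \<oplus> Num d))) {42 + b}"
proof (rule phaseI)
  fix R M assume b: "b < 2" and P: "param_regs R" and D: "\<And>a. a \<in> {28 + b, 30, 31, 32} \<Longrightarrow> spec a (rd w M a)"
  note PD = param_regsD[OF P]
  show "wp (window_prog (42 + b) 8 (\<lambda>d. Arr (28 + b) (Num 0) (Ln \<oslash> Rg 8 \<oplus> Num d))) R M
    (\<lambda>R' M'. param_regs R' \<and> (\<forall>a\<in>{42 + b}. spec a (rd w M' a)) \<and> same {42 + b} M M')"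
  proof (rule window_step[OF P, where Z = Z2 and F = "cell_pack (lev_bit b) h q Z1"], goal_cases)
    case (9 x d M')
    have c: "x div Z2 + d < NN div Z2" by (rule cell_less) (use 9 NN_mult(1) Z_pos in auto)
    moreover have "NN div Z2 \<le> NN" by simp
    ultimately have "x div Z2 + d < Q" using lane_Q(1)[of "x div Z2 + d"] by linarith
    moreover have "rd w M' (28 + b) = rd w M (28 + b)" using sameD[OF 9(3), of "28 + b"] b by simp
    moreover have "rd w M (28 + b) 0 (x div Z2 + d) = cell_pack (lev_bit b) h q Z1 (x div Z2 + d)"
      using D[of "28 + b"] b c by (simp add: spec_pair)
    ultimately show ?case using cell_pack_Q[OF Z2_less, of "lev_bit b" "x div Z2 + d"] level_facts[OF 9(1)] b 9(2)
      by (simp add: PD small_Q)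
  next
    case (10 M')
    then show ?case using P b by (simp add: spec_pair)
  qed (use D b Z_pos in \<open>auto simp: PD params_le_BB\<close>)
qed

lemma rank_facts:
  assumes b: "b < 2" and x: "x < N"
    and D: "spec (22 + b) (rd w M (22 + b))" "spec 30 (rd w M 30)" "spec 31 (rd w M 31)" "spec 32 (rd w M 32)"
    and P: "param_regs R"
    and M': "rd w M' (22 + b) = rd w M (22 + b)" "rd w M' 30 = rd w M 30" "rd w M' 31 = rd w M 31" "rd w M' 32 = rd w M 32"
  shows "safe w R M' x (Arr (22 + b) (Num 0) Ln)" "uval w R M' x (Arr (22 + b) (Num 0) Ln) = ones b x"
    "safe w R M' x (Arr (22 + b) (Num 0) node_st)" "uval w R M' x (Arr (22 + b) (Num 0) node_st) = ones b (nst (own x))"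
    "safe w R M' x (Arr (22 + b) (Num 0) node_en)" "uval w R M' x (Arr (22 + b) (Num 0) node_en) = ones b (nen (own x))"
    "ones b (nst (own x)) \<le> ones b x" "ones b (nst (own x)) \<le> ones b (nen (own x))"
    "local_rank b x < Q"
proof -
  note f = node_facts[OF x D(2-4) P M'(2-4)] and PD = param_regsD[OF P]
  have rk: "rd w M (22 + b) 0 y = ones b y" if "y < NN" for y using D(1) that b by (simp add: spec_pair)
  have xN: "x < NN" using x less_NN(1) by simp
  show le: "ones b (nst (own x)) \<le> ones b x" "ones b (nst (own x)) \<le> ones b (nen (own x))"
    using f by (intro cnt_mono; simp)+
  show "safe w R M' x (Arr (22 + b) (Num 0) Ln)" "uval w R M' x (Arr (22 + b) (Num 0) Ln) = ones b x"
    using rk[OF xN] ones_le(3)[OF xN, of b] b lane_Q(1,2)[OF xN] by (simp_all add: PD M'(1) small_Q)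
  show "safe w R M' x (Arr (22 + b) (Num 0) node_st)" "uval w R M' x (Arr (22 + b) (Num 0) node_st) = ones b (nst (own x))"
    "safe w R M' x (Arr (22 + b) (Num 0) node_en)" "uval w R M' x (Arr (22 + b) (Num 0) node_en) = ones b (nen (own x))"
    using f rk[OF f(10)] rk[OF f(9)] ones_le(3)[OF f(10), of b] ones_le(3)[OF f(9), of b] b
    by (simp_all add: PD M'(1) small_Q)
  have "ones b x \<le> x" by (rule cnt_le)
  then have "local_rank b x < NN" using xN unfolding local_rank_def by linarith
  then show "local_rank b x < Q" by (rule lane_Q)
qed

lemma sample_phase: "b < 2 \<Longrightarrow> phase {16 + b, 22 + b, 30, 31, 32} (sample_prog b) {44 + b}"
proof (rule phaseI)
  fix R M assume b: "b < 2" and P: "param_regs R"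
    and D: "\<And>a. a \<in> {16 + b, 22 + b, 30, 31, 32} \<Longrightarrow> spec a (rd w M a)"
  note PD = param_regsD[OF P]
  have bits: "rd w M (16 + b) 0 x = of_bool (lev_bit b x)" if "x < NN" for x
    using D[of "16 + b"] that b by (simp add: spec_pair)
  have "spec (22 + b) (rd w M (22 + b))" "spec 30 (rd w M 30)" "spec 31 (rd w M 31)" "spec 32 (rd w M 32)"
    using D by auto
  note D' = this
  let ?C = "\<lambda>x. ones b (nen (own x)) - ones b (nst (own x))"
  have quot: "y div G \<le> y" for y by simp
  show "wp (sample_prog b) R M (\<lambda>R' M'. param_regs R' \<and> (\<forall>a\<in>{44 + b}. spec a (rd w M' a)) \<and> same {44 + b} M M')"
    unfolding sample_prog_def
  proof (rule wp_Seq, rule wp_pd[OF P, where kk = N and Gd = "\<lambda>x. lev_bit b x \<and> local_rank b x mod G = 0"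
        and Xi = own and Yi = "\<lambda>x. local_rank b x div G" and V = "\<lambda>x. x"], goal_cases)
    case (1 M1)
    note W1 = this
    note s1 = writes_same[OF W1]
    have M1: "rd w M1 (22 + b) = rd w M (22 + b)" "rd w M1 30 = rd w M 30" "rd w M1 31 = rd w M 31"
      "rd w M1 32 = rd w M 32" using sameD[OF s1] b by auto
    show ?case
    proof (rule wp_pd[OF P, where kk = N and Gd = "\<lambda>_. True" and Xi = own
        and Yi = "\<lambda>x. (?C x + G - 1) div G" and V = "\<lambda>x. nen (own x)"], goal_cases)
      case (1 M2)
      note W2 = this
      have "rd w M2 (44 + b) (own x) k = sample b (own x) k" if x: "x < N" and k: "k \<le> (?C x + G - 1) div G" for x k
      proof (cases "k = (?C x + G - 1) div G")
        case True
        have "ones b (nst (own x)) \<le> ones b (nen (own x))" by (intro cnt_mono nen_bounds)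
        with last_group(1)[of "?C x"] True have "sample b (own x) k = nen (own x)"
          by (intro sample_end) (simp add: le_diff_conv2)
        then show ?thesis using writes_val[OF W2 x] True by simp
      next
        case False
        with k have k': "k < (?C x + G - 1) div G" by simp
        then have less: "ones b (nst (own x)) + k * G < ones b (nen (own x))" using last_group(2)[OF k'] by simp
        note z = sample_one[OF less]
        define z where "z = sample b (own x) k"
        have zN: "z < N" "own z = own x" using node_positions z(3,4) by (auto simp: z_def)
        then have "local_rank b z = k * G" using z(2) by (simp add: local_rank_def z_def)
        then have "rd w M1 (44 + b) (own z) k = z" using writes_val[OF W1 zN(1)] z(1) G_pos by (simp add: z_def)
        moreover have "rd w M2 (44 + b) (own x) k = rd w M1 (44 + b) (own x) k"
          by (rule writes_other[OF W2]) (use False in auto)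
        ultimately show ?thesis using zN by (simp add: z_def)
      qed
      then show ?case using P same_trans1[OF s1 writes_same[OF W2]] b by (simp add: spec_pair)
    next
      case (7 x)
      note f = node_facts[OF 7(1) D'(2-4) P M1(2-4)] and rf = rank_facts[OF b 7(1) D' P M1]
      have "(?C x + G - 1) div G \<le> ?C x + G" by (rule order_trans[OF quot]) simp
      also have "?C x + G \<le> 2 * BB"
        using ones_le(2)[of "nen (own x)" b] f(10) params_le_BB(10,11) by linarith
      also have "2 * BB < Q"
      proof -
        have "4 * BB \<le> BB * BB" using params_le_BB(18) by (rule mult_right_mono) simp
        then show ?thesis using BB_sq params_le_BB(18) by linarith
      qed
      finally have "(?C x + G - 1) div G < Q" .
      moreover have "Suc 0 \<le> ones b (nen (own x)) + G - ones b (nst (own x))" using rf(8) G_pos by linarith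
      ultimately show ?case
        by (simp add: f rf level_facts[OF 7(1)] G_pos PD small_Q del: no_arr_simps)
    next
      case (8 x y)
      then show ?case by simp
    qed (use N_X b in \<open>auto simp: PD\<close>)
  next
    case (6 x)
    note f = node_facts[OF 6(1) D'(2-4) P refl refl refl] and rf = rank_facts[OF b 6(1) D' P refl refl refl refl]
    have xN: "x < NN" using 6 less_NN(1) by simp
    have "safe w R M x (Arr (16 + b) (Num 0) Ln)" "uval w R M x (Arr (16 + b) (Num 0) Ln) = of_bool (lev_bit b x)"
      using bits[OF xN] lane_Q(1,2)[OF xN] b by (simp_all add: PD small_Q)
    then show ?case by (simp add: f rf G_pos PD small_Q local_rank_def del: no_arr_simps)
  next
    case (7 x)
    note f = node_facts[OF 7(1) D'(2-4) P refl refl refl] and rf = rank_facts[OF b 7(1) D' P refl refl refl refl]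
    have "local_rank b x div G < Q" using rf(9) quot[of "local_rank b x"] by linarith
    then show ?case by (simp add: f rf level_facts[OF 7(1)] PD small_Q local_rank_def del: no_arr_simps)
  next
    case (8 x y)
    then have "local_rank b x = local_rank b y" using div_mult_mod_eq[of "local_rank b x" G] div_mult_mod_eq[of "local_rank b y" G]
      by simp
    then have "ones b x = ones b y" using local_rank_less(1)[of x b] local_rank_less(1)[of y b] 8 by (simp add: local_rank_def)
    then show ?case using cnt_inj[of "lev_bit b" x y] 8 by simp
  qed (use N_X b in \<open>auto simp: PD\<close>)
qed

definition sparse_index :: "nat \<Rightarrow> nat \<Rightarrow> nat" where
  "sparse_index b x = (sample b (own x) (local_rank b x div G) - nst (own x)) div Z2 * G + local_rank b x mod G"

text \<open>Of two sparse groups of a node, the later starts at least \<open>Z2\<close> positions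
  after the earlier, hence in another block. Within a group the slot is the rank modulo
  \<open>G\<close>.\<close>

lemma sparse_index_inj:
  assumes x: "x < N" "lev_bit b x" "Z2 \<le> sample b (own x) (local_rank b x div G + 1) - sample b (own x) (local_rank b x div G)"
    and y: "y < N" "lev_bit b y" "Z2 \<le> sample b (own y) (local_rank b y div G + 1) - sample b (own y) (local_rank b y div G)"
    and eq: "own x = own y" "sparse_index b x = sparse_index b y"
  shows "x = y"
proof -
  let ?s = "sample b (own y)" and ?st = "nst (own y)"
  have *: "(?s k - ?st) div Z2 < (?s j - ?st) div Z2" if "k < j" "Z2 \<le> ?s (k + 1) - ?s k" for k j
  proof -
    have "?s (k + 1) \<le> ?s j" by (rule sample_mono) (use that in simp)
    moreover have "?st \<le> ?s k" by (rule sample_bounds)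
    ultimately have "?s k - ?st + Z2 \<le> ?s j - ?st" using that(2) Z_pos(2) by linarith
    then have "(?s k - ?st + Z2) div Z2 \<le> (?s j - ?st) div Z2" by (rule div_le_mono)
    then show ?thesis using Z_pos(2) by simp
  qed
  from eq have "(?s (local_rank b x div G) - ?st) div Z2 * G + local_rank b x mod G =
      (?s (local_rank b y div G) - ?st) div Z2 * G + local_rank b y mod G" by (simp add: sparse_index_def)
  from mult_add_eqD[OF this] G_pos have 1: "(?s (local_rank b x div G) - ?st) div Z2 = (?s (local_rank b y div G) - ?st) div Z2"
    "local_rank b x mod G = local_rank b y mod G" by auto
  from 1(1) *[of "local_rank b x div G" "local_rank b y div G"] *[of "local_rank b y div G" "local_rank b x div G"]
    x(3) y(3) eq(1) have "local_rank b x div G = local_rank b y div G" by (metis less_irrefl linorder_neqE_nat)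
  then have "local_rank b x = local_rank b y" using 1(2) by (metis div_mult_mod_eq)
  then have "ones b x = ones b y" using local_rank_less(1)[OF x(1,2)] local_rank_less(1)[OF y(1,2)] eq by (simp add: local_rank_def)
  then show ?thesis by (rule cnt_inj[OF x(2) y(2)])
qed

lemma sparse_phase: "b < 2 \<Longrightarrow> phase {16 + b, 22 + b, 30, 31, 32, 44 + b} (sparse_prog b) {46 + b}"
proof (rule phaseI)
  fix R M assume b: "b < 2" and P: "param_regs R"
    and D: "\<And>a. a \<in> {16 + b, 22 + b, 30, 31, 32, 44 + b} \<Longrightarrow> spec a (rd w M a)"
  note PD = param_regsD[OF P]
  have bits: "rd w M (16 + b) 0 x = of_bool (lev_bit b x)" if "x < NN" for x
    using D[of "16 + b"] that b by (simp add: spec_pair)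
  have "spec (22 + b) (rd w M (22 + b))" "spec 30 (rd w M 30)" "spec 31 (rd w M 31)" "spec 32 (rd w M 32)"
    using D by auto
  note D' = this
  let ?k = "\<lambda>x. local_rank b x div G"
  have smp: "rd w M (44 + b) (own x) k = sample b (own x) k" if "x < N" "lev_bit b x" "k \<le> ?k x + 1" for x k
  proof -
    have "?k x + 1 \<le> (ones b (nen (own x)) - ones b (nst (own x)) + G - 1) div G"
      by (rule group_index_le[OF local_rank_less(3)[OF that(1,2)]])
    then show ?thesis using D[of "44 + b"] that b by (simp add: spec_pair)
  qed
  have sQ: "sample b v k \<le> N" "sample b v k \<le> Q" for v k
    using sample_bounds(2)[of b v k] nen_bounds(2)[of v] params_le_Q(6) by linarith+
  have E: "safe w R M x (Arr (44 + b) node (rank_e b \<oslash> Rg 9)) \<and>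
      uval w R M x (Arr (44 + b) node (rank_e b \<oslash> Rg 9)) = sample b (own x) (?k x) \<and>
      safe w R M x (Arr (44 + b) node (rank_e b \<oslash> Rg 9 \<oplus> Num (Suc 0))) \<and>
      uval w R M x (Arr (44 + b) node (rank_e b \<oslash> Rg 9 \<oplus> Num (Suc 0))) = sample b (own x) (?k x + 1)"
    if x: "x < N" "lev_bit b x" for x
  proof -
    note f = node_facts[OF x(1) D'(2-4) P refl refl refl] and rf = rank_facts[OF b x(1) D' P refl refl refl refl]
    have "local_rank b x \<le> ones b x" by (simp add: local_rank_def)
    then have "local_rank b x < N" using cnt_le[of "lev_bit b" x] x(1) by linarith
    moreover have "?k x \<le> local_rank b x" by simp
    ultimately have "?k x + 1 < NN" using less_NN(1) by linarith
    then have "?k x + 1 < Q" "?k x < Q" using lane_Q(1)[of "?k x + 1"] by simp_all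
    moreover have "safe w R M x (rank_e b)" "uval w R M x (rank_e b) = local_rank b x"
      by (simp_all add: rf local_rank_def del: no_arr_simps)
    moreover have "safe w R M x (Arr a node e) \<and> uval w R M x (Arr a node e) = v"
      if "safe w R M x e" "uval w R M x e = k" "rd w M a (own x) k = v" "k < Q" "v \<le> Q" "a < 64" for a e k v
    proof -
      have "safe w R M x (Arr a node e) \<longleftrightarrow> safe w R M x node \<and> safe w R M x e \<and> a < 64 \<and> R 11 = Q \<and>
          uval w R M x node < Q \<and> uval w R M x e < Q \<and> rd w M a (uval w R M x node) (uval w R M x e) \<le> Q"
        "uval w R M x (Arr a node e) = rd w M a (uval w R M x node) (uval w R M x e)"
        by (rule safe.simps uval.simps)+
      then show ?thesis using that by (simp add: f(1,2) level_facts[OF x(1)] PD del: no_arr_simps)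
    qed
    ultimately show ?thesis
      using smp[OF x, of "?k x"] smp[OF x, of "?k x + 1"] sQ b by (simp add: PD small_Q del: no_arr_simps)
  qed
  show "wp (sparse_prog b) R M (\<lambda>R' M'. param_regs R' \<and> (\<forall>a\<in>{46 + b}. spec a (rd w M' a)) \<and> same {46 + b} M M')"
    unfolding sparse_prog_def
  proof (rule wp_pd[OF P, where kk = N and Xi = own and Yi = "sparse_index b" and V = "\<lambda>x. x - nst (own x)"
        and Gd = "\<lambda>x. lev_bit b x \<and> Z2 \<le> sample b (own x) (?k x + 1) - sample b (own x) (?k x)"], goal_cases)
    case (1 M1)
    have "rd w M1 (46 + b) (own x) (sparse_index b x) = x - nst (own x)" if "x < N" "lev_bit b x"
      "Z2 \<le> sample b (own x) (?k x + 1) - sample b (own x) (?k x)" for x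
      using writes_val[OF 1, of x] that by simp
    then show ?case using P writes_same[OF 1] b
      by (simp add: spec_pair Let_def sparse_index_def)
  next
    case (6 x)
    have xN: "x < NN" using 6 less_NN(1) by simp
    show ?case
    proof (cases "lev_bit b x")
      case True
      have "sample b (own x) (?k x) \<le> sample b (own x) (?k x + 1)" by (rule sample_mono) simp
      moreover have "safe w R M x (Arr (16 + b) (Num 0) Ln)" "uval w R M x (Arr (16 + b) (Num 0) Ln) = 1"
        using bits[OF xN] lane_Q(1,2)[OF xN] b True by (simp_all add: PD small_Q)
      ultimately show ?thesis
        using True by (simp add: E[OF 6 True, simplified] E[OF 6 True] PD small_Q less_Suc_eq_le del: no_arr_simps)
    next
      \<comment> \<open>For the other bit, the samples addressed by this lane need not have been
        written. \<open>Guard\<close> exempts them from being safe.\<close>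
      case False
      then show ?thesis using bits[OF xN] lane_Q(1,2)[OF xN] b by (simp add: PD small_Q)
    qed
  next
    case (7 x)
    note f = node_facts[OF 7(1) D'(2-4) P refl refl refl] and rf = rank_facts[OF b 7(1) D' P refl refl refl refl]
    note e = E[OF 7(1) conjunct1[OF 7(2)]]
    \<comment> \<open>The column is a product of two quantities, each known only to be at most
      \<open>BB\<close>, so \<open>BB_sq\<close> is needed to fit it into a row.\<close>
    have "sparse_index b x < BB * BB"
    proof -
      have "(sample b (own x) (?k x) - nst (own x)) div Z2 \<le> sample b (own x) (?k x) - nst (own x)" by simp
      then have "(sample b (own x) (?k x) - nst (own x)) div Z2 + 1 \<le> BB"
        using sQ(1)[of "own x" "?k x"] less_NN(1) params_le_BB(11) by linarith
      then have "((sample b (own x) (?k x) - nst (own x)) div Z2 + 1) * G \<le> BB * BB"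
        by (intro mult_mono params_le_BB) auto
      moreover have "local_rank b x mod G < G" using G_pos by simp
      ultimately show ?thesis unfolding sparse_index_def add_mult_distrib mult_1 by linarith
    qed
    then have "sparse_index b x < Q" using BB_sq by linarith
    then show ?case
      by (simp add: f rf e level_facts[OF 7(1)] G_pos sample_bounds(1) PD small_Q sparse_index_def local_rank_def del: no_arr_simps)
  next
    case (8 x y)
    then have "x = y" using sparse_index_inj[of x b y] by blast
    then show ?case by simp
  qed (use N_X b in \<open>auto simp: PD\<close>)
qed

section \<open>Lookup table and node records\<close>

lemma lane_TL:
  assumes "e < 2 ^ (U + h)"
  shows "e div 2 ^ h < 2 ^ U" "e < Q" "e \<le> Q" "e mod 2 ^ h < 2 ^ h" "e div 2 ^ h \<le> Q"
proof -
  show "e < Q" "e \<le> Q" using assms lane_Q(7,8) by auto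
  then show "e div 2 ^ h \<le> Q" by (meson div_le_dividend order_trans)
  show "e div 2 ^ h < 2 ^ U" using assms by (simp add: power_add less_mult_imp_div_less)
qed simp

lemma U_less: "U \<le> w" "U + h \<le> w"
  using U_le by (meson div_le_dividend le_trans le_add1)+

lemma sum_bool_less: "(\<Sum>t<T. of_bool (P t)) \<le> (T :: nat)"
  using sum_bounded_above[of "{..<T}" "\<lambda>t. of_bool (P t)" "1 :: nat"] by simp

lemma le_w_word: "T \<le> w \<Longrightarrow> T < 2 ^ w"
  using less_exp[of w] by linarith

lemma pop_phase: "phase {} pop_prog {33}"
proof (rule phaseI)
  fix R M assume P: "param_regs R"
  show "wp pop_prog R M (\<lambda>R' M'. param_regs R' \<and> (\<forall>a\<in>{33}. spec a (rd w M' a)) \<and> same {33} M M')"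
    unfolding pop_prog_def
  proof (rule wp_accum[OF P, where kk = "2 ^ (U + h)" and Xi = "\<lambda>_. 0" and Yi = "\<lambda>i. i" and T = U
        and V = "\<lambda>e p. e div 2 ^ h div 2 ^ p mod 2"], goal_cases)
    case (1 M')
    then show ?case using P by (simp add: spec_single pop_def)
  next
    case (3 R' M')
    then show ?case by (simp add: param_regsD[OF 3])
  next
    case (4 R' M')
    then show ?case by (simp add: param_regsD[OF 4])
  next
    case (7 i R' M')
    then show ?case using lane_TL[OF 7(1)] by (simp add: small_Q)
  next
    case (9 e p R' M')
    have "p \<le> Q ^ 4" using 9(2) U_less(1) by (intro le_Q4 order_trans[OF _ params_le_BB(3)]) simp
    then show ?case using 9 lane_TL[OF 9(1)] by (simp add: param_regsD[OF 9(4)] small_Q)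
  next
    case (10 e)
    have "(\<Sum>t<U. e div 2 ^ h div 2 ^ t mod 2) \<le> U" using pop_le[of "e div 2 ^ h" U] by (simp add: pop_def)
    also have "U < 2 ^ w" by (rule le_w_word[OF U_less(1)])
    finally show ?case .
  qed (use U_less X_ge(6)[of U] in auto)
qed

lemma sel_phase: "phase {33} sel_prog {34}"
proof (rule phaseI)
  fix R M assume P: "param_regs R" and D: "\<And>a. a \<in> {33} \<Longrightarrow> spec a (rd w M a)"
  have pp: "rd w M 33 0 e = pop (e div 2 ^ h) U" if "e < 2 ^ (U + h)" for e using D[of 33] that by (simp add: spec_single)
  show "wp sel_prog R M (\<lambda>R' M'. param_regs R' \<and> (\<forall>a\<in>{34}. spec a (rd w M' a)) \<and> same {34} M M')"
    unfolding sel_prog_def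
  proof (rule wp_accum[OF P, where kk = "2 ^ (U + h)" and Xi = "\<lambda>_. 0" and Yi = "\<lambda>i. i" and T = U
        and V = "\<lambda>e p. of_bool (pop (e div 2 ^ h mod 2 ^ Suc p) U + w \<le> e mod 2 ^ h)"], goal_cases)
    case (1 M')
    then show ?case using P unfolding sel_entry_def[symmetric] by (simp add: spec_single)
  next
    case (3 R' M')
    then show ?case by (simp add: param_regsD[OF 3])
  next
    case (4 R' M')
    then show ?case by (simp add: param_regsD[OF 4])
  next
    case (7 i R' M')
    then show ?case using lane_TL[OF 7(1)] by (simp add: small_Q)
  next
    case (9 e p R' M')
    have "p \<le> Q ^ 4" using 9(2) U_less(1) by (intro le_Q4 order_trans[OF _ params_le_BB(3)]) simp
    moreover have pQ: "2 ^ Suc p \<le> Q"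
    proof -
      have "(2::nat) ^ Suc p \<le> 2 ^ (U + h)" using 9(2) by (intro power_increasing) auto
      then show ?thesis using params_le_Q(16) by (rule order_trans)
    qed
    moreover define x where "x = e div 2 ^ h mod 2 ^ Suc p"
    moreover have xe: "x * 2 ^ h < 2 ^ (U + h)"
    proof -
      have "x \<le> e div 2 ^ h" unfolding x_def by (rule mod_less_eq_dividend)
      then have "x < 2 ^ U" using lane_TL(1)[OF 9(1)] by linarith
      then show ?thesis by (simp add: power_add)
    qed
    moreover have "rd w M' 33 0 (x * 2 ^ h) = pop x U"
      using pp[OF xe] sameD[OF 9(3), of 33] by simp
    moreover have "pop x U \<le> Q" using pop_le[of x U] U_less(1) params_le_Q(3) by linarith
    ultimately show ?case using 9 lane_TL[OF 9(1)] lane_TL(2)[OF xe]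
      by (simp add: param_regsD[OF 9(4)] small_Q x_def[symmetric] less_Suc_eq_le)
  next
    case (10 e)
    show ?case using sum_bool_less le_w_word[OF U_less(1)] by (rule le_less_trans)
  qed (use U_less X_ge(6)[of U] in auto)
qed

lemma field_phase: "phase {} field_prog {35}"
proof (rule phaseI)
  fix R M assume P: "param_regs R"
  show "wp field_prog R M (\<lambda>R' M'. param_regs R' \<and> (\<forall>a\<in>{35}. spec a (rd w M' a)) \<and> same {35} M M')"
    unfolding field_prog_def
  proof (rule wp_accum[OF P, where kk = "2 ^ (U + h)" and Xi = "\<lambda>_. 0" and Yi = "\<lambda>i. i" and T = q
        and V = "\<lambda>x e. of_bool (x div 2 ^ h div 2 ^ (e * h) mod 2 ^ h \<le> x mod 2 ^ h)"], goal_cases)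
    case (1 M')
    then show ?case using P unfolding field_entry_def[symmetric] by (simp add: spec_single)
  next
    case (3 R' M')
    then show ?case by (simp add: param_regsD[OF 3])
  next
    case (4 R' M')
    then show ?case by (simp add: param_regsD[OF 4])
  next
    case (7 i R' M')
    then show ?case using lane_TL[OF 7(1)] by (simp add: small_Q)
  next
    case (9 e p R' M')
    have "p \<le> Q ^ 4" using 9(2) q_le by (intro le_Q4 order_trans[OF _ params_le_BB(3)]) simp
    then show ?case using 9 lane_TL[OF 9(1)] by (simp add: param_regsD[OF 9(4)] small_Q less_Suc_eq_le)
  next
    case (10 e)
    show ?case using sum_bool_less le_w_word[OF q_le] by (rule le_less_trans)
  qed (use q_le X_ge(6)[of q] in auto)
qed

lemma length_rs_table: "length (rs_table n w) = 4 + 3 * 2 ^ (U + h)"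
  by (simp add: rs_table_def Let_def U_def q_def h_def)

lemma rs_table_nth: "rs_table n w ! 0 = h" "rs_table n w ! 1 = q" "rs_table n w ! 2 = 2 ^ w - 1" "rs_table n w ! 3 = 0"
  "i < 3 * 2 ^ (U + h) \<Longrightarrow> rs_table n w ! (4 + i) = table_entry h q w i"
  by (simp_all add: rs_table_def Let_def U_def q_def h_def nth_append)

lemma TL3_X: "3 * 2 ^ (U + h) + 1 \<le> X" and TL3_Q: "3 * 2 ^ (U + h) + 4 < Q"
proof -
  obtain B where B: "B = (2::nat) ^ (U + h)" by blast
  have "1 \<le> (2::nat) ^ (U + h)" by simp
  then have "1 \<le> B" unfolding B .
  then have "3 * B + 1 \<le> 4 * (B * (w + 1))" by (simp add: algebra_simps)
  then show "3 * 2 ^ (U + h) + 1 \<le> X" unfolding X_def B by simp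
  show "3 * 2 ^ (U + h) + 4 < Q" using TL_Q BB_less \<open>1 \<le> B\<close> unfolding B by linarith
qed

lemma table_phase: "phase {33, 34, 35} table_prog {3}"
proof (rule phaseI)
  fix R M assume P: "param_regs R" and D: "\<And>a. a \<in> {33, 34, 35} \<Longrightarrow> spec a (rd w M a)"
  note PD = param_regsD[OF P]
  show "wp table_prog R M (\<lambda>R' M'. param_regs R' \<and> (\<forall>a\<in>{3}. spec a (rd w M' a)) \<and> same {3} M M')"
    unfolding table_prog_def
  proof (rule wp_Seq, rule wp_pd[OF P, where kk = 4 and Gd = "\<lambda>_. True" and Xi = "\<lambda>_. 0"
        and Yi = "\<lambda>i. i" and V = "\<lambda>i. h * of_bool (i = 0) + q * of_bool (i = 1)"], goal_cases)
    case (1 M1)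
    note W1 = this
    note s1 = writes_same[OF W1]
    show ?case
    proof (rule wp_Seq, rule wp_pd[OF P, where kk = 1 and Gd = "\<lambda>_. True" and Xi = "\<lambda>_. 0"
        and Yi = "\<lambda>_. 2" and V = "\<lambda>_. 2 ^ w - 1"], goal_cases)
      case (1 M2)
      note W2 = this
      note s2 = same_trans1[OF s1 writes_same[OF W2]]
      have M2: "rd w M2 a = rd w M a" if "a \<in> {33, 34, 35}" for a using sameD[OF s2, of a] that by auto
      show ?case
      proof (rule wp_pd[OF P, where kk = "3 * 2 ^ (U + h)" and Gd = "\<lambda>_. True" and Xi = "\<lambda>_. 0"
          and Yi = "\<lambda>i. 4 + i" and V = "table_entry h q w"], goal_cases)
        case (1 M3)
        note W3 = this
        have "rd w M3 3 0 y = rs_table n w ! y" if "y < 4 + 3 * 2 ^ (U + h)" for y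
        proof (cases "y < 4")
          case True
          then have f1: "rd w M3 3 0 y = rd w M2 3 0 y" by (intro writes_other[OF W3]) auto
          have f2: "rd w M2 3 0 2 = 2 ^ w - 1" using writes_val[OF W2, of 0] by simp
          have f3: "rd w M2 3 0 y = rd w M1 3 0 y" if "y \<noteq> 2" by (rule writes_other[OF W2]) (use that in auto)
          have f4: "rd w M1 3 0 y = h * of_bool (y = 0) + q * of_bool (y = 1)" using writes_val[OF W1, of y] True by simp
          consider "y = 0" | "y = 1" | "y = 2" | "y = 3" using True by linarith
          then show ?thesis using f1 f2 f3 f4 rs_table_nth(1-4) by cases simp_all
        next
          case False
          then show ?thesis using writes_val[OF W3, of "y - 4"] rs_table_nth(5)[of "y - 4"] that by simp
        qed
        then show ?case using P same_trans1[OF s2 writes_same[OF W3]] by (simp add: spec_single length_rs_table)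
      next
        case (7 i)
        have e: "i div 3 < 2 ^ (U + h)" using 7 by (simp add: less_mult_imp_div_less)
        have v: "rd w M2 33 0 (i div 3) = pop (i div 3 div 2 ^ h) U"
          "rd w M2 34 0 (i div 3) = sel_entry w U (i div 3 div 2 ^ h) (i div 3 mod 2 ^ h)"
          "rd w M2 35 0 (i div 3) = field_entry h q (i div 3 div 2 ^ h) (i div 3 mod 2 ^ h)"
          using D[of 33] D[of 34] D[of 35] e by (simp_all add: M2 spec_single)
        have "rd w M2 33 0 (i div 3) \<le> w" "rd w M2 34 0 (i div 3) \<le> w" "rd w M2 35 0 (i div 3) \<le> w"
          unfolding v sel_entry_def field_entry_def using pop_le sum_bool_less U_less(1) q_le
          by (meson order_trans)+
        then have vQ: "rd w M2 33 0 (i div 3) \<le> Q" "rd w M2 34 0 (i div 3) \<le> Q" "rd w M2 35 0 (i div 3) \<le> Q"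
          using params_le_Q(3) by linarith+
        have "i < Q" "i \<le> Q" "4 + i < Q" "i div 3 < Q" using 7 TL3_Q lane_TL(2)[OF e] by simp_all
        moreover have "i mod 3 = 0 \<or> i mod 3 = 1 \<or> i mod 3 = 2" by linarith
        ultimately show ?case using vQ by (auto simp: PD small_Q table_entry_def Let_def v U_def[symmetric])
      qed (use TL3_X in \<open>auto simp: PD\<close>)
    qed (use X_ge in \<open>auto simp: PD small_Q\<close>)
  next
    case 5
    have "5 \<le> w" using w_large by simp
    then show ?case using X_ge(4) by linarith
  qed (auto simp: PD small_Q)
qed

lemma record_step:
  assumes P: "param_regs R" and a: "a < 64" "a \<notin> D" and D: "\<And>a. a \<in> D \<Longrightarrow> spec a (rd w M a)"
    and e: "\<And>v. v < 2 ^ L' \<Longrightarrow> safe w R M v e \<and> uval w R M v e = V v"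
    and s: "\<And>g. (\<And>v. v < 2 ^ L' \<Longrightarrow> g v 0 = V v) \<Longrightarrow> spec a g"
  shows "wp (record_prog a e) R M (\<lambda>R' M'. param_regs R' \<and> (\<forall>a\<in>{a}. spec a (rd w M' a)) \<and> same {a} M M')"
  unfolding record_prog_def
proof (rule wp_pd[OF P, where kk = "2 ^ L'" and Gd = "\<lambda>_. True" and Xi = "\<lambda>i. i"
        and Yi = "\<lambda>_. 0" and V = V], goal_cases)
  case (1 M1)
  then show ?case using P writes_val[OF 1] writes_same[OF 1] s by simp
next
  case (7 v)
  then show ?case using e lane_Q(5,6)[of v] by (simp add: small_Q)
qed (use a X_ge(2) in \<open>auto simp: param_regsD[OF P]\<close>)

lemma records_phases:
  "phase {} (record_prog 48 (Num 2 \<otimes> (Rg 11 \<otimes> Rg 11))) {48}"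
  "phase {31} (record_prog 49 (Arr 31 (Num 0) Ln)) {49}"
  "phase {31, 32} (record_prog 50 node_len) {50}"
  "phase {} (record_prog 51 (Num 16 \<otimes> (Rg 11 \<otimes> Rg 11) \<oplus> Num 64 \<otimes> (Ln \<otimes> Rg 11))) {51}"
  "phase {31, 32} (record_prog 52 (Num 64 \<otimes> (node_len \<oslash> Rg 13 \<oplus> node_len \<oslash> Rg 9 \<oplus> node_len \<oslash> Rg 8 \<otimes> Rg 9 \<oplus> Num 3))) {52}"
  "phase {} (record_prog 53 (Num 16 \<otimes> (Rg 11 \<otimes> Rg 11) \<oplus> Num 48 \<oplus> Num 64 \<otimes> (Num 2 \<otimes> Ln \<otimes> Rg 11))) {53}"
  "phase {} (record_prog 54 (Num 16 \<otimes> (Rg 11 \<otimes> Rg 11) \<oplus> Num 48 \<oplus> Num 64 \<otimes> ((Num 2 \<otimes> Ln \<oplus> Num (Suc 0)) \<otimes> Rg 11))) {54}"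
proof -
  have len: "safe w R M v node_len \<and> uval w R M v node_len = nen v - nst v"
    "safe w R M v (Arr 31 (Num 0) Ln)" "uval w R M v (Arr 31 (Num 0) Ln) = nst v"
    if "param_regs R" "\<And>a. a \<in> {31, 32} \<Longrightarrow> spec a (rd w M a)" "v < 2 ^ L'" for R M v
  proof -
    have "rd w M 31 0 v = nst v" "rd w M 32 0 v = nen v" using that(2)[of 31] that(2)[of 32] that(3) by (simp_all add: spec_single)
    moreover have "nst v \<le> Q" "nen v \<le> Q" using nst_le[of v] nen_bounds[of v] params_le_Q(6) by linarith+
    ultimately show "safe w R M v node_len \<and> uval w R M v node_len = nen v - nst v"
      "safe w R M v (Arr 31 (Num 0) Ln)" "uval w R M v (Arr 31 (Num 0) Ln) = nst v"
      using lane_Q(5,6)[OF that(3)] nen_bounds[of v] by (simp_all add: param_regsD[OF that(1)] small_Q)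
  qed
  show "phase {} (record_prog 48 (Num 2 \<otimes> (Rg 11 \<otimes> Rg 11))) {48}"
    by (rule phaseI, rule record_step[where V = "\<lambda>_. loc w 2 0 0" and D = "{}"])
      (auto simp: param_regsD loc_def spec_single)
  show "phase {} (record_prog 51 (Num 16 \<otimes> (Rg 11 \<otimes> Rg 11) \<oplus> Num 64 \<otimes> (Ln \<otimes> Rg 11))) {51}"
    by (rule phaseI, rule record_step[where V = "\<lambda>v. loc w 16 v 0 - 16" and D = "{}"])
      (auto simp: param_regsD loc_def spec_single lane_Q)
  show "phase {} (record_prog 53 (Num 16 \<otimes> (Rg 11 \<otimes> Rg 11) \<oplus> Num 48 \<oplus> Num 64 \<otimes> (Num 2 \<otimes> Ln \<otimes> Rg 11))) {53}"
    by (rule phaseI, rule record_step[where V = "\<lambda>v. loc w 48 (2 * v) 0" and D = "{}"])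
      (auto simp: param_regsD loc_def spec_single lane_Q)
  show "phase {} (record_prog 54 (Num 16 \<otimes> (Rg 11 \<otimes> Rg 11) \<oplus> Num 48 \<oplus> Num 64 \<otimes> ((Num 2 \<otimes> Ln \<oplus> Num (Suc 0)) \<otimes> Rg 11))) {54}"
    by (rule phaseI, rule record_step[where V = "\<lambda>v. loc w 48 (2 * v + 1) 0" and D = "{}"])
      (auto simp: param_regsD loc_def spec_single lane_Q)
  show "phase {31} (record_prog 49 (Arr 31 (Num 0) Ln)) {49}"
  proof (rule phaseI, rule record_step[where V = nst and D = "{31}"], goal_cases)
    case (5 R M v)
    have "rd w M 31 0 v = nst v" using 5(2)[of 31] 5(3) by (simp add: spec_single)
    moreover have "nst v \<le> Q" using nst_le[of v] params_le_Q(6) by linarith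
    ultimately show ?case using lane_Q(5,6)[OF 5(3)] by (simp add: param_regsD[OF 5(1)] small_Q)
  qed (auto simp: spec_single)
  show "phase {31, 32} (record_prog 50 node_len) {50}"
  proof (rule phaseI, rule record_step[where V = "\<lambda>v. nen v - nst v" and D = "{31, 32}"], goal_cases)
    case (5 R M v)
    then show ?case using len(1) by blast
  qed (auto simp: spec_single)
  show "phase {31, 32} (record_prog 52 (Num 64 \<otimes> (node_len \<oslash> Rg 13 \<oplus> node_len \<oslash> Rg 9 \<oplus> node_len \<oslash> Rg 8 \<otimes> Rg 9 \<oplus> Num 3))) {52}"
  proof (rule phaseI, rule record_step[where V = "\<lambda>v. 64 * struct_len (nen v - nst v)" and D = "{31, 32}"], goal_cases)
    case (5 R M v)
    have l: "safe w R M v node_len" "uval w R M v node_len = nen v - nst v" using len(1)[OF 5] by simp_all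
    have e: "safe w R M v (x \<oslash> y) \<longleftrightarrow> safe w R M v x \<and> safe w R M v y"
      "uval w R M v (x \<oslash> y) = uval w R M v x div uval w R M v y" for x y by simp_all
    have "safe w R M v (node_len \<oslash> Rg k) \<and> uval w R M v (node_len \<oslash> Rg k) = (nen v - nst v) div R k" if "R k \<le> Q ^ 4" for k
      unfolding e using l that by simp
    then have "safe w R M v (node_len \<oslash> Rg 13)" "uval w R M v (node_len \<oslash> Rg 13) = (nen v - nst v) div Z1"
      "safe w R M v (node_len \<oslash> Rg 9)" "uval w R M v (node_len \<oslash> Rg 9) = (nen v - nst v) div G"
      "safe w R M v (node_len \<oslash> Rg 8)" "uval w R M v (node_len \<oslash> Rg 8) = (nen v - nst v) div Z2"
      by (simp_all add: param_regsD[OF 5(1)] del: safe.simps uval.simps)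
    then show ?case by (simp add: struct_len_def param_regsD[OF 5(1)] del: safe.simps(12,15) uval.simps(12,15))
  qed (auto simp: spec_single)
qed

end

section \<open>The construction program\<close>

text \<open>All candidates are tested in parallel, which keeps the depth constant; by
  \<open>symbol_bits_unique\<close> only the right one passes.\<close>

definition log_prog :: "nat \<Rightarrow> uexp \<Rightarrow> com" where
  "log_prog x z = Seq
     (pd (Rg 2 \<oslash> Num 64) 55 (Num 0) (Num 0)
        (Lt z (Shiftl (Num 1) Ln \<oplus> Num 1) \<otimes> Lt (Shiftl (Num 1) Ln) (Num 2 \<otimes> z)) Ln)
     (asg x (Arr 55 (Num 0) (Num 0)))"

definition param_prog :: com where
  "param_prog =
     Seq (asg 11 (Shiftl (Num 1) (Rg 2 \<oslash> Num 64)))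
    (Seq (log_prog 3 (Rg 1))
    (Seq (asg 16 (Equal (Rg 3) (Num 0)))
    (Seq (asg 4 (Rg 3 \<oplus> Rg 16))
    (Seq (asg 5 (Rg 0 \<otimes> Rg 4))
    (Seq (log_prog 6 (Num 4 \<otimes> (Rg 2 \<otimes> Rg 2 \<otimes> Rg 2) \<oplus> Num 1))
    (Seq (log_prog 20 (Rg 0))
    (Seq (asg 7 (Rg 20 \<oslash> (Num 4 \<otimes> Rg 6) \<oplus> Num 1))
    (Seq (asg 13 (Rg 7 \<otimes> Rg 2))
    (Seq (asg 8 (Rg 7 \<otimes> Rg 13))
    (Seq (asg 9 (Rg 2 \<otimes> Rg 6))
    (Seq (asg 10 ((Rg 5 \<oslash> Rg 8 \<oplus> Num 3) \<otimes> Rg 8))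
    (Seq (asg 17 (Rg 10 \<oslash> Rg 2))
    (Seq (asg 14 (Rg 7 \<otimes> Rg 6))
    (Seq (asg 15 (Shiftl (Num 1) (Rg 6)))
    (Seq (asg 18 (Shiftl (Num 1) (Rg 14 \<oplus> Rg 6)))
         (asg 19 (Shiftl (Num 1) (Rg 4))))))))))))))))))"

text \<open>Level 0 is the copy of \<open>S\<close>, so lane \<open>l\<close> sorts for level l + 1.
  All calls read the same input at address 0.\<close>

definition sort_prog :: com where
  "sort_prog = Sortdo (cp (Rg 4 \<ominus> Num 1)) (Const 0) (adr 1 (cp (Ln \<oplus> Num 1)) (cp (Num 0))) (cp (Rg 0))
     (cp (Rg 1)) (cp (Ln \<oplus> Num 1))"

definition level_prog :: com where
  "level_prog = Seq (Seq (Seq (Seq own_prog (bit_prog 0)) (bit_prog 1)) st_prog) en_prog"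

definition rank_prog :: "nat \<Rightarrow> com" where
  "rank_prog b = Seq (Seq (Seq (Seq (word_cnt_prog b) (prefix_prog b)) (cnt_prog b))
     (cell_prog 24 b 13 2)) (cell_prog 28 b 8 13)"

definition struct_prog :: "nat \<Rightarrow> com" where
  "struct_prog b = Seq (Seq (Seq (Seq (Seq (base_prog b)
     (window_prog (38 + b) 13 (\<lambda>d. Arr (24 + b) (Num 0) (Ln \<oslash> Rg 13 \<oplus> Num d))))
     (window_prog (40 + b) 8 (\<lambda>d. Arr (22 + b) (Num 0) ((Ln \<oslash> Rg 8 \<oplus> Num d) \<otimes> Rg 8))))
     (window_prog (42 + b) 8 (\<lambda>d. Arr (28 + b) (Num 0) (Ln \<oslash> Rg 8 \<oplus> Num d))))
     (sample_prog b)) (sparse_prog b)"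

definition tables_prog :: com where
  "tables_prog = Seq (Seq (Seq pop_prog sel_prog) field_prog) table_prog"

definition main_prog :: com where
  "main_prog = Seq (Seq (Seq (Seq (Seq (Seq (Seq level_prog (rank_prog 0)) (rank_prog 1)) bitmap_prog)
     (struct_prog 0)) (struct_prog 1)) tables_prog) records_prog"

definition build_prog :: com where
  "build_prog = Seq param_prog (Seq (pd (Rg 0) 1 (Num 0) Ln (Num 1) (Arr 0 (Num 0) Ln)) (Seq sort_prog (Seq main_prog
     (Seq (Assign 0 (adr 48 (cp (Num 1)) (cp (Num 0)))) (Assign 1 (adr 3 (cp (Num 0)) (cp (Num 0))))))))"

context wavelet_input
begin

section \<open>Composition of the construction\<close>

lemma runs_Assign: "runs (Assign x e) R M (R(x := eval w (R, M) 0 e)) M"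
  unfolding runs_def
proof (intro exI conjI, rule exec.Assign)
  have "csz (Assign x e) * 1 \<le> csz (Assign x e) * X" using X_ge(4) by (intro mult_left_mono) auto
  then show "cost e + 1 \<le> csz (Assign x e) * X" by simp
qed simp

lemma wp_asg:
  assumes "safe w R M 0 e" "uval w R M 0 e = v" "Post (R(x := v)) M"
  shows "wp (asg x e) R M Post"
proof -
  have "runs (asg x e) R M (R(x := v)) M"
    using runs_Assign[of x "cp e" R M] cp_eval[OF w_large assms(1)] assms(2) by (simp add: asg_def)
  then show ?thesis using assms(3) unfolding wp_def by blast
qed

text \<open>The program runs while the parameters are still being computed, so only registers 2 and
  11 may be assumed and \<open>pd_exec\<close> is applied directly.\<close>

lemma wp_log:
  assumes R: "R 11 = Q" "R 2 = w"
    and z: "\<And>i. safe w R M i z" "\<And>i. uval w R M i z = zv" "1 \<le> zv" "2 ^ symbol_bits zv \<le> BB" "lvl z \<le> 50"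
    and post: "\<And>M'. same {55} M M' \<Longrightarrow> Post (R(x := symbol_bits zv)) M'"
  shows "wp (log_prog x z) R M Post"
proof -
  let ?t = "symbol_bits zv" and ?T = "w div 64"
  let ?g = "Lt z (Shiftl (Num 1) Ln \<oplus> Num 1) \<otimes> Lt (Shiftl (Num 1) Ln) (Num 2 \<otimes> z)"
  let ?c = "pd (Rg 2 \<oslash> Num 64) 55 (Num 0) (Num 0) ?g Ln"
  have tT: "?t < ?T"
  proof -
    have "(2::nat) ^ ?t < 2 ^ ?T" using z(4) BB_less unfolding rowlen_def[symmetric] by linarith
    then show ?thesis by (simp only: power_strict_increasing_iff)
  qed
  have pow: "2 ^ i \<le> Q" if "i < ?T" for i
    unfolding rowlen_def using that by (intro power_increasing) auto
  have iQ: "i \<le> Q" if "i < ?T" for i using that params_le_Q(3) by (meson div_le_dividend le_trans less_imp_le)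
  have G: "(zv \<le> 2 ^ i \<and> 2 ^ i < 2 * zv) = (i = ?t)" for i
    using symbol_bits_unique[OF z(3)] symbol_bits_bounds[OF z(3)] by blast
  have "\<exists>M' wk dp. exec w r ?c (R, M) (R, M') wk dp \<and>
    wk \<le> csz ?c * (?T + 1) \<and> dp \<le> csz ?c \<and>
    (\<forall>i<?T. i = ?t \<longrightarrow> rd w M' 55 0 0 = i) \<and>
    (\<forall>x y. (\<forall>i<?T. i = ?t \<longrightarrow> \<not> (0 = x \<and> 0 = y)) \<longrightarrow> rd w M' 55 x y = rd w M 55 x y) \<and>
    (\<forall>a'<64. a' \<noteq> 55 \<longrightarrow> rd w M' a' = rd w M a')"
  proof (rule pd_exec[where R = R and w = w, OF w_large R(1)], goal_cases)
    case (4 i)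
    have "uval w R M i ?g \<noteq> 0 \<longleftrightarrow> zv \<le> 2 ^ i \<and> 2 ^ i < 2 * zv" by (simp add: z(2) less_Suc_eq_le)
    moreover have "safe w R M i ?g" using pow[OF 4] iQ[OF 4] z(1,5) by simp
    ultimately show ?case using G by simp
  qed (use R iQ in auto)
  then obtain M' wk dp where e: "exec w r ?c (R, M) (R, M') wk dp"
    "wk \<le> csz ?c * (?T + 1)" "dp \<le> csz ?c" and v: "rd w M' 55 0 0 = ?t"
    and s: "same {55} M M'" using tT unfolding same_def singleton_iff by blast
  have "?T + 1 \<le> X" using X_ge(4) by (meson add_le_mono1 div_le_dividend le_trans)
  then have "csz ?c * (?T + 1) \<le> csz ?c * X" by (rule mult_left_mono) simp
  moreover have "csz ?c * 1 \<le> csz ?c * (w + 1)" by (rule mult_left_mono) simp_all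
  ultimately have "runs ?c R M R M'" unfolding runs_def using e by (intro exI[of _ wk] exI[of _ dp]) linarith
  moreover have "wp (asg x (Arr 55 (Num 0) (Num 0))) R M' Post"
    by (rule wp_asg[where v = ?t]) (use v R iQ[OF tT] post[OF s] in simp_all)
  ultimately show ?thesis unfolding log_prog_def by (intro wp_Seq) (auto simp: wp_def)
qed

text \<open>Only array 55, the scratch space for logarithms, is changed, so the input
  survives.\<close>

lemma param_wp:
  assumes R: "R 0 = n" "R 1 = \<sigma>" "R 2 = w" and post: "\<And>R' M'. param_regs R' \<Longrightarrow> same {55} M M' \<Longrightarrow> Post R' M'"
  shows "wp param_prog R M Post"
proof -
  have w3: "4 * (w * w * w) + 1 = 4 * w ^ 3 + 1" by (simp add: power3_eq_cube)
  have u: "2 ^ symbol_bits n \<le> BB" "symbol_bits n \<le> Q ^ 4"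
  proof -
    show "2 ^ symbol_bits n \<le> BB" using symbol_bits_bounds(2)[of n] n_pos by (intro le_BB[of _ 2 0]) auto
    show "symbol_bits n \<le> Q ^ 4" using n_w(2) params_le_Q4(3) by linarith
  qed
  have s0: "\<sigma> \<le> Q ^ 4" "n \<le> Q ^ 4" "w \<le> Q ^ 4" by simp_all
  have s1: "same {55} M1 M3" if "same {55} M1 M2" "same {55} M2 M3" for M1 M2 M3
    using same_trans1[OF that] .
  have [simp]: "\<sigma> \<noteq> 0" "n \<noteq> 0" using sigma by auto
  have Lb: "2 ^ symbol_bits \<sigma> \<le> BB"
  proof -
    have "(2::nat) ^ L \<le> 2 ^ L'" using L_le_L' by (intro power_increasing) auto
    then show ?thesis unfolding L_def[symmetric] using params_le_BB(17) by (rule order_trans)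
  qed
  have hb: "2 ^ symbol_bits (4 * (w * w * w) + 1) \<le> BB" using pow_h_BB by (simp only: w3 h_def)
  have pos: "Suc 0 \<le> \<sigma>" "Suc 0 \<le> n" using sigma by simp_all
  have LL: "L + of_bool (L = 0) = L'" "n * L' = N" "symbol_bits n div (4 * h) + 1 = q" "q * w = Z1" "q * Z1 = Z2" "w * h = G"
    "(N div Z2 + 3) * Z2 = NN" "NN div w = NW" "q * h = U"
    by (simp_all add: L'_def N_def q_def Z1_def Z2_def G_def NN_def NW_def U_def)
  have ob: "of_bool (L = 0) \<le> Q ^ 4" using small_Q(1)[of 1] rowlen_le_Q4 by (cases "L = 0") (auto intro: order_trans)
  have h4: "symbol_bits (Suc (4 * (w * w * w))) = h" "symbol_bits (4 * (w * w * w) + 1) = h"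
    using w3 by (simp_all add: h_def)
  show ?thesis unfolding param_prog_def
    apply (rule wp_Seq, rule wp_asg[where v = Q], (use R in \<open>simp add: rowlen_def[symmetric]; fail\<close>),
        (use R in \<open>simp add: rowlen_def; fail\<close>))
    apply (rule wp_Seq, rule wp_log[where zv = \<sigma>], (use R Lb pos in \<open>simp; fail\<close>)+)
    apply (rule wp_Seq, rule wp_asg[where v = "of_bool (L = 0)"], (simp add: L_def[symmetric]; fail)+)
    apply (rule wp_Seq, rule wp_asg[where v = L'], (use LL(1) ob in \<open>simp add: L_def[symmetric]; fail\<close>)+)
    apply (rule wp_Seq, rule wp_asg[where v = N], (use R in \<open>simp add: LL; fail\<close>)+)
    apply (rule wp_Seq, rule wp_log[where zv = "4 * (w * w * w) + 1"], (use R hb in \<open>simp; fail\<close>)+)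
    apply (rule wp_Seq, rule wp_log[where zv = n], (use R u pos in \<open>simp; fail\<close>)+)
    apply (rule wp_Seq, rule wp_asg[where v = q], (use R u LL h4 in \<open>simp; fail\<close>)+)
    apply (rule wp_Seq, rule wp_asg[where v = Z1], (use R LL h4 in \<open>simp; fail\<close>)+)
    apply (rule wp_Seq, rule wp_asg[where v = Z2], (use R LL h4 in \<open>simp; fail\<close>)+)
    apply (rule wp_Seq, rule wp_asg[where v = G], (use R LL h4 in \<open>simp; fail\<close>)+)
    apply (rule wp_Seq, rule wp_asg[where v = NN], (use R LL h4 in \<open>simp; fail\<close>)+)
    apply (rule wp_Seq, rule wp_asg[where v = NW], (use R LL h4 in \<open>simp; fail\<close>)+)
    apply (rule wp_Seq, rule wp_asg[where v = U], (use R LL h4 in \<open>simp; fail\<close>)+)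
    apply (rule wp_Seq, rule wp_asg[where v = "2 ^ h"], (use R h4 in \<open>simp; fail\<close>)+)
    apply (rule wp_Seq, rule wp_asg[where v = "2 ^ (U + h)"], (use R h4 in \<open>simp; fail\<close>)+)
    apply (rule wp_asg[where v = "2 ^ L'"], (use R in \<open>simp; fail\<close>)+)
    apply (rule post)
     apply (use R h4 in \<open>simp add: param_regs_def L_def[symmetric]; fail\<close>)
    apply (blast intro: s1)
    done
qed

text \<open>The calls form a single parallel step, so the depth of sorting enters once and its work
  at most \<open>L'\<close> times. The overhead stays within the general budget.\<close>

lemma sort_exec:
  assumes P: "param_regs R" and S0: "spec 0 (rd w M 0)" and row0: "\<And>i. i < n \<Longrightarrow> rd w M 1 0 i = S ! i"
  shows "\<exists>M' wk dp. exec w r sort_prog (R, M) (R, M') wk dp \<and>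
    wk \<le> csz sort_prog * X + L' * sort_work r n \<and> dp \<le> csz sort_prog * (w + 1) + sort_depth r n \<and>
    spec 1 (rd w M' 1) \<and> same {1} M M'"
proof -
  note PD = param_regsD[OF P]
  let ?k = "L' - 1"
  have ek: "eval w (R, M) 0 (cp (Rg 4 \<ominus> Num 1)) = ?k"
    using cp_eval[OF w_large, of R M 0 "Rg 4 \<ominus> Num 1"] L'_pos by (simp add: PD)
  have kw: "?k < w" using L'_le L'_pos by linarith
  have iQ: "i + 1 < Q" if "i < ?k" for i using that kw params_less_Q(3) by linarith
  have e1: "eval w (R, M) i (cp (Ln \<oplus> Num 1)) = i + 1" if "i < ?k" for i
    using cp_eval[OF w_large, of R M i "Ln \<oplus> Num 1"] iQ[OF that] by (simp del: cp.simps)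
  have eto: "eval w (R, M) i (adr 1 (cp (Ln \<oplus> Num 1)) (cp (Num 0))) = loc w 1 (i + 1) 0" if "i < ?k" for i
    by (rule eval_adr[OF w_large]) (use PD e1[OF that] iQ[OF that] in \<open>simp_all del: cp.simps\<close>, simp)
  have en: "eval w (R, M) i (cp (Rg 0)) = n" "eval w (R, M) i (cp (Rg 1)) = \<sigma>" "eval w (R, M) i (Const 0) = 0" for i
    by (simp_all add: PD)
  have seg: "segment M 0 n = S"
  proof (rule nth_equalityI)
    show "length (segment M 0 n) = length S" by (simp add: segment_def length_S)
    fix i assume "i < length (segment M 0 n)"
    then have i: "i < n" by (simp add: segment_def)
    then have "rd w M 0 0 i = S ! i" using S0 by (simp add: spec_single)
    moreover have "i < Q" using i params_less_Q(1) by linarith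
    ultimately have "rd w M 0 0 i = S ! i" "i < Q" by simp_all
    then show "segment M 0 n ! i = S ! i" using i by (simp add: segment_def rd_def loc_def)
  qed
  have nQ: "n < Q" by simp
  have nw: "n \<le> 2 ^ w" using nQ rowlen_le_Q4 Q_le_word(2) by linarith
  have to: "loc w 1 x 0 = (Q + x) * Q" "loc w 1 x j = loc w 1 x 0 + j" for x j by (simp_all add: loc_def)
  have to_lt: "loc w 1 (i + 1) 0 + n \<le> 2 ^ w" if "i < ?k" for i
  proof -
    have "loc w 1 (i + 1) 0 < Q ^ 3" by (rule loc_less[OF w_large]) (use iQ[OF that] in auto)
    moreover have "2 * Q ^ 3 \<le> Q * Q ^ 3" using small_Q(1)[of 2] by (intro mult_right_mono) auto
    moreover have "Q * Q ^ 3 = Q ^ 4" by (simp add: power_Suc[symmetric] del: power_Suc)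
    moreover have "Q \<le> Q ^ 3" using power_increasing[of 1 3 Q] by (simp add: Suc_le_eq)
    ultimately show ?thesis using nQ Q_le_word(2) by linarith
  qed
  define wr where "wr = {(loc w 1 (i + 1) 0 + j, srt (i + 1) ! j) | i j. i < ?k \<and> j < n}"
  have ysr: "sorted_by r \<sigma> (i + 1) S = srt (i + 1)" for i by (simp add: srt_def)
  have ex: "exec w r sort_prog (R, M) (R, store wr M)
      (cost (cp (Rg 4 \<ominus> Num 1)) + 1 + (\<Sum>i<?k. (csz sort_prog - cost (cp (Rg 4 \<ominus> Num 1)) - 1) + sort_work r (eval w (R, M) i (cp (Rg 0)))))
      (cost (cp (Rg 4 \<ominus> Num 1)) + 1 + (csz sort_prog - cost (cp (Rg 4 \<ominus> Num 1)) - 1) +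
        Max (insert 0 ((\<lambda>i. sort_depth r (eval w (R, M) i (cp (Rg 0)))) ` {..<?k})))"
    unfolding sort_prog_def
  proof (rule exec.Sortdo[OF _ refl refl refl refl refl], goal_cases)
    case 1
    then show ?case by (simp only: ek)
  next
    case 2
    show ?case
    proof (intro allI impI)
      fix i assume i: "i < ?k"
      then have "i + 1 < L" by (cases "L = 0") (auto simp: L'_def)
      then show "valid_sort_input (eval w (R, M) i (cp (Rg 1))) (eval w (R, M) i (cp (Ln \<oplus> Num 1)))
         (segment M (eval w (R, M) i (Const 0)) (eval w (R, M) i (cp (Rg 0))))"
        unfolding e1[OF i] en seg using sigma length_S set_S by (simp add: valid_sort_input_def L_def)
    qed
  next
    case 3
    show ?case
      using to_lt nw by (intro allI impI) (simp only: eto en, simp)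
  next
    case 4
    \<comment> \<open>The output rows start at multiples of \<open>Q\<close> that are at least Q *
      Q, whereas the input ends before \<open>n\<close>, which is below \<open>Q\<close>.\<close>
    have "n \<le> (Q + x) * Q" for x
    proof -
      have "1 * Q \<le> (Q + x) * Q" by (rule mult_right_mono) (use rowlen_pos[of w] in linarith, simp)
      then show ?thesis using nQ by linarith
    qed
    then have "n \<le> loc w 1 x 0" for x by (simp only: to(1))
    moreover have "disjnt {m..<m + n} {0..<0 + n}" if "n \<le> m" for m using that by (auto simp: disjnt_iff)
    ultimately have "disjnt {loc w 1 x 0..<loc w 1 x 0 + n} {0..<0 + n}" for x by blast
    then show ?case by (intro allI impI) (simp only: eto en)
  next
    case 5
    have "disjnt {loc w 1 (i + 1) 0..<loc w 1 (i + 1) 0 + n} {loc w 1 (j + 1) 0..<loc w 1 (j + 1) 0 + n}"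
      if "i < ?k" "j < ?k" "i \<noteq> j" for i j
    proof -
      have "p div Q = X" if "X * Q \<le> p" "p < X * Q + n" for p X
      proof (rule div_nat_eqI)
        have "p < X * Q + Q" using that(2) nQ by linarith
        then show "p < Q * Suc X" by (simp add: algebra_simps)
      qed (use that(1) in \<open>simp add: algebra_simps\<close>)
      then have d: "disjnt {X * Q..<X * Q + n} {Y * Q..<Y * Q + n}" if "X \<noteq> Y" for X Y
        using that unfolding disjnt_iff atLeastLessThan_iff by metis
      show ?thesis unfolding to(1) by (rule d) (use that(3) in simp)
    qed
    then show ?case by (intro allI impI) (simp only: eto en)
  next
    case 6
    show ?case unfolding wr_def
      by (rule Collect_cong) (metis (no_types, lifting) e1 eto en seg ysr)
  next
    case 7
    then show ?case by simp
  qed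
  have single: "single_valued wr"
  proof (rule single_valuedI)
    fix p u u' assume "(p, u) \<in> wr" "(p, u') \<in> wr"
    then obtain i j i' j' where *: "p = loc w 1 (i + 1) 0 + j" "u = srt (i + 1) ! j" "i < ?k" "j < n"
      "p = loc w 1 (i' + 1) 0 + j'" "u' = srt (i' + 1) ! j'" "i' < ?k" "j' < n" unfolding wr_def by blast
    then have "loc w 1 (i + 1) 0 + j = loc w 1 (i' + 1) 0 + j'" by metis
    then have "(Q + (i + 1)) * Q + j = (Q + (i' + 1)) * Q + j'" unfolding to(1) .
    from mult_add_eqD[OF this] * nQ show "u = u'" by simp
  qed
  have val: "rd w (store wr M) 1 l i = srt l ! i" if "l < L'" "i < n" for l i
  proof (cases l)
    case 0
    have "loc w 1 0 i \<notin> Domain wr"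
    proof
      assume "loc w 1 0 i \<in> Domain wr"
      then obtain i' j' where *: "loc w 1 0 i = loc w 1 (i' + 1) 0 + j'" "j' < n" unfolding wr_def by blast
      from *(1) have "(Q + 0) * Q + i = (Q + (i' + 1)) * Q + j'" unfolding to(2)[of 0 i] unfolding to(1) .
      from mult_add_eqD[OF this] * nQ that show False by simp
    qed
    then have "rd w (store wr M) 1 0 i = rd w M 1 0 i" by (simp add: rd_def store_def)
    then show ?thesis using row0[OF that(2)] 0 by (simp add: srt_def)
  next
    case (Suc l')
    have "(loc w 1 (l' + 1) 0 + i, srt (l' + 1) ! i) \<in> wr"
    proof -
      have "l' < ?k" using that Suc by linarith
      then show ?thesis unfolding wr_def using that(2) by blast
    qed
    then have m: "(loc w 1 l i, srt l ! i) \<in> wr" using to(2)[of l i] Suc by simp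
    then have "(THE v. (loc w 1 l i, v) \<in> wr) = srt l ! i" using single unfolding single_valued_def by blast
    moreover have "l < Q" "i < Q" using that params_less_Q(5) nQ by linarith+
    ultimately show ?thesis using m by (auto simp: rd_def store_def)
  qed
  have sm: "same {1} M (store wr M)"
    unfolding same_def
  proof (intro allI impI ext)
    fix a x y :: nat assume a: "a < 64" "a \<notin> {1}"
    show "rd w (store wr M) a x y = rd w M a x y"
    proof (cases "x < Q \<and> y < Q")
      case True
      have "loc w a x y \<notin> Domain wr"
      proof
        assume "loc w a x y \<in> Domain wr"
        then obtain i j where *: "loc w a x y = loc w 1 (i + 1) 0 + j" "i < ?k" "j < n"
          unfolding wr_def by blast
        then have "loc w a x y = loc w 1 (i + 1) j" unfolding to(2)[of "i + 1" j] by simp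
        moreover have "j < Q" "i + 1 < Q" using * nQ iQ[of i] by linarith+
        ultimately show False using True a loc_eq_iff[of x w y a "i + 1" j 1] by auto
      qed
      then show ?thesis by (simp add: rd_def store_def)
    qed (auto simp: rd_def)
  qed
  have depth: "Max (insert 0 ((\<lambda>i. sort_depth r (eval w (R, M) i (cp (Rg 0)))) ` {..<?k})) \<le> sort_depth r n"
    by (intro Max.boundedI) (auto simp: PD)
  define c where "c = csz sort_prog - cost (cp (Rg 4 \<ominus> Num 1)) - 1"
  have c: "cost (cp (Rg 4 \<ominus> Num 1)) + 1 + c = csz sort_prog" by (simp add: c_def sort_prog_def)
  have "cost (cp (Rg 4 \<ominus> Num 1)) + 1 + (\<Sum>i<?k. c + sort_work r (eval w (R, M) i (cp (Rg 0)))) \<le>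
      csz sort_prog * X + L' * sort_work r n"
  proof -
    have "(\<Sum>i<?k. c + sort_work r (eval w (R, M) i (cp (Rg 0)))) = ?k * c + ?k * sort_work r n"
      by (simp add: PD add_mult_distrib2)
    moreover have "?k * sort_work r n \<le> L' * sort_work r n" by (rule mult_right_mono) simp_all
    moreover have "cost (cp (Rg 4 \<ominus> Num 1)) + 1 + ?k * c \<le> (cost (cp (Rg 4 \<ominus> Num 1)) + 1 + c) * (?k + 1)"
    proof -
      have "e + k * d \<le> (e + d) * (k + 1)" for e k d :: nat by (simp add: algebra_simps)
      then show ?thesis .
    qed
    moreover have "csz sort_prog * (?k + 1) \<le> csz sort_prog * X"
      using kw X_ge(4) by (intro mult_left_mono) auto
    ultimately show ?thesis unfolding c by linarith
  qed
  moreover have "csz sort_prog * 1 \<le> csz sort_prog * (w + 1)" by (rule mult_left_mono) simp_all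
  then have "cost (cp (Rg 4 \<ominus> Num 1)) + 1 + c + Max (insert 0 ((\<lambda>i. sort_depth r (eval w (R, M) i (cp (Rg 0)))) ` {..<?k}))
      \<le> csz sort_prog * (w + 1) + sort_depth r n" using depth unfolding c by linarith
  moreover have "spec 1 (rd w (store wr M) 1)" using val by (simp add: spec_single)
  ultimately show ?thesis using ex sm unfolding c_def by blast
qed

lemma phase_cong: "phase D c A \<Longrightarrow> A = A' \<Longrightarrow> phase D c A'" by simp

lemma level_phase: "phase {1} level_prog {16, 17, 30, 31, 32}"
proof -
  note 1 = phase_Seq[OF own_phase bit_phase[of 0]]
  note 2 = phase_Seq[OF 1 bit_phase[of 1]]
  note 3 = phase_Seq[OF 2 st_phase]
  note 4 = phase_Seq[OF 3 en_phase]
  show ?thesis unfolding level_prog_def by (rule phase_cong, rule 4) auto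
qed

lemma rank_phase: "b < 2 \<Longrightarrow> phase {16 + b} (rank_prog b) {18 + b, 20 + b, 22 + b, 24 + b, 28 + b}"
proof -
  assume b: "b < 2"
  note 1 = phase_Seq[OF word_cnt_phase[OF b] prefix_phase[OF b]]
  note 2 = phase_Seq[OF 1 cnt_phase[OF b]]
  note 3 = phase_Seq[OF 2 small_cell_phase[OF b]]
  note 4 = phase_Seq[OF 3 large_cell_phase[OF b]]
  show ?thesis unfolding rank_prog_def by (rule phase_cong, rule 4) (use b in auto)
qed

lemma struct_phase: "b < 2 \<Longrightarrow> phase {16 + b, 22 + b, 24 + b, 28 + b, 30, 31, 32} (struct_prog b)
  {36 + b, 38 + b, 40 + b, 42 + b, 44 + b, 46 + b}"
proof -
  assume b: "b < 2"
  let ?D = "{16 + b, 22 + b, 24 + b, 28 + b, 30, 31, 32}"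
  \<comment> \<open>\<open>phase_Seq\<close> takes the inputs of a composition from its first part;
    hence the first phase must list those of all later ones.\<close>
  have 0: "phase ?D (base_prog b) {36 + b}"
    using base_phase[OF b] unfolding phase_def by simp
  note 1 = phase_Seq[OF 0 small_window_phase[OF b]]
  note 2 = phase_Seq[OF 1 count_window_phase[OF b]]
  note 3 = phase_Seq[OF 2 large_window_phase[OF b]]
  note 4 = phase_Seq[OF 3 sample_phase[OF b]]
  note 5 = phase_Seq[OF 4 sparse_phase[OF b]]
  show ?thesis unfolding struct_prog_def by (rule phase_cong, rule 5) (use b in auto)
qed

lemma tables_phase: "phase {} tables_prog {3, 33, 34, 35}"
proof -
  note 1 = phase_Seq[OF pop_phase sel_phase]
  note 2 = phase_Seq[OF 1 field_phase]
  note 3 = phase_Seq[OF 2 table_phase]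
  show ?thesis unfolding tables_prog_def by (rule phase_cong, rule 3) auto
qed

lemma records_phase: "phase {31, 32} records_prog {48, 49, 50, 51, 52, 53, 54}"
proof -
  have w: "phase {31, 32} c A" if "phase D c A" "D \<subseteq> {31, 32}" for D c A
    using that unfolding phase_def by (meson subset_iff)
  note 6 = phase_Seq[OF w[OF records_phases(6)] w[OF records_phases(7)]]
  note 5 = phase_Seq[OF w[OF records_phases(5)] 6]
  note 4 = phase_Seq[OF w[OF records_phases(4)] 5]
  note 3 = phase_Seq[OF w[OF records_phases(3)] 4]
  note 2 = phase_Seq[OF w[OF records_phases(2)] 3]
  note 1 = phase_Seq[OF w[OF records_phases(1)] 2]
  show ?thesis unfolding records_prog_def by (rule phase_cong, rule 1) auto
qed

definition built :: "nat set" where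
  "built = {2, 3, 48, 49, 50, 51, 52, 53, 54, 36, 37, 38, 39, 40, 41, 42, 43, 44, 45, 46, 47}"

lemma main_phase: "\<exists>A. built \<subseteq> A \<and> phase {1} main_prog A"
proof -
  have r: "phase {16} (rank_prog 0) {18, 20, 22, 24, 28}" "phase {17} (rank_prog 1) {19, 21, 23, 25, 29}"
    using rank_phase[of 0] rank_phase[of 1] by (simp_all del: One_nat_def)
  have t: "phase {16, 22, 24, 28, 30, 31, 32} (struct_prog 0) {36, 38, 40, 42, 44, 46}"
    "phase {17, 23, 25, 29, 30, 31, 32} (struct_prog 1) {37, 39, 41, 43, 45, 47}"
    using struct_phase[of 0] struct_phase[of 1] by (simp_all del: One_nat_def)
  note 1 = phase_Seq[OF level_phase r(1)]
  note 2 = phase_Seq[OF 1 r(2)]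
  note 3 = phase_Seq[OF 2 bitmap_phase]
  note 4 = phase_Seq[OF 3 t(1)]
  note 5 = phase_Seq[OF 4 t(2)]
  note 6 = phase_Seq[OF 5 tables_phase]
  note 7 = phase_Seq[OF 6 records_phase]
  show ?thesis unfolding main_prog_def
    by (rule exI, rule conjI[rotated], rule 7) (auto simp: built_def)
qed

lemma build_exec:
  assumes "initial_state w \<sigma> S s"
  shows "\<exists>R M wk dp. exec w r build_prog s (R, M) wk dp \<and>
    wk \<le> csz build_prog * X + L' * sort_work r n \<and> dp \<le> csz build_prog * (w + 1) + sort_depth r n \<and>
    R 0 = loc w 48 1 0 \<and> R 1 = loc w 3 0 0 \<and> (\<forall>a\<in>built. spec a (rd w M a))"
proof -
  obtain R0 M0 where s: "s = (R0, M0)" by (cases s)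
  have R0: "R0 0 = n" "R0 1 = \<sigma>" "R0 2 = w" "segment M0 0 n = S"
    using assms length_S by (simp_all add: initial_state_def s)
  have in0: "rd w M0 0 0 i = S ! i" if "i < n" for i
  proof -
    have "segment M0 0 n ! i = M0 i" using that by (simp add: segment_def)
    moreover have "i < Q" using that params_less_Q(1) by linarith
    ultimately show ?thesis using R0(4) by (simp add: rd_def loc_def)
  qed
  have "wp param_prog R0 M0 (\<lambda>R M. param_regs R \<and> same {55} M0 M)"
    by (rule param_wp) (use R0 in auto)
  then obtain R1 M1 where 1: "runs param_prog R0 M0 R1 M1" "param_regs R1" "same {55} M0 M1"
    unfolding wp_def by blast
  have in1: "rd w M1 0 0 i = S ! i" if "i < n" for i using sameD[OF 1(3), of 0] in0[OF that] by simp
  let ?copy = "pd (Rg 0) 1 (Num 0) Ln (Num 1) (Arr 0 (Num 0) Ln)"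
  have "wp ?copy R1 M1 (\<lambda>R M. R = R1 \<and> writes M1 1 n (\<lambda>_. True) (\<lambda>_. 0) (\<lambda>i. i) (\<lambda>i. S ! i) M)"
  proof (rule wp_pd[OF 1(2), where kk = n and Gd = "\<lambda>_. True" and Xi = "\<lambda>_. 0" and Yi = "\<lambda>i. i"
        and V = "\<lambda>i. S ! i"], goal_cases)
    case (7 i)
    have "i < Q" using 7 params_less_Q(1) by linarith
    moreover have "S ! i \<in> set S" using 7 length_S by simp
    then have "S ! i < n" using set_S sigma by auto
    then have "S ! i \<le> Q" using params_less_Q(1) by linarith
    ultimately show ?case using in1[of i] 7 by (simp add: param_regsD[OF 1(2)] small_Q)
  qed (use X_ge(1) less_NN in \<open>auto simp: param_regsD[OF 1(2)]\<close>)
  then obtain M2 where 2: "runs ?copy R1 M1 R1 M2" "writes M1 1 n (\<lambda>_. True) (\<lambda>_. 0) (\<lambda>i. i) (\<lambda>i. S ! i) M2"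
    unfolding wp_def by blast
  have "rd w M2 0 0 i = S ! i" if "i < n" for i
    using sameD[OF writes_same[OF 2(2)], of 0] in1[OF that] by simp
  then have "spec 0 (rd w M2 0)" by (simp add: spec_single)
  from sort_exec[OF 1(2) this] writes_val[OF 2(2)] obtain M3 wk3 dp3 where
    3: "exec w r sort_prog (R1, M2) (R1, M3) wk3 dp3" "wk3 \<le> csz sort_prog * X + L' * sort_work r n"
    "dp3 \<le> csz sort_prog * (w + 1) + sort_depth r n" "spec 1 (rd w M3 1)" by auto
  from main_phase obtain A where A: "built \<subseteq> A" "phase {1} main_prog A" by blast
  then have "wp main_prog R1 M3 (\<lambda>R' M'. param_regs R' \<and> (\<forall>a\<in>A. spec a (rd w M' a)) \<and> same A M3 M')"
    using 1(2) 3(4) unfolding phase_def by simp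
  then obtain R4 M4 where 4: "runs main_prog R1 M3 R4 M4" "param_regs R4" "\<forall>a\<in>A. spec a (rd w M4 a)"
    unfolding wp_def by blast
  let ?c0 = "Assign 0 (adr 48 (cp (Num 1)) (cp (Num 0)))" and ?c1 = "Assign 1 (adr 3 (cp (Num 0)) (cp (Num 0)))"
  have "Suc 0 < Q" using small_Q(2)[of 1] by simp
  then have a0: "eval w (R4, M4) 0 (adr 48 (cp (Num 1)) (cp (Num 0))) = loc w 48 1 0"
    using w_large by (intro eval_adr[where R = R4 and w = w, OF w_large param_regsD(13)[OF 4(2)]]) auto
  have a1: "eval w (R4(0 := loc w 48 1 0), M4) 0 (adr 3 (cp (Num 0)) (cp (Num 0))) = loc w 3 0 0"
    using param_regsD(13)[OF 4(2)] by (intro eval_adr[OF w_large]) auto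
  have e0: "runs ?c0 R4 M4 (R4(0 := loc w 48 1 0)) M4"
    using runs_Assign[of 0 "adr 48 (cp (Num 1)) (cp (Num 0))" R4 M4] unfolding a0 .
  have e1: "runs ?c1 (R4(0 := loc w 48 1 0)) M4 (R4(0 := loc w 48 1 0, 1 := loc w 3 0 0)) M4"
    using runs_Assign[of 1 "adr 3 (cp (Num 0)) (cp (Num 0))" "R4(0 := loc w 48 1 0)" M4] unfolding a1 .
  let ?rest = "Seq main_prog (Seq ?c0 ?c1)"
  from runs_Seq[OF 4(1) runs_Seq[OF e0 e1]] obtain wk5 dp5 where
    5: "exec w r ?rest (R1, M3) (R4(0 := loc w 48 1 0, 1 := loc w 3 0 0), M4) wk5 dp5"
      "wk5 \<le> csz ?rest * X" "dp5 \<le> csz ?rest * (w + 1)" unfolding runs_def by blast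
  from 1(1) obtain wk1 dp1 where 6: "exec w r param_prog (R0, M0) (R1, M1) wk1 dp1"
    "wk1 \<le> csz param_prog * X" "dp1 \<le> csz param_prog * (w + 1)" unfolding runs_def by blast
  from 2(1) obtain wk2 dp2 where 7: "exec w r ?copy (R1, M1) (R1, M2) wk2 dp2"
    "wk2 \<le> csz ?copy * X" "dp2 \<le> csz ?copy * (w + 1)" unfolding runs_def by blast
  have "exec w r build_prog s (R4(0 := loc w 48 1 0, 1 := loc w 3 0 0), M4)
      (wk1 + (wk2 + (wk3 + wk5))) (dp1 + (dp2 + (dp3 + dp5)))"
    unfolding build_prog_def s
    by (rule exec.Seq[OF 6(1) exec.Seq[OF 7(1) exec.Seq[OF 3(1) 5(1)]]])
  moreover have csz: "csz build_prog = csz param_prog + (csz ?copy + (csz sort_prog + csz ?rest))"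
    unfolding build_prog_def by (simp only: csz.simps)
  have "wk1 + (wk2 + (wk3 + wk5)) \<le> csz build_prog * X + L' * sort_work r n"
    unfolding csz add_mult_distrib using 3(2) 5(2) 6(2) 7(2) by linarith
  moreover have "dp1 + (dp2 + (dp3 + dp5)) \<le> csz build_prog * (w + 1) + sort_depth r n"
    unfolding csz add_mult_distrib using 3(3) 5(3) 6(3) 7(3) by linarith
  ultimately show ?thesis using 4(3) A(1)
    by (intro exI[of _ "R4(0 := loc w 48 1 0, 1 := loc w 3 0 0)"] exI[of _ M4] exI[of _ "wk1 + (wk2 + (wk3 + wk5))"]
        exI[of _ "dp1 + (dp2 + (dp3 + dp5))"]) auto
qed

end

section \<open>The query programs\<close>

text \<open>The pointer stored in a node is the address of array 16 in its row minus 16, so that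
  array numbers are offsets. Register 4, the queried bit, selects the member of a pair.\<close>

abbreviation struct_e :: "nat \<Rightarrow> uexp \<Rightarrow> uexp" where
  "struct_e a e \<equiv> Mem (Mem (Rg 0 \<oplus> Num 3) \<oplus> (Num a \<oplus> Rg 4) \<oplus> Num 64 \<otimes> e)"
abbreviation table_e :: "nat \<Rightarrow> uexp \<Rightarrow> uexp \<Rightarrow> uexp" where
  "table_e c x j \<equiv> Mem (Rg 1 \<oplus> Num (4 + c) \<oplus> Num 3 \<otimes> (x \<otimes> Shiftl (Num 1) (Rg 6) \<oplus> j))"
abbreviation field_e :: "uexp \<Rightarrow> uexp \<Rightarrow> uexp" where
  "field_e x e \<equiv> Shiftr x (e \<otimes> Rg 6) \<odot> Shiftl (Num 1) (Rg 6)"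
abbreviation chunk_e :: uexp where
  "chunk_e \<equiv> RgW 15 \<odot> Shiftl (Num 1) (Rg 10)"
abbreviation word_e :: "uexp \<Rightarrow> uexp" where
  "word_e k \<equiv> XorW (MemW (Mem (Rg 0) \<oplus> k)) (MemW (Rg 1 \<oplus> Num 2 \<oplus> Rg 4))"

definition setup_prog :: com where
  "setup_prog = Seq (asg 6 (Mem (Rg 1))) (Seq (asg 7 (Mem (Rg 1 \<oplus> Num 1))) (Seq (asg 8 (Rg 7 \<otimes> Rg 3))
     (Seq (asg 9 (Rg 7 \<otimes> Rg 8)) (Seq (asg 10 (Rg 7 \<otimes> Rg 6)) (asg 13 (Mem (Rg 0 \<oplus> Num 1)))))))"

text \<open>
  Register 17 accumulates the number of ones in the word in register 15 and, if \<open>s\<close> holds, register 18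
  the number of positions \<open>p\<close> such that at most (register 16) ones are among the first \<open>p + 1\<close> bits.
\<close>

primrec scan_prog :: "bool \<Rightarrow> nat \<Rightarrow> com" where
  "scan_prog s 0 = Seq (asg 17 (Num 0)) (asg 18 (Num 0))"
| "scan_prog s (Suc k) = Seq (scan_prog s k)
     (Seq (asg 18 (if s then Rg 18 \<oplus> table_e 1 chunk_e (Rg 16 \<oplus> Rg 3 \<ominus> Rg 17) else Num 0))
     (Seq (asg 17 (Rg 17 \<oplus> table_e 0 chunk_e (Num 0)))
          (asg 15 (Shiftr (RgW 15) (Rg 10)))))"

text \<open>The argument 0 is treated separately because an empty bitmap has no cells stored for it.
  In the other case the count before the node is subtracted last, as all stored counts are
  global.\<close>

definition rankq :: "nat \<Rightarrow> com" where
  "rankq K = Cond (cp (Rg 5))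
     (Seq setup_prog
     (Seq (asg 14 (Rg 13 \<oplus> Rg 5))
     (Seq (asg 15 (word_e (Rg 14 \<oslash> Rg 3) \<odot> ShiftlW (Num 1) (Rg 14 \<odot> Rg 3)))
     (Seq (asg 16 (Num 0))
     (Seq (scan_prog False K)
     (Seq (asg 19 (Rg 14 \<oslash> Rg 9 \<ominus> Rg 13 \<oslash> Rg 9))
     (Seq (asg 20 (struct_e 40 (Rg 19)))
     (Seq (asg 20 (Rg 20 \<oplus> field_e (struct_e 42 (Rg 19)) (Rg 14 \<oslash> Rg 8 \<odot> Rg 7)))
     (Seq (asg 19 (Rg 14 \<oslash> Rg 8 \<ominus> Rg 13 \<oslash> Rg 8))
     (Seq (asg 20 (Rg 20 \<oplus> field_e (struct_e 38 (Rg 19)) (Rg 14 \<oslash> Rg 3 \<odot> Rg 7)))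
          (asg 0 (Rg 20 \<oplus> Rg 17 \<ominus> struct_e 36 (Num 0)))))))))))))
     (asg 0 (Num 0))"

text \<open>Register 26 holds the current large cell, small cell and word in turn, 27 the rank
  relative to its start, 28 the packed counts and 29 the index of a field. The table returns the
  number of fields not exceeding the rank, hence the decrements.\<close>

definition dense_prog :: "nat \<Rightarrow> com" where
  "dense_prog K =
     Seq (asg 26 (Rg 24 \<oslash> Rg 9))
    (Seq (asg 26 (Rg 26 \<oplus> Lt (struct_e 40 (Rg 26 \<oplus> Num 1 \<ominus> Rg 13 \<oslash> Rg 9)) (Rg 21 \<oplus> Num 1)))
    (Seq (asg 27 (Rg 21 \<ominus> struct_e 40 (Rg 26 \<ominus> Rg 13 \<oslash> Rg 9)))
    (Seq (asg 28 (struct_e 42 (Rg 26 \<ominus> Rg 13 \<oslash> Rg 9)))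
    (Seq (asg 29 (table_e 2 (Rg 28) (Rg 27) \<ominus> Num 1))
    (Seq (asg 27 (Rg 27 \<ominus> field_e (Rg 28) (Rg 29)))
    (Seq (asg 26 (Rg 26 \<otimes> Rg 7 \<oplus> Rg 29))
    (Seq (asg 28 (struct_e 38 (Rg 26 \<ominus> Rg 13 \<oslash> Rg 8)))
    (Seq (asg 29 (table_e 2 (Rg 28) (Rg 27) \<ominus> Num 1))
    (Seq (asg 16 (Rg 27 \<ominus> field_e (Rg 28) (Rg 29)))
    (Seq (asg 26 (Rg 26 \<otimes> Rg 7 \<oplus> Rg 29))
    (Seq (asg 15 (word_e (Rg 26)))
    (Seq (scan_prog True K)
         (asg 0 (Rg 26 \<otimes> Rg 3 \<oplus> Rg 18 \<ominus> Rg 13))))))))))))))"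

definition selectq :: "nat \<Rightarrow> com" where
  "selectq K =
     Seq setup_prog
    (Seq (asg 21 (Rg 5 \<oplus> struct_e 36 (Num 0)))
    (Seq (asg 22 (Rg 3 \<otimes> Rg 6))
    (Seq (asg 23 (Rg 5 \<oslash> Rg 22))
    (Seq (asg 24 (struct_e 44 (Rg 23)))
    (Seq (asg 25 (struct_e 44 (Rg 23 \<oplus> Num 1)))
         (Cond (cp (Lt (Rg 9) (Rg 25 \<ominus> Rg 24 \<oplus> Num 1)))
            (asg 0 (struct_e 46 ((Rg 24 \<ominus> Rg 13) \<oslash> Rg 9 \<otimes> Rg 22 \<oplus> Rg 5 \<odot> Rg 22)))
            (dense_prog K)))))))"

text \<open>The work bound is a constant because the query programs depend on \<open>K\<close>
  only.\<close>

definition qwp :: "nat \<Rightarrow> sort_routine \<Rightarrow> com \<Rightarrow> (nat \<Rightarrow> nat) \<Rightarrow> (nat \<Rightarrow> nat) \<Rightarrow> ((nat \<Rightarrow> nat) \<Rightarrow> bool) \<Rightarrow> bool" where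
  "qwp w r c R M Post \<longleftrightarrow> (\<exists>R' wk dp. exec w r c (R, M) (R', M) wk dp \<and> wk \<le> csz c \<and> Post R')"

lemma qwp_Seq: "qwp w r c1 R M (\<lambda>R1. qwp w r c2 R1 M Post) \<Longrightarrow> qwp w r (Seq c1 c2) R M Post"
  unfolding qwp_def by (elim exE conjE, intro exI conjI, erule (1) exec.Seq) simp_all

lemma qwp_mono: "qwp w r c R M P \<Longrightarrow> (\<And>R'. P R' \<Longrightarrow> P' R') \<Longrightarrow> qwp w r c R M P'"
  unfolding qwp_def by blast

lemma qwp_asg:
  assumes "2 ^ 16 \<le> w" "safe w R M 0 e" "uval w R M 0 e = v" "Post (R(x := v))"
  shows "qwp w r (asg x e) R M Post"
proof -
  have "exec w r (asg x e) (R, M) (R(x := v), M) (cost (cp e) + 1) (cost (cp e) + 1)"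
    using exec.Assign[of w r x "cp e" R M] cp_eval[OF assms(1,2)] assms(3) by (simp add: asg_def)
  moreover have "csz (asg x e) = cost (cp e) + 1" by (simp add: asg_def)
  ultimately show ?thesis unfolding qwp_def using assms(4) by (intro exI[of _ "R(x := v)"]) auto
qed

lemma qwp_Cond1:
  assumes "2 ^ 16 \<le> w" "safe w R M 0 e" "uval w R M 0 e \<noteq> 0" "qwp w r c1 R M Post"
  shows "qwp w r (Cond (cp e) c1 c2) R M Post"
proof -
  from assms(4) obtain R' wk dp where *: "exec w r c1 (R, M) (R', M) wk dp" "wk \<le> csz c1" "Post R'"
    unfolding qwp_def by blast
  have "eval w (R, M) 0 (cp e) \<noteq> 0" using cp_eval[OF assms(1,2)] assms(3) by simp
  from exec.CondTrue[OF this *(1)] *(2,3) show ?thesis unfolding qwp_def by fastforce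
qed

lemma qwp_Cond0:
  assumes "2 ^ 16 \<le> w" "safe w R M 0 e" "uval w R M 0 e = 0" "qwp w r c2 R M Post"
  shows "qwp w r (Cond (cp e) c1 c2) R M Post"
proof -
  from assms(4) obtain R' wk dp where *: "exec w r c2 (R, M) (R', M) wk dp" "wk \<le> csz c2" "Post R'"
    unfolding qwp_def by blast
  have "eval w (R, M) 0 (cp e) = 0" using cp_eval[OF assms(1,2)] assms(3) by simp
  from exec.CondFalse[OF this *(1)] *(2,3) show ?thesis unfolding qwp_def by fastforce
qed

text \<open>What a query may rely on: facts about words within its reach, so that \<open>M\<close>
  can be any memory agreeing with the constructed one there. \<open>K\<close> chunks of
  \<open>U\<close> bits cover a word.\<close>

locale node_query = wavelet_input +
  fixes M :: "nat \<Rightarrow> nat" and t p v b K :: nat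
  assumes b: "b < 2" and K: "w \<le> K * U" and node_ne: "nst v < nen v" and v_less: "v < 2 ^ L'"
    and pt: "p \<le> Q ^ 3" "t \<le> Q ^ 3"
    and M_word: "M a < 2 ^ w"
    and M_rec: "M p = loc w 2 0 0" "M (p + 1) = nst v" "M (p + 3) = loc w 16 v 0 - 16"
    and M_table: "y < length (rs_table n w) \<Longrightarrow> M (t + y) = rs_table n w ! y"
    and M_bits: "nst v \<le> x \<Longrightarrow> x < nen v \<Longrightarrow> M (loc w 2 0 0 + x div w) = bit_word (x div w)"
    and M_base: "M (loc w 16 v 0 - 16 + (36 + b)) = ones b (nst v)"
    and M_small: "nst v div Z1 \<le> c \<Longrightarrow> c \<le> Suc ((nen v - 1) div Z1) \<Longrightarrow>
      M (loc w 16 v 0 - 16 + (38 + b) + 64 * (c - nst v div Z1)) = cell_pack (lev_bit b) h q w c"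
    and M_count: "nst v div Z2 \<le> c \<Longrightarrow> c \<le> Suc ((nen v - 1) div Z2) \<Longrightarrow>
      M (loc w 16 v 0 - 16 + (40 + b) + 64 * (c - nst v div Z2)) = ones b (c * Z2)"
    and M_large: "nst v div Z2 \<le> c \<Longrightarrow> c \<le> Suc ((nen v - 1) div Z2) \<Longrightarrow>
      M (loc w 16 v 0 - 16 + (42 + b) + 64 * (c - nst v div Z2)) = cell_pack (lev_bit b) h q Z1 c"
    and M_sample: "k \<le> (ones b (nen v) - ones b (nst v) + G - 1) div G \<Longrightarrow>
      M (loc w 16 v 0 - 16 + (44 + b) + 64 * k) = sample b v k"
    and M_sparse: "nst v \<le> x \<Longrightarrow> x < nen v \<Longrightarrow> lev_bit b x \<Longrightarrow>
      Z2 \<le> sample b v (local_rank b x div G + 1) - sample b v (local_rank b x div G) \<Longrightarrow>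
      M (loc w 16 v 0 - 16 + (46 + b) + 64 * ((sample b v (local_rank b x div G) - nst v) div Z2 * G + local_rank b x mod G)) = x - nst v"
begin

section \<open>Correctness of queries on one node\<close>

definition sb where "sb = loc w 16 v 0 - 16"

lemma Q34: "Q ^ 3 \<le> Q ^ 4"
  by (rule power_increasing) (simp_all add: Suc_le_eq)

lemma pointers [simp]: "p \<le> Q ^ 4" "t \<le> Q ^ 4" "sb \<le> Q ^ 4" "loc w 2 0 0 \<le> Q ^ 4" "b \<le> Q ^ 4"
proof -
  show "p \<le> Q ^ 4" "t \<le> Q ^ 4" using pt Q34 by linarith+
  have "loc w 16 v 0 < Q ^ 3" "loc w 2 0 0 < Q ^ 3"
    using lane_Q(5)[OF v_less] by (intro loc_less[OF w_large]; simp)+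
  then show "sb \<le> Q ^ 4" "loc w 2 0 0 \<le> Q ^ 4" unfolding sb_def using Q34 by linarith+
  show "b \<le> Q ^ 4" using b params_le_BB(18) by (intro le_Q4) simp
qed

lemma BB_Q4: "x \<le> NN \<Longrightarrow> x \<le> Q ^ 4" "x \<le> w \<Longrightarrow> x \<le> Q ^ 4"
  using params_le_BB(3,11) by (intro le_Q4; linarith)+

lemma node_le: "nst v \<le> NN" "nen v \<le> NN" "nst v \<le> N" "nen v \<le> N" "nen v < NN"
  using nst_le[of v] nen_bounds[of v] less_NN(1) by linarith+

lemma ones_Q4: "x \<le> NN \<Longrightarrow> ones b x \<le> Q ^ 4"
  using ones_le(2)[of x b] BB_Q4(1) by simp

lemma TL4: "4 \<le> length (rs_table n w)" by (simp add: length_rs_table)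

lemma M_header: "M t = h" "M (t + 1) = q" "M (Suc t) = q" "M (t + 2) = 2 ^ w - 1" "M (t + 3) = 0"
  "M (Suc (Suc (Suc t))) = 0"
proof -
  have "rs_table n w \<noteq> []" using TL4 by auto
  then show "M t = h" "M (t + 1) = q" "M (Suc t) = q" "M (t + 2) = 2 ^ w - 1" "M (t + 3) = 0"
    using M_table[of 0] M_table[of 1] M_table[of 2] M_table[of 3] TL4 rs_table_nth(1-4) by simp_all
  then show "M (Suc (Suc (Suc t))) = 0" by (simp add: numeral_3_eq_3)
qed

lemma table_lookup:
  assumes "x < 2 ^ U" "j < 2 ^ h" "c < 3"
  shows "M (t + (4 + c) + 3 * (x * 2 ^ h + j)) = table_entry h q w (3 * (x * 2 ^ h + j) + c)"
proof -
  have "x * 2 ^ h + j < (x + 1) * 2 ^ h" using assms by simp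
  also have "\<dots> \<le> 2 ^ U * 2 ^ h" using assms by (intro mult_right_mono) auto
  finally have e: "x * 2 ^ h + j < 2 ^ (U + h)" by (simp add: power_add)
  moreover have "3 * e + c < 3 * B" if "e < B" for e B using that assms(3) by linarith
  ultimately have "3 * (x * 2 ^ h + j) + c < 3 * 2 ^ (U + h)" by blast
  then show ?thesis using M_table[of "4 + (3 * (x * 2 ^ h + j) + c)"] rs_table_nth(5)[of "3 * (x * 2 ^ h + j) + c"]
    by (simp add: length_rs_table ac_simps)
qed

lemma table_entries:
  assumes "x < 2 ^ U" "j < 2 ^ h"
  shows "M (t + 4 + 3 * (x * 2 ^ h)) = pop x U"
    "M (t + 5 + 3 * (x * 2 ^ h + j)) = sel_entry w U x j"
    "M (t + 6 + 3 * (x * 2 ^ h + j)) = field_entry h q x j"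
proof -
  have e: "(x * 2 ^ h + i) div 2 ^ h = x" "(x * 2 ^ h + i) mod 2 ^ h = i" if "i < 2 ^ h" for i using that by simp_all
  have te: "table_entry h q w (3 * e) = pop (e div 2 ^ h) U"
    "table_entry h q w (3 * e + 1) = sel_entry w U (e div 2 ^ h) (e mod 2 ^ h)"
    "table_entry h q w (3 * e + 2) = field_entry h q (e div 2 ^ h) (e mod 2 ^ h)" for e
  proof -
    have "(3 * e + 1) mod 3 = 1" "(3 * e + 1) div 3 = e" "(3 * e + 2) mod 3 = 2" "(3 * e + 2) div 3 = e" by presburger+
    then show "table_entry h q w (3 * e) = pop (e div 2 ^ h) U"
      "table_entry h q w (3 * e + 1) = sel_entry w U (e div 2 ^ h) (e mod 2 ^ h)"
      "table_entry h q w (3 * e + 2) = field_entry h q (e div 2 ^ h) (e mod 2 ^ h)"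
      by (simp_all only: table_entry_def Let_def U_def[symmetric]) simp_all
  qed
  note tl = table_lookup[OF assms(1)]
  show "M (t + 4 + 3 * (x * 2 ^ h)) = pop x U" using tl[of 0 0] te(1)[of "x * 2 ^ h"] by simp
  show "M (t + 5 + 3 * (x * 2 ^ h + j)) = sel_entry w U x j"
    using tl[OF assms(2), of 1] te(2)[of "x * 2 ^ h + j"] by (simp only: e[OF assms(2)]) simp
  show "M (t + 6 + 3 * (x * 2 ^ h + j)) = field_entry h q x j"
    using tl[OF assms(2), of 2] te(3)[of "x * 2 ^ h + j"] by (simp only: e[OF assms(2)]) simp
qed

text \<open>The xor complements whole words, including positions from \<open>N\<close> on, where
  \<open>lev_bit\<close> is false for both bits. Hence this predicate, which agrees with
  \<open>lev_bit b\<close> below \<open>N\<close> only.\<close>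

definition target :: "nat \<Rightarrow> bool" where
  "target x \<longleftrightarrow> (lev_bit 1 x \<longleftrightarrow> b = 1)"

lemma cnt_target: "x \<le> N \<Longrightarrow> cnt target x = ones b x"
  by (rule cnt_cong) (use b in \<open>auto simp: target_def lev_bit_def\<close>)

lemma word_value:
  assumes "y = Bit_Operations.xor (bit_word k) (M (t + 2 + b))" "j < w"
  shows "y div 2 ^ j mod 2 = of_bool (target (k * w + j))"
proof -
  have "bit (M (t + 2 + b)) j \<longleftrightarrow> b = 0"
  proof -
    consider "b = 0" | "b = 1" using b by linarith
    then show ?thesis
    proof cases
      case 1
      then have "M (t + 2 + b) = mask w" using M_header by (simp add: mask_eq_exp_minus_1)
      then show ?thesis using 1 assms(2) by (simp add: bit_mask_iff)
    qed (use M_header in simp)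
  qed
  moreover have "bit (bit_word k) j \<longleftrightarrow> lev_bit 1 (k * w + j)"
    using bit_word_digit[OF assms(2), of k] by (simp add: bit_iff_odd odd_iff_mod_2_eq_one)
  ultimately have "bit y j \<longleftrightarrow> target (k * w + j)"
    unfolding assms(1) bit_xor_iff target_def using b by auto
  then show ?thesis
    by (cases "target (k * w + j)") (simp_all add: bit_iff_odd odd_iff_mod_2_eq_one even_iff_mod_2_eq_zero)
qed

definition qregs :: "(nat \<Rightarrow> nat) \<Rightarrow> nat \<Rightarrow> bool" where
  "qregs R i \<longleftrightarrow> R 0 = p \<and> R 1 = t \<and> R 3 = w \<and> R 4 = b \<and> R 5 = i \<and>
     R 6 = h \<and> R 7 = q \<and> R 8 = Z1 \<and> R 9 = Z2 \<and> R 10 = U \<and> R 13 = nst v"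

lemma qregsD:
  assumes "qregs R i"
  shows "R 0 = p" "R 1 = t" "R (Suc 0) = t" "R 3 = w" "R 4 = b" "R 5 = i" "R 6 = h" "R 7 = q" "R 8 = Z1" "R 9 = Z2"
    "R 10 = U" "R 13 = nst v"
  using assms by (simp_all add: qregs_def)

lemma qregs_upd: "qregs R i \<Longrightarrow> x \<in> {14..<64} \<Longrightarrow> qregs (R(x := y)) i"
  by (auto simp: qregs_def)

lemma setup_qwp:
  assumes "R 0 = p" "R 1 = t" "R 3 = w" "R 4 = b" "R 5 = i"
  shows "qwp w r setup_prog R M (\<lambda>R'. qregs R' i)"
proof -
  have Z: "q * w = Z1" "q * Z1 = Z2" "q * h = U" by (simp_all add: Z1_def Z2_def U_def)
  have st: "nst v \<le> Q ^ 4" using node_le BB_Q4 by blast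
  have R1: "R (Suc 0) = t" using assms(2) by simp
  show ?thesis unfolding setup_prog_def
    apply (rule qwp_Seq, rule qwp_asg[OF w_large, where v = h], (use assms R1 M_header in \<open>simp; fail\<close>)+)
    apply (rule qwp_Seq, rule qwp_asg[OF w_large, where v = q], (use assms R1 M_header in \<open>simp; fail\<close>)+)
    apply (rule qwp_Seq, rule qwp_asg[OF w_large, where v = Z1], (use assms Z in \<open>simp; fail\<close>)+)
    apply (rule qwp_Seq, rule qwp_asg[OF w_large, where v = Z2], (use assms Z in \<open>simp; fail\<close>)+)
    apply (rule qwp_Seq, rule qwp_asg[OF w_large, where v = U], (use assms Z in \<open>simp; fail\<close>)+)
    apply (rule qwp_asg[OF w_large, where v = "nst v"], (use assms M_rec st in \<open>simp; fail\<close>)+)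
    apply (use assms in \<open>simp add: qregs_def\<close>)
    done
qed

lemma pow_h: "2 ^ h \<le> Q" "2 ^ U \<le> Q" "2 * w < 2 ^ h"
proof -
  show "2 ^ h \<le> Q" by simp
  have "(2::nat) ^ U \<le> 2 ^ (U + h)" by (rule power_increasing) auto
  then show "2 ^ U \<le> Q" using params_le_Q(16) by (rule order_trans)
  have "w ^ 1 \<le> w ^ 3" using w_pos by (intro power_increasing) auto
  then show "2 * w < 2 ^ h" using h_bounds(1) by simp
qed

text \<open>\<open>KU\<close> bounds every partial sum, as required to exclude overflow of register
  18 during the scan.\<close>

lemma scan_qwp:
  assumes R: "qregs R i" and y: "R 15 = y" "y < 2 ^ w" and d: "R 16 = d" "d \<le> w"
    and KU: "s \<Longrightarrow> \<forall>m. (\<Sum>p<m. of_bool (pop y (Suc p) \<le> d)) \<le> w"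
  shows "qwp w r (scan_prog s k) R M (\<lambda>R'. qregs R' i \<and> (\<forall>x. x \<notin> {15, 17, 18} \<longrightarrow> R' x = R x) \<and>
    R' 15 = y div 2 ^ (k * U) \<and> R' 17 = pop y (k * U) \<and>
    R' 18 = (if s then \<Sum>c<k. sel_entry w U (y div 2 ^ (c * U) mod 2 ^ U) (d + w - pop y (c * U)) else 0))"
proof (induction k)
  case 0
  show ?case
    apply (simp only: scan_prog.simps)
    apply (rule qwp_Seq, rule qwp_asg[OF w_large, where v = 0], simp, simp)
    apply (rule qwp_asg[OF w_large, where v = 0], simp, simp)
    by (intro conjI qregs_upd R) (use y in \<open>auto simp: pop_def\<close>)
next
  case (Suc k)
  let ?s = "\<lambda>k. if s then \<Sum>c<k. sel_entry w U (y div 2 ^ (c * U) mod 2 ^ U) (d + w - pop y (c * U)) else 0"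
  show ?case unfolding scan_prog.simps
  proof (rule qwp_Seq, rule qwp_mono[OF Suc.IH], elim conjE)
    fix R1 assume R1: "qregs R1 i" "\<forall>x. x \<notin> {15, 17, 18} \<longrightarrow> R1 x = R x"
      "R1 15 = y div 2 ^ (k * U)" "R1 17 = pop y (k * U)" "R1 18 = ?s k"
    let ?ch = "y div 2 ^ (k * U) mod 2 ^ U"
    have y15: "R1 15 < 2 ^ w" unfolding R1(3) using y(2) by (meson div_le_dividend le_less_trans)
    have d16: "R1 16 = d" using R1(2) d(1) by simp
    have ch: "?ch < 2 ^ U" by simp
    have pw: "pop y m \<le> w" for m by (rule pop_le_word[OF y(2)])
    have J: "d + w - pop y (k * U) < 2 ^ h" using d(2) pow_h(3) by linarith
    note te = table_entries[OF ch J]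
    have sel_le: "sel_entry w U x j \<le> U" for x j unfolding sel_entry_def by (rule sum_bool_less)
    have sQ: "?s k \<le> Q ^ 4"
    proof (cases s)
      case True
      then have "?s k \<le> w" using KU unfolding scan_chunks(2)[OF y(2)] by simp
      then show ?thesis by (rule BB_Q4)
    qed simp
    have uQ: "sel_entry w U x j \<le> Q ^ 4" "pop x U \<le> Q ^ 4" for x j
      using sel_le[of x j] pop_le[of x U] params_le_Q4(13) by linarith+
    have pQ: "pop y m \<le> Q ^ 4" for m using pw[of m] BB_Q4(2) by simp
    have dw: "d \<le> Q ^ 4" "pop y (k * U) \<le> d + w" using d(2) BB_Q4(2) pw[of "k * U"] by simp_all
    have sc: "pop y (k * U) + pop ?ch U = pop y (Suc k * U)"
      using pop_chunk[of U U y "k * U"] pop_mono[of "k * U" "k * U + U" y] by (simp add: add.commute)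
    have dv: "y div 2 ^ (k * U) div 2 ^ U = y div 2 ^ (Suc k * U)"
      by (simp add: div_mult2_eq[symmetric] power_add[symmetric] add.commute)
    note D = qregsD[OF R1(1)]
    show "qwp w r (Seq (asg 18 (if s then Rg 18 \<oplus> table_e 1 chunk_e (Rg 16 \<oplus> Rg 3 \<ominus> Rg 17) else Num 0))
        (Seq (asg 17 (Rg 17 \<oplus> table_e 0 chunk_e (Num 0))) (asg 15 (Shiftr (RgW 15) (Rg 10))))) R1 M
      (\<lambda>R'. qregs R' i \<and> (\<forall>x. x \<notin> {15, 17, 18} \<longrightarrow> R' x = R x) \<and>
        R' 15 = y div 2 ^ (Suc k * U) \<and> R' 17 = pop y (Suc k * U) \<and> R' 18 = ?s (Suc k))"
    proof (rule qwp_Seq, rule qwp_asg[OF w_large, where v = "?s (Suc k)"], goal_cases)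
      case 1
      then show ?case using D R1 y15 d16 pow_h te sQ uQ pQ dw by (cases s) simp_all
    next
      case 2
      then show ?case using D R1 d16 te by (cases s) simp_all
    next
      case 3
      show ?case
      proof (rule qwp_Seq, rule qwp_asg[OF w_large, where v = "pop y (Suc k * U)"], goal_cases)
        case 1
        then show ?case using D R1 y15 pow_h te sQ uQ pQ by simp
      next
        case 2
        then show ?case using D R1 te sc by simp
      next
        case 3
        show ?case
          by (rule qwp_asg[OF w_large, where v = "y div 2 ^ (Suc k * U)"])
            (use D R1 y15 dv in \<open>simp_all add: qregs_upd\<close>)
      qed
    qed
  qed
qed

lemma M_sb: "M (p + 3) = sb"
  using M_rec by (simp add: sb_def)

lemmas M_struct = M_base[folded sb_def] M_small[folded sb_def] M_count[folded sb_def] M_large[folded sb_def]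
  M_sample[folded sb_def] M_sparse[folded sb_def]

lemma cell_pack_Q4: "q * z < 2 ^ h \<Longrightarrow> cell_pack f h q z c \<le> Q ^ 4" "q * z < 2 ^ h \<Longrightarrow> cell_pack f h q z c < 2 ^ U"
  using cell_pack_Q[of z f c] rowlen_le_Q4 cell_pack_less[of q z h f c] unfolding U_def by linarith+

text \<open>The end \<open>nen v\<close> is included for the sake of rank; it may belong to the cell
  after the last one of the node.\<close>

lemma cell_range:
  assumes "nst v \<le> x" "x \<le> nen v"
  shows "nst v div Z \<le> x div Z" "x div Z \<le> Suc ((nen v - 1) div Z)"
proof -
  show "nst v div Z \<le> x div Z" using assms(1) by (rule div_le_mono)
  have "x div Z \<le> nen v div Z" using assms(2) by (rule div_le_mono)
  also have "nen v = Suc (nen v - 1)" using node_ne by simp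
  also have "Suc (nen v - 1) div Z \<le> Suc ((nen v - 1) div Z)" by (simp add: div_Suc)
  finally show "x div Z \<le> Suc ((nen v - 1) div Z)" .
qed

lemma nested_cells: "x div Z1 = x div Z2 * q + x div Z1 mod q" "x div w = x div Z1 * q + x div w mod q"
  "x div Z2 * (q * Z1) + (x div Z1 mod q) * Z1 = x div Z1 * Z1" "x div Z1 * (q * w) + (x div w mod q) * w = x div w * w"
proof -
  have "x div Z2 = x div Z1 div q" by (simp add: Z2_def div_mult2_eq mult.commute)
  then show 1: "x div Z1 = x div Z2 * q + x div Z1 mod q" by (metis div_mult_mod_eq)
  have "x div Z1 = x div w div q" by (simp add: Z1_def div_mult2_eq mult.commute)
  then show 2: "x div w = x div Z1 * q + x div w mod q" by (metis div_mult_mod_eq)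
  show "x div Z2 * (q * Z1) + (x div Z1 mod q) * Z1 = x div Z1 * Z1"
    using arg_cong[OF 1, of "\<lambda>a. a * Z1"] by (simp add: algebra_simps)
  show "x div Z1 * (q * w) + (x div w mod q) * w = x div w * w"
    using arg_cong[OF 2, of "\<lambda>a. a * w"] by (simp add: algebra_simps)
qed

lemma ones_chain: "ones b (x div Z2 * Z2) \<le> ones b (x div Z1 * Z1)" "ones b (x div Z1 * Z1) \<le> ones b (x div w * w)"
  "ones b (x div w * w) \<le> ones b x"
proof -
  have "x div Z2 * Z2 \<le> x div Z1 * Z1" using nested_cells(3)[of x] Z2_def by (metis le_add1)
  then show "ones b (x div Z2 * Z2) \<le> ones b (x div Z1 * Z1)" by (rule cnt_mono)
  have "x div Z1 * Z1 \<le> x div w * w" using nested_cells(4)[of x] Z1_def by (metis le_add1)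
  then show "ones b (x div Z1 * Z1) \<le> ones b (x div w * w)" by (rule cnt_mono)
  show "ones b (x div w * w) \<le> ones b x" by (rule cnt_mono) simp
qed

lemma fields:
  "cell_pack (lev_bit b) h q Z1 (x div Z2) div 2 ^ (x div Z1 mod q * h) mod 2 ^ h =
     ones b (x div Z1 * Z1) - ones b (x div Z2 * Z2)"
  "cell_pack (lev_bit b) h q w (x div Z1) div 2 ^ (x div w mod q * h) mod 2 ^ h =
     ones b (x div w * w) - ones b (x div Z1 * Z1)"
  using cell_pack_field[OF Z2_less, of "x div Z1 mod q" "lev_bit b" "x div Z2"]
    cell_pack_field[OF Z1_less, of "x div w mod q" "lev_bit b" "x div Z1"] q_pos nested_cells[of x]
  by (simp_all add: Z1_def[symmetric] Z2_def[symmetric])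

lemma rank_correct:
  assumes R: "R 0 = p" "R 1 = t" "R 3 = w" "R 4 = b" "R 5 = i" and i: "0 < i" "i \<le> nen v - nst v"
  shows "qwp w r (rankq K) R M (\<lambda>R'. R' 0 = ones b (nst v + i) - ones b (nst v))"
proof -
  define x where "x = nst v + i"
  have x: "nst v < x" "x \<le> nen v" using i by (simp_all add: x_def)
  have xN: "x \<le> N" "x \<le> NN" using x node_le by linarith+
  define y where "y = Bit_Operations.xor (M (loc w 2 0 0 + x div w)) (M (t + 2 + b)) mod 2 ^ (x mod w)"
  have pw: "(2::nat) ^ (x mod w) < 2 ^ w" using w_pos by simp
  have y_less: "y < 2 ^ w"
  proof -
    have "y < 2 ^ (x mod w)" unfolding y_def by simp
    then show ?thesis using pw by linarith
  qed
  have pop_y: "pop y (K * U) = ones b x - ones b (x div w * w)"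
  proof -
    let ?m = "x mod w" and ?z = "Bit_Operations.xor (M (loc w 2 0 0 + x div w)) (M (t + 2 + b))"
    have m: "?m < w" using w_pos by simp
    then have "?m \<le> K * U" using K by linarith
    then have "pop y (K * U) = pop ?z ?m" unfolding y_def by (rule pop_mod_ge)
    also have "\<dots> = cnt target (x div w * w + ?m) - cnt target (x div w * w)"
    \<comment> \<open>If \<open>?m\<close> is positive, the word also contains position x - 1 of the
      node, so its contents are known. Otherwise it may lie outside the bitmap, but all of its bits
      are masked out.\<close>
    proof (cases "?m = 0")
      case False
      have "x - 1 = x div w * w + (?m - 1)" using False div_mult_mod_eq[of x w] by linarith
      then have dv: "(x - 1) div w = x div w" using m by (simp add: div_nat_eqI algebra_simps)
      have "M (loc w 2 0 0 + (x - 1) div w) = bit_word ((x - 1) div w)" by (rule M_bits) (use x in auto)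
      then have "?z = Bit_Operations.xor (bit_word (x div w)) (M (t + 2 + b))" unfolding dv by simp
      from word_pop[of w ?z target "x div w" ?m, OF word_value[OF this]] m show ?thesis by simp
    qed (simp add: pop_def)
    also have "\<dots> = ones b x - ones b (x div w * w)"
    proof -
      have "x div w * w \<le> N" using xN(1) by (meson div_times_less_eq_dividend le_trans)
      then show ?thesis using cnt_target[OF xN(1)] cnt_target[of "x div w * w"] by simp
    qed
    finally show ?thesis .
  qed
  note rng = cell_range[of x, OF less_imp_le[OF x(1)] x(2)]
  define a2 where "a2 = ones b (x div Z2 * Z2)"
  define a1 where "a1 = ones b (x div Z1 * Z1)"
  define a0 where "a0 = ones b (x div w * w)"
  define X2 where "X2 = cell_pack (lev_bit b) h q Z1 (x div Z2)"
  define X1 where "X1 = cell_pack (lev_bit b) h q w (x div Z1)"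
  have Mx: "M (sb + (36 + b)) = ones b (nst v)"
    "M (sb + (40 + b) + 64 * (x div Z2 - nst v div Z2)) = a2"
    "M (sb + (42 + b) + 64 * (x div Z2 - nst v div Z2)) = X2"
    "M (sb + (38 + b) + 64 * (x div Z1 - nst v div Z1)) = X1"
    using M_struct(1) M_struct(2)[OF rng] M_struct(3)[OF rng] M_struct(4)[OF rng]
    by (simp_all add: a2_def X1_def X2_def)
  have fl: "X2 div 2 ^ (x div Z1 mod q * h) mod 2 ^ h = a1 - a2" "X1 div 2 ^ (x div w mod q * h) mod 2 ^ h = a0 - a1"
    unfolding X1_def X2_def a2_def a1_def a0_def by (rule fields)+
  have XQ: "X2 \<le> Q ^ 4" "X1 \<le> Q ^ 4"
    unfolding X2_def X1_def using cell_pack_Q4[OF Z2_less] cell_pack_Q4[OF Z1_less] by simp_all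
  have bnd: "x \<le> Q ^ 4" "nst v \<le> Q ^ 4" "i \<le> Q ^ 4" "x div Z1 - nst v div Z1 \<le> Q ^ 4" "x div Z2 - nst v div Z2 \<le> Q ^ 4"
  proof -
    show "x \<le> Q ^ 4" "nst v \<le> Q ^ 4" "i \<le> Q ^ 4" using xN(2) node_le x_def by (auto intro!: BB_Q4(1))
    have "x div Z1 - nst v div Z1 \<le> x" "x div Z2 - nst v div Z2 \<le> x" by (meson diff_le_self div_le_dividend le_trans)+
    then show "x div Z1 - nst v div Z1 \<le> Q ^ 4" "x div Z2 - nst v div Z2 \<le> Q ^ 4" using \<open>x \<le> Q ^ 4\<close> by linarith+
  qed
  note ch = ones_chain[of x, folded a2_def a1_def a0_def] and oQ = ones_Q4[OF xN(2)]
  note pop_y = pop_y[folded a0_def]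
  have oQ': "a2 \<le> Q ^ 4" "a1 \<le> Q ^ 4" "a0 \<le> Q ^ 4"
    "ones b (nst v) \<le> Q ^ 4" "ones b (nst v) \<le> ones b x" "pop y (K * U) \<le> Q ^ 4" "ones b x - a0 \<le> Q ^ 4"
    using ch oQ ones_Q4[OF node_le(1)] pop_y cnt_mono[of "nst v" x "lev_bit b"] x by linarith+
  have bw: "M a < 2 ^ w" for a by (rule M_word)
  show ?thesis unfolding rankq_def
  proof (rule qwp_Cond1[OF w_large], goal_cases)
    case 3
    show ?case
    proof (rule qwp_Seq, rule qwp_mono[OF setup_qwp[OF R]])
      fix R1 assume R1: "qregs R1 i"
      note D = qregsD[OF R1]
      show "qwp w r (Seq (asg 14 (Rg 13 \<oplus> Rg 5))
       (Seq (asg 15 (word_e (Rg 14 \<oslash> Rg 3) \<odot> ShiftlW (Num 1) (Rg 14 \<odot> Rg 3)))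
       (Seq (asg 16 (Num 0))
       (Seq (scan_prog False K)
       (Seq (asg 19 (Rg 14 \<oslash> Rg 9 \<ominus> Rg 13 \<oslash> Rg 9))
       (Seq (asg 20 (struct_e 40 (Rg 19)))
       (Seq (asg 20 (Rg 20 \<oplus> field_e (struct_e 42 (Rg 19)) (Rg 14 \<oslash> Rg 8 \<odot> Rg 7)))
       (Seq (asg 19 (Rg 14 \<oslash> Rg 8 \<ominus> Rg 13 \<oslash> Rg 8))
       (Seq (asg 20 (Rg 20 \<oplus> field_e (struct_e 38 (Rg 19)) (Rg 14 \<oslash> Rg 3 \<odot> Rg 7)))
            (asg 0 (Rg 20 \<oplus> Rg 17 \<ominus> struct_e 36 (Num 0)))))))))))) R1 M
         (\<lambda>R'. R' 0 = ones b (nst v + i) - ones b (nst v))"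
        apply (rule qwp_Seq, rule qwp_asg[OF w_large, where v = x], (simp add: D bnd x_def[symmetric]; fail), (simp add: D bnd x_def[symmetric]; fail))
        apply (rule qwp_Seq, rule qwp_asg[OF w_large, where v = y],
            (simp add: D bnd bw M_rec w_pos pw y_def; fail), (simp add: D bnd bw M_rec w_pos pw y_def; fail))
        apply (rule qwp_Seq, rule qwp_asg[OF w_large, where v = 0], (simp; fail)+)
        apply (rule qwp_Seq, rule qwp_mono[OF scan_qwp[where d = 0 and i = i and y = y]])
             apply (intro qregs_upd R1; simp)
            apply (simp; fail)
           apply (rule y_less)
          apply (simp; fail)
         apply (simp; fail)
        apply (simp; fail)
      proof (elim conjE)
        fix R2 assume R2: "qregs R2 i" "\<forall>x'. x' \<notin> {15, 17, 18} \<longrightarrow> R2 x' = (R1(14 := x, 15 := y, 16 := 0)) x'"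
          "R2 17 = pop y (K * U)"
        have r14: "R2 14 = x" using R2(2) by simp
        note D = qregsD[OF R2(1)]
        show "qwp w r (Seq (asg 19 (Rg 14 \<oslash> Rg 9 \<ominus> Rg 13 \<oslash> Rg 9))
         (Seq (asg 20 (struct_e 40 (Rg 19)))
         (Seq (asg 20 (Rg 20 \<oplus> field_e (struct_e 42 (Rg 19)) (Rg 14 \<oslash> Rg 8 \<odot> Rg 7)))
         (Seq (asg 19 (Rg 14 \<oslash> Rg 8 \<ominus> Rg 13 \<oslash> Rg 8))
         (Seq (asg 20 (Rg 20 \<oplus> field_e (struct_e 38 (Rg 19)) (Rg 14 \<oslash> Rg 3 \<odot> Rg 7)))
              (asg 0 (Rg 20 \<oplus> Rg 17 \<ominus> struct_e 36 (Num 0)))))))) R2 M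
           (\<lambda>R'. R' 0 = ones b (nst v + i) - ones b (nst v))"
          apply (rule qwp_Seq, rule qwp_asg[OF w_large, where v = "x div Z2 - nst v div Z2"],
              (simp add: D bnd rng r14; fail), (simp add: D bnd rng r14; fail))
          apply (rule qwp_Seq, rule qwp_asg[OF w_large, where v = a2],
              (simp add: D bnd r14 Mx M_sb oQ'; fail), (simp add: D bnd r14 Mx M_sb oQ'; fail))
          apply (rule qwp_Seq, rule qwp_asg[OF w_large, where v = a1],
              (simp add: D bnd r14 Mx M_sb oQ' q_pos pow_h fl ch XQ; fail), (simp add: D bnd r14 Mx M_sb oQ' q_pos pow_h fl ch XQ; fail))
          apply (rule qwp_Seq, rule qwp_asg[OF w_large, where v = "x div Z1 - nst v div Z1"],
              (simp add: D bnd rng r14; fail), (simp add: D bnd rng r14; fail))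
          apply (rule qwp_Seq, rule qwp_asg[OF w_large, where v = a0],
              (simp add: D bnd r14 Mx M_sb oQ' q_pos pow_h fl ch XQ; fail), (simp add: D bnd r14 Mx M_sb oQ' q_pos pow_h fl ch XQ; fail))
          apply (rule qwp_asg[OF w_large, where v = "ones b x - ones b (nst v)"],
              (simp add: D bnd r14 R2(3) Mx M_sb oQ' ch pop_y; fail), (simp add: D bnd r14 R2(3) Mx M_sb oQ' ch pop_y; fail))
          apply (simp add: x_def)
          done
      qed
    qed
  qed (use R i bnd in auto)
qed

lemma sparse_correct:
  assumes z: "lev_bit b z" "nst v \<le> z" "z < nen v" and zk: "local_rank b z = j"
    and sp: "Z2 \<le> sample b v (j div G + 1) - sample b v (j div G)"
  shows "M (sb + (46 + b) + 64 * ((sample b v (j div G) - nst v) div Z2 * G + j mod G)) = z - nst v"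
  using M_struct(6)[OF z(2,3,1)] zk sp by simp

text \<open>Every value is expressed through the position \<open>z\<close> of the occurrence sought,
  and \<open>le_z\<close> turns the comparisons of counts into comparisons of positions.\<close>

lemma select_correct:
  assumes R: "R 0 = p" "R 1 = t" "R 3 = w" "R 4 = b" "R 5 = j"
    and j: "ones b (nst v) + j < ones b (nen v)"
  shows "qwp w r (selectq K) R M (\<lambda>R'. nst v + R' 0 < nen v \<and> lev_bit b (nst v + R' 0) \<and>
    ones b (nst v + R' 0) = ones b (nst v) + j)"
proof -
  define \<rho> where "\<rho> = ones b (nst v) + j"
  obtain z where z: "lev_bit b z" "ones b z = \<rho>" "nst v \<le> z" "z < nen v"
    using node_one_exists[of b v \<rho>] j by (auto simp: \<rho>_def)
  have zN: "z < N" "z \<le> N" "z \<le> NN" "z < NN" "own z = v" using z node_le node_positions[OF z(3,4)] by auto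
  have lr: "local_rank b z = j" using z(2) zN by (simp add: local_rank_def \<rho>_def)
  have le_z: "ones b y \<le> \<rho> \<longleftrightarrow> y \<le> z" for y using cnt_le_iff[of "lev_bit b" z y] z by simp
  define k where "k = j div G"
  define P0 where "P0 = sample b v k"
  define P1 where "P1 = sample b v (k + 1)"
  have gi: "k + 1 \<le> (ones b (nen v) - ones b (nst v) + G - 1) div G"
    unfolding k_def by (rule group_index_le) (use j in linarith)
  have MP: "M (sb + (44 + b) + 64 * k) = P0" "M (sb + (44 + b) + 64 * Suc k) = P1"
    using M_struct(5)[of k] M_struct(5)[of "Suc k"] gi by (simp_all add: P0_def P1_def)
  have kG: "k * G \<le> j" by (simp add: k_def)
  have P0: "nst v \<le> P0" "P0 \<le> z" "P0 \<le> P1" "P1 \<le> nen v" "z < P1"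
  proof -
    show "nst v \<le> P0" "P1 \<le> nen v" unfolding P0_def P1_def by (rule sample_bounds)+
    show "P0 \<le> P1" unfolding P0_def P1_def by (rule sample_mono) simp
    have "ones b P0 = ones b (nst v) + k * G" unfolding P0_def by (rule sample_one) (use kG j in linarith)
    then show "P0 \<le> z" using le_z[of P0] kG by (simp add: \<rho>_def)
    show "z < P1"
    proof (cases "ones b (nst v) + (k + 1) * G < ones b (nen v)")
      case True
      have "j < k * G + G" unfolding k_def using G_pos by (metis add.commute dividend_less_div_times)
      then have "\<rho> < ones b P1" unfolding P1_def using sample_one(2)[OF True] by (simp add: \<rho>_def)
      then show ?thesis using le_z[of P1] by linarith
    next
      case False
      then show ?thesis unfolding P1_def using sample_end[of b v "k + 1"] z(4) by simp
    qed
  qed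
  have bnd: "z \<le> Q ^ 4" "nst v \<le> Q ^ 4" "j \<le> Q ^ 4" "k \<le> Q ^ 4" "P0 \<le> Q ^ 4" "P1 \<le> Q ^ 4" "\<rho> \<le> Q ^ 4" "k + 1 \<le> Q ^ 4"
    "ones b (nst v) \<le> Q ^ 4"
  proof -
    have "\<rho> \<le> NN" using z(2) ones_le(2)[OF zN(3), of b] by simp
    then have "j \<le> NN" "ones b (nst v) \<le> NN" by (simp_all add: \<rho>_def)
    moreover have "k \<le> j" by (simp add: k_def)
    moreover have "j < NN" using j ones_le(2)[OF node_le(2), of b] by linarith
    ultimately show "z \<le> Q ^ 4" "nst v \<le> Q ^ 4" "j \<le> Q ^ 4" "k \<le> Q ^ 4" "P0 \<le> Q ^ 4" "P1 \<le> Q ^ 4" "\<rho> \<le> Q ^ 4" "k + 1 \<le> Q ^ 4"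
      "ones b (nst v) \<le> Q ^ 4"
      using zN node_le P0 \<open>\<rho> \<le> NN\<close> by (auto intro!: BB_Q4(1))
  qed
  have bw: "M a < 2 ^ w" for a by (rule M_word)
  have goal: "nst v + (z - nst v) < nen v \<and> lev_bit b (nst v + (z - nst v)) \<and>
    ones b (nst v + (z - nst v)) = ones b (nst v) + j" using z by (simp add: \<rho>_def)
  let ?Post = "\<lambda>R'. nst v + R' 0 < nen v \<and> lev_bit b (nst v + R' 0) \<and> ones b (nst v + R' 0) = ones b (nst v) + j"
  note G = G_def[symmetric]
  show ?thesis unfolding selectq_def
  proof (rule qwp_Seq, rule qwp_mono[OF setup_qwp[OF R]])
    fix R1 assume R1: "qregs R1 j"
    note D = qregsD[OF R1]
    let ?R = "R1(21 := \<rho>, 22 := G, 23 := k, 24 := P0, 25 := P1)"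
    have Rq: "qregs ?R j" by (intro qregs_upd R1) auto
    note DR = qregsD[OF Rq]
    have main: "qwp w r (Cond (cp (Lt (Rg 9) (Rg 25 \<ominus> Rg 24 \<oplus> Num 1)))
            (asg 0 (struct_e 46 ((Rg 24 \<ominus> Rg 13) \<oslash> Rg 9 \<otimes> Rg 22 \<oplus> Rg 5 \<odot> Rg 22)))
            (dense_prog K)) ?R M ?Post"
    proof (cases "Z2 \<le> P1 - P0")
      case True
      have sp: "M (sb + (46 + b) + 64 * ((P0 - nst v) div Z2 * G + j mod G)) = z - nst v"
        unfolding P0_def k_def by (rule sparse_correct[OF z(1,3,4) lr]) (use True in \<open>simp add: P0_def P1_def k_def\<close>)
      have zs: "z - nst v \<le> Q ^ 4" using bnd(1) by linarith
      show ?thesis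
      proof (rule qwp_Cond1[OF w_large], goal_cases)
        case 3
        show ?case
          by (rule qwp_asg[OF w_large, where v = "z - nst v"])
            (use DR bnd P0 M_sb sp zs G_pos goal in \<open>simp_all del: fun_upd_apply add: fun_upd_other fun_upd_same\<close>)
      qed (use DR bnd P0 True in \<open>auto\<close>)
    next
      case False
      \<comment> \<open>The group spans fewer than \<open>Z2\<close> positions, so \<open>z\<close>
        lies in the large cell of \<open>P0\<close> or in the next one. The count at the start of
        the next cell decides.\<close>
      have c0: "z div Z2 = P0 div Z2 + of_bool (ones b ((P0 div Z2 + 1) * Z2) \<le> \<rho>)"
      proof -
        have "P0 < (P0 div Z2 + 1) * Z2" using Z_pos(2) by (metis Suc_eq_plus1 dividend_less_div_times mult_Suc)
        have lt: "z < (P0 div Z2 + 2) * Z2"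
        proof -
          have "z < P0 + Z2" using False P0 by linarith
          also have "\<dots> < (P0 div Z2 + 1) * Z2 + Z2" using \<open>P0 < _\<close> by linarith
          finally show ?thesis by (simp add: algebra_simps)
        qed
        show ?thesis
        proof (cases "(P0 div Z2 + 1) * Z2 \<le> z")
          case True
          then have "z div Z2 = P0 div Z2 + 1" using lt by (intro div_nat_eqI) (simp_all add: algebra_simps)
          then show ?thesis using True le_z[of "(P0 div Z2 + 1) * Z2"] by simp
        next
          case F: False
          then have "z < (P0 div Z2 + 1) * Z2" by simp
          then have "z div Z2 \<le> P0 div Z2" by (simp add: less_mult_imp_div_less less_Suc_eq_le[symmetric])
          then have "z div Z2 = P0 div Z2" using div_le_mono[OF P0(2), of Z2] by simp
          then show ?thesis using F le_z[of "(P0 div Z2 + 1) * Z2"] by simp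
        qed
      qed
      note rng = cell_range[OF z(3) less_imp_le[OF z(4)]]
      have rP: "nst v div Z2 \<le> Suc (P0 div Z2)" "Suc (P0 div Z2) \<le> Suc ((nen v - 1) div Z2)" "nst v div Z2 \<le> P0 div Z2"
        using div_le_mono[OF P0(1), of Z2] div_le_mono[of P0 "nen v - 1" Z2] P0 z(4) by simp_all
      have Mz: "M (sb + (40 + b) + 64 * (z div Z2 - nst v div Z2)) = ones b (z div Z2 * Z2)"
        "M (sb + (42 + b) + 64 * (z div Z2 - nst v div Z2)) = cell_pack (lev_bit b) h q Z1 (z div Z2)"
        "M (sb + (38 + b) + 64 * (z div Z1 - nst v div Z1)) = cell_pack (lev_bit b) h q w (z div Z1)"
        "M (sb + (40 + b) + 64 * (Suc (P0 div Z2) - nst v div Z2)) = ones b (Suc (P0 div Z2) * Z2)"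
        using M_struct(2)[OF rng] M_struct(3)[OF rng] M_struct(4)[OF rng] M_struct(3)[OF rP(1,2)] by simp_all
      define d2 where "d2 = \<rho> - ones b (z div Z2 * Z2)"
      define d1 where "d1 = \<rho> - ones b (z div Z1 * Z1)"
      define d0 where "d0 = \<rho> - ones b (z div w * w)"
      define X2 where "X2 = cell_pack (lev_bit b) h q Z1 (z div Z2)"
      define X1 where "X1 = cell_pack (lev_bit b) h q w (z div Z1)"
      note ch = ones_chain[of z, unfolded z(2)]
      have dless: "ones b z - ones b (z div Z * Z) < Z" if "0 < Z" for Z
      proof -
        have "ones b (z div Z * Z + z mod Z) \<le> ones b (z div Z * Z) + z mod Z" by (rule cnt_add_le)
        then show ?thesis using mod_less_divisor[OF that, of z] by simp
      qed
      have chz: "ones b (z div Z2 * Z2) \<le> \<rho>" using ch by linarith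
      have d: "d2 < 2 ^ h" "d1 < 2 ^ h" "d0 \<le> w"
        using dless[OF Z_pos(2)] dless[OF Z_pos(1)] dless[OF w_pos] Z1_less Z2_less z(2)
        unfolding d2_def d1_def d0_def Z1_def[symmetric] Z2_def[symmetric] by linarith+
      have XU: "X2 < 2 ^ U" "X1 < 2 ^ U" "X2 \<le> Q ^ 4" "X1 \<le> Q ^ 4"
        unfolding X2_def X1_def using cell_pack_Q4[OF Z2_less] cell_pack_Q4[OF Z1_less] by simp_all
      have fe: "field_entry h q X2 d2 = Suc (z div Z1 mod q)" "field_entry h q X1 d1 = Suc (z div w mod q)"
        using field_entry_cell_pack[of q Z1 h "lev_bit b" z "z div Z2", OF Z2_less z(1)]
          field_entry_cell_pack[of q w h "lev_bit b" z "z div Z1", OF Z1_less z(1)] Z_pos q_pos w_pos z(2)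
        by (simp_all add: X2_def X1_def d2_def d1_def Z1_def[symmetric] Z2_def[symmetric])
      have te: "M (t + 6 + 3 * (X2 * 2 ^ h + d2)) = Suc (z div Z1 mod q)" "M (t + 6 + 3 * (X1 * 2 ^ h + d1)) = Suc (z div w mod q)"
        using table_entries(3)[OF XU(1) d(1)] table_entries(3)[OF XU(2) d(2)] fe by simp_all
      have fl: "X2 div 2 ^ (z div Z1 mod q * h) mod 2 ^ h = d2 - d1" "X1 div 2 ^ (z div w mod q * h) mod 2 ^ h = d1 - d0"
        "d1 \<le> d2" "d0 \<le> d1"
        using fields[of z] ch by (simp_all add: X2_def X1_def d2_def d1_def d0_def)
      define y where "y = Bit_Operations.xor (bit_word (z div w)) (M (t + 2 + b))"
      have Mw: "M (loc w 2 0 0 + z div w) = bit_word (z div w)" by (rule M_bits[OF z(3,4)])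
      have y_less: "y < 2 ^ w" unfolding y_def by (rule xor_less_power[OF bit_word_less M_word])
      have tz: "target z" "cnt target z - cnt target (z div w * w) = d0"
      proof -
        show "target z" using z(1) zN b by (auto simp: target_def lev_bit_def)
        have "z div w * w \<le> N" using zN(2) by (meson div_times_less_eq_dividend le_trans)
        then show "cnt target z - cnt target (z div w * w) = d0"
          using cnt_target[OF zN(2)] cnt_target z(2) by (simp add: d0_def)
      qed
      have ws: "(\<Sum>p<T. of_bool (pop y (Suc p) \<le> d0)) = z mod w" if "w \<le> T" for T
        using word_select[of w y target "z div w" z T, OF word_value[OF y_def]] w_pos that tz by simp
      have sel_le: "\<forall>m. (\<Sum>p<m. of_bool (pop y (Suc p) \<le> d0)) \<le> w"
      proof
        fix m show "(\<Sum>p<m. of_bool (pop y (Suc p) \<le> d0)) \<le> w"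
        proof (cases "w \<le> m")
          case True
          then show ?thesis using ws[OF True] w_pos by (simp add: less_imp_le)
        next
          case False
          then show ?thesis using sum_bool_less[of "\<lambda>p. pop y (Suc p) \<le> d0" m] by linarith
        qed
      qed
      have sel: "(\<Sum>c<K. sel_entry w U (y div 2 ^ (c * U) mod 2 ^ U) (d0 + w - pop y (c * U))) = z mod w"
        unfolding scan_chunks(2)[OF y_less] using ws K by simp
      have dQ: "d2 \<le> Q ^ 4" "d1 \<le> Q ^ 4" "d0 \<le> Q ^ 4" using bnd(7) unfolding d2_def d1_def d0_def by linarith+
      have cQ: "z div Z2 \<le> Q ^ 4" "z div Z1 \<le> Q ^ 4" "z div w \<le> Q ^ 4" "P0 div Z2 \<le> Q ^ 4" "z div Z1 mod q \<le> Q ^ 4" "z div w mod q \<le> Q ^ 4"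
        "Suc (z div Z1 mod q) \<le> Q ^ 4" "Suc (z div w mod q) \<le> Q ^ 4"
      proof -
        show "z div Z2 \<le> Q ^ 4" "z div Z1 \<le> Q ^ 4" "z div w \<le> Q ^ 4" "P0 div Z2 \<le> Q ^ 4"
          using bnd(1,5) by (meson div_le_dividend le_trans)+
        have "Suc (a mod q) \<le> q" for a using q_pos by (simp add: Suc_le_eq)
        then have "Suc (a mod q) \<le> Q ^ 4" for a using params_le_Q4(8) by (meson order_trans)
        then show "Suc (z div Z1 mod q) \<le> Q ^ 4" "Suc (z div w mod q) \<le> Q ^ 4"
          "z div Z1 mod q \<le> Q ^ 4" "z div w mod q \<le> Q ^ 4" by (meson Suc_leD)+
      qed
      have oQ: "ones b (z div Z2 * Z2) \<le> Q ^ 4" "ones b (Suc (P0 div Z2) * Z2) \<le> Q ^ 4"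
      proof -
        show "ones b (z div Z2 * Z2) \<le> Q ^ 4" using ch bnd(7) by linarith
        have "P0 div Z2 * Z2 \<le> P0" by simp
        moreover have "Suc (P0 div Z2) * Z2 = P0 div Z2 * Z2 + Z2" by simp
        ultimately have "Suc (P0 div Z2) * Z2 \<le> NN" using P0(2) zN(1) NN_lower by linarith
        then show "ones b (Suc (P0 div Z2) * Z2) \<le> Q ^ 4" by (rule ones_Q4)
      qed
      define A4 where "A4 = ones b (Suc (P0 div Z2) * Z2)"
      have A4: "M (sb + (40 + b) + 64 * (Suc (P0 div Z2) - nst v div Z2)) = A4" "A4 \<le> Q ^ 4"
        "P0 div Z2 + of_bool (A4 \<le> \<rho>) = z div Z2"
        using Mz(4) oQ(2) c0 unfolding A4_def by (simp_all only: Suc_eq_plus1)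
      note nc = nested_cells(1,2)[of z, symmetric]
      show ?thesis
      proof (rule qwp_Cond0[OF w_large], goal_cases)
        case 3
        show ?case unfolding dense_prog_def
          apply (rule qwp_Seq, rule qwp_asg[OF w_large, where v = "P0 div Z2"], (simp add: D bnd; fail), (simp add: D bnd; fail))
          apply (rule qwp_Seq, rule qwp_asg[OF w_large, where v = "z div Z2"],
              (simp add: D bnd M_sb A4 cQ rP less_Suc_eq_le; fail), (simp add: D bnd M_sb A4 cQ rP less_Suc_eq_le; fail))
          apply (rule qwp_Seq, rule qwp_asg[OF w_large, where v = d2],
              (simp add: D bnd M_sb Mz(1) cQ oQ(1) rng chz d2_def[symmetric]; fail), (simp add: D bnd M_sb Mz(1) cQ oQ(1) rng chz d2_def[symmetric]; fail))
          apply (rule qwp_Seq, rule qwp_asg[OF w_large, where v = X2],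
              (simp add: D bnd M_sb Mz cQ XU rng X2_def[symmetric]; fail), (simp add: D bnd M_sb Mz cQ XU rng X2_def[symmetric]; fail))
          apply (rule qwp_Seq, rule qwp_asg[OF w_large, where v = "z div Z1 mod q"],
              (use te in \<open>simp add: D bnd cQ XU dQ pow_h; fail\<close>), (use te in \<open>simp add: D bnd cQ XU dQ pow_h; fail\<close>))
          apply (rule qwp_Seq, rule qwp_asg[OF w_large, where v = d1],
              (simp add: D bnd fl cQ XU dQ pow_h; fail), (simp add: D bnd fl cQ XU dQ pow_h; fail))
          apply (rule qwp_Seq, rule qwp_asg[OF w_large, where v = "z div Z1"],
              (simp add: D bnd cQ nc; fail), (simp add: D bnd cQ nc; fail))
          apply (rule qwp_Seq, rule qwp_asg[OF w_large, where v = X1],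
              (simp add: D bnd M_sb Mz cQ XU rng X1_def[symmetric]; fail), (simp add: D bnd M_sb Mz cQ XU rng X1_def[symmetric]; fail))
          apply (rule qwp_Seq, rule qwp_asg[OF w_large, where v = "z div w mod q"],
              (use te in \<open>simp add: D bnd cQ XU dQ pow_h; fail\<close>), (use te in \<open>simp add: D bnd cQ XU dQ pow_h; fail\<close>))
          apply (rule qwp_Seq, rule qwp_asg[OF w_large, where v = d0],
              (simp add: D bnd fl cQ XU dQ pow_h; fail), (simp add: D bnd fl cQ XU dQ pow_h; fail))
          apply (rule qwp_Seq, rule qwp_asg[OF w_large, where v = "z div w"],
              (simp add: D bnd cQ nc; fail), (simp add: D bnd cQ nc; fail))
          apply (rule qwp_Seq, rule qwp_asg[OF w_large, where v = y],
              (simp add: D bnd cQ Mw M_rec bw bit_word_less y_def; fail), (simp add: D bnd cQ Mw M_rec bw bit_word_less y_def; fail))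
          apply (rule qwp_Seq, rule qwp_mono[OF scan_qwp[where d = d0 and i = j and y = y]])
               apply (intro qregs_upd R1; simp)
              apply (simp; fail)
             apply (rule y_less)
            apply (simp; fail)
           apply (rule d(3))
          apply (rule sel_le)
        proof (elim conjE)
          fix R2 :: "nat \<Rightarrow> nat" let ?R2 = "?R(26 := P0 div Z2, 26 := z div Z2, 27 := d2, 28 := X2, 29 := z div Z1 mod q, 27 := d1, 26 := z div Z1,
            28 := X1, 29 := z div w mod q, 16 := d0, 26 := z div w, 15 := y)"
          assume R2: "qregs R2 j" "\<forall>x'. x' \<notin> {15, 17, 18} \<longrightarrow> R2 x' = ?R2 x'"
            "R2 18 = (if True then \<Sum>c<K. sel_entry w U (y div 2 ^ (c * U) mod 2 ^ U) (d0 + w - pop y (c * U)) else 0)"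
          have r26: "R2 26 = z div w" using R2(2) by simp
          have "z mod w \<le> Q ^ 4" using w_pos by (intro BB_Q4(2)) simp
          then show "qwp w r (asg 0 (Rg 26 \<otimes> Rg 3 \<oplus> Rg 18 \<ominus> Rg 13)) R2 M ?Post"
            using qregsD[OF R2(1)] R2(3) r26 sel cQ bnd z(3) goal
            by (intro qwp_asg[OF w_large, where v = "z - nst v"]) simp_all
        qed
      qed (use DR bnd P0 False in \<open>auto\<close>)
    qed
    show "qwp w r (Seq (asg 21 (Rg 5 \<oplus> struct_e 36 (Num 0)))
      (Seq (asg 22 (Rg 3 \<otimes> Rg 6))
      (Seq (asg 23 (Rg 5 \<oslash> Rg 22))
      (Seq (asg 24 (struct_e 44 (Rg 23)))
      (Seq (asg 25 (struct_e 44 (Rg 23 \<oplus> Num 1)))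
           (Cond (cp (Lt (Rg 9) (Rg 25 \<ominus> Rg 24 \<oplus> Num 1)))
              (asg 0 (struct_e 46 ((Rg 24 \<ominus> Rg 13) \<oslash> Rg 9 \<otimes> Rg 22 \<oplus> Rg 5 \<odot> Rg 22)))
              (dense_prog K))))))) R1 M ?Post"
      apply (rule qwp_Seq, rule qwp_asg[OF w_large, where v = \<rho>], (use D bnd M_sb M_struct(1) in \<open>simp add: \<rho>_def; fail\<close>)+)
      apply (rule qwp_Seq, rule qwp_asg[OF w_large, where v = G], (simp add: D G; fail), (simp add: D G; fail))
      apply (rule qwp_Seq, rule qwp_asg[OF w_large, where v = k], (simp add: D bnd k_def[symmetric]; fail), (simp add: D bnd k_def[symmetric]; fail))
      apply (rule qwp_Seq, rule qwp_asg[OF w_large, where v = P0], (simp add: D bnd M_sb MP; fail), (simp add: D bnd M_sb MP; fail))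
      apply (rule qwp_Seq, rule qwp_asg[OF w_large, where v = P1], (use MP(2) in \<open>simp add: D bnd M_sb; fail\<close>), (use MP(2) in \<open>simp add: D bnd M_sb; fail\<close>))
      apply (rule main)
      done
  qed
qed

end

section \<open>The final memory\<close>

context wavelet_input
begin

definition rec :: "nat \<Rightarrow> nat" where "rec v = loc w 48 v 0"

definition tab_pos :: nat where "tab_pos = loc w 3 0 0"

lemma rec_add: "k < 16 \<Longrightarrow> rec v + k = loc w (48 + k) v 0"
  by (simp add: rec_def loc_def)

lemma struct_len_Q:
  assumes "m \<le> N" shows "struct_len m < Q"
proof -
  have m: "64 * m \<le> BB" using assms less_NN(1) NN_BB by linarith
  have "m div Z2 * G \<le> m * BB" by (intro mult_mono params_le_BB) auto
  then have "64 * (m div Z2 * G) \<le> 64 * m * BB" by simp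
  also have "\<dots> \<le> BB * BB" using m by (rule mult_right_mono) simp
  also have "\<dots> \<le> Q" by (rule BB_sq)
  finally have 1: "64 * (m div Z2 * G) \<le> Q" .
  have "m div Z1 \<le> m" "m div G \<le> m" by simp_all
  moreover have "4 * BB \<le> Q"
  proof -
    have "4 * BB \<le> BB * BB" using params_le_BB(18) by (rule mult_right_mono) simp
    then show ?thesis using BB_sq by linarith
  qed
  ultimately show ?thesis unfolding struct_len_def using 1 m params_le_BB(18) by linarith
qed

text \<open>The windows are specified by positions, and this finds a position for each cell. In a
  cell met by the node it is the first position of the node there; the cell after the last one is
  reached by \<open>d = 1\<close>.\<close>

lemma cell_witness:
  assumes ne: "nst v < nen v" and c: "nst v div Z \<le> c" "c \<le> Suc ((nen v - 1) div Z)" and Z: "0 < Z"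
  shows "\<exists>x d. x < N \<and> own x = v \<and> d < (2::nat) \<and> c = x div Z + d"
proof (cases "c = Suc ((nen v - 1) div Z)")
  case True
  have "nen v - 1 < N \<and> own (nen v - 1) = v" by (rule node_positions) (use ne in auto)
  then show ?thesis using True by (intro exI[of _ "nen v - 1"] exI[of _ 1]) simp
next
  case False
  define x where "x = max (nst v) (c * Z)"
  have "c \<le> (nen v - 1) div Z" using False c(2) by simp
  then have "c * Z \<le> nen v - 1" using Z by (simp add: less_eq_div_iff_mult_less_eq)
  then have x: "nst v \<le> x" "x < nen v" using ne by (auto simp: x_def)
  have "x div Z = c"
  proof (cases "nst v \<le> c * Z")
    case True
    then show ?thesis using Z by (simp add: x_def)
  next
    case F: False
    then have "c \<le> nst v div Z" using Z by (simp add: less_eq_div_iff_mult_less_eq)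
    then show ?thesis using F c(1) by (simp add: x_def)
  qed
  then show ?thesis using node_positions[OF x] by (intro exI[of _ x] exI[of _ 0]) simp
qed

text \<open>Integer division of a sum exceeds the sum of the quotients by at most 1. So for a node
  of length m the column is at most m div Z1 + 2, which is why \<open>struct_len\<close> has the
  summand 3.\<close>

lemma window_index:
  assumes "nst v < nen v" "c \<le> Suc ((nen v - 1) div Z)" "Z1 \<le> Z"
  shows "c - nst v div Z < struct_len (nen v - nst v)"
proof -
  let ?m = "nen v - nst v"
  have "(nen v - 1) div Z \<le> (nst v + ?m) div Z" by (rule div_le_mono) simp
  also have "\<dots> \<le> nst v div Z + ?m div Z + 1"
  proof -
    have Z: "0 < Z" using assms(3) Z_pos(1) by simp
    have "nst v < nst v div Z * Z + Z" "?m < ?m div Z * Z + Z"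
      using Z by (metis add.commute dividend_less_div_times)+
    then have "nst v + ?m < (nst v div Z + ?m div Z + 2) * Z" unfolding add_mult_distrib by linarith
    then have "(nst v + ?m) div Z < nst v div Z + ?m div Z + 2" by (rule less_mult_imp_div_less)
    then show ?thesis by simp
  qed
  also have "?m div Z \<le> ?m div Z1" using assms(3) Z_pos(1) by (rule div_le_mono2[rotated])
  finally show ?thesis using assms(2) unfolding struct_len_def by linarith
qed

lemma count_list_node_bits:
  assumes "i \<le> nen v - nst v"
  shows "count_list (take i (node_bits v)) bb = ones (of_bool bb) (nst v + i) - ones (of_bool bb) (nst v)"
  using assms
proof (induction i)
  case (Suc i)
  have x: "nst v + i < N" using Suc.prems nen_bounds[of v] by linarith
  have "take (Suc i) (node_bits v) = take i (node_bits v) @ [lbit (nst v + i)]"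
    using Suc.prems by (simp add: take_Suc_conv_app_nth node_bits_def)
  then have "count_list (take (Suc i) (node_bits v)) bb =
      count_list (take i (node_bits v)) bb + of_bool (lbit (nst v + i) = bb)" by simp
  moreover have "lev_bit (of_bool bb) (nst v + i) \<longleftrightarrow> lbit (nst v + i) = bb" using x by (auto simp: lev_bit_def)
  moreover have "ones (of_bool bb) (nst v) \<le> ones (of_bool bb) (nst v + i)" by (rule cnt_mono) simp
  ultimately show ?case using Suc by simp
qed simp

definition final_memory :: "(nat \<Rightarrow> nat) \<Rightarrow> bool" where
  "final_memory M \<longleftrightarrow> (\<forall>a\<in>built. spec a (rd w M a))"

lemma final_spec: "final_memory M \<Longrightarrow> a \<in> built \<Longrightarrow> spec a (rd w M a)"
  by (simp add: final_memory_def)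

lemma final_record:
  assumes M: "final_memory M" and v: "v < 2 ^ L'"
  shows "M (rec v) = loc w 2 0 0" "M (rec v + 1) = nst v" "M (rec v + 2) = nen v - nst v"
    "M (rec v + 3) = loc w 16 v 0 - 16" "M (rec v + 4) = 64 * struct_len (nen v - nst v)"
    "M (rec v + 5) = rec (2 * v)" "M (rec v + 6) = rec (2 * v + 1)"
proof -
  have vQ: "v < Q" using lane_Q(5)[OF v] .
  have r: "M (rec v + k) = rd w M (48 + k) v 0" if "k < 16" for k
    using rec_add[OF that] vQ by (simp add: rd_def)
  have "spec a (rd w M a)" if "a \<in> {48, 49, 50, 51, 52, 53, 54}" for a
    using final_spec[OF M, of a] that by (auto simp: built_def)
  then have "rd w M 48 v 0 = loc w 2 0 0" "rd w M 49 v 0 = nst v" "rd w M 50 v 0 = nen v - nst v"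
    "rd w M 51 v 0 = loc w 16 v 0 - 16" "rd w M 52 v 0 = 64 * struct_len (nen v - nst v)"
    "rd w M 53 v 0 = loc w 48 (2 * v) 0" "rd w M 54 v 0 = loc w 48 (2 * v + 1) 0"
    using v spec_single(12-18) by (metis insertCI)+
  then show "M (rec v) = loc w 2 0 0" "M (rec v + 1) = nst v" "M (rec v + 2) = nen v - nst v"
    "M (rec v + 3) = loc w 16 v 0 - 16" "M (rec v + 4) = 64 * struct_len (nen v - nst v)"
    "M (rec v + 5) = rec (2 * v)" "M (rec v + 6) = rec (2 * v + 1)"
    using r[of 0] r[of 1] r[of 2] r[of 3] r[of 4] r[of 5] r[of 6] by (simp_all add: rec_def)
qed

lemma final_table:
  assumes M: "final_memory M" and y: "y < length (rs_table n w)"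
  shows "M (tab_pos + y) = rs_table n w ! y"
proof -
  have "y < Q" using y TL3_Q by (simp add: length_rs_table)
  moreover have "tab_pos + y = loc w 3 0 y" by (simp add: tab_pos_def loc_def)
  ultimately have "M (tab_pos + y) = rd w M 3 0 y" by (simp add: rd_def)
  then show ?thesis using final_spec[OF M, of 3] y by (simp add: built_def spec_single)
qed

lemma final_bits:
  assumes M: "final_memory M" and x: "x < N"
  shows "M (loc w 2 0 0 + x div w) = bit_word (x div w)"
proof -
  have k: "x div w < NW" using x less_NN(1) NN_mult(3) by (simp add: less_mult_imp_div_less)
  then have "x div w < Q" using lane_Q(9)[of "x div w"] by simp
  moreover have "loc w 2 0 0 + x div w = loc w 2 0 (x div w)" by (simp add: loc_def)
  ultimately have "M (loc w 2 0 0 + x div w) = rd w M 2 0 (x div w)" by (simp add: rd_def)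
  then show ?thesis using final_spec[OF M, of 2] k by (simp add: built_def spec_single)
qed

lemma final_struct:
  assumes v: "v < 2 ^ L'" and a: "16 \<le> a" "a < 64" and k: "k < struct_len (nen v - nst v)"
  shows "M (loc w 16 v 0 - 16 + a + 64 * k) = rd w M a v k"
    "loc w 16 v 0 - 16 + a + 64 * k \<in> {loc w 16 v 0 - 16..<loc w 16 v 0 - 16 + 64 * struct_len (nen v - nst v)}"
proof -
  have "nen v - nst v \<le> N" using nen_bounds(2)[of v] by linarith
  then have "k < Q" "v < Q" using k struct_len_Q[of "nen v - nst v"] lane_Q(5)[OF v] by linarith+
  moreover have "loc w 16 v 0 - 16 + a + 64 * k = loc w a v k" using a by (simp add: loc_def)
  ultimately show "M (loc w 16 v 0 - 16 + a + 64 * k) = rd w M a v k" by (simp add: rd_def)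
  have "64 * k + 64 \<le> 64 * struct_len (nen v - nst v)" using k by simp
  then show "loc w 16 v 0 - 16 + a + 64 * k \<in> {loc w 16 v 0 - 16..<loc w 16 v 0 - 16 + 64 * struct_len (nen v - nst v)}"
    using a by auto
qed

lemma final_bitmap:
  assumes M: "final_memory M" and v: "v < 2 ^ L'"
  shows "has_bitmap w M (rec v) (node_bits v)"
  unfolding has_bitmap_def
proof (intro conjI allI impI)
  note r = final_record[OF M v]
  show "M (rec v + 2) = length (node_bits v)" using r by (simp add: length_node_bits)
  fix i assume "i < length (node_bits v)"
  then have i: "i < nen v - nst v" by (simp add: length_node_bits)
  let ?x = "nst v + i"
  have x: "?x < N" using i nen_bounds(2)[of v] by linarith
  have "bit (bit_word (?x div w)) (?x mod w) \<longleftrightarrow> lev_bit 1 ?x"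
    using bit_word_digit[of "?x mod w" "?x div w"] w_pos by (simp add: bit_iff_odd odd_iff_mod_2_eq_one)
  then show "bit (M (M (rec v) + (M (rec v + 1) + i) div w)) ((M (rec v + 1) + i) mod w) = node_bits v ! i"
    using final_bits[OF M x] r(1,2) x i by (simp add: lev_bit_def node_bits_def)
qed

text \<open>Each address read must be shown to be among the query words, the only ones at which
  \<open>M'\<close> is known to agree with the constructed memory.\<close>

lemma node_query_final:
  assumes M: "final_memory M" and v: "v < 2 ^ L'" and ne: "nst v < nen v" and b: "b < 2" and K: "w \<le> K * U"
    and words: "words w M'"
    and agree: "\<And>a. a \<in> query_words w M tab_pos (length (rs_table n w)) (rec v) \<Longrightarrow> M' a = M a"
  shows "node_query n \<sigma> w S r M' tab_pos (rec v) v b K"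
proof unfold_locales
  note r = final_record[OF M v]
  let ?sb = "loc w 16 v 0 - 16" and ?len = "struct_len (nen v - nst v)"
  have sp: "spec (x + b) (rd w M (x + b))" if "x \<in> {36, 38, 40, 42, 44, 46}" for x
    using final_spec[OF M, of "x + b"] that b by (auto simp: built_def less_2_cases_iff)
  have st: "M' (?sb + (a + b) + 64 * k) = rd w M (a + b) v k" if "a \<in> {36, 38, 40, 42, 44, 46}" "k < ?len" for a k
  proof -
    have ab: "16 \<le> a + b" "a + b < 64" using that(1) b by auto
    have "M' (?sb + (a + b) + 64 * k) = M (?sb + (a + b) + 64 * k)"
    proof (rule agree)
      have "M (rec v + 3) = ?sb" "M (rec v + 4) = 64 * ?len" using r by simp_all
      then show "?sb + (a + b) + 64 * k \<in> query_words w M tab_pos (length (rs_table n w)) (rec v)"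
        unfolding query_words_def using final_struct(2)[OF v ab that(2)] by simp
    qed
    then show ?thesis using final_struct(1)[OF v ab that(2), of M] by simp
  qed
  have vQ: "v < Q" using lane_Q(5)[OF v] .
  show "b < 2" "w \<le> K * U" "nst v < nen v" "v < 2 ^ L'" by fact+
  have "rec v < Q ^ 3" "tab_pos < Q ^ 3" unfolding rec_def tab_pos_def using vQ by (intro loc_less[OF w_large]; simp)+
  then show "rec v \<le> Q ^ 3" "tab_pos \<le> Q ^ 3" by simp_all
  show "M' a < 2 ^ w" for a using words by (simp add: words_def)
  have rq: "M' (rec v + k) = M (rec v + k)" if "k < 5" for k
    by (rule agree) (use that in \<open>simp add: query_words_def\<close>)
  show "M' (rec v) = loc w 2 0 0" "M' (rec v + 1) = nst v" "M' (rec v + 3) = ?sb"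
    using rq[of 0] rq[of 1] rq[of 3] r by simp_all
  show "M' (tab_pos + y) = rs_table n w ! y" if "y < length (rs_table n w)" for y
  proof -
    have "M' (tab_pos + y) = M (tab_pos + y)" by (rule agree) (use that in \<open>simp add: query_words_def\<close>)
    then show ?thesis using final_table[OF M that] by simp
  qed
  show "M' (loc w 2 0 0 + x div w) = bit_word (x div w)" if "nst v \<le> x" "x < nen v" for x
  proof -
    have "M' (loc w 2 0 0 + x div w) = M (loc w 2 0 0 + x div w)"
    proof (rule agree)
      have "loc w 2 0 0 + x div w = M (rec v) + (M (rec v + 1) + (x - nst v)) div w" using r that by simp
      moreover have "x - nst v \<in> {..<M (rec v + 2)}" using r(3) that by simp
      ultimately have "loc w 2 0 0 + x div w \<in> bitmap_words w M (rec v)" unfolding bitmap_words_def by blast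
      then show "loc w 2 0 0 + x div w \<in> query_words w M tab_pos (length (rs_table n w)) (rec v)"
        by (simp add: query_words_def)
    qed
    moreover have "x < N" using that nen_bounds(2)[of v] by linarith
    ultimately show ?thesis using final_bits[OF M] by simp
  qed
  have st_own: "nst v < N" "own (nst v) = v" using node_positions[of v "nst v"] ne by simp_all
  show "M' (?sb + (36 + b)) = ones b (nst v)"
  proof -
    have "rd w M (36 + b) (own (nst v)) 0 = ones b (nst (own (nst v)))"
      using sp[of 36] spec_pair(7)[OF b] st_own(1) by blast
    then show ?thesis using st[of 36 0] unfolding st_own(2) by (simp add: struct_len_def)
  qed
  show "M' (?sb + (38 + b) + 64 * (c - nst v div Z1)) = cell_pack (lev_bit b) h q w c"
    if c: "nst v div Z1 \<le> c" "c \<le> Suc ((nen v - 1) div Z1)" for c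
  proof -
    from cell_witness[OF ne c Z_pos(1)] obtain x d where "x < N" "own x = v" "d < 2" "c = x div Z1 + d" by blast
    then show ?thesis
      using st[of 38, OF _ window_index[OF ne c(2) order_refl]] sp[of 38] spec_pair(8)[OF b] by auto
  qed
  show "M' (?sb + (40 + b) + 64 * (c - nst v div Z2)) = ones b (c * Z2)"
    if c: "nst v div Z2 \<le> c" "c \<le> Suc ((nen v - 1) div Z2)" for c
  proof -
    from cell_witness[OF ne c Z_pos(2)] obtain x d where "x < N" "own x = v" "d < 2" "c = x div Z2 + d" by blast
    then show ?thesis
      using st[of 40, OF _ window_index[OF ne c(2) w_le_Z(2)]] sp[of 40] spec_pair(9)[OF b] by auto
  qed
  show "M' (?sb + (42 + b) + 64 * (c - nst v div Z2)) = cell_pack (lev_bit b) h q Z1 c"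
    if c: "nst v div Z2 \<le> c" "c \<le> Suc ((nen v - 1) div Z2)" for c
  proof -
    from cell_witness[OF ne c Z_pos(2)] obtain x d where "x < N" "own x = v" "d < 2" "c = x div Z2 + d" by blast
    then show ?thesis
      using st[of 42, OF _ window_index[OF ne c(2) w_le_Z(2)]] sp[of 42] spec_pair(10)[OF b] by auto
  qed
  show "M' (?sb + (44 + b) + 64 * k) = sample b v k"
    if k: "k \<le> (ones b (nen v) - ones b (nst v) + G - 1) div G" for k
  proof -
    have "ones b (nst v + (nen v - nst v)) \<le> ones b (nst v) + (nen v - nst v)" by (rule cnt_add_le)
    then have "ones b (nen v) - ones b (nst v) \<le> nen v - nst v" using ne by simp
    then have "(ones b (nen v) - ones b (nst v) + G - 1) div G \<le> (nen v - nst v + G) div G" by (intro div_le_mono) simp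
    also have "\<dots> = (nen v - nst v) div G + 1" using G_pos by simp
    finally have "k < ?len" using k by (simp add: struct_len_def)
    then have s: "M' (?sb + (44 + b) + 64 * k) = rd w M (44 + b) v k" using st[of 44 k] by simp
    have "k \<le> (ones b (nen (own (nst v))) - ones b (nst (own (nst v))) + G - 1) div G"
      unfolding st_own(2) by (rule k)
    then have "rd w M (44 + b) (own (nst v)) k = sample b (own (nst v)) k"
      using sp[of 44] spec_pair(11)[OF b] st_own(1) by blast
    then show ?thesis unfolding s st_own(2) .
  qed
  show "M' (?sb + (46 + b) + 64 * ((sample b v (local_rank b x div G) - nst v) div Z2 * G + local_rank b x mod G)) = x - nst v"
    if x: "nst v \<le> x" "x < nen v" "lev_bit b x"
      "Z2 \<le> sample b v (local_rank b x div G + 1) - sample b v (local_rank b x div G)" for x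
  proof -
    let ?P = "sample b v (local_rank b x div G)"
    have xv: "x < N" "own x = v" using node_positions[OF x(1,2)] by simp_all
    \<comment> \<open>A sparse group ends inside the node, so \<open>Z2\<close> further positions of
      the node start at its first sample. Hence the number of its block is below the length of the
      node divided by \<open>Z2\<close>.\<close>
    have "?P - nst v + Z2 \<le> nen v - nst v"
      using x(4) sample_bounds(1)[of v b "local_rank b x div G"]
        sample_bounds(2)[of b v "local_rank b x div G + 1"] Z_pos(2) by linarith
    then have "(?P - nst v + Z2) div Z2 \<le> (nen v - nst v) div Z2" by (rule div_le_mono)
    then have "(?P - nst v) div Z2 + 1 \<le> (nen v - nst v) div Z2" using Z_pos(2) by simp
    then have "((?P - nst v) div Z2 + 1) * G \<le> (nen v - nst v) div Z2 * G" by (rule mult_right_mono) simp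
    moreover have "local_rank b x mod G < G" using G_pos by simp
    ultimately have "(?P - nst v) div Z2 * G + local_rank b x mod G < ?len"
      unfolding struct_len_def add_mult_distrib mult_1 by linarith
    then have s: "M' (?sb + (46 + b) + 64 * ((?P - nst v) div Z2 * G + local_rank b x mod G)) =
        rd w M (46 + b) v ((?P - nst v) div Z2 * G + local_rank b x mod G)" by (intro st) simp_all
    have "\<forall>x<N. lev_bit b x \<longrightarrow>
        Z2 \<le> sample b (own x) (local_rank b x div G + 1) - sample b (own x) (local_rank b x div G) \<longrightarrow>
        rd w M (46 + b) (own x)
          ((sample b (own x) (local_rank b x div G) - nst (own x)) div Z2 * G + local_rank b x mod G) = x - nst (own x)"
      using sp[of 46] spec_pair(12)[OF b] by (simp add: Let_def)
    from this[rule_format, OF xv(1) x(3)] show ?thesis unfolding s xv(2) using x(4) by blast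
  qed
qed

lemma final_rank_select:
  assumes M: "final_memory M" and v: "v < 2 ^ L'" and K: "w \<le> K * U"
    and c: "csz (rankq K) \<le> c" "csz (selectq K) \<le> c"
  shows "supports_rank_select w r (rankq K) (selectq K) c n M tab_pos (length (rs_table n w)) (rec v) (node_bits v)"
  unfolding supports_rank_select_def computes_query_def
proof (intro conjI allI impI)
  fix bb i R M'
  assume i: "i \<le> length (node_bits v)"
    and a: "words w R \<and> words w M' \<and> (\<forall>a\<in>query_words w M tab_pos (length (rs_table n w)) (rec v). M' a = M a) \<and>
      (\<forall>j<length [rec v, tab_pos, n, w, of_bool bb, i]. R j = [rec v, tab_pos, n, w, of_bool bb, i] ! j)"
  then have R: "R 0 = rec v" "R 1 = tab_pos" "R 3 = w" "R 4 = of_bool bb" "R 5 = i" and W: "words w M'"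
    by (auto simp: All_less_Suc numeral_eq_Suc)
  have i': "i \<le> nen v - nst v" using i by (simp add: length_node_bits)
  have b: "of_bool bb < (2::nat)" by simp
  have "qwp w r (rankq K) R M' (\<lambda>R'. R' 0 = ones (of_bool bb) (nst v + i) - ones (of_bool bb) (nst v))"
  proof (cases "i = 0")
    case True
    show ?thesis unfolding rankq_def
      by (rule qwp_Cond0[OF w_large], use R True in simp, use R True in simp, rule qwp_asg[OF w_large, where v = 0])
        (use True in simp_all)
  next
    case False
    then have "nst v < nen v" using i' by linarith
    then have "node_query n \<sigma> w S r M' tab_pos (rec v) v (of_bool bb) K"
      using a W by (intro node_query_final[OF M v _ b K]) auto
    from node_query.rank_correct[OF this R] False i' show ?thesis by simp
  qed
  then obtain R' wk dp where "exec w r (rankq K) (R, M') (R', M') wk dp" "wk \<le> csz (rankq K)"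
    "R' 0 = ones (of_bool bb) (nst v + i) - ones (of_bool bb) (nst v)" unfolding qwp_def by blast
  then show "\<exists>R' wk dp. exec w r (rankq K) (R, M') (R', M') wk dp \<and> wk \<le> c \<and> R' 0 = count_list (take i (node_bits v)) bb"
    using c(1) count_list_node_bits[OF i'] by (metis le_trans)
next
  fix bb j R M'
  assume j: "j < count_list (node_bits v) bb"
    and a: "words w R \<and> words w M' \<and> (\<forall>a\<in>query_words w M tab_pos (length (rs_table n w)) (rec v). M' a = M a) \<and>
      (\<forall>k<length [rec v, tab_pos, n, w, of_bool bb, j]. R k = [rec v, tab_pos, n, w, of_bool bb, j] ! k)"
  then have R: "R 0 = rec v" "R 1 = tab_pos" "R 3 = w" "R 4 = of_bool bb" "R 5 = j" and W: "words w M'"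
    by (auto simp: All_less_Suc numeral_eq_Suc)
  have b: "of_bool bb < (2::nat)" by simp
  have j': "j < ones (of_bool bb) (nen v) - ones (of_bool bb) (nst v)"
    using j count_list_node_bits[of "nen v - nst v" v bb] nen_bounds(1)[of v] by (simp add: length_node_bits)
  then have jj: "ones (of_bool bb) (nst v) + j < ones (of_bool bb) (nen v)" by linarith
  have "\<not> nen v \<le> nst v" using jj cnt_mono[of "nen v" "nst v" "lev_bit (of_bool bb)"] by linarith
  then have "nst v < nen v" by simp
  then have "node_query n \<sigma> w S r M' tab_pos (rec v) v (of_bool bb) K"
    using a W by (intro node_query_final[OF M v _ b K]) auto
  from node_query.select_correct[OF this R jj] obtain R' wk dp where
    e: "exec w r (selectq K) (R, M') (R', M') wk dp" "wk \<le> csz (selectq K)" and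
    s: "nst v + R' 0 < nen v" "lev_bit (of_bool bb) (nst v + R' 0)"
      "ones (of_bool bb) (nst v + R' 0) = ones (of_bool bb) (nst v) + j" unfolding qwp_def by blast
  have "R' 0 < length (node_bits v) \<and> node_bits v ! R' 0 = bb \<and> count_list (take (R' 0) (node_bits v)) bb = j"
  proof (intro conjI)
    show "R' 0 < length (node_bits v)" using s(1) by (simp add: length_node_bits)
    then show "node_bits v ! R' 0 = bb" using s(2) by (cases bb) (simp_all add: node_bits_def lev_bit_def)
    show "count_list (take (R' 0) (node_bits v)) bb = j"
      using count_list_node_bits[of "R' 0" v bb] s(1,3) by simp
  qed
  then show "\<exists>R' wk dp. exec w r (selectq K) (R, M') (R', M') wk dp \<and> wk \<le> c \<and>
      R' 0 < length (node_bits v) \<and> node_bits v ! R' 0 = bb \<and> count_list (take (R' 0) (node_bits v)) bb = j"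
    using e(1) le_trans[OF e(2) c(2)] by blast
qed

lemma final_wavelet_tree:
  assumes M: "final_memory M" and K: "w \<le> K * U" and c: "csz (rankq K) \<le> c" "csz (selectq K) \<le> c"
    and f: "\<And>m. m \<le> n \<Longrightarrow> real (64 * struct_len m * w) \<le> f m + real (c * w)"
  shows "wavelet_tree_in_memory w r (rankq K) (selectq K) c f n M tab_pos (length (rs_table n w)) (rec 1) (wavelet_tree \<sigma> S)"
  unfolding wavelet_tree_in_memory_def
proof (rule wavelet_tree_stored)
  fix v :: nat assume v: "v < 2 ^ L'" "0 < v"
  note r = final_record[OF M v(1)]
  show "has_bitmap w M (rec v) (node_bits v) \<and>
    real (M (rec v + 4) * w) \<le> f (length (node_bits v)) + real (c * w) \<and>
    supports_rank_select w r (rankq K) (selectq K) c n M tab_pos (length (rs_table n w)) (rec v) (node_bits v)"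
    using final_bitmap[OF M v(1)] final_rank_select[OF M v(1) K c] f[OF node_length] r(5)
    by (simp add: length_node_bits)
  show "M (rec v + 5) = rec (2 * v) \<and> M (rec v + 6) = rec (2 * v + 1)" using r by simp
qed

end

section \<open>Asymptotic bounds\<close>

lemma one_le_lg: "1 \<le> lg x"
  by (simp add: lg_def)

lemma lg_eq_log: "2 \<le> x \<Longrightarrow> lg x = log 2 (real x)"
  by (simp add: lg_def)

lemma lg_mono: "x \<le> y \<Longrightarrow> lg x \<le> lg y"
proof (cases "x = 0")
  case False
  assume "x \<le> y"
  with False have "log 2 (real x) \<le> log 2 (real y)" by simp
  then show ?thesis unfolding lg_def by (rule max.mono[OF order_refl])
qed (simp add: lg_def log_def)

lemma le_two_powr_lg: "real x \<le> 2 powr lg x"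
proof (cases "x = 0")
  case False
  then have "real x = 2 powr log 2 (real x)" by simp
  also have "\<dots> \<le> 2 powr lg x" by (intro powr_mono) (simp_all add: lg_def)
  finally show ?thesis .
qed simp

lemma lg_le_symbol_bits: "1 \<le> x \<Longrightarrow> lg x \<le> real (symbol_bits x) + 1"
  and lg_le_symbol_bits': "2 \<le> x \<Longrightarrow> lg x \<le> real (symbol_bits x)"
proof -
  have l: "log 2 (real x) \<le> real (symbol_bits x)" if "1 \<le> x"
  proof -
    have "real x \<le> 2 ^ symbol_bits x" using symbol_bits_bounds(1)[OF that]
      by (metis of_nat_le_iff of_nat_numeral of_nat_power)
    then show ?thesis using that by (simp add: log_le_iff powr_realpow)
  qed
  then show "1 \<le> x \<Longrightarrow> lg x \<le> real (symbol_bits x) + 1" by (simp add: lg_def)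
  show "2 \<le> x \<Longrightarrow> lg x \<le> real (symbol_bits x)" using l by (simp add: lg_eq_log)
qed

lemma symbol_bits_le_lg: "1 \<le> x \<Longrightarrow> real (symbol_bits x) \<le> lg x + 1"
proof -
  assume x: "1 \<le> x"
  have "real (2 ^ symbol_bits x) \<le> real (2 * x)" using symbol_bits_bounds(2)[OF x] by linarith
  then have "2 powr real (symbol_bits x) \<le> 2 * real x" by (simp add: powr_realpow)
  also have "\<dots> \<le> 2 * 2 powr lg x" using le_two_powr_lg by simp
  finally have "2 powr real (symbol_bits x) \<le> 2 powr (lg x + 1)" by (simp add: powr_add)
  then show ?thesis by simp
qed

text \<open>For a = w div 2^16 one has n < 2^(a + 1) and w \<le> 2^(16 + a), so the left side of
  \<open>rowlen_large\<close> is at most 2^(18 * a + 274). The row length is at least 2^(1024 * a),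
  and a \<ge> 1.\<close>

lemma wavelet_inputI:
  assumes "length S = n" "1 \<le> \<sigma>" "\<sigma> \<le> n" "set S \<subseteq> {0..<\<sigma>}" "stable_integer_sort r" "2 ^ 16 * lg n \<le> real w"
  shows "wavelet_input n \<sigma> w S r"
proof
  define a where "a = w div 2 ^ 16"
  have "(2 ^ 16 :: real) * 1 \<le> 2 ^ 16 * lg n" using one_le_lg by (intro mult_left_mono) auto
  then have w: "2 ^ 16 \<le> w" using assms(6) by simp
  then have a1: "1 \<le> a" by (simp add: a_def div_greater_zero_iff Suc_le_eq)
  have wa: "w < 2 ^ 16 * (a + 1)" "2 ^ 16 * a \<le> w" unfolding a_def by simp_all
  have "real w < real (2 ^ 16 * (a + 1))" using wa(1) by (simp only: of_nat_less_iff)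
  then have "lg n < real (a + 1)" using assms(6) by simp
  then have "2 powr lg n < 2 powr real (a + 1)" by simp
  then have "real n < 2 powr real (a + 1)" using le_two_powr_lg[of n] by linarith
  then have "real n < real (2 ^ (a + 1))" unfolding powr_realpow[OF zero_less_numeral] by simp
  then have n: "n < 2 ^ (a + 1)" by linarith
  have "a + 1 \<le> 2 ^ a" by (simp add: Suc_leI)
  then have "w \<le> 2 ^ 16 * 2 ^ a" using wa(1) by (meson le_trans less_imp_le mult_le_mono2)
  then have "w \<le> 2 ^ (16 + a)" by (simp add: power_add)
  then have "w ^ 8 \<le> (2 ^ (16 + a)) ^ 8" by (rule power_mono) simp
  then have "2 ^ 8 * n * w ^ 8 \<le> 2 ^ 8 * 2 ^ (a + 1) * (2 ^ (16 + a)) ^ 8"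
    using n by (intro mult_le_mono) auto
  also have "\<dots> = 2 ^ (8 + (a + 1) + (16 + a) * 8)" by (simp only: power_add power_mult)
  finally have "(2 ^ 8 * n * w ^ 8)\<^sup>2 \<le> (2 ^ (8 + (a + 1) + (16 + a) * 8))\<^sup>2" by (rule power_mono) simp
  also have "\<dots> = 2 ^ ((8 + (a + 1) + (16 + a) * 8) * 2)" by (simp only: power_mult)
  also have "\<dots> \<le> 2 ^ (w div 64)"
  proof (rule power_increasing)
    have "1024 * a \<le> w div 64" using wa(2) by (simp add: less_eq_div_iff_mult_less_eq)
    moreover have "(8 + (a + 1) + (16 + a) * 8) * 2 \<le> 1024 * a" using a1 by simp
    ultimately show "(8 + (a + 1) + (16 + a) * 8) * 2 \<le> w div 64" by (rule le_trans[rotated])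
  qed simp
  finally show "(2 ^ 8 * n * w ^ 8)\<^sup>2 \<le> rowlen w" by (simp add: rowlen_def)
  have "2 * n \<le> 2 ^ (a + 2)" using n by simp
  also have "\<dots> \<le> 2 ^ w" using wa(2) a1 by (intro power_increasing) simp_all
  finally show n2: "2 * n \<le> 2 ^ w" .
  have "(2::nat) ^ symbol_bits n < 2 ^ w" using symbol_bits_bounds(2)[of n] assms n2 by linarith
  then show "symbol_bits n < w" by (simp only: power_strict_increasing_iff)
  show "2 ^ 16 \<le> w" by (rule w)
qed (use assms in auto)

text \<open>With \<open>y\<close> in the place of \<open>w\<close>, this bounds the number 2^(U + h)
  of pairs of a chunk and an argument.\<close>

definition table_factor :: "nat \<Rightarrow> real \<Rightarrow> real" where
  "table_factor n y = (2 * real n) powr (1 / 4) * (81 * y ^ 6)"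

text \<open>The summands belong to the samples, the small cells and the sparse positions, in this
  order. The number 62208 is the constant of \<open>h_pow4\<close>.\<close>

definition struct_coeff :: "real \<Rightarrow> real" where
  "struct_coeff \<kappa> = 1 + 4 * \<kappa> * 62208 + 16 * \<kappa>\<^sup>2 * 62208"

text \<open>The bound may depend on the node length \<open>m\<close> only, whereas the cell sizes
  depend on n and w; \<open>h_ge_log_lg\<close> mediates between them. The 1 in the denominator
  covers small \<open>m\<close>, where the logarithm vanishes.\<close>

definition struct_bits :: "real \<Rightarrow> nat \<Rightarrow> real" where
  "struct_bits \<kappa> m = 64 * struct_coeff \<kappa> * real m / (1 + log 2 (lg m))"

definition table_bits :: "real \<Rightarrow> nat \<Rightarrow> real" where
  "table_bits \<kappa> n = (4 + 3 * table_factor n (\<kappa> * lg n)) * (\<kappa> * lg n)"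

lemma struct_bits_smallo: "struct_bits \<kappa> \<in> o(\<lambda>m. real m)"
proof (rule smalloI_tendsto)
  have "((\<lambda>m::nat. 64 * struct_coeff \<kappa> / (1 + log 2 (log 2 (real m)))) \<longlongrightarrow> 0) at_top" by real_asymp
  then show "((\<lambda>m. struct_bits \<kappa> m / real m) \<longlongrightarrow> 0) at_top"
  proof (rule Lim_transform_eventually)
    show "\<forall>\<^sub>F m::nat in at_top. 64 * struct_coeff \<kappa> / (1 + log 2 (log 2 (real m))) = struct_bits \<kappa> m / real m"
      using eventually_ge_at_top[of "2::nat"] by eventually_elim (simp add: struct_bits_def lg_eq_log)
  qed
  show "\<forall>\<^sub>F m::nat in at_top. real m \<noteq> 0" using eventually_ge_at_top[of "1::nat"] by eventually_elim simp
qed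

lemma table_bits_smallo: "table_bits \<kappa> \<in> o(\<lambda>n. real n)"
proof (rule smalloI_tendsto)
  let ?t = "\<lambda>n::nat. (4 + 3 * ((2 * real n) powr (1 / 4) * (81 * (\<kappa> * log 2 (real n)) ^ 6))) * (\<kappa> * log 2 (real n)) / real n"
  have "(?t \<longlongrightarrow> 0) at_top" unfolding power_mult_distrib by real_asymp
  then show "((\<lambda>n. table_bits \<kappa> n / real n) \<longlongrightarrow> 0) at_top"
  proof (rule Lim_transform_eventually)
    show "\<forall>\<^sub>F n in at_top. ?t n = table_bits \<kappa> n / real n"
      using eventually_ge_at_top[of "2::nat"]
      by eventually_elim (simp add: table_bits_def table_factor_def lg_eq_log)
  qed
  show "\<forall>\<^sub>F m::nat in at_top. real m \<noteq> 0" using eventually_ge_at_top[of "1::nat"] by eventually_elim simp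
qed

text \<open>These are the parts of the work besides positions and nodes: the padding, the word
  length and the construction of the table.\<close>

lemma lower_order_terms:
  assumes "0 < \<kappa>"
  shows "\<forall>\<^sub>F n in at_top. 3 * (\<kappa> * lg n) ^ 3 + \<kappa> * lg n + table_factor n (\<kappa> * lg n) * (\<kappa> * lg n + 1) \<le> real n"
proof -
  have "\<forall>\<^sub>F n::nat in at_top. 3 * (\<kappa> ^ 3 * log 2 (real n) ^ 3) + \<kappa> * log 2 (real n) +
      (2 * real n) powr (1 / 4) * (81 * (\<kappa> ^ 6 * log 2 (real n) ^ 6)) * (\<kappa> * log 2 (real n) + 1) \<le> real n"
    using assms by real_asymp
  with eventually_ge_at_top[of "2::nat"] show ?thesis
    by eventually_elim (simp add: table_factor_def lg_eq_log power_mult_distrib)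
qed

lemma table_factor_nonneg: "0 \<le> table_factor n y"
  by (simp add: table_factor_def)

lemma table_factor_mono: "0 \<le> x \<Longrightarrow> x \<le> y \<Longrightarrow> table_factor n x \<le> table_factor n y"
  unfolding table_factor_def by (intro mult_left_mono power_mono) auto

context wavelet_input
begin

section \<open>Size and running time of the construction\<close>

lemma lg_le_w: "lg n \<le> real w"
  using lg_le_symbol_bits[of n] sigma n_w(2) by linarith

lemma symbol_bits_less_U: "symbol_bits n < 4 * U"
proof -
  have "symbol_bits n < (symbol_bits n div (4 * h) + 1) * (4 * h)"
    using dividend_less_div_times[of "4 * h" "symbol_bits n"] h_pos by (simp add: add_mult_distrib)
  then show ?thesis by (simp add: U_def q_def mult_ac)
qed

text \<open>A word has at most \<kappa> * lg n bits, and lg n \<le> 4 * U. So a constant number of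
  chunks covers a word, and scanning it takes constant time.\<close>

lemma w_le_U:
  assumes "0 < \<kappa>" "real w \<le> \<kappa> * lg n"
  shows "w \<le> nat \<lceil>4 * \<kappa>\<rceil> * U"
proof -
  have "lg n \<le> real (4 * U)" using lg_le_symbol_bits[of n] sigma symbol_bits_less_U by linarith
  then have "\<kappa> * lg n \<le> \<kappa> * real (4 * U)" using assms(1) by (intro mult_left_mono) auto
  then have "real w \<le> (4 * \<kappa>) * real U" using assms(2) by simp
  also have "\<dots> \<le> real (nat \<lceil>4 * \<kappa>\<rceil>) * real U" by (intro mult_right_mono real_nat_ceiling_ge) simp
  finally have "real w \<le> real (nat \<lceil>4 * \<kappa>\<rceil> * U)" by simp
  then show ?thesis by linarith
qed

text \<open>With y = 2^(h div 12), h \<le> 12 * y, and y^12 \<le> 2^h \<le> (3 * w)^3 gives y^4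
  \<le> 3 * w. So the constant is 12^4 * 3 = 62208.\<close>

lemma h_pow4: "h ^ 4 \<le> 62208 * w"
proof -
  define y :: nat where "y = 2 ^ (h div 12)"
  have "h div 12 + 1 \<le> y" unfolding y_def by (simp add: Suc_leI)
  moreover have "h < 12 * (h div 12 + 1)" by simp
  ultimately have "h \<le> 12 * y" by linarith
  then have "h ^ 4 \<le> (12 * y) ^ 4" by (rule power_mono) simp
  then have h: "h ^ 4 \<le> 20736 * y ^ 4" by (simp add: power_mult_distrib)
  have "(y ^ 4) ^ 3 = 2 ^ (h div 12 * 4 * 3)" unfolding y_def by (simp only: power_mult)
  also have "\<dots> \<le> 2 ^ h" by (intro power_increasing) simp_all
  also have "\<dots> \<le> 9 * w ^ 3" by (rule h_bounds)
  also have "\<dots> \<le> (3 * w) ^ 3" by (simp add: power_mult_distrib)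
  finally have "(y ^ 4) ^ Suc 2 \<le> (3 * w) ^ Suc 2" by (simp add: numeral_3_eq_3)
  then have "y ^ 4 \<le> 3 * w" by (rule power_le_imp_le_base) simp
  with h show ?thesis by linarith
qed

text \<open>For t = symbol_bits n div (4 * h), U + h = t * h + 2 * h. The first term is at most a
  quarter of \<open>symbol_bits n\<close>, which gives the fourth root, and 2^(2 * h) \<le> (9 *
  w^3)^2.\<close>

lemma pow_U_h: "real (2 ^ (U + h)) \<le> table_factor n (real w)"
proof -
  let ?t = "symbol_bits n div (4 * h)"
  have "((2::nat) ^ (?t * h)) ^ 4 = 2 ^ (?t * (4 * h))" by (simp add: power_mult[symmetric] mult_ac)
  also have "\<dots> \<le> 2 ^ symbol_bits n" by (intro power_increasing div_times_less_eq_dividend) simp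
  also have "\<dots> \<le> 2 * n" using symbol_bits_bounds(2)[of n] sigma by linarith
  finally have "real (((2::nat) ^ (?t * h)) ^ 4) \<le> real (2 * n)" by (simp only: of_nat_le_iff)
  then have "(real (2 ^ (?t * h)) ^ 4) powr (1 / 4) \<le> (2 * real n) powr (1 / 4)" by (intro powr_mono2) simp_all
  moreover have "(real (2 ^ (?t * h)) ^ 4) powr (1 / 4) = real (2 ^ (?t * h))"
    by (simp add: powr_realpow[symmetric] powr_powr)
  ultimately have 1: "real (2 ^ (?t * h)) \<le> (2 * real n) powr (1 / 4)" by simp
  have "(2::nat) ^ (h + h) \<le> (9 * w ^ 3) * (9 * w ^ 3)" unfolding power_add by (intro mult_le_mono h_bounds)
  also have "\<dots> = 81 * w ^ 6" by (simp add: power_add[symmetric])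
  finally have "real (2 ^ (h + h)) \<le> real (81 * w ^ 6)" by (simp only: of_nat_le_iff)
  then have 2: "real (2 ^ (h + h)) \<le> 81 * real w ^ 6" by simp
  have "U + h = ?t * h + (h + h)" by (simp add: U_def q_def add_mult_distrib)
  then have "real (2 ^ (U + h)) = real (2 ^ (?t * h)) * real (2 ^ (h + h))" by (simp add: power_add)
  also have "\<dots> \<le> table_factor n (real w)" unfolding table_factor_def by (intro mult_mono 1 2) simp_all
  finally show ?thesis .
qed

lemma h_ge_log_lg:
  assumes "m \<le> n" shows "1 + log 2 (lg m) \<le> real h"
proof -
  have "2 * lg m \<le> 2 * real w" using lg_mono[OF assms] lg_le_w by linarith
  moreover have "w \<le> w ^ 3" using w_pos by (simp add: self_le_power)
  then have "2 * w \<le> 2 ^ h" using h_bounds(1) by linarith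
  then have "real (2 * w) \<le> real (2 ^ h)" by (simp only: of_nat_le_iff)
  ultimately have "2 * lg m \<le> 2 powr real h" by (simp add: powr_realpow)
  moreover have "0 < lg m" using one_le_lg[of m] by linarith
  ultimately have "log 2 (2 * lg m) \<le> real h" by (subst log_le_iff) simp_all
  then show ?thesis using \<open>0 < lg m\<close> by (simp add: log_mult)
qed

text \<open>Multiplied by \<open>h\<close>, the space is about m * h / q for small cells, m for
  samples and m * w * h^2 / q^2 for sparse positions. Since w \<le> 4 * \<kappa> * h * q, the first
  and the last are multiples of m * h^2 / w and m * h^4 / w, so \<open>h_pow4\<close> makes all
  three O(m).\<close>

lemma struct_size_bound:
  assumes \<kappa>: "0 < \<kappa>" "real w \<le> \<kappa> * lg n" and mn: "m \<le> n" and c: "192 \<le> c"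
  shows "real (64 * struct_len m * w) \<le> struct_bits \<kappa> m + real (c * w)"
proof -
  have lm: "0 < 1 + log 2 (lg m)" using one_le_lg[of m] by (smt (verit) zero_le_log_cancel_iff)
  have D0: "0 \<le> struct_coeff \<kappa>" using \<kappa>(1) by (simp add: struct_coeff_def)
  have cw: "192 * real w \<le> real (c * w)" using c by (simp add: mult_right_mono)
  let ?T = "(m div Z1 + m div G + m div Z2 * G) * w"
  have "real (64 * ?T) \<le> struct_bits \<kappa> m"
  proof (cases "m < w")
    case True
    \<comment> \<open>Below \<open>w\<close> positions only the constant part of the structure
      remains, and the allowance of \<open>c\<close> words absorbs it.\<close>
    have "w \<le> G" using h_pos by (simp add: G_def)
    then have "m div Z1 = 0" "m div G = 0" "m div Z2 = 0" using True w_le_Z by simp_all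
    then show ?thesis using D0 lm by (simp add: struct_bits_def)
  next
    case False
    then have "2 \<le> n" using mn w_large by simp
    then have "lg n \<le> real (4 * U)" using lg_le_symbol_bits'[of n] symbol_bits_less_U by linarith
    then have "\<kappa> * lg n \<le> \<kappa> * real (4 * U)" using \<kappa>(1) by (intro mult_left_mono) auto
    then have wq: "real w \<le> 4 * \<kappa> * real h * real q" using \<kappa>(2) by (simp add: U_def mult_ac)
    define d1 d2 d3 where d: "d1 = real (m div Z1)" "d2 = real (m div G)" "d3 = real (m div Z2)"
    have d0: "0 \<le> d1" "0 \<le> d2" "0 \<le> d3" by (simp_all add: d)
    have "real (m div Z1 * Z1) \<le> real m" "real (m div G * G) \<le> real m" "real (m div Z2 * Z2) \<le> real m"
      by (simp_all only: of_nat_le_iff div_times_less_eq_dividend)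
    then have dm: "d1 * (real q * real w) \<le> real m" "d2 * (real w * real h) \<le> real m"
      "d3 * (real q * (real q * real w)) \<le> real m"
      by (simp_all add: d Z1_def Z2_def G_def)
    have h4: "real h ^ 4 \<le> 62208 * real w" using h_pow4
      by (metis of_nat_le_iff of_nat_mult of_nat_numeral of_nat_power)
    have "real h ^ 2 \<le> real h ^ 4" using h_pos by (intro power_increasing) auto
    then have h2: "real h ^ 2 \<le> 62208 * real w" using h4 by linarith
    have wp: "0 < real w" using w_pos by simp
    have "real w * (d1 * real w * real h) \<le> (4 * \<kappa> * real h * real q) * (d1 * real w * real h)"
      using d0 by (intro mult_right_mono wq) simp
    also have "\<dots> = 4 * \<kappa> * real h ^ 2 * (d1 * (real q * real w))" by (simp add: power2_eq_square)
    also have "\<dots> \<le> 4 * \<kappa> * (62208 * real w) * real m"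
      using \<kappa>(1) d0 by (intro mult_mono mult_left_mono dm h2) auto
    finally have "real w * (d1 * real w * real h) \<le> real w * (4 * \<kappa> * 62208 * real m)" by (simp add: mult_ac)
    then have t1: "d1 * real w * real h \<le> 4 * \<kappa> * 62208 * real m" using wp by simp
    have "real w * (d3 * (real w * real h) * real w * real h) = real w ^ 2 * (d3 * real w * real h ^ 2)"
      by (simp add: power2_eq_square)
    also have "\<dots> \<le> (4 * \<kappa> * real h * real q) ^ 2 * (d3 * real w * real h ^ 2)"
      using d0 by (intro mult_right_mono power_mono wq) auto
    also have "\<dots> = 16 * \<kappa> ^ 2 * real h ^ 4 * (d3 * (real q * (real q * real w)))"
      by (simp add: power2_eq_square power4_eq_xxxx)
    also have "\<dots> \<le> 16 * \<kappa> ^ 2 * (62208 * real w) * real m"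
      using d0 by (intro mult_mono mult_left_mono dm h4) auto
    finally have "real w * (d3 * (real w * real h) * real w * real h) \<le> real w * (16 * \<kappa> ^ 2 * 62208 * real m)"
      by (simp add: mult_ac)
    then have t3: "d3 * (real w * real h) * real w * real h \<le> 16 * \<kappa> ^ 2 * 62208 * real m" using wp by simp
    have "real ?T * real h = d1 * real w * real h + d2 * (real w * real h) + d3 * (real w * real h) * real w * real h"
      by (simp add: d G_def algebra_simps)
    also have "\<dots> \<le> struct_coeff \<kappa> * real m"
      using t1 dm(2) t3 by (simp add: struct_coeff_def algebra_simps)
    finally have th: "real ?T * real h \<le> struct_coeff \<kappa> * real m" .
    have "real ?T * (1 + log 2 (lg m)) \<le> real ?T * real h" by (intro mult_left_mono h_ge_log_lg mn) simp
    with th have "real ?T * (1 + log 2 (lg m)) \<le> struct_coeff \<kappa> * real m" by linarith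
    then have "real ?T \<le> struct_coeff \<kappa> * real m / (1 + log 2 (lg m))" using lm by (simp add: pos_le_divide_eq)
    then show ?thesis by (simp add: struct_bits_def)
  qed
  moreover have "64 * struct_len m * w = 64 * ?T + 192 * w" by (simp add: struct_len_def algebra_simps)
  then have "real (64 * struct_len m * w) = real (64 * ?T) + 192 * real w" by simp
  ultimately show ?thesis using cw by linarith
qed

lemma table_size_bound:
  assumes "real w \<le> \<kappa> * lg n"
  shows "real (length (rs_table n w) * w) \<le> table_bits \<kappa> n"
proof -
  have "real (2 ^ (U + h)) \<le> table_factor n (\<kappa> * lg n)"
    using pow_U_h table_factor_mono[of "real w" "\<kappa> * lg n" n] assms by simp
  then have "(4 + 3 * real (2 ^ (U + h))) * real w \<le> table_bits \<kappa> n"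
    unfolding table_bits_def using assms table_factor_nonneg[of n] by (intro mult_mono) auto
  then show ?thesis by (simp add: length_rs_table)
qed

lemma L'_le_lg: "real L' \<le> 2 * lg \<sigma>"
  using symbol_bits_le_lg[of \<sigma>] one_le_lg[of \<sigma>] sigma by (cases "L = 0") (simp_all add: L'_def L_def)

lemma X_le:
  assumes "real w \<le> \<kappa> * lg n"
    and "3 * (\<kappa> * lg n) ^ 3 + \<kappa> * lg n + table_factor n (\<kappa> * lg n) * (\<kappa> * lg n + 1) \<le> real n"
  shows "real X \<le> 32 * (real n * lg \<sigma>)"
proof -
  have "real w ^ 3 \<le> (\<kappa> * lg n) ^ 3" using assms(1) by (intro power_mono) auto
  moreover have "real (2 ^ (U + h)) \<le> table_factor n (\<kappa> * lg n)"
    using pow_U_h table_factor_mono[of "real w" "\<kappa> * lg n" n] assms(1) by simp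
  then have "real (2 ^ (U + h)) * (real w + 1) \<le> table_factor n (\<kappa> * lg n) * (\<kappa> * lg n + 1)"
    using assms(1) by (intro mult_mono table_factor_nonneg) auto
  ultimately have s: "3 * real w ^ 3 + real w + real (2 ^ (U + h)) * (real w + 1) \<le> real n"
    using assms by linarith
  have "real NN \<le> real (N + 3 * w ^ 3)" using NN_upper Z2_le by linarith
  moreover have "real (2 ^ L') \<le> real (2 * n)" using pow_L'_le by (simp only: of_nat_le_iff)
  moreover have "real n \<le> real N" using n_le_N by simp
  moreover have "real X = 4 * (real NN + real w + real (2 ^ L') + real (2 ^ (U + h)) * (real w + 1))"
    by (simp add: X_def algebra_simps)
  ultimately have "real X \<le> 16 * real N" using s by simp
  also have "real N \<le> real n * (2 * lg \<sigma>)" unfolding N_def of_nat_mult by (intro mult_left_mono L'_le_lg) simp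
  finally show ?thesis by simp
qed

end

text \<open>The lower bound on the word length comes from \<open>wavelet_inputI\<close>. Correctness
  is claimed for every n \<ge> \<sigma> \<ge> 1, and only the time bounds are restricted to large n,
  where the lower-order terms and the lower bound on sorting take effect.\<close>

theorem theorem4p2:
  fixes r :: sort_routine
  assumes "stable_integer_sort r"
    and "(\<lambda>n. real (sort_work r n)) \<in> \<Omega>(\<lambda>n. real n)"
  shows "\<exists>\<kappa>\<^sub>0>0. \<forall>\<kappa>\<ge>\<kappa>\<^sub>0.
    \<exists>sortWT rankq selectq :: com. \<exists>c :: nat. \<exists>f g :: nat \<Rightarrow> real. \<exists>tab :: nat \<Rightarrow> nat \<Rightarrow> nat list.
    \<exists>C :: real. \<exists>N :: nat.
      f \<in> o(\<lambda>m. real m) \<and> g \<in> o(\<lambda>n. real n) \<and>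
      (\<forall>n \<sigma> w :: nat. \<forall>S :: nat list. \<forall>s :: state.
         1 \<le> \<sigma> \<and> \<sigma> \<le> n \<and> length S = n \<and> set S \<subseteq> {0..<\<sigma>} \<and>
         \<kappa>\<^sub>0 * lg n \<le> real w \<and> real w \<le> \<kappa> * lg n \<and> initial_state w \<sigma> S s \<longrightarrow>
         (\<exists>wk dp :: nat.
            constructs_wavelet_tree w r sortWT rankq selectq c f g tab \<sigma> S s wk dp \<and>
            (n \<ge> N \<longrightarrow>
               real wk \<le> C * (real (sort_work r n) * lg \<sigma>) \<and>
               real dp \<le> C * (real (sort_depth r n) + lg n))))"
proof (intro exI[of _ "2 ^ 16"] conjI allI impI)
  show "(0::real) < 2 ^ 16" by simp
  fix \<kappa> :: real assume "2 ^ 16 \<le> \<kappa>"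
  then have \<kappa>: "0 < \<kappa>" by simp
  define K P where "K = nat \<lceil>4 * \<kappa>\<rceil>" and "P = real (csz build_prog)"
  \<comment> \<open>The number 192 = 64 * 3 is the constant part of a node's structure in
    words.\<close>
  define c where "c = csz (rankq K) + csz (selectq K) + 192"
  \<comment> \<open>The linear lower bound on the work of sorting absorbs the O(n log \<sigma>) work
    outside the routine.\<close>
  obtain c0 where c0: "0 < c0" "\<forall>\<^sub>F n in at_top. c0 * real n \<le> real (sort_work r n)"
    using landau_omega.bigE[OF assms(2)] by (auto simp: abs_of_nonneg)
  from eventually_conj[OF c0(2) lower_order_terms[OF \<kappa>]] obtain n0 where
    n0: "\<And>n. n0 \<le> n \<Longrightarrow> c0 * real n \<le> real (sort_work r n)"
      "\<And>n. n0 \<le> n \<Longrightarrow> 3 * (\<kappa> * lg n) ^ 3 + \<kappa> * lg n + table_factor n (\<kappa> * lg n) * (\<kappa> * lg n + 1) \<le> real n"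
    unfolding eventually_at_top_linorder by blast
  \<comment> \<open>The first two summands come from the work, with X \<le> 32 * n * lg \<sigma> and
    L' \<le> 2 * lg \<sigma>. The last one bounds the code size times w + 1 in the depth by a
    multiple of lg n.\<close>
  define C where "C = 32 * P / c0 + 2 + P * (\<kappa> + 1)"
  have P0: "0 \<le> P" by (simp add: P_def)
  then have C: "32 * P / c0 + 2 \<le> C" "P * (\<kappa> + 1) \<le> C" "1 \<le> C"
    using c0(1) \<kappa> by (simp_all add: C_def add_increasing)
  show "\<exists>sortWT rankq selectq :: com. \<exists>c :: nat. \<exists>f g :: nat \<Rightarrow> real. \<exists>tab :: nat \<Rightarrow> nat \<Rightarrow> nat list.
    \<exists>C :: real. \<exists>N :: nat.
      f \<in> o(\<lambda>m. real m) \<and> g \<in> o(\<lambda>n. real n) \<and>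
      (\<forall>n \<sigma> w :: nat. \<forall>S :: nat list. \<forall>s :: state.
         1 \<le> \<sigma> \<and> \<sigma> \<le> n \<and> length S = n \<and> set S \<subseteq> {0..<\<sigma>} \<and>
         2 ^ 16 * lg n \<le> real w \<and> real w \<le> \<kappa> * lg n \<and> initial_state w \<sigma> S s \<longrightarrow>
         (\<exists>wk dp :: nat.
            constructs_wavelet_tree w r sortWT rankq selectq c f g tab \<sigma> S s wk dp \<and>
            (n \<ge> N \<longrightarrow>
               real wk \<le> C * (real (sort_work r n) * lg \<sigma>) \<and>
               real dp \<le> C * (real (sort_depth r n) + lg n))))"
  proof (rule exI[of _ build_prog], rule exI[of _ "rankq K"], rule exI[of _ "selectq K"], rule exI[of _ c],
      rule exI[of _ "struct_bits \<kappa>"], rule exI[of _ "table_bits \<kappa>"], rule exI[of _ rs_table], rule exI[of _ C],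
      rule exI[of _ n0], intro conjI allI impI)
    show "struct_bits \<kappa> \<in> o(\<lambda>m. real m)" "table_bits \<kappa> \<in> o(\<lambda>n. real n)"
      by (rule struct_bits_smallo table_bits_smallo)+
    fix n \<sigma> w :: nat and S :: "nat list" and s :: state
    assume a: "1 \<le> \<sigma> \<and> \<sigma> \<le> n \<and> length S = n \<and> set S \<subseteq> {0..<\<sigma>} \<and>
      2 ^ 16 * lg n \<le> real w \<and> real w \<le> \<kappa> * lg n \<and> initial_state w \<sigma> S s"
    then interpret wavelet_input n \<sigma> w S r by (intro wavelet_inputI assms(1)) auto
    have w\<kappa>: "real w \<le> \<kappa> * lg n" using a by blast
    from a build_exec[of s] obtain R M wk dp where
      ex: "exec w r build_prog s (R, M) wk dp" "wk \<le> csz build_prog * X + L' * sort_work r n"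
        "dp \<le> csz build_prog * (w + 1) + sort_depth r n"
      and R: "R 0 = rec 1" "R 1 = tab_pos" and M: "final_memory M"
      unfolding final_memory_def rec_def tab_pos_def by blast
    show "\<exists>wk dp. constructs_wavelet_tree w r build_prog (rankq K) (selectq K) c (struct_bits \<kappa>) (table_bits \<kappa>)
          rs_table \<sigma> S s wk dp \<and>
        (n \<ge> n0 \<longrightarrow> real wk \<le> C * (real (sort_work r n) * lg \<sigma>) \<and> real dp \<le> C * (real (sort_depth r n) + lg n))"
    proof (intro exI conjI impI)
      have "segment M tab_pos (length (rs_table n w)) = rs_table n w"
        by (rule nth_equalityI) (simp_all add: segment_def final_table[OF M])
      moreover have "wavelet_tree_in_memory w r (rankq K) (selectq K) c (struct_bits \<kappa>) n M tab_pos
          (length (rs_table n w)) (rec 1) (wavelet_tree \<sigma> S)"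
        by (rule final_wavelet_tree[OF M])
          (simp_all add: K_def w_le_U[OF \<kappa> w\<kappa>] c_def struct_size_bound[OF \<kappa> w\<kappa>] del: of_nat_mult of_nat_add)
      ultimately show "constructs_wavelet_tree w r build_prog (rankq K) (selectq K) c (struct_bits \<kappa>) (table_bits \<kappa>)
          rs_table \<sigma> S s wk dp"
        unfolding constructs_wavelet_tree_def Let_def length_S
        using ex(1) R table_size_bound[OF w\<kappa>] by (intro exI[of _ R] exI[of _ M]) simp
    next
      assume n: "n0 \<le> n"
      have l: "0 \<le> lg \<sigma>" using one_le_lg[of \<sigma>] by linarith
      have "real wk \<le> real (csz build_prog * X + L' * sort_work r n)" using ex(2) by (simp only: of_nat_le_iff)
      also have "\<dots> = P * real X + real L' * real (sort_work r n)" by (simp add: P_def)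
      also have "\<dots> \<le> P * (32 * (real n * lg \<sigma>)) + 2 * lg \<sigma> * real (sort_work r n)"
        by (intro add_mono mult_left_mono mult_right_mono X_le[OF w\<kappa> n0(2)[OF n]] L'_le_lg P0) simp
      also have "real n \<le> real (sort_work r n) / c0" using n0(1)[OF n] c0(1) by (simp add: pos_le_divide_eq mult.commute)
      then have "P * (32 * (real n * lg \<sigma>)) \<le> P * (32 * (real (sort_work r n) / c0 * lg \<sigma>))"
        using l P0 by (intro mult_left_mono mult_right_mono) auto
      also have "P * (32 * (real (sort_work r n) / c0 * lg \<sigma>)) + 2 * lg \<sigma> * real (sort_work r n) =
          (32 * P / c0 + 2) * (real (sort_work r n) * lg \<sigma>)" by (simp add: field_simps)
      also have "\<dots> \<le> C * (real (sort_work r n) * lg \<sigma>)" using l by (intro mult_right_mono C) simp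
      finally show "real wk \<le> C * (real (sort_work r n) * lg \<sigma>)" by simp
    next
      assume "n0 \<le> n"
      have "real dp \<le> real (csz build_prog * (w + 1) + sort_depth r n)" using ex(3) by (simp only: of_nat_le_iff)
      also have "\<dots> = P * (real w + 1) + real (sort_depth r n)" by (simp add: P_def algebra_simps)
      also have "\<dots> \<le> P * ((\<kappa> + 1) * lg n) + real (sort_depth r n)"
        using w\<kappa> one_le_lg[of n] by (intro add_mono mult_left_mono P0) (simp_all add: algebra_simps)
      also have "\<dots> \<le> C * lg n + C * real (sort_depth r n)"
      proof (rule add_mono)
        show "P * ((\<kappa> + 1) * lg n) \<le> C * lg n"
          using mult_right_mono[OF C(2), of "lg n"] one_le_lg[of n] by (simp add: mult.assoc)
        show "real (sort_depth r n) \<le> C * real (sort_depth r n)" using mult_right_mono[OF C(3), of "real (sort_depth r n)"] by simp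
      qed
      finally show "real dp \<le> C * (real (sort_depth r n) + lg n)" by (simp add: algebra_simps)
    qed
  qed
qed

end
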